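(* Let $G=N\rtimes H$ be a locally compact group which is the semi-direct product of a closed normal subgroup $N$ and a closed subgroup $H$. Let $(\mathrm{Bohr}(G),\beta_G)$, $(\mathrm{Bohr}(N),\beta_N)$, $(\mathrm{Bohr}(H),\beta_H)$ be Bohr compactifications of $G$, $N$, $H$. Let $\varphi_N:\mathrm{Bohr}(N)\to\overline{\beta_G(N)}$ and $\varphi_H:\mathrm{Bohr}(H)\to\overline{\beta_G(H)}$ be the continuous homomorphisms such that $\varphi_N\circ\beta_N=\beta_G|_N$ and $\varphi_H\circ\beta_H=\beta_G|_H$. Set $$C:=\bigcap_{\sigma\in\widehat{N}_{\mathrm{fd}}^{H-\mathrm{per}}}\ker(\mathrm{Bohr}(\sigma)).$$ Then: (i) $\ker\varphi_N=C$, and so $\varphi_N$ induces a topological isomorphism $\overline{\varphi_N}:\mathrm{Bohr}(N)/C\to\overline{\beta_G(N)}$. (ii) $\varphi_H:\mathrm{Bohr}(H)\to\overline{\beta_G(H)}$ is a topological isomorphism. (iii) The action of $H$ by automorphisms on $\mathrm{Bohr}(N)$ induces an action of $\mathrm{Bohr}(H)$ by automorphisms on $\mathrm{Bohr}(N)/C$ (that is, $C$ is $H$-invariant and there is a continuous action of $\mathrm{Bohr}(H)$ on $\mathrm{Bohr}(N)/C$ by automorphisms for which $\beta_H(h)$ acts, for every $h\in H$, as the automorphism of $\mathrm{Bohr}(N)/C$ induced by $h$), and the maps $\overline{\varphi_N}$ and $\varphi_H$ give rise to an isomorphism of topological groups $$(\mathrm{Bohr}(N)/C)\rtimes\mathrm{Bohr}(H)\to\mathrm{Bohr}(G),\qquad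 (xC,y)\mapsto\varphi_N(x)\varphi_H(y).$$
   Context: Compact groups are Hausdorff. A Bohr compactification of a topological group $G$ is a pair $(\mathrm{Bohr}(G),\beta_G)$ consisting of a compact group $\mathrm{Bohr}(G)$ and a continuous homomorphism $\beta_G:G\to\mathrm{Bohr}(G)$ with dense image such that for every compact group $L$ and every continuous homomorphism $\alpha:G\to L$ there exists a continuous homomorphism $\alpha':\mathrm{Bohr}(G)\to L$ with $\alpha=\alpha'\circ\beta_G$. It exists and is unique up to isomorphism. $\overline{X}$ denotes the closure of a subset $X$ of $\mathrm{Bohr}(G)$. $G=N\rtimes H$ is a semi-direct product of topological groups, with $H$ acting on $N$ by conjugation. $\widehat{N}_{\mathrm{fd}}$ is the set of equivalence classes (modulo unitary equivalence) of irreducible finite dimensional unitary representations of $N$, i.e. of irreducible continuous homomorphisms $\sigma:N\to U(n)$, $n\ge 1$. For such $\sigma$, $\mathrm{Bohr}(\sigma):\mathrm{Bohr}(N)\to U(n)$ is the unique continuous unitary representation with $\mathrm{Bohr}(\sigma)\circ\beta_N=\sigma$. The group $H$ acts on $\widehat{N}_{\mathrm{fd}}$ by $\sigma\mapsto\sigma^h$, where $\sigma^h(n)=\sigma(h^{-1}nh)$ for $n\in N$. $\widehat{N}_{\mathrm{fd}}^{H-\mathrm{per}}$ is the set of $\sigma\in\widehat{N}_{\mathrm{fd}}$ whose $H$-orbit (in $\widehat{N}_{\mathrm{fd}}$) is finite. By the universal property, $H$ acts by automorphisms on $\mathrm{Bohr}(N)$: $h\in H$ acts as the unique continuous automorphism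 sending $\beta_N(n)$ to $\beta_N(hnh^{-1})$ for all $n\in N$. *)

theory Defs
  imports
    "HOL-Analysis.Analysis"
    "HOL-Algebra.Algebra"
    "Jordan_Normal_Form.VS_Connect"
    "Jordan_Normal_Form.Schur_Decomposition"
begin

section \<open>Topological groups on explicit carriers\<close>

definition topological_group :: "('a, 'm) monoid_scheme \<Rightarrow> 'a topology \<Rightarrow> bool" where
  "topological_group G T \<longleftrightarrow>
     group G \<and> topspace T = carrier G \<and>
     continuous_map (prod_topology T T) T (\<lambda>(x, y). x \<otimes>\<^bsub>G\<^esub> y) \<and>
     continuous_map T T (\<lambda>x. inv\<^bsub>G\<^esub> x)"

definition compact_group :: "('a, 'm) monoid_scheme \<Rightarrow> 'a topology \<Rightarrow> bool" where
  "compact_group G T \<longleftrightarrow> topological_group G T \<and> compact_space T \<and> Hausdorff_space T"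

definition locally_compact_group :: "('a, 'm) monoid_scheme \<Rightarrow> 'a topology \<Rightarrow> bool" where
  "locally_compact_group G T \<longleftrightarrow>
     topological_group G T \<and> locally_compact_space T \<and> Hausdorff_space T"

definition cont_hom ::
  "('a, 'm) monoid_scheme \<Rightarrow> 'a topology \<Rightarrow> ('b, 'n) monoid_scheme \<Rightarrow> 'b topology \<Rightarrow> ('a \<Rightarrow> 'b) set" where
  "cont_hom G T H S = {f \<in> hom G H. continuous_map T S f}"

definition topological_group_iso ::
  "('a, 'm) monoid_scheme \<Rightarrow> 'a topology \<Rightarrow> ('b, 'n) monoid_scheme \<Rightarrow> 'b topology \<Rightarrow> ('a \<Rightarrow> 'b) \<Rightarrow> bool" where
  "topological_group_iso G T H S f \<longleftrightarrow> f \<in> iso G H \<and> homeomorphic_map T S f"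

definition coset_topology :: "('a, 'm) monoid_scheme \<Rightarrow> 'a topology \<Rightarrow> 'a set \<Rightarrow> 'a set topology" where
  "coset_topology G T C =
     topology (\<lambda>U. U \<subseteq> (\<lambda>x. C #>\<^bsub>G\<^esub> x) ` topspace T \<and> openin T {x \<in> topspace T. C #>\<^bsub>G\<^esub> x \<in> U})"

lemma openin_coset_topology:
  "openin (coset_topology G T C) U \<longleftrightarrow>
     U \<subseteq> (\<lambda>x. C #>\<^bsub>G\<^esub> x) ` topspace T \<and> openin T {x \<in> topspace T. C #>\<^bsub>G\<^esub> x \<in> U}"
proof -
  let ?q = "\<lambda>x. C #>\<^bsub>G\<^esub> x"
  have "istopology (\<lambda>U. U \<subseteq> ?q ` topspace T \<and> openin T {x \<in> topspace T. ?q x \<in> U})"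
    unfolding istopology_def
  proof (intro conjI allI impI)
    fix S S'
    assume *: "S \<subseteq> ?q ` topspace T \<and> openin T {x \<in> topspace T. ?q x \<in> S}"
      "S' \<subseteq> ?q ` topspace T \<and> openin T {x \<in> topspace T. ?q x \<in> S'}"
    then show "S \<inter> S' \<subseteq> ?q ` topspace T" by auto
    have "{x \<in> topspace T. ?q x \<in> S \<inter> S'} =
        {x \<in> topspace T. ?q x \<in> S} \<inter> {x \<in> topspace T. ?q x \<in> S'}" by auto
    with * show "openin T {x \<in> topspace T. ?q x \<in> S \<inter> S'}" by (simp add: openin_Int)
  next
    fix \<K>
    assume *: "\<forall>K\<in>\<K>. K \<subseteq> ?q ` topspace T \<and> openin T {x \<in> topspace T. ?q x \<in> K}"
    then show "\<Union>\<K> \<subseteq> ?q ` topspace T" by auto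
    have "{x \<in> topspace T. ?q x \<in> \<Union>\<K>} = (\<Union>K\<in>\<K>. {x \<in> topspace T. ?q x \<in> K})" by auto
    with * show "openin T {x \<in> topspace T. ?q x \<in> \<Union>\<K>}" by auto
  qed
  then show ?thesis by (simp add: coset_topology_def)
qed

lemma topspace_coset_topology:
  "topspace (coset_topology G T C) = (\<lambda>x. C #>\<^bsub>G\<^esub> x) ` topspace T"
proof
  show "topspace (coset_topology G T C) \<subseteq> (\<lambda>x. C #>\<^bsub>G\<^esub> x) ` topspace T"
    using openin_coset_topology[of G T C "topspace (coset_topology G T C)"] by simp
  have "{x \<in> topspace T. C #>\<^bsub>G\<^esub> x \<in> (\<lambda>x. C #>\<^bsub>G\<^esub> x) ` topspace T} = topspace T" by auto
  then have "openin (coset_topology G T C) ((\<lambda>x. C #>\<^bsub>G\<^esub> x) ` topspace T)"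
    by (simp add: openin_coset_topology)
  then show "(\<lambda>x. C #>\<^bsub>G\<^esub> x) ` topspace T \<subseteq> topspace (coset_topology G T C)"
    by (rule openin_subset)
qed

lemma quotient_map_coset_topology:
  "quotient_map T (coset_topology G T C) (\<lambda>x. C #>\<^bsub>G\<^esub> x)"
  by (auto simp: quotient_map_def topspace_coset_topology openin_coset_topology)

section \<open>Semi-direct products\<close>

text \<open>For arbitrary topological groups the algebraic conditions do not imply that multiplication
  from the product is a homeomorphism, so this is part of being a semi-direct product of
  topological groups.\<close>

definition internal_semidirect_product ::
  "('a, 'm) monoid_scheme \<Rightarrow> 'a topology \<Rightarrow> 'a set \<Rightarrow> 'a set \<Rightarrow> bool" where
  "internal_semidirect_product G T N H \<longleftrightarrow>
     N \<lhd> G \<and> subgroup H G \<and> N \<inter> H = {\<one>\<^bsub>G\<^esub>} \<and> N <#>\<^bsub>G\<^esub> H = carrier G \<and>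
     homeomorphic_map (prod_topology (subtopology T N) (subtopology T H)) T
       (\<lambda>(n, h). n \<otimes>\<^bsub>G\<^esub> h)"

definition semidirect_product ::
  "('a, 'm) monoid_scheme \<Rightarrow> ('b, 'n) monoid_scheme \<Rightarrow> ('b \<Rightarrow> 'a \<Rightarrow> 'a) \<Rightarrow> ('a \<times> 'b) monoid" where
  "semidirect_product N H act =
     \<lparr>carrier = carrier N \<times> carrier H,
      mult = (\<lambda>(x, y) (x', y'). (x \<otimes>\<^bsub>N\<^esub> act y x', y \<otimes>\<^bsub>H\<^esub> y')),
      one = (\<one>\<^bsub>N\<^esub>, \<one>\<^bsub>H\<^esub>)\<rparr>"

section \<open>Bohr compactifications\<close>

text \<open>HOL cannot quantify over all types, so the test groups \<open>L\<close> range over all compact groups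
  whose carrier is a subset of the fixed type \<^typ>\<open>'g set set\<close>, where \<^typ>\<open>'g\<close> is the type of the
  elements of \<open>G\<close>. This is no restriction: a Hausdorff space with a dense image of \<open>G\<close> has at
  most as many points as there are sets of subsets of \<open>G\<close>. The lemma
  \<open>bohr_compactification_universal\<close> below derives the universal property for compact groups over an
  arbitrary type.\<close>

definition bohr_compactification ::
  "('g, 'm) monoid_scheme \<Rightarrow> 'g topology \<Rightarrow> ('b, 'n) monoid_scheme \<Rightarrow> 'b topology \<Rightarrow> ('g \<Rightarrow> 'b) \<Rightarrow> bool" where
  "bohr_compactification G T B TB \<beta> \<longleftrightarrow>
     topological_group G T \<and> compact_group B TB \<and> \<beta> \<in> cont_hom G T B TB \<and>
     TB closure_of (\<beta> ` carrier G) = carrier B \<and>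
     (\<forall>(L :: 'g set set monoid) TL. compact_group L TL \<longrightarrow>
        (\<forall>\<alpha> \<in> cont_hom G T L TL. \<exists>\<alpha>' \<in> cont_hom B TB L TL. \<forall>x \<in> carrier G. \<alpha> x = \<alpha>' (\<beta> x)))"

lemma subgroup_closure_of:
  assumes "topological_group L T" and "subgroup A L"
  shows "subgroup (T closure_of A) L"
proof -
  interpret group L using assms(1) by (simp add: topological_group_def)
  have top: "topspace T = carrier L"
    and cm: "continuous_map (prod_topology T T) T (\<lambda>(x, y). x \<otimes>\<^bsub>L\<^esub> y)"
    and ci: "continuous_map T T (\<lambda>x. inv\<^bsub>L\<^esub> x)"
    using assms(1) by (auto simp: topological_group_def)
  have AL: "A \<subseteq> carrier L" using assms(2) by (rule subgroup.subset)
  show ?thesis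
  proof
    show "T closure_of A \<subseteq> carrier L" by (metis closure_of_subset_topspace top)
    have "\<one>\<^bsub>L\<^esub> \<in> A" using assms(2) by (rule subgroup.one_closed)
    then show "\<one>\<^bsub>L\<^esub> \<in> T closure_of A" using AL closure_of_subset top by (metis subsetD)
  next
    fix x y assume xy: "x \<in> T closure_of A" "y \<in> T closure_of A"
    have "(\<lambda>(x, y). x \<otimes>\<^bsub>L\<^esub> y) ` (prod_topology T T closure_of (A \<times> A))
        \<subseteq> T closure_of ((\<lambda>(x, y). x \<otimes>\<^bsub>L\<^esub> y) ` (A \<times> A))"
      using cm by (rule continuous_map_image_closure_subset)
    moreover have "(\<lambda>(x, y). x \<otimes>\<^bsub>L\<^esub> y) ` (A \<times> A) \<subseteq> A"
      using assms(2) by (auto simp: subgroup.m_closed)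
    ultimately have "(\<lambda>(x, y). x \<otimes>\<^bsub>L\<^esub> y) ` (prod_topology T T closure_of (A \<times> A)) \<subseteq> T closure_of A"
      by (meson closure_of_mono subset_trans)
    with xy show "x \<otimes>\<^bsub>L\<^esub> y \<in> T closure_of A" by (auto simp: closure_of_Times)
  next
    fix x assume x: "x \<in> T closure_of A"
    have "(\<lambda>x. inv\<^bsub>L\<^esub> x) ` (T closure_of A) \<subseteq> T closure_of ((\<lambda>x. inv\<^bsub>L\<^esub> x) ` A)"
      using ci by (rule continuous_map_image_closure_subset)
    moreover have "(\<lambda>x. inv\<^bsub>L\<^esub> x) ` A \<subseteq> A"
      using assms(2) by (auto simp: subgroup.m_inv_closed)
    ultimately show "inv\<^bsub>L\<^esub> x \<in> T closure_of A"
      using x by (meson closure_of_mono image_subset_iff subset_trans)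
  qed
qed

lemma topological_group_subgroup:
  assumes "topological_group L T" and "subgroup K L"
  shows "topological_group (L\<lparr>carrier := K\<rparr>) (subtopology T K)"
proof -
  interpret group L using assms(1) by (simp add: topological_group_def)
  have top: "topspace T = carrier L"
    and cm: "continuous_map (prod_topology T T) T (\<lambda>(x, y). x \<otimes>\<^bsub>L\<^esub> y)"
    and ci: "continuous_map T T (\<lambda>x. inv\<^bsub>L\<^esub> x)"
    using assms(1) by (auto simp: topological_group_def)
  have KL: "K \<subseteq> carrier L" using assms(2) by (rule subgroup.subset)
  have "continuous_map (subtopology (prod_topology T T) (K \<times> K)) (subtopology T K) (\<lambda>(x, y). x \<otimes>\<^bsub>L\<^esub> y)"
    using cm assms(2) by (auto simp: continuous_map_in_subtopology continuous_map_from_subtopology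
        subgroup.m_closed)
  moreover have "continuous_map (subtopology T K) (subtopology T K) (\<lambda>x. inv\<^bsub>L\<^esub> x)"
    using ci assms(2) by (auto simp: continuous_map_in_subtopology continuous_map_from_subtopology
        subgroup.m_inv_closed)
  then have "continuous_map (subtopology T K) (subtopology T K) (\<lambda>x. inv\<^bsub>L\<lparr>carrier := K\<rparr>\<^esub> x)"
    by (rule continuous_map_eq) (simp add: m_inv_consistent[OF assms(2)])
  ultimately show ?thesis
    using KL top subgroup.subgroup_is_group[OF assms(2) is_group]
    by (simp add: topological_group_def subtopology_Times Int_absorb1)
qed

lemma compact_group_transport:
  fixes K :: "('l, 'm) monoid_scheme" and f :: "'l \<Rightarrow> 'c"
  assumes K: "compact_group K S" and inj: "inj_on f (carrier K)"
  obtains L :: "'c monoid" and TL where "compact_group L TL" and "f \<in> cont_hom K S L TL"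
    and "inv_into (carrier K) f \<in> cont_hom L TL K S"
proof -
  let ?g = "inv_into (carrier K) f"
  define L :: "'c monoid" where
    "L = \<lparr>carrier = f ` carrier K, mult = (\<lambda>u v. f (?g u \<otimes>\<^bsub>K\<^esub> ?g v)), one = f \<one>\<^bsub>K\<^esub>\<rparr>"
  define TL where "TL = pullback_topology (f ` carrier K) ?g S"
  have tg: "topological_group K S" and cK: "compact_space S" and hK: "Hausdorff_space S"
    using K by (auto simp: compact_group_def)
  interpret group K using tg by (simp add: topological_group_def)
  have top: "topspace S = carrier K"
    and cm: "continuous_map (prod_topology S S) S (\<lambda>(x, y). x \<otimes>\<^bsub>K\<^esub> y)"
    and ci: "continuous_map S S (\<lambda>x. inv\<^bsub>K\<^esub> x)"
    using tg by (auto simp: topological_group_def)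
  have gf: "?g (f x) = x" if "x \<in> carrier K" for x using inj that by simp
  have tTL: "topspace TL = f ` carrier K"
    using gf by (auto simp: TL_def topspace_pullback_topology top)
  have cg: "continuous_map TL S ?g"
    unfolding TL_def using continuous_map_pullback[of S S id "f ` carrier K" ?g] by simp
  have cf: "continuous_map S TL f"
    unfolding TL_def
  proof (rule continuous_map_pullback')
    show "continuous_map S S (?g \<circ> f)"
      by (rule continuous_map_eq[of _ _ id]) (auto simp: top gf)
    show "topspace S \<subseteq> f -` (f ` carrier K)" by (auto simp: top)
  qed
  have homeo: "homeomorphic_maps S TL f ?g"
    using cf cg gf by (auto simp: homeomorphic_maps_def top tTL)
  have hf: "f \<in> iso K L"
    using inj gf by (auto simp: L_def iso_def hom_def bij_betw_def)
  have mL: "u \<otimes>\<^bsub>L\<^esub> v = f (?g u \<otimes>\<^bsub>K\<^esub> ?g v)" for u v by (simp add: L_def)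
  have cL: "carrier L = f ` carrier K" by (simp add: L_def)
  have gL: "group L"
  proof (rule groupI)
    fix x assume "x \<in> carrier L"
    then obtain a where "a \<in> carrier K" "x = f a" by (auto simp: cL)
    then show "\<exists>y\<in>carrier L. y \<otimes>\<^bsub>L\<^esub> x = \<one>\<^bsub>L\<^esub>"
      by (intro bexI[of _ "f (inv\<^bsub>K\<^esub> a)"]) (auto simp: cL mL gf L_def)
  qed (auto simp: L_def gf m_assoc)
  have invL: "inv\<^bsub>L\<^esub> u = f (inv\<^bsub>K\<^esub> (?g u))" if "u \<in> carrier L" for u
  proof -
    from that obtain a where "a \<in> carrier K" "u = f a" by (auto simp: cL)
    then show ?thesis
      by (intro group.inv_equality[OF gL]) (auto simp: cL mL gf, auto simp: L_def)
  qed
  have c1: "continuous_map (prod_topology TL TL) TL (\<lambda>(x, y). x \<otimes>\<^bsub>L\<^esub> y)"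
  proof -
    have "continuous_map (prod_topology TL TL) (prod_topology S S) (\<lambda>(x, y). (?g x, ?g y))"
      using cg by (simp add: continuous_map_prod_top)
    from continuous_map_compose[OF continuous_map_compose[OF this cm] cf]
    show ?thesis by (simp add: mL comp_def case_prod_unfold)
  qed
  have c2: "continuous_map TL TL (\<lambda>x. inv\<^bsub>L\<^esub> x)"
    by (rule continuous_map_eq[OF continuous_map_compose[OF continuous_map_compose[OF cg ci] cf]])
      (simp add: invL tTL cL)
  have hs: "S homeomorphic_space TL" using homeo by (auto simp: homeomorphic_space_def)
  have "compact_group L TL"
    using gL c1 c2 cK hK hs homeomorphic_compact_space homeomorphic_Hausdorff_space
    by (auto simp: compact_group_def topological_group_def tTL cL)
  moreover have "f \<in> cont_hom K S L TL" using hf cf by (simp add: cont_hom_def iso_def)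
  moreover have "?g \<in> cont_hom L TL K S"
    using cg group.iso_set_sym[OF is_group hf] by (auto simp: cont_hom_def iso_def)
  ultimately show thesis by (rule that)
qed

lemma bohr_compactification_universal:
  fixes L :: "('l, 'k) monoid_scheme"
  assumes B: "bohr_compactification G T B TB \<beta>"
    and L: "compact_group L TL" and \<alpha>: "\<alpha> \<in> cont_hom G T L TL"
  shows "\<exists>\<alpha>' \<in> cont_hom B TB L TL. \<forall>x \<in> carrier G. \<alpha> x = \<alpha>' (\<beta> x)"
proof -
  have tG: "topological_group G T" and \<beta>: "\<beta> \<in> cont_hom G T B TB"
    using B by (auto simp: bohr_compactification_def)
  have tL: "topological_group L TL" and cL: "compact_space TL" and hL: "Hausdorff_space TL"
    using L by (auto simp: compact_group_def)
  have gG: "group G" and gL: "group L" and topG: "topspace T = carrier G" and topL: "topspace TL = carrier L"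
    using tG tL by (auto simp: topological_group_def)
  interpret group_hom G L \<alpha>
    using gG gL \<alpha> by (simp add: group_hom_def group_hom_axioms_def cont_hom_def)
  define K where "K = TL closure_of (\<alpha> ` carrier G)"
  have sK: "subgroup K L" unfolding K_def by (rule subgroup_closure_of[OF tL img_is_subgroup])
  have KL: "K \<subseteq> carrier L" using sK by (rule subgroup.subset)
  have imK: "\<alpha> ` carrier G \<subseteq> K"
    unfolding K_def by (rule closure_of_subset) (auto simp: topL)
  have cK: "compact_group (L\<lparr>carrier := K\<rparr>) (subtopology TL K)"
    using topological_group_subgroup[OF tL sK] cL hL
    by (auto simp: compact_group_def Hausdorff_space_subtopology K_def
        intro!: compact_space_subtopology closedin_compact_space)
  define f where "f y = {{x \<in> carrier G. \<alpha> x \<in> U} | U. openin TL U \<and> y \<in> U}" for y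
  have inj: "inj_on f K"
  proof (rule inj_onI, rule ccontr)
    fix y z assume y: "y \<in> K" and z: "z \<in> K" and eq: "f y = f z" and ne: "y \<noteq> z"
    have "y \<in> topspace TL" "z \<in> topspace TL" using y z KL topL by auto
    with hL ne obtain U V where UV: "openin TL U" "openin TL V" "y \<in> U" "z \<in> V" "disjnt U V"
      unfolding Hausdorff_space_def by blast
    have "{x \<in> carrier G. \<alpha> x \<in> U} \<in> f y" unfolding f_def using UV(1,3) by blast
    then have "{x \<in> carrier G. \<alpha> x \<in> U} \<in> f z" by (simp only: eq)
    then obtain W where W: "openin TL W" "z \<in> W"
      "{x \<in> carrier G. \<alpha> x \<in> U} = {x \<in> carrier G. \<alpha> x \<in> W}" by (auto simp: f_def)
    have "openin TL (V \<inter> W)" "z \<in> V \<inter> W" using UV W by auto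
    with z obtain x where "x \<in> carrier G" "\<alpha> x \<in> V \<inter> W"
      unfolding K_def in_closure_of by blast
    with W UV show False by (auto simp: disjnt_iff)
  qed
  obtain M :: "'a set set monoid" and TM where M: "compact_group M TM"
    and f: "f \<in> cont_hom (L\<lparr>carrier := K\<rparr>) (subtopology TL K) M TM"
    and g: "inv_into K f \<in> cont_hom M TM (L\<lparr>carrier := K\<rparr>) (subtopology TL K)"
    using compact_group_transport[OF cK, of f] inj by auto
  have "\<alpha> \<in> cont_hom G T (L\<lparr>carrier := K\<rparr>) (subtopology TL K)"
    using \<alpha> imK by (auto simp: cont_hom_def hom_def continuous_map_in_subtopology topG)
  then have f\<alpha>: "f \<circ> \<alpha> \<in> cont_hom G T M TM"
    using f by (auto simp: cont_hom_def hom_def continuous_map_compose Pi_iff)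
  have "\<forall>\<delta> \<in> cont_hom G T M TM. \<exists>\<gamma> \<in> cont_hom B TB M TM. \<forall>x \<in> carrier G. \<delta> x = \<gamma> (\<beta> x)"
    using B[unfolded bohr_compactification_def] by (elim conjE) (drule spec, drule spec, erule mp[OF _ M])
  from bspec[OF this f\<alpha>] obtain \<gamma> where \<gamma>: "\<gamma> \<in> cont_hom B TB M TM"
    and \<gamma>eq: "\<And>x. x \<in> carrier G \<Longrightarrow> (f \<circ> \<alpha>) x = \<gamma> (\<beta> x)"
    by blast
  have "inv_into K f \<circ> \<gamma> \<in> cont_hom B TB L TL"
    using g \<gamma> KL by (auto simp: cont_hom_def hom_def Pi_iff continuous_map_in_subtopology
        intro: continuous_map_compose)
  moreover have "\<alpha> x = (inv_into K f \<circ> \<gamma>) (\<beta> x)" if "x \<in> carrier G" for x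
    using \<gamma>eq[OF that] inj imK that by (simp add: comp_def) (metis imageI inv_into_f_f subsetD)
  ultimately show ?thesis by blast
qed

section \<open>Finite dimensional unitary representations\<close>

definition unitary_group :: "nat \<Rightarrow> complex mat monoid" where
  "unitary_group n =
     \<lparr>carrier = {A \<in> carrier_mat n n. A * mat_adjoint A = 1\<^sub>m n \<and> mat_adjoint A * A = 1\<^sub>m n},
      mult = (*), one = 1\<^sub>m n\<rparr>"

text \<open>The topology of entrywise convergence.\<close>

definition unitary_topology :: "nat \<Rightarrow> complex mat topology" where
  "unitary_topology n =
     pullback_topology (carrier (unitary_group n)) (\<lambda>A. restrict (\<lambda>ij. A $$ ij) ({..<n} \<times> {..<n}))
       (product_topology (\<lambda>_. euclidean) ({..<n} \<times> {..<n}))"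

lemma topspace_unitary_topology: "topspace (unitary_topology n) = carrier (unitary_group n)"
  by (auto simp: unitary_topology_def topspace_pullback_topology)

lemma continuous_map_unitary_topology:
  "continuous_map T (unitary_topology n) \<sigma> \<longleftrightarrow>
     \<sigma> \<in> topspace T \<rightarrow> carrier (unitary_group n) \<and>
     (\<forall>i<n. \<forall>j<n. continuous_map T euclidean (\<lambda>x. \<sigma> x $$ (i, j)))" (is "?l \<longleftrightarrow> ?r")
proof
  let ?e = "\<lambda>A :: complex mat. restrict (\<lambda>ij. A $$ ij) ({..<n} \<times> {..<n})"
  let ?P = "product_topology (\<lambda>_. euclidean :: complex topology) ({..<n} \<times> {..<n})"
  {
    assume l: ?l
    have "continuous_map (unitary_topology n) ?P ?e"
      unfolding unitary_topology_def using continuous_map_pullback[of ?P ?P id] by simp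
    with l have "continuous_map T ?P (?e \<circ> \<sigma>)" by (rule continuous_map_compose)
    then have "continuous_map T euclidean (\<lambda>x. \<sigma> x $$ (i, j))" if "i < n" "j < n" for i j
      using that unfolding continuous_map_componentwise by (force simp: comp_def)
    moreover have "\<sigma> \<in> topspace T \<rightarrow> carrier (unitary_group n)"
      using l by (auto simp: continuous_map_def topspace_unitary_topology)
    ultimately show ?r by blast
  next
    assume r: ?r
    have "continuous_map T ?P (?e \<circ> \<sigma>)"
      using r by (auto simp: continuous_map_componentwise comp_def)
    then show ?l unfolding unitary_topology_def
      using r by (intro continuous_map_pullback') auto
  }
qed

text \<open>A representation of dimension \<open>n\<close> is kept as the pair \<open>(n, \<sigma>)\<close>; only the values of \<open>\<sigma>\<close> on the
  carrier matter.\<close>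

type_synonym 'g rep = "nat \<times> ('g \<Rightarrow> complex mat)"

definition irreps :: "('g, 'm) monoid_scheme \<Rightarrow> 'g topology \<Rightarrow> 'g rep set" where
  "irreps G T =
     {(n, \<sigma>). 1 \<le> n \<and> \<sigma> \<in> cont_hom G T (unitary_group n) (unitary_topology n) \<and>
        (\<forall>W. VectorSpace.subspace class_ring W (module_vec TYPE(complex) n) \<and>
              (\<forall>x \<in> carrier G. \<forall>w \<in> W. \<sigma> x *\<^sub>v w \<in> W)
           \<longrightarrow> W = {0\<^sub>v n} \<or> W = carrier_vec n)}"

definition unitary_equiv :: "('g, 'm) monoid_scheme \<Rightarrow> 'g topology \<Rightarrow> 'g rep rel" where
  "unitary_equiv G T =
     {((n, \<sigma>), (m, \<tau>)). (n, \<sigma>) \<in> irreps G T \<and> (m, \<tau>) \<in> irreps G T \<and> n = m \<and>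
        (\<exists>U \<in> carrier (unitary_group n). \<forall>x \<in> carrier G. \<tau> x = U * \<sigma> x * mat_adjoint U)}"

definition fd_dual :: "('g, 'm) monoid_scheme \<Rightarrow> 'g topology \<Rightarrow> 'g rep set set" where
  "fd_dual G T = irreps G T // unitary_equiv G T"

definition conj_rep :: "('g, 'm) monoid_scheme \<Rightarrow> 'g \<Rightarrow> 'g rep \<Rightarrow> 'g rep" where
  "conj_rep G h = (\<lambda>(n, \<sigma>). (n, \<lambda>x. \<sigma> (inv\<^bsub>G\<^esub> h \<otimes>\<^bsub>G\<^esub> x \<otimes>\<^bsub>G\<^esub> h)))"

definition dual_act ::
  "('g, 'm) monoid_scheme \<Rightarrow> 'g topology \<Rightarrow> 'g set \<Rightarrow> 'g \<Rightarrow> 'g rep set \<Rightarrow> 'g rep set" where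
  "dual_act G T N h c =
     unitary_equiv (G\<lparr>carrier := N\<rparr>) (subtopology T N) `` (conj_rep G h ` c)"

definition fd_dual_per ::
  "('g, 'm) monoid_scheme \<Rightarrow> 'g topology \<Rightarrow> 'g set \<Rightarrow> 'g set \<Rightarrow> 'g rep set set" where
  "fd_dual_per G T N H =
     {c \<in> fd_dual (G\<lparr>carrier := N\<rparr>) (subtopology T N). finite ((\<lambda>h. dual_act G T N h c) ` H)}"

text \<open>Extensionality makes the extensions to the Bohr compactification unique as HOL functions.\<close>

definition bohr_rep ::
  "('g, 'm) monoid_scheme \<Rightarrow> ('b, 'n) monoid_scheme \<Rightarrow> 'b topology \<Rightarrow> ('g \<Rightarrow> 'b) \<Rightarrow> 'g rep \<Rightarrow> 'b \<Rightarrow> complex mat" where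
  "bohr_rep G B TB \<beta> = (\<lambda>(n, \<sigma>).
     THE \<rho>. \<rho> \<in> extensional (carrier B) \<and>
       \<rho> \<in> cont_hom B TB (unitary_group n) (unitary_topology n) \<and>
       (\<forall>x \<in> carrier G. \<rho> (\<beta> x) = \<sigma> x))"

text \<open>The kernel of \<open>Bohr(\<sigma>)\<close> depends only on the class of \<open>\<sigma>\<close>, so the intersection runs over all
  representatives. It is never over an empty family, because of the trivial representation.\<close>

definition per_kernel ::
  "('g, 'm) monoid_scheme \<Rightarrow> 'g topology \<Rightarrow> 'g set \<Rightarrow> 'g set \<Rightarrow>
   ('b, 'n) monoid_scheme \<Rightarrow> 'b topology \<Rightarrow> ('g \<Rightarrow> 'b) \<Rightarrow> 'b set" where
  "per_kernel G T N H B TB \<beta> =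
     (\<Inter>(n, \<sigma>) \<in> \<Union>(fd_dual_per G T N H).
        kernel B (unitary_group n) (bohr_rep (G\<lparr>carrier := N\<rparr>) B TB \<beta> (n, \<sigma>)))"

definition bohr_act ::
  "('g, 'm) monoid_scheme \<Rightarrow> 'g set \<Rightarrow> ('b, 'n) monoid_scheme \<Rightarrow> 'b topology \<Rightarrow> ('g \<Rightarrow> 'b) \<Rightarrow> 'g \<Rightarrow> 'b \<Rightarrow> 'b" where
  "bohr_act G N B TB \<beta> h =
     (THE a. a \<in> auto B \<and> continuous_map TB TB a \<and>
        (\<forall>n \<in> N. a (\<beta> n) = \<beta> (h \<otimes>\<^bsub>G\<^esub> n \<otimes>\<^bsub>G\<^esub> inv\<^bsub>G\<^esub> h)))"

end

theory Submission
  imports Defs "Jordan_Normal_Form.Spectral_Radius" "HOL-Complex_Analysis.Great_Picard"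
begin

text \<open>
The images of \<open>\<phi>N\<close> and \<open>\<phi>H\<close> are compact, hence equal to the closures of the images of \<open>N\<close> and \<open>H\<close>. The
topological statements follow from the algebraic ones, as a continuous bijection from a compact space to a
Hausdorff space is a homeomorphism.

The projection of \<open>G\<close> onto \<open>H\<close> is a continuous homomorphism. Its extension \<open>Bohr(G) \<rightarrow> Bohr(H)\<close> is a left
inverse of \<open>\<phi>H\<close> and trivial on the closure of the image of \<open>N\<close> (\<open>bohr_projection\<close>). Hence \<open>\<phi>H\<close> is injective
and \<open>Bohr(G)\<close> is the semidirect product of the two closures. Conjugation inside \<open>Bohr(G)\<close> gives the action
of \<open>Bohr(H)\<close>.

The substance is the kernel of \<open>\<phi>N\<close> (\<open>kernel_\<phi>N\<close>).

Let \<open>k\<close> be in the kernel and let \<open>\<sigma>\<close> be an irreducible representation of \<open>N\<close> with finite \<open>H\<close>-orbit. The sum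
\<open>\<chi>\<close> of the real parts of the characters of the conjugates of \<open>\<sigma>\<close> is invariant under conjugation by all of \<open>G\<close>. Therefore
\<open>(a, b) \<mapsto> \<chi> (pN a \<cdot> (pN b)\<^sup>-\<^sup>1)\<close>, where \<open>pN\<close> is the projection of \<open>G\<close> onto \<open>N\<close>, is a positive form of
finite rank that is invariant under left translations by \<open>G\<close>, and the representation of \<open>G\<close> that it defines
(\<open>unitary_rep_of_invariant_vectors\<close>) has \<open>\<chi>\<close> on \<open>N\<close> as a combination of its matrix entries. As it extends to
\<open>Bohr(G)\<close>, the value at \<open>k\<close> of the extension of \<open>\<chi>\<close> is the one at the identity. This is the largest
possible value, and the trace of a unitary matrix attains it only for the identity matrix. So \<open>k\<close> acts trivially in \<open>Bohr(\<sigma>)\<close>.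

Conversely, a representation of \<open>Bohr(G)\<close>, restricted to \<open>N\<close>, is a sum of irreducible representations. Their
\<open>H\<close>-orbits are finite: the translates of an irreducible subspace by elements of \<open>H\<close> carry the conjugates, and
the inequivalent ones among them are orthogonal in a space of finite dimension (\<open>finite_orbit_of_subrep\<close>).
So the common kernel of the periodic representations is killed by every finite dimensional representation
of \<open>Bohr(G)\<close>, and these separate points (\<open>Peter_Weyl\<close>).

The theorem of Peter and Weyl is proved from an invariant mean, constructed from averages of
translates. Convolution with a symmetric kernel is a self-adjoint compact operator for the inner product
given by the mean; an eigenspace, found by iterating the operator, is finite dimensional and carries a
representation of the group by translations.
\<close>

section \<open>The invariant mean of a compact group\<close>

locale compact_top_group = group K for K (structure) + fixes T
  assumes compact_group: "compact_group K T"
begin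

lemma topspace_eq [simp]: "topspace T = carrier K"
  and mult_continuous: "continuous_map (prod_topology T T) T (\<lambda>(x, y). x \<otimes> y)"
  and inv_continuous: "continuous_map T T (\<lambda>x. inv x)"
  and compact: "compact_space T"
  and Hausdorff: "Hausdorff_space T"
  using compact_group by (auto simp: compact_group_def topological_group_def)

lemma continuous_map_mult_group [continuous_intros]:
  assumes "continuous_map S T f" "continuous_map S T g"
  shows "continuous_map S T (\<lambda>x. f x \<otimes> g x)"
proof -
  have "continuous_map S (prod_topology T T) (\<lambda>x. (f x, g x))"
    using assms by (simp add: continuous_map_pairedI)
  from continuous_map_compose[OF this mult_continuous] show ?thesis by (simp add: comp_def)
qed

lemma continuous_map_inv_group [continuous_intros]:
  assumes "continuous_map S T f"
  shows "continuous_map S T (\<lambda>x. inv (f x))"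
  using continuous_map_compose[OF assms inv_continuous] by (simp add: comp_def)

abbreviation cfun :: "('a \<Rightarrow> real) \<Rightarrow> bool" where "cfun \<equiv> continuous_map T euclideanreal"

lemma cfun_compose:
  assumes "cfun f" "continuous_map S T g"
  shows "continuous_map S euclideanreal (\<lambda>x. f (g x))"
  using continuous_map_compose[OF assms(2,1)] by (simp add: comp_def)

lemma cfun_translate:
  assumes "cfun f" "a \<in> carrier K"
  shows "cfun (\<lambda>x. f (a \<otimes> x))" "cfun (\<lambda>x. f (x \<otimes> a))"
  using assms by (auto intro!: cfun_compose[OF assms(1)] continuous_intros)

lemma cfun_bounded:
  assumes "cfun f"
  obtains b where "0 \<le> b" "\<And>x. x \<in> carrier K \<Longrightarrow> \<bar>f x\<bar> \<le> b"
proof -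
  have "compact (f ` carrier K)"
    using image_compactin[of T "carrier K" euclideanreal f] assms compact
    by (simp add: compact_space_def)
  then have "bounded (f ` carrier K)" by (rule compact_imp_bounded)
  then obtain b where "\<forall>y \<in> f ` carrier K. \<bar>y\<bar> \<le> b" by (auto simp: bounded_iff)
  then have "\<bar>f x\<bar> \<le> max b 0" if "x \<in> carrier K" for x using that by fastforce
  then show thesis by (intro that[of "max b 0"]) auto
qed

lemma finite_subcover:
  assumes U: "\<And>x. x \<in> carrier K \<Longrightarrow> openin T (U x)" and cover: "carrier K \<subseteq> \<Union>(U ` carrier K)"
  obtains D where "finite D" "D \<subseteq> carrier K" "carrier K \<subseteq> \<Union>(U ` D)"
proof -
  have "compactin T (carrier K)" using compact by (simp add: compact_space_def)
  moreover have "\<forall>V \<in> U ` carrier K. openin T V" using U by blast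
  ultimately obtain \<F> where \<F>: "finite \<F>" "\<F> \<subseteq> U ` carrier K" "carrier K \<subseteq> \<Union>\<F>"
    using cover unfolding compactin_def by (metis (no_types, lifting))
  from \<F>(1,2) obtain D where "D \<subseteq> carrier K" "finite D" "\<F> = U ` D" using finite_subset_image by metis
  with \<F>(3) show thesis by (intro that[of D]) auto
qed

text \<open>An application of the tube lemma. It yields uniform continuity, the continuity of means that depend
  on a parameter, and the equicontinuity of convolutions.\<close>

lemma uniform_in_compact_variable:
  assumes F: "continuous_map (prod_topology S T) euclideanreal (\<lambda>(x, y). F x y)"
    and x: "x \<in> topspace S" and e: "0 < e"
  obtains U where "openin S U" "x \<in> U"
    "\<And>x' y. x' \<in> U \<Longrightarrow> y \<in> carrier K \<Longrightarrow> \<bar>F x' y - F x y\<bar> < e"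
proof -
  have c: "continuous_map (prod_topology S T) euclideanreal (\<lambda>(x', y). F x' y - F x y)"
  proof -
    have "continuous_map (prod_topology S T) (prod_topology S T) (\<lambda>p. (x, snd p))"
      using x by (intro continuous_map_pairedI continuous_map_snd continuous_map_const[THEN iffD2]) auto
    from continuous_map_compose[OF this F]
    have "continuous_map (prod_topology S T) euclideanreal (\<lambda>p. F x (snd p))"
      by (simp add: comp_def)
    with F show ?thesis by (auto simp: case_prod_unfold intro: continuous_map_diff)
  qed
  define W where "W = {p \<in> topspace (prod_topology S T). (case p of (x', y) \<Rightarrow> F x' y - F x y) \<in> {-e<..<e}}"
  have "openin (prod_topology S T) W"
    unfolding W_def using c by (rule openin_continuous_map_preimage) (simp flip: open_openin)
  moreover have "compactin T (carrier K)" using compact by (simp add: compact_space_def)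
  moreover have "{x} \<times> carrier K \<subseteq> W" using x e by (auto simp: W_def)
  ultimately obtain U V where UV: "openin S U" "x \<in> U" "carrier K \<subseteq> V" "U \<times> V \<subseteq> W"
    using tube_lemma_right[of S T W "carrier K" x] x by blast
  show thesis
  proof
    show "openin S U" "x \<in> U" by fact+
    fix x' y assume "x' \<in> U" "y \<in> carrier K"
    then have "(x', y) \<in> W" using UV by auto
    then show "\<bar>F x' y - F x y\<bar> < e" by (auto simp: W_def)
  qed
qed

definition avg :: "'a list \<Rightarrow> ('a \<Rightarrow> real) \<Rightarrow> 'a \<Rightarrow> real" where
  "avg as f x = (\<Sum>a\<leftarrow>as. f (a \<otimes> x)) / length as"

definition Lists :: "'a list set" where "Lists = {as. as \<noteq> [] \<and> set as \<subseteq> carrier K}"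

definition supr :: "('a \<Rightarrow> real) \<Rightarrow> real" where "supr f = (SUP x\<in>carrier K. f x)"

text \<open>This is the Haar integral, obtained without measure theory: the least possible maximum of the
  averages of finitely many left translates. The translations form lists and not sets, since
  iterated averages repeat translations.\<close>

definition mean :: "('a \<Rightarrow> real) \<Rightarrow> real" where "mean f = (INF as\<in>Lists. supr (avg as f))"

lemma cfun_avg: "cfun f \<Longrightarrow> as \<in> Lists \<Longrightarrow> cfun (avg as f)"
proof -
  assume f: "cfun f" and as: "as \<in> Lists"
  have "cfun (\<lambda>x. \<Sum>a\<leftarrow>as. f (a \<otimes> x))" if "set as \<subseteq> carrier K" for as
    using that by (induction as) (auto intro!: continuous_map_add cfun_translate f)
  then show ?thesis using as unfolding avg_def[abs_def] Lists_def
    by (auto intro!: continuous_map_real_divide)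
qed

lemma supr_upper: "cfun f \<Longrightarrow> x \<in> carrier K \<Longrightarrow> f x \<le> supr f"
proof -
  assume f: "cfun f" and x: "x \<in> carrier K"
  obtain b where "\<And>x. x \<in> carrier K \<Longrightarrow> \<bar>f x\<bar> \<le> b" using cfun_bounded[OF f] by blast
  then have "bdd_above (f ` carrier K)" by (intro bdd_aboveI[of _ b]) force
  then show ?thesis unfolding supr_def using x by (intro cSUP_upper)
qed

lemma supr_least: "(\<And>x. x \<in> carrier K \<Longrightarrow> f x \<le> b) \<Longrightarrow> supr f \<le> b"
  unfolding supr_def by (intro cSUP_least) auto

lemma avg_mono:
  assumes "as \<in> Lists" "x \<in> carrier K" "\<And>x. x \<in> carrier K \<Longrightarrow> f x \<le> g x"
  shows "avg as f x \<le> avg as g x"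
  using assms unfolding avg_def Lists_def
  by (intro divide_right_mono sum_list_mono) auto

lemma avg_const [simp]: "as \<in> Lists \<Longrightarrow> avg as (\<lambda>x. c) x = c"
  by (simp add: avg_def Lists_def sum_list_triv)

lemma avg_add: "avg as (\<lambda>x. f x + g x) x = avg as f x + avg as g x"
  by (simp add: avg_def sum_list_addf add_divide_distrib)

lemma avg_scale: "avg as (\<lambda>x. c * f x) x = c * avg as f x"
  by (simp add: avg_def sum_list_const_mult)

lemma mean_lower: "cfun f \<Longrightarrow> as \<in> Lists \<Longrightarrow> mean f \<le> supr (avg as f)"
proof -
  assume f: "cfun f" and as: "as \<in> Lists"
  obtain b where b: "\<And>x. x \<in> carrier K \<Longrightarrow> \<bar>f x\<bar> \<le> b" using cfun_bounded[OF f] by blast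
  have "-b \<le> supr (avg as f)" if "as \<in> Lists" for as
  proof -
    have "-b = avg as (\<lambda>x. -b) \<one>" using that by simp
    also have "\<dots> \<le> avg as f \<one>" using that b by (intro avg_mono) (auto simp: abs_le_iff minus_le_iff)
    also have "\<dots> \<le> supr (avg as f)" using that f by (intro supr_upper cfun_avg) auto
    finally show ?thesis .
  qed
  then have "bdd_below ((\<lambda>as. supr (avg as f)) ` Lists)" by (intro bdd_belowI[of _ "-b"]) auto
  then show ?thesis unfolding mean_def using as by (intro cINF_lower)
qed

lemma one_Lists: "[\<one>] \<in> Lists" by (simp add: Lists_def)

lemma mean_greatest: "(\<And>as. as \<in> Lists \<Longrightarrow> b \<le> supr (avg as f)) \<Longrightarrow> b \<le> mean f"
  unfolding mean_def using one_Lists by (intro cINF_greatest) auto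

lemma mean_attained:
  assumes f: "cfun f" and e: "0 < e"
  obtains as where "as \<in> Lists" "\<And>x. x \<in> carrier K \<Longrightarrow> avg as f x < mean f + e"
proof -
  have "\<exists>as\<in>Lists. supr (avg as f) < mean f + e"
  proof (rule ccontr)
    assume "\<not> ?thesis"
    then have "mean f + e \<le> mean f" by (intro mean_greatest) force
    with e show False by simp
  qed
  then show thesis using that supr_upper cfun_avg[OF f] by (metis le_less_trans)
qed

lemma avg_append_map:
  assumes "as \<in> Lists" "bs \<in> Lists" "x \<in> carrier K"
  shows "avg bs (avg as f) x = avg (concat (map (\<lambda>b. map (\<lambda>a. a \<otimes> b) as) bs)) f x"
proof -
  have 1: "(\<Sum>b\<leftarrow>bs. (\<Sum>a\<leftarrow>as. f (a \<otimes> (b \<otimes> x))) / l) =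
      sum_list (map (\<lambda>a. f (a \<otimes> x)) (concat (map (\<lambda>b. map (\<lambda>a. a \<otimes> b) as) bs))) / l"
    if "set bs \<subseteq> carrier K" for bs and l :: real
    using that
  proof (induction bs)
    case (Cons b bs)
    have "(\<Sum>a\<leftarrow>as. f (a \<otimes> (b \<otimes> x))) = sum_list (map ((\<lambda>a. f (a \<otimes> x)) \<circ> (\<lambda>a. a \<otimes> b)) as)"
      using Cons.prems assms
      by (intro arg_cong[where f = sum_list] map_cong) (auto simp: Lists_def m_assoc subset_iff)
    with Cons show ?case by (simp add: add_divide_distrib)
  qed simp
  have 2: "length (concat (map (\<lambda>b. map (\<lambda>a. a \<otimes> b) as) bs)) = length as * length bs"
    by (induction bs) auto
  show ?thesis unfolding avg_def using assms by (subst 1) (auto simp: 2 Lists_def)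
qed

lemma Lists_concat:
  "as \<in> Lists \<Longrightarrow> bs \<in> Lists \<Longrightarrow> concat (map (\<lambda>b. map (\<lambda>a. a \<otimes> b) as) bs) \<in> Lists"
  by (auto simp: Lists_def subset_iff neq_Nil_conv)

lemma mean_le_avg:
  assumes f: "cfun f" and as: "as \<in> Lists" and le: "\<And>x. x \<in> carrier K \<Longrightarrow> avg as f x \<le> c"
  shows "mean f \<le> c"
  using mean_lower[OF f as] supr_least[of "avg as f" c] le by force

lemma mean_le_avg_avg:
  assumes f: "cfun f" and as: "as \<in> Lists" and bs: "bs \<in> Lists"
    and le: "\<And>x. x \<in> carrier K \<Longrightarrow> avg bs (avg as f) x \<le> c"
  shows "mean f \<le> c"
  using le by (intro mean_le_avg[OF f Lists_concat[OF as bs]]) (simp flip: avg_append_map[OF as bs])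

lemma uniformly_continuous:
  assumes f: "cfun f" and e: "0 < e"
  obtains V where "openin T V" "\<one> \<in> V"
    "\<And>x v. x \<in> carrier K \<Longrightarrow> v \<in> V \<Longrightarrow> \<bar>f (x \<otimes> v) - f x\<bar> < e"
proof -
  have "continuous_map (prod_topology T T) euclideanreal (\<lambda>(v, x). f (x \<otimes> v))"
    by (auto simp: case_prod_unfold intro!: cfun_compose[OF f] continuous_map_mult_group
        continuous_map_fst continuous_map_snd)
  from uniform_in_compact_variable[OF this, of \<one> e] e obtain U where
    "openin T U" "\<one> \<in> U" "\<And>x' y. x' \<in> U \<Longrightarrow> y \<in> carrier K \<Longrightarrow> \<bar>f (y \<otimes> x') - f (y \<otimes> \<one>)\<bar> < e"
    by auto
  then show thesis by (intro that[of U]) auto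
qed

text \<open>An average whose maximum is close to the least possible value is close to that value everywhere:
  were it much smaller somewhere, then it would be so on a whole translate of a neighbourhood that
  depends on the function only; finitely many translates of it cover the group, and averaging over
  them would push the maximum below the infimum.\<close>

lemma mean_uniform:
  assumes f: "cfun f" and e: "0 < e"
  obtains as where "as \<in> Lists" "\<And>x. x \<in> carrier K \<Longrightarrow> \<bar>avg as f x - mean f\<bar> \<le> e"
proof -
  obtain V where V: "openin T V" "\<one> \<in> V"
    "\<And>x v. x \<in> carrier K \<Longrightarrow> v \<in> V \<Longrightarrow> \<bar>f (x \<otimes> v) - f x\<bar> < e/2"
    using uniformly_continuous[OF f, of "e/2"] e by auto
  have VK: "V \<subseteq> carrier K" using V(1) openin_subset by fastforce
  define tr where "tr c = {x \<in> carrier K. inv c \<otimes> x \<in> V}" for c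
  have "openin T (tr c)" if "c \<in> carrier K" for c
  proof -
    have "continuous_map T T (\<lambda>x. inv c \<otimes> x)" using that by (auto intro!: continuous_intros)
    from openin_continuous_map_preimage[OF this V(1)] show ?thesis by (simp add: tr_def)
  qed
  moreover have "carrier K \<subseteq> \<Union>(tr ` carrier K)"
    using V(2) by (auto simp: tr_def intro!: bexI)
  ultimately obtain D where D: "finite D" "D \<subseteq> carrier K" "carrier K \<subseteq> \<Union>(tr ` D)"
    by (rule finite_subcover)
  obtain cs where cs: "set cs = D" using D(1) finite_list by blast
  have csL: "cs \<in> Lists" using D cs by (auto simp: Lists_def)
  define r where "r = real (length cs)"
  have r: "0 < r" using csL by (simp add: r_def Lists_def)
  have "1 \<le> length cs" using csL by (simp add: Lists_def Suc_le_eq)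
  then have r1: "1 \<le> r" by (simp add: r_def)
  (* One value below mean f - e/2 has to outweigh r - 1 values that may reach mean f + \<delta>. *)
  define \<delta> where "\<delta> = e / (4 * r)"
  have \<delta>: "0 < \<delta>" "\<delta> \<le> e" using e r r1 by (auto simp: \<delta>_def field_simps)
  obtain as where as: "as \<in> Lists" and less: "\<And>x. x \<in> carrier K \<Longrightarrow> avg as f x < mean f + \<delta>"
    using mean_attained[OF f \<delta>(1)] by blast
  have "mean f - e \<le> avg as f p" if p: "p \<in> carrier K" for p
  proof (rule ccontr)
    assume "\<not> ?thesis"
    then have lt: "avg as f p < mean f - e" by simp
    have near: "avg as f (p \<otimes> v) < mean f - e/2" if v: "v \<in> V" for v
    proof -
      have "f (x \<otimes> v) \<le> f x + e/2" if "x \<in> carrier K" for x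
        using V(3)[OF that v] by linarith
      then have "avg as (\<lambda>x. f (x \<otimes> v)) p \<le> avg as (\<lambda>x. f x + e/2) p"
        using p as by (intro avg_mono)
      also have "avg as (\<lambda>x. f (x \<otimes> v)) p = avg as f (p \<otimes> v)"
      proof -
        have "(\<Sum>a\<leftarrow>as. f (a \<otimes> p \<otimes> v)) = (\<Sum>a\<leftarrow>as. f (a \<otimes> (p \<otimes> v)))"
          using as p v VK
          by (intro arg_cong[where f = sum_list] map_cong) (auto simp: Lists_def m_assoc subset_iff)
        then show ?thesis by (simp add: avg_def)
      qed
      finally show ?thesis using lt as by (simp add: avg_add)
    qed
    define bs where "bs = map (\<lambda>c. p \<otimes> inv c) cs"
    have bs: "bs \<in> Lists" using csL p by (auto simp: bs_def Lists_def)
    have "avg bs (avg as f) x \<le> mean f - \<delta>" if x: "x \<in> carrier K" for x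
    proof -
      obtain c where c: "c \<in> set cs" "x \<in> tr c" using D cs x by blast
      then obtain ys zs where yz: "cs = ys @ c # zs" by (meson split_list)
      have cK: "c \<in> carrier K" "set ys \<subseteq> carrier K" "set zs \<subseteq> carrier K"
        using D cs yz by auto
      have "avg as f (p \<otimes> inv c \<otimes> x) < mean f - e/2"
        using near[of "inv c \<otimes> x"] c cK p x by (simp add: tr_def m_assoc)
      moreover have "(\<Sum>c\<leftarrow>us. avg as f (p \<otimes> inv c \<otimes> x)) \<le> length us * (mean f + \<delta>)"
        if "set us \<subseteq> carrier K" for us
        using that
      proof (induction us)
        case (Cons u us)
        then have "avg as f (p \<otimes> inv u \<otimes> x) < mean f + \<delta>" using p x by (intro less) auto
        with Cons show ?case by (simp add: algebra_simps)
      qed simp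
      from this[OF cK(2)] this[OF cK(3)]
      have "(\<Sum>c\<leftarrow>ys. avg as f (p \<otimes> inv c \<otimes> x)) + (\<Sum>c\<leftarrow>zs. avg as f (p \<otimes> inv c \<otimes> x))
          \<le> (r - 1) * (mean f + \<delta>)" by (simp add: r_def yz algebra_simps)
      ultimately have "(\<Sum>c\<leftarrow>cs. avg as f (p \<otimes> inv c \<otimes> x)) \<le> (r - 1) * (mean f + \<delta>) + (mean f - e/2)"
        by (simp add: yz)
      also have "\<dots> \<le> r * (mean f - \<delta>)"
      proof -
        have "4 * r * \<delta> = e" using r by (simp add: \<delta>_def)
        moreover have "0 < \<delta>" by fact
        ultimately show ?thesis by (simp add: algebra_simps)
      qed
      finally show ?thesis using r by (subst avg_def) (simp add: bs_def r_def comp_def divide_le_eq mult.commute)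
    qed
    from mean_le_avg_avg[OF f as bs this] \<delta>(1) show False by simp
  qed
  then show thesis using that[OF as] less \<delta>(2) by (force simp: abs_le_iff)
qed

lemma mean_const [simp]: "mean (\<lambda>x. c) = c"
proof (rule antisym)
  show "mean (\<lambda>x. c) \<le> c" using one_Lists by (intro mean_le_avg[of _ "[\<one>]"]) auto
  show "c \<le> mean (\<lambda>x. c)"
  proof (rule mean_greatest)
    fix as assume as: "as \<in> Lists"
    then have "c = avg as (\<lambda>x. c) \<one>" by simp
    also have "\<dots> \<le> supr (avg as (\<lambda>x. c))" using as by (intro supr_upper cfun_avg) auto
    finally show "c \<le> supr (avg as (\<lambda>x. c))" .
  qed
qed

lemma mean_mono:
  assumes f: "cfun f" and g: "cfun g" and le: "\<And>x. x \<in> carrier K \<Longrightarrow> f x \<le> g x"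
  shows "mean f \<le> mean g"
proof (rule field_le_epsilon)
  fix e :: real assume "0 < e"
  then obtain as where as: "as \<in> Lists" "\<And>x. x \<in> carrier K \<Longrightarrow> avg as g x < mean g + e"
    using mean_attained[OF g] by blast
  then show "mean f \<le> mean g + e"
    using avg_mono[OF as(1), of _ f g] le by (intro mean_le_avg[OF f as(1)]) force
qed

lemma mean_cong: "(\<And>x. x \<in> carrier K \<Longrightarrow> f x = g x) \<Longrightarrow> mean f = mean g"
proof -
  assume eq: "\<And>x. x \<in> carrier K \<Longrightarrow> f x = g x"
  have "supr (avg as f) = supr (avg as g)" if "as \<in> Lists" for as
  proof -
    have "avg as f x = avg as g x" if "x \<in> carrier K" for x
      using avg_mono[OF \<open>as \<in> Lists\<close> that, of f g] avg_mono[OF \<open>as \<in> Lists\<close> that, of g f] eq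
      by (simp add: order_antisym)
    then show ?thesis by (simp add: supr_def)
  qed
  then show ?thesis by (simp add: mean_def)
qed

definition ravg :: "'a list \<Rightarrow> ('a \<Rightarrow> real) \<Rightarrow> 'a \<Rightarrow> real" where
  "ravg bs f x = (\<Sum>b\<leftarrow>bs. f (x \<otimes> b)) / length bs"

lemma avg_close:
  assumes "as \<in> Lists" "x \<in> carrier K" "\<And>x. x \<in> carrier K \<Longrightarrow> \<bar>f x - c\<bar> \<le> e"
  shows "\<bar>avg as f x - c\<bar> \<le> e"
proof -
  have "avg as f x \<le> avg as (\<lambda>x. c + e) x"
    using assms(3) by (intro avg_mono assms) (force simp: abs_le_iff)
  moreover have "avg as (\<lambda>x. c - e) x \<le> avg as f x"
    using assms(3) by (intro avg_mono assms) (force simp: abs_le_iff)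
  ultimately show ?thesis using assms(1) by (simp add: abs_le_iff)
qed

lemma ravg_eq_avg:
  assumes "bs \<in> Lists" "x \<in> carrier K"
  shows "ravg bs f x = avg (map (\<lambda>b. inv b) bs) (\<lambda>y. f (inv y)) (inv x)"
proof -
  have "(\<Sum>b\<leftarrow>bs. f (x \<otimes> b)) = (\<Sum>b\<leftarrow>bs. f (inv (inv b \<otimes> inv x)))"
    using assms by (intro arg_cong[where f = sum_list] map_cong) (auto simp: Lists_def inv_mult_group subset_iff)
  then show ?thesis by (simp add: ravg_def avg_def comp_def)
qed

lemma Lists_inv: "bs \<in> Lists \<Longrightarrow> map (\<lambda>b. inv b) bs \<in> Lists"
  by (auto simp: Lists_def)

lemma ravg_close:
  assumes "bs \<in> Lists" "x \<in> carrier K" "\<And>x. x \<in> carrier K \<Longrightarrow> \<bar>f x - c\<bar> \<le> e"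
  shows "\<bar>ravg bs f x - c\<bar> \<le> e"
  using assms by (simp add: ravg_eq_avg avg_close Lists_inv)

lemma ravg_avg:
  assumes "as \<in> Lists" "bs \<in> Lists" "x \<in> carrier K"
  shows "ravg bs (avg as f) x = avg as (ravg bs f) x"
proof -
  have "(\<Sum>b\<leftarrow>bs. (\<Sum>a\<leftarrow>as. f (a \<otimes> (x \<otimes> b))) / k) = (\<Sum>b\<leftarrow>bs. \<Sum>a\<leftarrow>as. f (a \<otimes> x \<otimes> b)) / k"
    if "set bs \<subseteq> carrier K" for bs and k :: real
    using that
  proof (induction bs)
    case (Cons b bs)
    have "(\<Sum>a\<leftarrow>as. f (a \<otimes> (x \<otimes> b))) = (\<Sum>a\<leftarrow>as. f (a \<otimes> x \<otimes> b))"
      using Cons.prems assms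
      by (intro arg_cong[where f = sum_list] map_cong) (auto simp: Lists_def m_assoc subset_iff)
    with Cons show ?case by (simp add: add_divide_distrib)
  qed simp
  moreover have "(\<Sum>a\<leftarrow>as. (\<Sum>b\<leftarrow>bs. f (a \<otimes> x \<otimes> b)) / k) = (\<Sum>a\<leftarrow>as. \<Sum>b\<leftarrow>bs. f (a \<otimes> x \<otimes> b)) / k"
    for k :: real
    by (induction as) (auto simp: add_divide_distrib)
  moreover have "(\<Sum>a\<leftarrow>as. \<Sum>b\<leftarrow>bs. f (a \<otimes> x \<otimes> b)) = (\<Sum>b\<leftarrow>bs. \<Sum>a\<leftarrow>as. f (a \<otimes> x \<otimes> b))"
    by (induction as) (auto simp: sum_list_addf)
  ultimately show ?thesis using assms by (simp add: avg_def ravg_def Lists_def mult.commute)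
qed

text \<open>Left and right averages commute, so that a constant that is approximated by right averages is the
  mean. This is what makes the mean additive.\<close>

lemma mean_close_of_ravg:
  assumes f: "cfun f" and bs: "bs \<in> Lists" and le: "\<And>x. x \<in> carrier K \<Longrightarrow> \<bar>ravg bs f x - c\<bar> \<le> e"
  shows "\<bar>mean f - c\<bar> \<le> e"
proof (rule field_le_epsilon)
  fix d :: real assume "0 < d"
  then obtain as where as: "as \<in> Lists" "\<And>x. x \<in> carrier K \<Longrightarrow> \<bar>avg as f x - mean f\<bar> \<le> d"
    using mean_uniform[OF f] by blast
  have "\<bar>ravg bs (avg as f) \<one> - mean f\<bar> \<le> d" by (intro ravg_close bs as) auto
  moreover have "\<bar>avg as (ravg bs f) \<one> - c\<bar> \<le> e" by (intro avg_close as le) auto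
  ultimately show "\<bar>mean f - c\<bar> \<le> e + d" using ravg_avg[OF as(1) bs] by simp
qed

lemma ravg_uniform:
  assumes f: "cfun f" and e: "0 < e"
  obtains bs c where "bs \<in> Lists" "\<And>x. x \<in> carrier K \<Longrightarrow> \<bar>ravg bs f x - c\<bar> \<le> e"
proof -
  have "cfun (\<lambda>y. f (inv y))" by (intro cfun_compose[OF f] inv_continuous)
  then obtain as where as: "as \<in> Lists"
    "\<And>x. x \<in> carrier K \<Longrightarrow> \<bar>avg as (\<lambda>y. f (inv y)) x - mean (\<lambda>y. f (inv y))\<bar> \<le> e"
    using mean_uniform e by blast
  have "map (\<lambda>b. inv b) (map (\<lambda>b. inv b) as) = as"
    using as(1) by (auto simp: Lists_def subset_iff intro!: map_idI)
  then show thesis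
    using as by (intro that[of "map (\<lambda>b. inv b) as" "mean (\<lambda>y. f (inv y))"] Lists_inv)
      (auto simp: ravg_eq_avg Lists_inv)
qed

text \<open>Once a right average is close to a constant, it remains so, with the same constant, after left
  averaging.\<close>

lemma mean_avg:
  assumes f: "cfun f" and as: "as \<in> Lists"
  shows "mean (avg as f) = mean f"
proof -
  have "\<bar>mean (avg as f) - mean f\<bar> \<le> 0"
  proof (rule field_le_epsilon)
    fix e :: real assume "0 < e"
    then obtain bs c where bs: "bs \<in> Lists" "\<And>x. x \<in> carrier K \<Longrightarrow> \<bar>ravg bs f x - c\<bar> \<le> e/2"
      using ravg_uniform[OF f, of "e/2"] by auto
    have "\<bar>mean f - c\<bar> \<le> e/2" by (rule mean_close_of_ravg[OF f bs])
    moreover have "\<bar>mean (avg as f) - c\<bar> \<le> e/2"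
    proof (rule mean_close_of_ravg[OF cfun_avg[OF f as] bs(1)])
      fix x assume "x \<in> carrier K"
      then show "\<bar>ravg bs (avg as f) x - c\<bar> \<le> e/2"
        unfolding ravg_avg[OF as bs(1) \<open>x \<in> carrier K\<close>] using as bs(2) by (intro avg_close)
    qed
    ultimately show "\<bar>mean (avg as f) - mean f\<bar> \<le> 0 + e" by linarith
  qed
  then show ?thesis by simp
qed

lemma mean_minus:
  assumes f: "cfun f"
  shows "mean (\<lambda>x. - f x) = - mean f"
proof -
  have "\<bar>mean (\<lambda>x. - f x) + mean f\<bar> \<le> 0"
  proof (rule field_le_epsilon)
    fix e :: real assume "0 < e"
    then obtain bs c where bs: "bs \<in> Lists" "\<And>x. x \<in> carrier K \<Longrightarrow> \<bar>ravg bs f x - c\<bar> \<le> e/2"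
      using ravg_uniform[OF f, of "e/2"] by auto
    have "\<bar>mean f - c\<bar> \<le> e/2" by (rule mean_close_of_ravg[OF f bs])
    moreover have "ravg bs (\<lambda>x. - f x) x = - ravg bs f x" for x
      by (simp add: ravg_def uminus_sum_list_map[symmetric, unfolded comp_def] del: minus_divide_left)
    then have "\<bar>ravg bs (\<lambda>x. - f x) x - (- c)\<bar> \<le> e/2" if "x \<in> carrier K" for x
      using bs(2)[OF that] by (simp add: abs_minus_commute)
    then have "\<bar>mean (\<lambda>x. - f x) - (- c)\<bar> \<le> e/2"
      by (intro mean_close_of_ravg[OF _ bs(1)] continuous_map_minus f)
    ultimately show "\<bar>mean (\<lambda>x. - f x) + mean f\<bar> \<le> 0 + e" by linarith
  qed
  then show ?thesis by simp
qed

lemma mean_add: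
  assumes f: "cfun f" and g: "cfun g"
  shows "mean (\<lambda>x. f x + g x) = mean f + mean g"
proof -
  (* The list bs averages avg as g, whose mean is that of g, and does not increase the bound for avg as f. *)
  have sub: "mean (\<lambda>x. f x + g x) \<le> mean f + mean g" if f: "cfun f" and g: "cfun g" for f g
  proof (rule field_le_epsilon)
    fix e :: real assume "0 < e"
    then have e: "0 < e/2" by simp
    obtain as where as: "as \<in> Lists" "\<And>x. x \<in> carrier K \<Longrightarrow> avg as f x < mean f + e/2"
      using mean_attained[OF f e] by blast
    obtain bs where bs: "bs \<in> Lists" "\<And>x. x \<in> carrier K \<Longrightarrow> avg bs (avg as g) x < mean g + e/2"
      using mean_attained[OF cfun_avg[OF g as(1)] e] mean_avg[OF g as(1)] by auto
    have "avg bs (avg as (\<lambda>x. f x + g x)) x \<le> mean f + mean g + e" if x: "x \<in> carrier K" for x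
    proof -
      have "avg bs (avg as (\<lambda>x. f x + g x)) x = avg bs (avg as f) x + avg bs (avg as g) x"
        by (simp add: avg_add[abs_def, of as] avg_add)
      moreover have "avg bs (avg as f) x \<le> avg bs (\<lambda>x. mean f + e/2) x"
        using as(2) by (intro avg_mono bs x) (simp add: less_imp_le)
      ultimately show ?thesis using bs(2)[OF x] bs(1) by simp
    qed
    then show "mean (\<lambda>x. f x + g x) \<le> mean f + mean g + e"
      by (intro mean_le_avg_avg[OF continuous_map_add[OF f g] as(1) bs(1)]) 
  qed
  have "mean f = mean (\<lambda>x. (f x + g x) + - g x)" by simp
  also have "\<dots> \<le> mean (\<lambda>x. f x + g x) + mean (\<lambda>x. - g x)"
    by (rule sub) (auto intro: continuous_map_add f g continuous_map_minus)
  finally show ?thesis using sub[OF f g] mean_minus[OF g] by linarith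
qed

lemma mean_diff:
  assumes f: "cfun f" and g: "cfun g"
  shows "mean (\<lambda>x. f x - g x) = mean f - mean g"
  using mean_add[OF f, of "\<lambda>x. - g x"] g by (simp add: mean_minus continuous_map_minus)

lemma mean_scale:
  assumes f: "cfun f"
  shows "mean (\<lambda>x. c * f x) = c * mean f"
proof -
  have le: "mean (\<lambda>x. c * f x) \<le> c * mean f" if c: "0 < c" and f: "cfun f" for c f
  proof (rule field_le_epsilon)
    fix e :: real assume e: "0 < e"
    then obtain as where as: "as \<in> Lists" "\<And>x. x \<in> carrier K \<Longrightarrow> avg as f x < mean f + e/c"
      using mean_attained[OF f, of "e/c"] c by auto
    show "mean (\<lambda>x. c * f x) \<le> c * mean f + e"
    proof (rule mean_le_avg[OF continuous_map_real_mult_left[OF f] as(1)])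
      fix x assume "x \<in> carrier K"
      from as(2)[OF this] c show "avg as (\<lambda>x. c * f x) x \<le> c * mean f + e"
        by (simp add: avg_scale field_simps)
    qed
  qed
  have pos: "mean (\<lambda>x. c * f x) = c * mean f" if c: "0 < c" for c
  proof -
    have "mean (\<lambda>x. inverse c * (c * f x)) \<le> inverse c * mean (\<lambda>x. c * f x)"
      by (rule le) (auto intro: continuous_map_real_mult_left f c)
    then have "mean f \<le> inverse c * mean (\<lambda>x. c * f x)"
      using c by (simp flip: mult.assoc)
    then have "c * mean f \<le> mean (\<lambda>x. c * f x)" using c by (simp add: field_simps)
    with le[OF c f] show ?thesis by simp
  qed
  consider "c = 0" | "0 < c" | "0 < - c" by linarith
  then show ?thesis
  proof cases
    case 3
    have "mean (\<lambda>x. - (- c * f x)) = - mean (\<lambda>x. - c * f x)"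
      by (intro mean_minus continuous_map_real_mult_left f)
    with pos[OF 3] show ?thesis by simp
  qed (auto simp: pos)
qed

lemma mean_nonneg:
  assumes f: "cfun f" and "\<And>x. x \<in> carrier K \<Longrightarrow> 0 \<le> f x"
  shows "0 \<le> mean f"
  using mean_mono[of "\<lambda>x. 0" f] assms by simp

lemma mean_sum:
  assumes "finite I" "\<And>i. i \<in> I \<Longrightarrow> cfun (f i)"
  shows "mean (\<lambda>x. \<Sum>i\<in>I. f i x) = (\<Sum>i\<in>I. mean (f i))"
  using assms by (induction I) (auto simp: mean_add continuous_map_sum)

lemma mean_translate:
  assumes f: "cfun f" and a: "a \<in> carrier K"
  shows "mean (\<lambda>x. f (a \<otimes> x)) = mean f"
  using mean_avg[OF f, of "[a]"] a by (simp add: avg_def[abs_def] Lists_def)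

lemma mean_rtranslate:
  assumes f: "cfun f" and a: "a \<in> carrier K"
  shows "mean (\<lambda>x. f (x \<otimes> a)) = mean f"
proof -
  have le: "mean f \<le> mean (\<lambda>x. f (x \<otimes> a))" if f: "cfun f" and a: "a \<in> carrier K" for f a
  proof (rule mean_greatest)
    fix as assume as: "as \<in> Lists"
    have eq: "avg as (\<lambda>x. f (x \<otimes> a)) x = avg as f (x \<otimes> a)" if "x \<in> carrier K" for x
    proof -
      have "(\<Sum>b\<leftarrow>as. f (b \<otimes> x \<otimes> a)) = (\<Sum>b\<leftarrow>as. f (b \<otimes> (x \<otimes> a)))"
        using as that a
        by (intro arg_cong[where f = sum_list] map_cong) (auto simp: Lists_def m_assoc subset_iff)
      then show ?thesis by (simp add: avg_def)
    qed
    have "supr (avg as f) \<le> supr (avg as (\<lambda>x. f (x \<otimes> a)))"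
    proof (rule supr_least)
      fix x assume x: "x \<in> carrier K"
      have "avg as f x = avg as (\<lambda>x. f (x \<otimes> a)) (x \<otimes> inv a)"
        using x a by (simp add: eq m_assoc)
      also have "\<dots> \<le> supr (avg as (\<lambda>x. f (x \<otimes> a)))"
        using x a f as by (intro supr_upper cfun_avg cfun_translate) auto
      finally show "avg as f x \<le> supr (avg as (\<lambda>x. f (x \<otimes> a)))" .
    qed
    with mean_lower[OF f as] show "mean f \<le> supr (avg as (\<lambda>x. f (x \<otimes> a)))" by simp
  qed
  have "mean (\<lambda>x. f (x \<otimes> a)) \<le> mean (\<lambda>x. f (x \<otimes> inv a \<otimes> a))"
    using le[OF cfun_translate(2)[OF f a], of "inv a"] a by simp
  also have "\<dots> = mean f" using a by (intro mean_cong) (simp add: m_assoc)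
  finally show ?thesis using le[OF f a] by simp
qed

text \<open>Finitely many translates of the set where \<open>f\<close> exceeds half of its value at \<open>p\<close> cover the group, so that
  their average has a positive lower bound.\<close>

lemma mean_pos:
  assumes f: "cfun f" and nonneg: "\<And>x. x \<in> carrier K \<Longrightarrow> 0 \<le> f x"
    and p: "p \<in> carrier K" "0 < f p"
  shows "0 < mean f"
proof (rule ccontr)
  assume "\<not> ?thesis"
  then have m0: "mean f = 0" using mean_nonneg[OF f nonneg] by simp
  define D where "D c = {x \<in> carrier K. f (c \<otimes> x) \<in> {f p/2<..}}" for c
  have "openin T (D c)" if "c \<in> carrier K" for c
    using openin_continuous_map_preimage[OF cfun_translate(1)[OF f that], of "{f p/2<..}"]
    by (simp add: D_def flip: open_openin)
  moreover have "carrier K \<subseteq> \<Union>(D ` carrier K)"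
  proof
    fix x assume x: "x \<in> carrier K"
    then have "x \<in> D (p \<otimes> inv x)" using p by (simp add: D_def m_assoc)
    then show "x \<in> \<Union>(D ` carrier K)" using x p by (intro UN_I[of "p \<otimes> inv x"]) auto
  qed
  ultimately obtain C where C: "finite C" "C \<subseteq> carrier K" "carrier K \<subseteq> \<Union>(D ` C)"
    by (rule finite_subcover)
  obtain cs where cs: "set cs = C" using C(1) finite_list by blast
  have csL: "cs \<in> Lists" using C cs by (auto simp: Lists_def)
  have "f p / 2 / length cs \<le> avg cs f x" if x: "x \<in> carrier K" for x
  proof -
    obtain c where c: "c \<in> C" "f p / 2 < f (c \<otimes> x)" using C x by (auto simp: D_def)
    have "f (c \<otimes> x) \<le> (\<Sum>a\<leftarrow>cs. f (a \<otimes> x))"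
      using c cs C x nonneg by (intro member_le_sum_list) auto
    with c show ?thesis unfolding avg_def by (intro divide_right_mono) auto
  qed
  then have "f p / 2 / length cs \<le> mean (avg cs f)"
    using mean_mono[of "\<lambda>x. f p / 2 / length cs" "avg cs f"] cfun_avg[OF f csL] by simp
  moreover have "0 < f p / 2 / length cs" using p csL by (simp add: Lists_def)
  ultimately show False using m0 mean_avg[OF f csL] by simp
qed

lemma mean_square_eq_0:
  assumes f: "cfun f" and 0: "mean (\<lambda>x. f x * f x) = 0" and x: "x \<in> carrier K"
  shows "f x = 0"
proof (rule ccontr)
  assume "f x \<noteq> 0"
  then have "0 < f x * f x" by (simp add: zero_less_mult_iff) linarith
  then have "0 < mean (\<lambda>x. f x * f x)"
    using mean_pos[of "\<lambda>x. f x * f x" x] x continuous_map_real_mult[OF f f] by simp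
  with 0 show False by simp
qed

text \<open>An invariant functional has the same value at a function and its averages, hence is bounded by the
  mean; the same holds for the negative of the function.\<close>

lemma mean_unique:
  assumes add: "\<And>f g. cfun f \<Longrightarrow> cfun g \<Longrightarrow> I (\<lambda>x. f x + g x) = I f + I g"
    and scale: "\<And>f c. cfun f \<Longrightarrow> I (\<lambda>x. c * f x) = c * I f"
    and mono: "\<And>f g. cfun f \<Longrightarrow> cfun g \<Longrightarrow> (\<And>x. x \<in> carrier K \<Longrightarrow> f x \<le> g x) \<Longrightarrow> I f \<le> I g"
    and const: "I (\<lambda>x. 1) = (1 :: real)"
    and translate: "\<And>f a. cfun f \<Longrightarrow> a \<in> carrier K \<Longrightarrow> I (\<lambda>x. f (a \<otimes> x)) = I f"
    and f: "cfun f"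
  shows "I f = mean f"
proof -
  have le: "I f \<le> mean f" if f: "cfun f" for f
  proof (rule field_le_epsilon)
    fix e :: real assume "0 < e"
    then obtain as where as: "as \<in> Lists" "\<And>x. x \<in> carrier K \<Longrightarrow> avg as f x < mean f + e"
      using mean_attained[OF f] by blast
    have "cfun (\<lambda>x. \<Sum>a\<leftarrow>bs. f (a \<otimes> x)) \<and> I (\<lambda>x. \<Sum>a\<leftarrow>bs. f (a \<otimes> x)) = length bs * I f"
      if "set bs \<subseteq> carrier K" for bs
      using that
    proof (induction bs)
      case Nil
      then show ?case using scale[of "\<lambda>x. 1" 0] by simp
    next
      case (Cons b bs)
      then show ?case by (auto simp: add translate f cfun_translate algebra_simps intro: continuous_map_add)
    qed
    with as(1) have "cfun (\<lambda>x. \<Sum>a\<leftarrow>as. f (a \<otimes> x))" "I (\<lambda>x. \<Sum>a\<leftarrow>as. f (a \<otimes> x)) = length as * I f"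
      by (auto simp: Lists_def)
    from scale[OF this(1), of "1 / length as"] this(2) as(1)
    have "I f = I (avg as f)" by (simp add: avg_def[abs_def] Lists_def)
    also have "\<dots> \<le> I (\<lambda>x. (mean f + e) * 1)"
      using as cfun_avg[OF f as(1)] by (intro mono) (auto simp: less_imp_le)
    also have "\<dots> = mean f + e" using scale[of "\<lambda>x. 1" "mean f + e"] const by simp
    finally show "I f \<le> mean f + e" .
  qed
  have "I (\<lambda>x. - 1 * f x) \<le> mean (\<lambda>x. - 1 * f x)"
    by (intro le continuous_map_real_mult_left f)
  then have "mean f \<le> I f" unfolding scale[OF f] mean_scale[OF f] by simp
  with le[OF f] show ?thesis by simp
qed

lemma continuous_map_mean:
  assumes F: "continuous_map (prod_topology S T) euclideanreal (\<lambda>(x, y). F x y)"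
  shows "continuous_map S euclideanreal (\<lambda>x. mean (F x))"
proof -
  have cF: "cfun (F x)" if "x \<in> topspace S" for x
  proof -
    have "continuous_map T (prod_topology S T) (\<lambda>y. (x, y))"
      using that by (intro continuous_map_pairedI) auto
    from continuous_map_compose[OF this F] show ?thesis by (simp add: comp_def)
  qed
  have "\<exists>U. openin S U \<and> x \<in> U \<and> (\<forall>x'\<in>U. mean (F x') \<in> ball (mean (F x)) e)"
    if x: "x \<in> topspace S" and e: "0 < e" for x e
  proof -
    obtain U where U: "openin S U" "x \<in> U"
      "\<And>x' y. x' \<in> U \<Longrightarrow> y \<in> carrier K \<Longrightarrow> \<bar>F x' y - F x y\<bar> < e/2"
      using uniform_in_compact_variable[OF F x, of "e/2"] e by auto
    have "\<bar>mean (F x') - mean (F x)\<bar> \<le> e/2" if x': "x' \<in> U" for x'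
    proof -
      have "x' \<in> topspace S" using U(1) x' openin_subset by blast
      note c = cF[OF this] cF[OF x]
      have d: "F x' y \<le> F x y + e/2" "F x y \<le> F x' y + e/2" if "y \<in> carrier K" for y
        using U(3)[OF x' that] by linarith+
      have "mean (F x') \<le> mean (\<lambda>y. F x y + e/2)"
        by (intro mean_mono continuous_map_add c d) auto
      moreover have "mean (F x) \<le> mean (\<lambda>y. F x' y + e/2)"
        by (intro mean_mono continuous_map_add c d) auto
      ultimately have "mean (F x') \<le> mean (F x) + e/2" "mean (F x) \<le> mean (F x') + e/2"
        using c by (simp_all add: mean_add)
      then show ?thesis by linarith
    qed
    then show ?thesis using U e by (intro exI[of _ U]) (force simp: dist_real_def abs_minus_commute)
  qed
  then show ?thesis
    using Met_TC.continuous_map_to_metric[of S "\<lambda>x. mean (F x)"] by simp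
qed

end

lemma (in compact_top_group) compact_top_group_DirProd:
  "compact_top_group (K \<times>\<times> K) (prod_topology T T)"
proof -
  interpret KK: group "K \<times>\<times> K" by (intro DirProd_group is_group)
  have "topological_group (K \<times>\<times> K) (prod_topology T T)"
    unfolding topological_group_def
  proof (intro conjI)
    have c1: "continuous_map (prod_topology (prod_topology T T) (prod_topology T T)) (prod_topology T T)
       (\<lambda>p. (fst (fst p) \<otimes> fst (snd p), snd (fst p) \<otimes> snd (snd p)))"
      by (intro continuous_map_pairedI continuous_map_mult_group
          continuous_map_compose[OF continuous_map_fst continuous_map_fst, unfolded comp_def]
          continuous_map_compose[OF continuous_map_fst continuous_map_snd, unfolded comp_def]
          continuous_map_compose[OF continuous_map_snd continuous_map_fst, unfolded comp_def]
          continuous_map_compose[OF continuous_map_snd continuous_map_snd, unfolded comp_def])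
    then show "continuous_map (prod_topology (prod_topology T T) (prod_topology T T)) (prod_topology T T)
       (\<lambda>(x, y). x \<otimes>\<^bsub>K \<times>\<times> K\<^esub> y)"
      by (simp add: DirProd_def case_prod_unfold)
    have c2: "continuous_map (prod_topology T T) (prod_topology T T) (\<lambda>p. (inv (fst p), inv (snd p)))"
      by (intro continuous_map_pairedI continuous_map_inv_group continuous_map_fst continuous_map_snd)
    show "continuous_map (prod_topology T T) (prod_topology T T) (\<lambda>x. inv\<^bsub>K \<times>\<times> K\<^esub> x)"
      by (rule continuous_map_eq[OF c2]) (auto simp: inv_DirProd is_group)
  qed (auto simp: DirProd_def intro: KK.is_group[unfolded DirProd_def])
  then show ?thesis
    by unfold_locales (simp add: compact_group_def compact compact_space_prod_topology Hausdorff Hausdorff_space_prod_topology)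
qed

text \<open>Both iterated means are invariant on the product group, whose invariant mean is unique.\<close>

lemma (in compact_top_group) mean_Fubini:
  assumes F: "continuous_map (prod_topology T T) euclideanreal (\<lambda>(x, y). F x y)"
  shows "mean (\<lambda>x. mean (\<lambda>y. F x y)) = mean (\<lambda>y. mean (\<lambda>x. F x y))"
proof -
  interpret KK: compact_top_group "K \<times>\<times> K" "prod_topology T T" by (rule compact_top_group_DirProd)
  have swap: "continuous_map (prod_topology T T) euclideanreal (\<lambda>(x, y). G (y, x))"
    if "KK.cfun G" for G
    using continuous_map_compose[OF continuous_map_pairedI[OF continuous_map_snd continuous_map_fst] that]
    by (simp add: comp_def case_prod_unfold)
  have m1: "cfun (\<lambda>x. mean (\<lambda>y. G (x, y)))" if "KK.cfun G" for G
    using continuous_map_mean[of T "\<lambda>x y. G (x, y)"] that by simp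
  have m2: "cfun (\<lambda>y. mean (\<lambda>x. G (x, y)))" if "KK.cfun G" for G
    using continuous_map_mean[of T "\<lambda>y x. G (x, y)"] swap[OF that] by simp
  have s1: "cfun (\<lambda>y. G (x, y))" and s2: "cfun (\<lambda>y. G (y, x))" if "KK.cfun G" "x \<in> carrier K" for G x
    using that by (auto intro!: continuous_map_compose[OF _ that(1), unfolded comp_def] continuous_map_pairedI)
  have "mean (\<lambda>x. mean (\<lambda>y. G (x, y))) = KK.mean G" if G: "KK.cfun G" for G
  proof (rule KK.mean_unique[where I="\<lambda>G. mean (\<lambda>x. mean (\<lambda>y. G (x, y)))", OF _ _ _ _ _ G])
    fix f a assume f: "KK.cfun f" and "a \<in> carrier (K \<times>\<times> K)"
    then obtain b c where a: "a = (b, c)" "b \<in> carrier K" "c \<in> carrier K" by (auto simp: DirProd_def)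
    have "mean (\<lambda>y. f (b \<otimes> x, c \<otimes> y)) = mean (\<lambda>y. f (b \<otimes> x, y))" if "x \<in> carrier K" for x
      using mean_translate[OF s1[OF f, of "b \<otimes> x"] a(3)] that a by simp
    then have "mean (\<lambda>x. mean (\<lambda>y. f (b \<otimes> x, c \<otimes> y))) = mean (\<lambda>x. mean (\<lambda>y. f (b \<otimes> x, y)))"
      by (rule mean_cong)
    also have "\<dots> = mean (\<lambda>x. mean (\<lambda>y. f (x, y)))" by (rule mean_translate[OF m1[OF f] a(2)])
    finally show "mean (\<lambda>x. mean (\<lambda>y. f (a \<otimes>\<^bsub>K \<times>\<times> K\<^esub> (x, y)))) = mean (\<lambda>x. mean (\<lambda>y. f (x, y)))"
      by (simp add: a DirProd_def)
  next
    fix f g assume fg: "KK.cfun f" "KK.cfun g"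
    have "mean (\<lambda>x. mean (\<lambda>y. f (x, y) + g (x, y))) = mean (\<lambda>x. mean (\<lambda>y. f (x, y)) + mean (\<lambda>y. g (x, y)))"
      by (intro mean_cong mean_add s1 fg)
    then show "mean (\<lambda>x. mean (\<lambda>y. f (x, y) + g (x, y))) = mean (\<lambda>x. mean (\<lambda>y. f (x, y))) + mean (\<lambda>x. mean (\<lambda>y. g (x, y)))"
      by (simp add: mean_add m1 fg)
  next
    fix f and c :: real assume f: "KK.cfun f"
    have "mean (\<lambda>x. mean (\<lambda>y. c * f (x, y))) = mean (\<lambda>x. c * mean (\<lambda>y. f (x, y)))"
      by (intro mean_cong mean_scale s1 f)
    then show "mean (\<lambda>x. mean (\<lambda>y. c * f (x, y))) = c * mean (\<lambda>x. mean (\<lambda>y. f (x, y)))"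
      by (simp add: mean_scale m1 f)
  next
    fix f g assume fg: "KK.cfun f" "KK.cfun g" "\<And>x. x \<in> carrier (K \<times>\<times> K) \<Longrightarrow> f x \<le> g x"
    then show "mean (\<lambda>x. mean (\<lambda>y. f (x, y))) \<le> mean (\<lambda>x. mean (\<lambda>y. g (x, y)))"
      by (intro mean_mono m1 s1 fg) (auto simp: DirProd_def)
  qed simp
  moreover have "mean (\<lambda>y. mean (\<lambda>x. G (x, y))) = KK.mean G" if G: "KK.cfun G" for G
  proof (rule KK.mean_unique[where I="\<lambda>G. mean (\<lambda>y. mean (\<lambda>x. G (x, y)))", OF _ _ _ _ _ G])
    fix f a assume f: "KK.cfun f" and "a \<in> carrier (K \<times>\<times> K)"
    then obtain b c where a: "a = (b, c)" "b \<in> carrier K" "c \<in> carrier K" by (auto simp: DirProd_def)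
    have "mean (\<lambda>x. f (b \<otimes> x, c \<otimes> y)) = mean (\<lambda>x. f (x, c \<otimes> y))" if "y \<in> carrier K" for y
      using mean_translate[OF s2[OF f, of "c \<otimes> y"] a(2)] that a by simp
    then have "mean (\<lambda>y. mean (\<lambda>x. f (b \<otimes> x, c \<otimes> y))) = mean (\<lambda>y. mean (\<lambda>x. f (x, c \<otimes> y)))"
      by (rule mean_cong)
    also have "\<dots> = mean (\<lambda>y. mean (\<lambda>x. f (x, y)))" by (rule mean_translate[OF m2[OF f] a(3)])
    finally show "mean (\<lambda>y. mean (\<lambda>x. f (a \<otimes>\<^bsub>K \<times>\<times> K\<^esub> (x, y)))) = mean (\<lambda>y. mean (\<lambda>x. f (x, y)))"
      by (simp add: a DirProd_def)
  next
    fix f g assume fg: "KK.cfun f" "KK.cfun g"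
    have "mean (\<lambda>y. mean (\<lambda>x. f (x, y) + g (x, y))) = mean (\<lambda>y. mean (\<lambda>x. f (x, y)) + mean (\<lambda>x. g (x, y)))"
      by (intro mean_cong mean_add s2 fg)
    then show "mean (\<lambda>y. mean (\<lambda>x. f (x, y) + g (x, y))) = mean (\<lambda>y. mean (\<lambda>x. f (x, y))) + mean (\<lambda>y. mean (\<lambda>x. g (x, y)))"
      by (simp add: mean_add m2 fg)
  next
    fix f and c :: real assume f: "KK.cfun f"
    have "mean (\<lambda>y. mean (\<lambda>x. c * f (x, y))) = mean (\<lambda>y. c * mean (\<lambda>x. f (x, y)))"
      by (intro mean_cong mean_scale s2 f)
    then show "mean (\<lambda>y. mean (\<lambda>x. c * f (x, y))) = c * mean (\<lambda>y. mean (\<lambda>x. f (x, y)))"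
      by (simp add: mean_scale m2 f)
  next
    fix f g assume fg: "KK.cfun f" "KK.cfun g" "\<And>x. x \<in> carrier (K \<times>\<times> K) \<Longrightarrow> f x \<le> g x"
    then show "mean (\<lambda>y. mean (\<lambda>x. f (x, y))) \<le> mean (\<lambda>y. mean (\<lambda>x. g (x, y)))"
      by (intro mean_mono m2 s2 fg) (auto simp: DirProd_def)
  qed simp
  ultimately show ?thesis using F[unfolded case_prod_unfold] by fastforce
qed

section \<open>Unitary matrices\<close>

lemma continuous_map_complex_mult [continuous_intros]:
  fixes f g :: "'a \<Rightarrow> complex"
  shows "continuous_map Y euclidean f \<Longrightarrow> continuous_map Y euclidean g \<Longrightarrow>
    continuous_map Y euclidean (\<lambda>x. f x * g x)"
  by (simp add: continuous_map_atin tendsto_mult)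

lemma continuous_map_cnj [continuous_intros]:
  "continuous_map Y euclidean f \<Longrightarrow> continuous_map Y euclidean (\<lambda>x. cnj (f x))"
  by (simp add: continuous_map_atin tendsto_cnj)

lemma continuous_map_Re [continuous_intros]:
  "continuous_map Y euclidean f \<Longrightarrow> continuous_map Y euclidean (\<lambda>x. Re (f x))"
  by (simp add: continuous_map_atin tendsto_Re)

lemma continuous_map_Im [continuous_intros]:
  "continuous_map Y euclidean f \<Longrightarrow> continuous_map Y euclidean (\<lambda>x. Im (f x))"
  by (simp add: continuous_map_atin tendsto_Im)

lemma continuous_map_of_real [continuous_intros]:
  "continuous_map Y euclidean f \<Longrightarrow> continuous_map Y euclidean (\<lambda>x. complex_of_real (f x))"
  by (simp add: continuous_map_atin tendsto_of_real)

lemma mat_adjoint_dim [simp]: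
  "dim_row (mat_adjoint A) = dim_col A" "dim_col (mat_adjoint A) = dim_row A"
  by (simp_all add: mat_adjoint_def)

lemma mat_adjoint_carrier [simp]: "A \<in> carrier_mat n m \<Longrightarrow> mat_adjoint A \<in> carrier_mat m n"
  using mat_adjoint_dim by blast

lemma mat_adjoint_index [simp]:
  fixes A :: "complex mat"
  assumes "i < dim_col A" "j < dim_row A"
  shows "mat_adjoint A $$ (i, j) = cnj (A $$ (j, i))"
proof -
  have "mat_adjoint A $$ (i, j) = map conjugate (cols A) ! i $ j"
    unfolding mat_adjoint_def mat_of_rows_def using assms by (subst index_mat) auto
  also have "\<dots> = conjugate (col A i) $ j" using assms by simp
  also have "\<dots> = cnj (A $$ (j, i))" using assms by simp
  finally show ?thesis .
qed

lemma mat_adjoint_adjoint [simp]: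
  fixes A :: "complex mat"
  shows "mat_adjoint (mat_adjoint A) = A"
  by (rule eq_matI) simp_all

lemma mat_mult_index:
  fixes A B :: "complex mat"
  assumes "A \<in> carrier_mat n m" "B \<in> carrier_mat m l" "i < n" "j < l"
  shows "(A * B) $$ (i, j) = (\<Sum>k<m. A $$ (i, k) * B $$ (k, j))"
proof -
  have "(A * B) $$ (i, j) = row A i \<bullet> col B j" using assms by simp
  also have "\<dots> = (\<Sum>k<m. A $$ (i, k) * B $$ (k, j))"
    unfolding scalar_prod_def atLeast0LessThan using assms by (intro sum.cong) auto
  finally show ?thesis .
qed

lemma mat_adjoint_mult:
  fixes A B :: "complex mat"
  assumes "A \<in> carrier_mat n m" "B \<in> carrier_mat m l"
  shows "mat_adjoint (A * B) = mat_adjoint B * mat_adjoint A"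
proof (rule eq_matI)
  fix i j assume "i < dim_row (mat_adjoint B * mat_adjoint A)" "j < dim_col (mat_adjoint B * mat_adjoint A)"
  then have ij: "i < l" "j < n" using assms by auto
  have "mat_adjoint (A * B) $$ (i, j) = cnj (\<Sum>k<m. A $$ (j, k) * B $$ (k, i))"
    using assms ij mat_mult_index[OF assms ij(2,1)] by (subst mat_adjoint_index) (auto simp del: index_mult_mat(1))
  also have "\<dots> = (\<Sum>k<m. mat_adjoint B $$ (i, k) * mat_adjoint A $$ (k, j))"
    unfolding cnj_sum using assms ij by (intro sum.cong refl) (simp add: mult.commute)
  also have "\<dots> = (mat_adjoint B * mat_adjoint A) $$ (i, j)"
    using assms ij by (intro mat_mult_index[of _ l m _ n, symmetric]) auto
  finally show "mat_adjoint (A * B) $$ (i, j) = (mat_adjoint B * mat_adjoint A) $$ (i, j)" .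
qed (use assms in auto)

lemma unitary_carrier: "A \<in> carrier (unitary_group n) \<Longrightarrow> A \<in> carrier_mat n n"
  by (simp add: unitary_group_def)

lemma unitary_adjoint:
  assumes "A \<in> carrier (unitary_group n)"
  shows "A * mat_adjoint A = 1\<^sub>m n" "mat_adjoint A * A = 1\<^sub>m n"
  using assms by (simp_all add: unitary_group_def)

lemma unitaryI:
  assumes "A \<in> carrier_mat n n" "A * mat_adjoint A = 1\<^sub>m n"
  shows "A \<in> carrier (unitary_group n)"
  using assms mat_mult_left_right_inverse[OF assms(1) mat_adjoint_carrier[OF assms(1)] assms(2)]
  by (simp add: unitary_group_def)

lemma unitary_mult [simp]: "A \<otimes>\<^bsub>unitary_group n\<^esub> B = A * B"
  and unitary_one [simp]: "\<one>\<^bsub>unitary_group n\<^esub> = 1\<^sub>m n"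
  by (simp_all add: unitary_group_def)

lemma unitary_closed:
  assumes A: "A \<in> carrier (unitary_group n)" and B: "B \<in> carrier (unitary_group n)"
  shows "A * B \<in> carrier (unitary_group n)"
proof (rule unitaryI)
  note c = unitary_carrier[OF A] unitary_carrier[OF B]
  show "A * B \<in> carrier_mat n n" using c by simp
  have "A * B * mat_adjoint (A * B) = A * B * (mat_adjoint B * mat_adjoint A)"
    by (simp add: mat_adjoint_mult[OF c])
  also have "\<dots> = A * (B * (mat_adjoint B * mat_adjoint A))"
    using c by (intro assoc_mult_mat[of _ n n _ n _ n] mult_carrier_mat[of _ n n] mat_adjoint_carrier)
  also have "B * (mat_adjoint B * mat_adjoint A) = B * mat_adjoint B * mat_adjoint A"
    using c by (intro assoc_mult_mat[of _ n n _ n _ n, symmetric]) simp_all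
  also have "A * \<dots> = 1\<^sub>m n"
    using c by (simp add: unitary_adjoint[OF A] unitary_adjoint[OF B])
  finally show "A * B * mat_adjoint (A * B) = 1\<^sub>m n" .
qed

lemma unitary_adjoint_closed:
  "A \<in> carrier (unitary_group n) \<Longrightarrow> mat_adjoint A \<in> carrier (unitary_group n)"
  by (intro unitaryI) (simp_all add: unitary_adjoint unitary_carrier)

lemma group_unitary: "group (unitary_group n)"
proof (rule groupI)
  fix A assume "A \<in> carrier (unitary_group n)"
  then show "\<exists>B\<in>carrier (unitary_group n). B \<otimes>\<^bsub>unitary_group n\<^esub> A = \<one>\<^bsub>unitary_group n\<^esub>"
    by (intro bexI[of _ "mat_adjoint A"]) (simp_all add: unitary_adjoint unitary_adjoint_closed)
next
  show "\<one>\<^bsub>unitary_group n\<^esub> \<in> carrier (unitary_group n)"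
  proof -
    have "mat_adjoint (1\<^sub>m n) = (1\<^sub>m n :: complex mat)" by (rule eq_matI) simp_all
    then show ?thesis by (simp add: unitaryI)
  qed
next
  fix A B C assume "A \<in> carrier (unitary_group n)" "B \<in> carrier (unitary_group n)" "C \<in> carrier (unitary_group n)"
  then show "A \<otimes>\<^bsub>unitary_group n\<^esub> B \<otimes>\<^bsub>unitary_group n\<^esub> C = A \<otimes>\<^bsub>unitary_group n\<^esub> (B \<otimes>\<^bsub>unitary_group n\<^esub> C)"
    by (simp add: assoc_mult_mat[of A n n B n C n] unitary_carrier)
qed (simp_all add: unitary_closed left_mult_one_mat[OF unitary_carrier])

lemma unitary_inv:
  assumes "A \<in> carrier (unitary_group n)"
  shows "inv\<^bsub>unitary_group n\<^esub> A = mat_adjoint A"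
  using assms by (intro group.inv_equality[OF group_unitary]) (simp_all add: unitary_adjoint unitary_adjoint_closed)

lemma unitary_row_norm:
  assumes A: "A \<in> carrier (unitary_group n)" and i: "i < n"
  shows "(\<Sum>j<n. (cmod (A $$ (i, j)))\<^sup>2) = 1"
proof -
  note c = unitary_carrier[OF A]
  have "complex_of_real (\<Sum>j<n. (cmod (A $$ (i, j)))\<^sup>2) = (\<Sum>j<n. A $$ (i, j) * mat_adjoint A $$ (j, i))"
    unfolding of_real_sum
  proof (intro sum.cong refl)
    fix j assume "j \<in> {..<n}"
    then have "mat_adjoint A $$ (j, i) = cnj (A $$ (i, j))" using c i by simp
    then show "complex_of_real ((cmod (A $$ (i, j)))\<^sup>2) = A $$ (i, j) * mat_adjoint A $$ (j, i)"
      using complex_norm_square[of "A $$ (i, j)"] by simp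
  qed
  also have "\<dots> = (A * mat_adjoint A) $$ (i, i)"
    using c i by (intro mat_mult_index[of _ n n _ n, symmetric]) auto
  also have "\<dots> = 1" using unitary_adjoint(1)[OF A] i by simp
  finally show ?thesis by (metis of_real_1 of_real_eq_iff)
qed

lemma unitary_entry_le_1:
  assumes A: "A \<in> carrier (unitary_group n)" and ij: "i < n" "j < n"
  shows "cmod (A $$ (i, j)) \<le> 1"
proof -
  have "(cmod (A $$ (i, j)))\<^sup>2 \<le> (\<Sum>j<n. (cmod (A $$ (i, j)))\<^sup>2)"
    using ij by (intro member_le_sum) auto
  then show ?thesis by (simp add: unitary_row_norm[OF A ij(1)] abs_square_le_1)
qed

text \<open>Diagonal entries have modulus at most 1, so that all of them are equal to 1. The rows have norm 1, which
  leaves nothing for the other entries.\<close>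

lemma unitary_eq_one_if_Re_diag:
  assumes A: "A \<in> carrier (unitary_group n)" and tr: "(\<Sum>i<n. Re (A $$ (i, i))) \<ge> n"
  shows "A = 1\<^sub>m n"
proof -
  note c = unitary_carrier[OF A]
  have le: "Re (A $$ (i, i)) \<le> 1" if "i < n" for i
    using unitary_entry_le_1[OF A that that] complex_Re_le_cmod[of "A $$ (i, i)"] by simp
  have diag: "Re (A $$ (i, i)) = 1" if i: "i < n" for i
  proof (rule ccontr)
    assume "Re (A $$ (i, i)) \<noteq> 1"
    then have "Re (A $$ (i, i)) < 1" using le[OF i] by simp
    then have "(\<Sum>i<n. Re (A $$ (i, i))) < (\<Sum>i<n. 1)"
      using le i by (intro sum_strict_mono_ex1) auto
    with tr show False by simp
  qed
  show ?thesis
  proof (rule eq_matI)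
    fix i j assume "i < dim_row (1\<^sub>m n :: complex mat)" "j < dim_col (1\<^sub>m n :: complex mat)"
    then have ij: "i < n" "j < n" by auto
    have m: "cmod (A $$ (i, i)) = 1"
      using diag[OF ij(1)] unitary_entry_le_1[OF A ij(1) ij(1)] complex_Re_le_cmod[of "A $$ (i, i)"] by simp
    have "Im (A $$ (i, i)) = 0" using m diag[OF ij(1)] by (simp add: cmod_def)
    then have ii: "A $$ (i, i) = 1" using diag[OF ij(1)] by (simp add: complex_eq_iff)
    have "(\<Sum>j\<in>{..<n} - {i}. (cmod (A $$ (i, j)))\<^sup>2) = 0"
      using unitary_row_norm[OF A ij(1)] ij m by (subst (asm) sum.remove[of _ i]) auto
    then have "\<forall>j\<in>{..<n} - {i}. (cmod (A $$ (i, j)))\<^sup>2 = 0"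
      by (subst (asm) sum_nonneg_eq_0_iff) auto
    then show "A $$ (i, j) = 1\<^sub>m n $$ (i, j)" using ij ii by (cases "i = j") auto
  qed (use c in auto)
qed

text \<open>The entries identify the unitary group with a closed subset \<open>Z\<close> of a product of closed discs.\<close>

lemma compact_group_unitary: "compact_group (unitary_group n) (unitary_topology n)"
proof -
  let ?U = "carrier (unitary_group n)" and ?T = "unitary_topology n"
  let ?I = "{..<n} \<times> {..<n}"
  let ?P = "product_topology (\<lambda>_. euclidean :: complex topology) ?I"
  let ?e = "\<lambda>A :: complex mat. restrict (\<lambda>ij. A $$ ij) ?I"
  have entry: "continuous_map ?T euclidean (\<lambda>A. A $$ (i, j))" if "i < n" "j < n" for i j
    using continuous_map_unitary_topology[of ?T n "\<lambda>A. A"] that by simp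
  have mult: "continuous_map (prod_topology ?T ?T) ?T (\<lambda>(A, B). A \<otimes>\<^bsub>unitary_group n\<^esub> B)"
    unfolding continuous_map_unitary_topology
  proof (intro conjI allI impI)
    fix i j assume ij: "i < n" "j < n"
    have "continuous_map (prod_topology ?T ?T) euclidean (\<lambda>p. \<Sum>k<n. fst p $$ (i, k) * snd p $$ (k, j))"
      using ij continuous_map_compose[OF continuous_map_fst entry] continuous_map_compose[OF continuous_map_snd entry]
      by (intro continuous_map_sum continuous_map_complex_mult) (auto simp: comp_def)
    then show "continuous_map (prod_topology ?T ?T) euclidean (\<lambda>p. (case p of (A, B) \<Rightarrow> A \<otimes>\<^bsub>unitary_group n\<^esub> B) $$ (i, j))"
      by (rule continuous_map_eq) (use ij in \<open>auto simp: topspace_unitary_topology intro!: mat_mult_index[symmetric] dest: unitary_carrier simp del: index_mult_mat(1)\<close>)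
  qed (auto simp: topspace_unitary_topology unitary_closed)
  have adj: "continuous_map ?T ?T mat_adjoint"
    unfolding continuous_map_unitary_topology
  proof (intro conjI allI impI)
    fix i j assume ij: "i < n" "j < n"
    have "continuous_map ?T euclidean (\<lambda>A. cnj (A $$ (j, i)))"
      using ij by (intro continuous_map_cnj entry)
    then show "continuous_map ?T euclidean (\<lambda>A. mat_adjoint A $$ (i, j))"
      by (rule continuous_map_eq) (use ij in \<open>auto simp: topspace_unitary_topology unitary_group_def\<close>)
  qed (auto simp: topspace_unitary_topology unitary_adjoint_closed)
  have "continuous_map ?T ?T (\<lambda>A. inv\<^bsub>unitary_group n\<^esub> A)"
    by (rule continuous_map_eq[OF adj]) (simp add: topspace_unitary_topology unitary_inv)
  with mult have tg: "topological_group (unitary_group n) ?T"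
    by (simp add: topological_group_def group_unitary topspace_unitary_topology)
  have emb: "continuous_map ?T ?P ?e"
    using entry by (auto simp: continuous_map_componentwise)
  have inj: "inj_on ?e ?U"
  proof (rule inj_onI)
    fix A B assume A: "A \<in> ?U" and B: "B \<in> ?U" and eq: "?e A = ?e B"
    show "A = B"
    proof (rule eq_matI)
      fix i j assume "i < dim_row B" "j < dim_col B"
      then show "A $$ (i, j) = B $$ (i, j)"
        using fun_cong[OF eq, of "(i, j)"] unitary_carrier[OF B] by auto
    qed (use unitary_carrier[OF A] unitary_carrier[OF B] in auto)
  qed
  have "Hausdorff_space ?P" by (simp add: Hausdorff_space_product_topology)
  then have H: "Hausdorff_space ?T"
    by (rule Hausdorff_space_injective_preimage[OF _ emb]) (simp add: topspace_unitary_topology inj)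
  define rel where "rel f = (\<lambda>(i, j). \<Sum>k<n. f (i, k) * cnj (f (j, k)))" for f :: "nat \<times> nat \<Rightarrow> complex"
  define Z where "Z = {f \<in> topspace ?P. \<forall>p\<in>?I. rel f p = (if fst p = snd p then 1 else 0)}"
  have proj: "continuous_map ?P euclidean (\<lambda>f. f (i, j))" if "i < n" "j < n" for i j
    using continuous_map_product_projection[of "(i, j)" ?I "\<lambda>_. euclidean :: complex topology"] that by auto
  (* The additional index (0,0) keeps the intersection non-empty if n = 0. *)
  have Zeq: "Z = (\<Inter>p\<in>insert (0,0) ?I. {f \<in> topspace ?P. p \<in> ?I \<longrightarrow> rel f p \<in> {if fst p = snd p then 1 else 0}})"
    unfolding Z_def by auto
  have closedZ: "closedin ?P Z"
    unfolding Zeq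
  proof (intro closedin_INT)
    fix p
    show "closedin ?P {f \<in> topspace ?P. p \<in> ?I \<longrightarrow> rel f p \<in> {if fst p = snd p then 1 else 0}}"
    proof (cases "p \<in> ?I")
      case True
      have c: "continuous_map ?P euclidean (\<lambda>f. rel f p)"
        using True unfolding rel_def by (auto intro!: continuous_map_sum continuous_map_complex_mult continuous_map_cnj proj)
      have "closedin ?P {f \<in> topspace ?P. rel f p \<in> {if fst p = snd p then 1 else 0}}"
        by (rule closedin_continuous_map_preimage[OF c]) simp
      then show ?thesis using True by simp
    next
      case False
      then show ?thesis by (simp only: simp_thms Collect_mem_eq closedin_topspace)
    qed
  qed auto
  have relA: "(\<Sum>k<n. A $$ (i, k) * cnj (A $$ (j, k))) = (A * mat_adjoint A) $$ (i, j)"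
    if "A \<in> carrier_mat n n" "i < n" "j < n" for A i j
  proof -
    have "(A * mat_adjoint A) $$ (i, j) = (\<Sum>k<n. A $$ (i, k) * mat_adjoint A $$ (k, j))"
      using that by (intro mat_mult_index) auto
    then show ?thesis using that by simp
  qed
  have dec: "mat n n f \<in> ?U" if "f \<in> Z" for f
  proof (rule unitaryI)
    show "mat n n f * mat_adjoint (mat n n f) = 1\<^sub>m n"
    proof (rule eq_matI)
      fix i j assume "i < dim_row (1\<^sub>m n :: complex mat)" "j < dim_col (1\<^sub>m n :: complex mat)"
      then have ij: "i < n" "j < n" by auto
      have "(mat n n f * mat_adjoint (mat n n f)) $$ (i, j) = rel f (i, j)"
        unfolding relA[OF mat_carrier ij, symmetric] using ij by (simp add: rel_def)
      also have "\<dots> = (if i = j then 1 else 0)" using that ij by (auto simp: Z_def)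
      finally show "(mat n n f * mat_adjoint (mat n n f)) $$ (i, j) = 1\<^sub>m n $$ (i, j)" using ij by simp
    qed auto
  qed auto
  have encZ: "?e A \<in> Z" if A: "A \<in> ?U" for A
  proof -
    have "rel (?e A) (i, j) = (if i = j then 1 else 0)" if ij: "i < n" "j < n" for i j
    proof -
      have "rel (?e A) (i, j) = (\<Sum>k<n. A $$ (i, k) * cnj (A $$ (j, k)))"
        using ij by (simp add: rel_def)
      also have "\<dots> = (if i = j then 1 else 0)"
        using relA[OF unitary_carrier[OF A] ij] unitary_adjoint(1)[OF A] ij by simp
      finally show ?thesis .
    qed
    then show ?thesis by (auto simp: Z_def)
  qed
  have "Z \<subseteq> PiE ?I (\<lambda>_. cball 0 1)"
  proof
    fix f assume f: "f \<in> Z"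
    then have "f \<in> extensional ?I" by (auto simp: Z_def PiE_def)
    moreover have "f (i, j) \<in> cball 0 1" if "i < n" "j < n" for i j
      using unitary_entry_le_1[OF dec[OF f] that] that by simp
    ultimately show "f \<in> PiE ?I (\<lambda>_. cball 0 1)" by (auto simp: PiE_def)
  qed
  moreover have "compactin ?P (PiE ?I (\<lambda>_. cball 0 1))"
    by (subst compactin_PiE) auto
  ultimately have "compactin ?P Z" using closedZ closed_compactin by blast
  then have "compactin (subtopology ?P Z) Z" by (simp add: compactin_subtopology)
  moreover have "continuous_map (subtopology ?P Z) ?T (\<lambda>f. mat n n f)"
    unfolding continuous_map_unitary_topology using dec proj
    by (auto intro!: continuous_map_from_subtopology)
  ultimately have "compactin ?T ((\<lambda>f. mat n n f) ` Z)" by (rule image_compactin)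
  moreover have "(\<lambda>f. mat n n f) ` Z = ?U"
  proof
    show "?U \<subseteq> (\<lambda>f. mat n n f) ` Z"
    proof
      fix A assume A: "A \<in> ?U"
      have "A = mat n n (?e A)" using unitary_carrier[OF A] by (intro eq_matI) auto
      with encZ[OF A] show "A \<in> (\<lambda>f. mat n n f) ` Z" by blast
    qed
  qed (use dec in auto)
  ultimately have "compact_space ?T" by (simp add: compact_space_def topspace_unitary_topology)
  with tg H show ?thesis by (simp add: compact_group_def)
qed

lemma cont_hom_unitary_iff:
  "\<sigma> \<in> cont_hom G T (unitary_group n) (unitary_topology n) \<longleftrightarrow>
     \<sigma> \<in> carrier G \<rightarrow> carrier (unitary_group n) \<and>
     (\<forall>x\<in>carrier G. \<forall>y\<in>carrier G. \<sigma> (x \<otimes>\<^bsub>G\<^esub> y) = \<sigma> x * \<sigma> y) \<and>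
     (\<forall>i<n. \<forall>j<n. continuous_map T euclidean (\<lambda>x. \<sigma> x $$ (i, j)))"
  if "topspace T = carrier G"
  using that by (auto simp: cont_hom_def hom_def continuous_map_unitary_topology)

section \<open>Representations from invariant forms\<close>

text \<open>An orthonormal system of the largest possible size has this property. The remainder \<open>r a\<close> of \<open>a\<close> has
  norm 0, since it could be normalised and added to the system otherwise. The form is only semi-definite,
  so that \<open>r a\<close> need not vanish, but it is orthogonal to everything.\<close>

lemma Parseval_system:
  fixes B :: "('x \<Rightarrow> real) \<Rightarrow> ('x \<Rightarrow> real) \<Rightarrow> real" and d :: nat
  assumes zero: "(\<lambda>x. 0) \<in> E"
    and E_add: "\<And>a b. a \<in> E \<Longrightarrow> b \<in> E \<Longrightarrow> (\<lambda>x. a x + b x) \<in> E"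
    and E_scale: "\<And>a c. a \<in> E \<Longrightarrow> (\<lambda>x. c * a x) \<in> E"
    and sym: "\<And>a b. a \<in> E \<Longrightarrow> b \<in> E \<Longrightarrow> B a b = B b a"
    and B_add: "\<And>a b c. a \<in> E \<Longrightarrow> b \<in> E \<Longrightarrow> c \<in> E \<Longrightarrow> B (\<lambda>x. a x + b x) c = B a c + B b c"
    and B_scale: "\<And>a b c. a \<in> E \<Longrightarrow> b \<in> E \<Longrightarrow> B (\<lambda>x. c * a x) b = c * B a b"
    and pos: "\<And>a. a \<in> E \<Longrightarrow> 0 \<le> B a a"
    and bound: "\<And>m f. (\<And>i. i < m \<Longrightarrow> f i \<in> E) \<Longrightarrow>
      (\<And>i j. i < m \<Longrightarrow> j < m \<Longrightarrow> B (f i) (f j) = (if i = j then 1 else 0)) \<Longrightarrow> m \<le> d"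
  obtains m :: nat and f where "\<And>i. i < m \<Longrightarrow> f i \<in> E"
    and "\<And>i j. i < m \<Longrightarrow> j < m \<Longrightarrow> B (f i) (f j) = (if i = j then 1 else 0)"
    and "\<And>a b. a \<in> E \<Longrightarrow> b \<in> E \<Longrightarrow> B a b = (\<Sum>i<m. B a (f i) * B b (f i))"
proof -
  define P where "P m \<longleftrightarrow> (\<exists>f. (\<forall>i<m. f i \<in> E) \<and> (\<forall>i<m. \<forall>j<m. B (f i) (f j) = (if i = j then 1 else 0)))" for m :: nat
  have "P 0" by (simp add: P_def)
  moreover have "\<forall>m. P m \<longrightarrow> m \<le> d" unfolding P_def using bound by blast
  ultimately obtain m where m: "P m" "\<And>m'. P m' \<Longrightarrow> m' \<le> m"
    by (metis Nat.ex_has_greatest_nat)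
  from m(1) obtain f where "\<forall>i<m. f i \<in> E" "\<forall>i<m. \<forall>j<m. B (f i) (f j) = (if i = j then 1 else 0)"
    unfolding P_def by blast
  then have f: "\<And>i. i < m \<Longrightarrow> f i \<in> E"
    and orth: "\<And>i j. i < m \<Longrightarrow> j < m \<Longrightarrow> B (f i) (f j) = (if i = j then 1 else 0)"
    by blast+
  have sum: "(\<lambda>x. \<Sum>i<k. c i * f i x) \<in> E \<and> (\<forall>b\<in>E. B (\<lambda>x. \<Sum>i<k. c i * f i x) b = (\<Sum>i<k. c i * B (f i) b))"
    if "k \<le> m" for k c
    using that
  proof (induction k)
    case 0
    have "B (\<lambda>x. 0) b = 0" if "b \<in> E" for b using B_scale[OF zero that, of 0] by simp
    then show ?case using zero by simp
  next
    case (Suc k)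
    then show ?case by (simp add: E_add E_scale f B_add B_scale)
  qed
  define r where "r a = (\<lambda>x. a x + (\<Sum>i<m. (- B a (f i)) * f i x))" for a
  have sumE: "(\<lambda>x. \<Sum>i<m. c i * f i x) \<in> E" for c using sum by blast
  have sumB: "B (\<lambda>x. \<Sum>i<m. c i * f i x) b = (\<Sum>i<m. c i * B (f i) b)" if "b \<in> E" for c b
    using sum that by blast
  have rE: "r a \<in> E" if "a \<in> E" for a unfolding r_def by (intro E_add that sumE)
  have Br: "B (r a) b = B a b - (\<Sum>i<m. B a (f i) * B (f i) b)" if "a \<in> E" "b \<in> E" for a b
    unfolding r_def B_add[OF that(1) sumE that(2)] sumB[OF that(2)] by (simp add: sum_negf)
  have rf: "B (r a) (f j) = 0" if "a \<in> E" "j < m" for a j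
  proof -
    have "(\<Sum>i<m. B a (f i) * B (f i) (f j)) = (\<Sum>i<m. if i = j then B a (f i) else 0)"
      using that by (intro sum.cong) (auto simp: orth)
    then show ?thesis using that f by (simp add: Br)
  qed
  have rr: "B (r a) (r a) = 0" if a: "a \<in> E" for a
  proof (rule ccontr)
    assume "B (r a) (r a) \<noteq> 0"
    then have s: "0 < B (r a) (r a)" using pos[OF rE[OF a]] by simp
    define g where "g = (\<lambda>x. (1 / sqrt (B (r a) (r a))) * r a x)"
    have gE: "g \<in> E" unfolding g_def by (intro E_scale rE a)
    have gf: "B g (f j) = 0" if "j < m" for j
      unfolding g_def using that a f rE by (subst B_scale) (auto simp: rf)
    have gr: "B g b = B (r a) b / sqrt (B (r a) (r a))" if "b \<in> E" for b
      unfolding g_def using that rE[OF a] by (subst B_scale) auto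
    have "B g g = B g (r a) / sqrt (B (r a) (r a))"
      using gr[OF gE] sym[OF gE rE[OF a]] by simp
    also have "\<dots> = 1" using gr[OF rE[OF a]] s by (simp add: real_div_sqrt)
    finally have gg: "B g g = 1" .
    have "P (Suc m)"
      unfolding P_def
    proof (intro exI[of _ "f(m := g)"] conjI allI impI)
      fix i j assume "i < Suc m" "j < Suc m"
      then show "B ((f(m := g)) i) ((f(m := g)) j) = (if i = j then 1 else 0)"
        using gf gg orth sym[OF f gE] by (auto simp: less_Suc_eq)
    qed (use gE f in \<open>auto simp: less_Suc_eq\<close>)
    with m(2) show False by force
  qed
  have rb: "B (r a) b = 0" if a: "a \<in> E" and b: "b \<in> E" for a b
  proof (rule ccontr)
    assume n: "B (r a) b \<noteq> 0"
    have E: "(\<lambda>x. t * r a x) \<in> E" for t by (intro E_scale rE a)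
    have sq: "0 \<le> 2 * t * B (r a) b + B b b" for t
    proof -
      have "0 \<le> B (\<lambda>x. t * r a x + b x) (\<lambda>x. t * r a x + b x)" by (intro pos E_add E b)
      also have "\<dots> = t * B (r a) (\<lambda>x. t * r a x + b x) + B b (\<lambda>x. t * r a x + b x)"
        by (simp add: B_add E_add E b rE a B_scale)
      also have "B (r a) (\<lambda>x. t * r a x + b x) = B (r a) b"
        by (subst sym) (auto simp: B_add E_add E b rE a B_scale rr sym[OF b rE[OF a]])
      also have "B b (\<lambda>x. t * r a x + b x) = t * B (r a) b + B b b"
        by (subst sym) (auto simp: B_add E_add E b rE a B_scale)
      finally show ?thesis by simp
    qed
    (* For this t the linear function of t is equal to -1. *)
    have "2 * (- (B b b + 1) / (2 * B (r a) b)) * B (r a) b = - (B b b + 1)" using n by simp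
    with sq[of "- (B b b + 1) / (2 * B (r a) b)"] show False by linarith
  qed
  show thesis
  proof (rule that[of m f])
    fix a b assume ab: "a \<in> E" "b \<in> E"
    have "B a b = (\<Sum>i<m. B a (f i) * B (f i) b)" using Br[OF ab] rb[OF ab] by simp
    also have "\<dots> = (\<Sum>i<m. B a (f i) * B b (f i))"
      using ab f by (intro sum.cong) (auto simp: sym)
    finally show "B a b = (\<Sum>i<m. B a (f i) * B b (f i))" .
  qed (use f orth in auto)
qed

text \<open>The entries of \<open>\<rho> g\<close> are those of the operator \<open>R g\<close> with respect to the orthonormal system. As the
  form may vanish on non-zero vectors, \<open>R\<close> has to be an action only as far as the form can see; the
  assumption on products contains at the same time that the form is invariant.\<close>

lemma unitary_rep_of_Parseval_system:
  fixes G :: "('g, 'm) monoid_scheme" (structure) and m :: nat and B :: "'v \<Rightarrow> 'v \<Rightarrow> real"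
  assumes tg: "topological_group G T"
    and f: "\<And>i. i < m \<Longrightarrow> f i \<in> E"
    and sym: "\<And>a b. a \<in> E \<Longrightarrow> b \<in> E \<Longrightarrow> B a b = B b a"
    and orth: "\<And>i j. i < m \<Longrightarrow> j < m \<Longrightarrow> B (f i) (f j) = (if i = j then 1 else 0)"
    and Parseval: "\<And>a b. a \<in> E \<Longrightarrow> b \<in> E \<Longrightarrow> B a b = (\<Sum>i<m. B a (f i) * B b (f i))"
    and R: "\<And>g a. g \<in> carrier G \<Longrightarrow> a \<in> E \<Longrightarrow> R g a \<in> E"
    and one: "\<And>a b. a \<in> E \<Longrightarrow> b \<in> E \<Longrightarrow> B (R \<one> a) b = B a b"
    and mult: "\<And>g h a b. g \<in> carrier G \<Longrightarrow> h \<in> carrier G \<Longrightarrow> a \<in> E \<Longrightarrow> b \<in> E \<Longrightarrow>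
      B (R (g \<otimes> h) a) b = B (R h a) (R (inv g) b)"
    and cont: "\<And>a b. a \<in> E \<Longrightarrow> b \<in> E \<Longrightarrow> continuous_map T euclideanreal (\<lambda>g. B (R g a) b)"
  obtains \<rho> where "\<rho> \<in> cont_hom G T (unitary_group m) (unitary_topology m)"
    and "\<And>g a b. g \<in> carrier G \<Longrightarrow> a \<in> E \<Longrightarrow> b \<in> E \<Longrightarrow>
      B (R g a) b = (\<Sum>i<m. \<Sum>j<m. B a (f j) * B b (f i) * Re (\<rho> g $$ (i, j)))"
proof -
  interpret group G using tg by (simp add: topological_group_def)
  have top: "topspace T = carrier G" using tg by (simp add: topological_group_def)
  define q where "q g i j = B (R g (f j)) (f i)" for g i j
  define \<rho> where "\<rho> g = mat m m (\<lambda>(i, j). complex_of_real (q g i j))" for g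
  have adj: "B (R g a) b = B a (R (inv g) b)" if "g \<in> carrier G" "a \<in> E" "b \<in> E" for g a b
    using mult[of g \<one> a b] that R one by simp
  have q_inv: "q (inv g) i j = q g j i" if "g \<in> carrier G" "i < m" "j < m" for g i j
    unfolding q_def using that f R adj[of g "f i" "f j"] sym by simp
  have q_mult: "q (g \<otimes> h) i j = (\<Sum>k<m. q g i k * q h k j)"
    if gh: "g \<in> carrier G" "h \<in> carrier G" and ij: "i < m" "j < m" for g h i j
  proof -
    have "q (g \<otimes> h) i j = B (R h (f j)) (R (inv g) (f i))"
      unfolding q_def using gh ij f by (intro mult) auto
    also have "\<dots> = (\<Sum>k<m. B (R h (f j)) (f k) * B (R (inv g) (f i)) (f k))"
      using gh ij f R by (intro Parseval) auto
    also have "\<dots> = (\<Sum>k<m. q g i k * q h k j)"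
      using gh ij q_inv[of g _ i] by (intro sum.cong) (auto simp: q_def mult.commute)
    finally show ?thesis .
  qed
  have q_one: "q \<one> i j = (if i = j then 1 else 0)" if "i < m" "j < m" for i j
    unfolding q_def using that f orth one by auto
  have unit: "\<rho> g \<in> carrier (unitary_group m)" if g: "g \<in> carrier G" for g
  proof (rule unitaryI)
    show "\<rho> g * mat_adjoint (\<rho> g) = 1\<^sub>m m"
    proof (rule eq_matI)
      fix i j assume "i < dim_row (1\<^sub>m m :: complex mat)" "j < dim_col (1\<^sub>m m :: complex mat)"
      then have ij: "i < m" "j < m" by auto
      have "(\<rho> g * mat_adjoint (\<rho> g)) $$ (i, j) = (\<Sum>k<m. complex_of_real (q g i k * q (inv g) k j))"
      proof -
        have "(\<rho> g * mat_adjoint (\<rho> g)) $$ (i, j) = (\<Sum>k<m. \<rho> g $$ (i, k) * mat_adjoint (\<rho> g) $$ (k, j))"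
          using ij by (intro mat_mult_index[of _ m m _ m]) (auto simp: \<rho>_def)
        also have "\<dots> = (\<Sum>k<m. complex_of_real (q g i k * q (inv g) k j))"
          using ij g by (intro sum.cong refl) (simp add: \<rho>_def q_inv)
        finally show ?thesis .
      qed
      also have "\<dots> = complex_of_real (q (g \<otimes> inv g) i j)"
        using ij g q_mult[of g "inv g" i j] by (simp flip: of_real_mult of_real_sum)
      also have "\<dots> = 1\<^sub>m m $$ (i, j)" using ij g by (simp add: q_one)
      finally show "(\<rho> g * mat_adjoint (\<rho> g)) $$ (i, j) = 1\<^sub>m m $$ (i, j)" .
    qed (auto simp: \<rho>_def)
  qed (auto simp: \<rho>_def)
  have "\<rho> \<in> cont_hom G T (unitary_group m) (unitary_topology m)"
    unfolding cont_hom_unitary_iff[OF top]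
  proof (intro conjI ballI allI impI)
    fix g h assume gh: "g \<in> carrier G" "h \<in> carrier G"
    show "\<rho> (g \<otimes> h) = \<rho> g * \<rho> h"
    proof (rule eq_matI)
      fix i j assume "i < dim_row (\<rho> g * \<rho> h)" "j < dim_col (\<rho> g * \<rho> h)"
      then have ij: "i < m" "j < m" by (auto simp: \<rho>_def)
      have "(\<rho> g * \<rho> h) $$ (i, j) = (\<Sum>k<m. \<rho> g $$ (i, k) * \<rho> h $$ (k, j))"
        using ij by (intro mat_mult_index[of _ m m _ m]) (auto simp: \<rho>_def)
      then show "\<rho> (g \<otimes> h) $$ (i, j) = (\<rho> g * \<rho> h) $$ (i, j)"
        using ij gh by (simp add: \<rho>_def q_mult)
    qed (auto simp: \<rho>_def)
  next
    fix i j assume ij: "i < m" "j < m"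
    then show "continuous_map T euclidean (\<lambda>g. \<rho> g $$ (i, j))"
      using continuous_map_of_real[OF cont[OF f[OF ij(2)] f[OF ij(1)]]] by (simp add: \<rho>_def q_def)
  qed (use unit in auto)
  moreover have "B (R g a) b = (\<Sum>i<m. \<Sum>j<m. B a (f j) * B b (f i) * Re (\<rho> g $$ (i, j)))"
    if g: "g \<in> carrier G" and ab: "a \<in> E" "b \<in> E" for g a b
  proof -
    have "B (R g a) b = (\<Sum>i<m. B (R g a) (f i) * B b (f i))" using g ab R by (intro Parseval) auto
    also have "\<dots> = (\<Sum>i<m. (\<Sum>j<m. B a (f j) * q g i j) * B b (f i))"
    proof (intro sum.cong refl)
      fix i assume "i \<in> {..<m}"
      then have i: "i < m" by simp
      have "B (R g a) (f i) = B a (R (inv g) (f i))" using g ab f i by (intro adj) auto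
      also have "\<dots> = (\<Sum>j<m. B a (f j) * B (R (inv g) (f i)) (f j))" using g ab f i R by (intro Parseval) auto
      also have "\<dots> = (\<Sum>j<m. B a (f j) * q g i j)"
        using g i q_inv[OF g _ i] by (intro sum.cong) (auto simp: q_def)
      finally show "B (R g a) (f i) * B b (f i) = (\<Sum>j<m. B a (f j) * q g i j) * B b (f i)" by simp
    qed
    also have "\<dots> = (\<Sum>i<m. \<Sum>j<m. B a (f j) * B b (f i) * Re (\<rho> g $$ (i, j)))"
      unfolding sum_distrib_right by (intro sum.cong refl) (simp add: \<rho>_def)
    finally show ?thesis .
  qed
  ultimately show thesis by (rule that)
qed

section \<open>The Peter-Weyl theorem\<close>

context compact_top_group
begin

definition inner :: "('a \<Rightarrow> real) \<Rightarrow> ('a \<Rightarrow> real) \<Rightarrow> real" where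
  "inner f g = mean (\<lambda>x. f x * g x)"

lemma inner_commute: "inner f g = inner g f"
  by (simp add: inner_def mult.commute)

lemma inner_cong:
  "(\<And>x. x \<in> carrier K \<Longrightarrow> f x = f' x) \<Longrightarrow> (\<And>x. x \<in> carrier K \<Longrightarrow> g x = g' x) \<Longrightarrow> inner f g = inner f' g'"
  unfolding inner_def by (rule mean_cong) simp

lemma inner_add: "cfun f \<Longrightarrow> cfun g \<Longrightarrow> cfun h \<Longrightarrow> inner (\<lambda>x. f x + g x) h = inner f h + inner g h"
  by (simp add: inner_def distrib_right mean_add continuous_map_real_mult)

lemma inner_diff: "cfun f \<Longrightarrow> cfun g \<Longrightarrow> cfun h \<Longrightarrow> inner (\<lambda>x. f x - g x) h = inner f h - inner g h"
  by (simp add: inner_def left_diff_distrib mean_diff continuous_map_real_mult)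

lemma inner_diff_right: "cfun f \<Longrightarrow> cfun g \<Longrightarrow> cfun h \<Longrightarrow> inner h (\<lambda>x. f x - g x) = inner h f - inner h g"
  by (simp add: inner_commute[of h] inner_diff)

lemma inner_scale: "cfun f \<Longrightarrow> cfun h \<Longrightarrow> inner (\<lambda>x. c * f x) h = c * inner f h"
  by (simp add: inner_def mult.assoc mean_scale continuous_map_real_mult)

lemma inner_scale_right: "cfun f \<Longrightarrow> cfun h \<Longrightarrow> inner h (\<lambda>x. c * f x) = c * inner h f"
  by (simp add: inner_commute[of h] inner_scale)

lemma inner_nonneg: "cfun f \<Longrightarrow> 0 \<le> inner f f"
  unfolding inner_def by (rule mean_nonneg) (auto intro: continuous_map_real_mult)

lemma inner_eq_0: "cfun f \<Longrightarrow> inner f f = 0 \<Longrightarrow> x \<in> carrier K \<Longrightarrow> f x = 0"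
  unfolding inner_def by (rule mean_square_eq_0)

lemma inner_pos: "cfun f \<Longrightarrow> x \<in> carrier K \<Longrightarrow> f x \<noteq> 0 \<Longrightarrow> 0 < inner f f"
  using inner_nonneg[of f] inner_eq_0[of f x] by fastforce

lemma inner_Cauchy_Schwarz:
  assumes f: "cfun f" and g: "cfun g"
  shows "(inner f g)\<^sup>2 \<le> inner f f * inner g g"
proof (cases "inner g g = 0")
  case True
  then have "inner f g = inner f (\<lambda>x. 0)" using inner_eq_0[OF g] by (intro inner_cong) auto
  then show ?thesis using True by (simp add: inner_def)
next
  case False
  then have s: "0 < inner g g" using inner_nonneg[OF g] by simp
  let ?s = "inner g g" and ?t = "inner f g"
  have c: "cfun (\<lambda>x. ?s * f x)" "cfun (\<lambda>x. ?t * g x)" using f g by (auto intro: continuous_map_real_mult_left)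
  have d: "cfun (\<lambda>x. ?s * f x - ?t * g x)" using c by (rule continuous_map_diff)
  have "0 \<le> inner (\<lambda>x. ?s * f x - ?t * g x) (\<lambda>x. ?s * f x - ?t * g x)" by (rule inner_nonneg[OF d])
  also have "\<dots> = ?s * (?s * inner f f) - ?t * (?s * ?t) - (?s * (?t * ?t) - ?t * (?t * ?s))"
    unfolding inner_diff[OF c d] inner_diff_right[OF c c(1)] inner_diff_right[OF c c(2)]
      inner_scale[OF f c(1)] inner_scale[OF f c(2)] inner_scale[OF g c(1)] inner_scale[OF g c(2)]
      inner_scale_right[OF f f] inner_scale_right[OF f g] inner_scale_right[OF g f]
      inner_scale_right[OF g g] inner_commute[of g f]
    by (simp only: mult.assoc mult.left_commute)
  also have "\<dots> = ?s * (?s * inner f f - ?t\<^sup>2)"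
    by (simp add: power2_eq_square algebra_simps)
  finally show ?thesis using s by (simp add: zero_le_mult_iff mult.commute)
qed

lemma mean_abs_le:
  assumes "cfun f" "\<And>x. x \<in> carrier K \<Longrightarrow> \<bar>f x\<bar> \<le> c"
  shows "\<bar>mean f\<bar> \<le> c"
proof -
  have "mean f \<le> mean (\<lambda>x. c)" using assms by (intro mean_mono) (auto simp: abs_le_iff)
  moreover have "mean (\<lambda>x. - c) \<le> mean f" using assms by (intro mean_mono) (force simp: abs_le_iff)+
  ultimately show ?thesis by simp
qed

definition conv :: "('a \<Rightarrow> real) \<Rightarrow> ('a \<Rightarrow> real) \<Rightarrow> 'a \<Rightarrow> real" where
  "conv \<phi> f x = mean (\<lambda>y. \<phi> (x \<otimes> inv y) * f y)"

lemma conv_kernel_continuous: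
  assumes "cfun \<phi>" "cfun f"
  shows "continuous_map (prod_topology T T) euclideanreal (\<lambda>(x, y). \<phi> (x \<otimes> inv y) * f y)"
  unfolding case_prod_unfold
  by (intro continuous_map_real_mult cfun_compose[OF assms(1)] cfun_compose[OF assms(2)]
      continuous_map_mult_group continuous_map_inv_group continuous_map_fst continuous_map_snd)

lemma conv_kernel_cfun:
  "cfun \<phi> \<Longrightarrow> x \<in> carrier K \<Longrightarrow> cfun (\<lambda>y. \<phi> (x \<otimes> inv y))"
  by (auto intro!: cfun_compose[of \<phi>] continuous_map_mult_group continuous_map_inv_group)

lemma conv_cfun: "cfun \<phi> \<Longrightarrow> cfun f \<Longrightarrow> cfun (conv \<phi> f)"
  using continuous_map_mean[OF conv_kernel_continuous, of \<phi> f] by (simp add: conv_def[abs_def])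

lemma conv_eq_inner: "conv \<phi> f x = inner (\<lambda>y. \<phi> (x \<otimes> inv y)) f"
  by (simp add: conv_def inner_def)

lemma conv_cong: "(\<And>x. x \<in> carrier K \<Longrightarrow> f x = g x) \<Longrightarrow> conv \<phi> f x = conv \<phi> g x"
  unfolding conv_eq_inner by (rule inner_cong) auto

lemma conv_add:
  "cfun \<phi> \<Longrightarrow> cfun f \<Longrightarrow> cfun g \<Longrightarrow> x \<in> carrier K \<Longrightarrow> conv \<phi> (\<lambda>x. f x + g x) x = conv \<phi> f x + conv \<phi> g x"
  by (simp add: conv_eq_inner inner_commute[of "\<lambda>y. \<phi> (x \<otimes> inv y)"] inner_add conv_kernel_cfun)

lemma conv_diff:
  "cfun \<phi> \<Longrightarrow> cfun f \<Longrightarrow> cfun g \<Longrightarrow> x \<in> carrier K \<Longrightarrow> conv \<phi> (\<lambda>x. f x - g x) x = conv \<phi> f x - conv \<phi> g x"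
  by (simp add: conv_eq_inner inner_diff_right conv_kernel_cfun)

lemma conv_scale:
  "cfun \<phi> \<Longrightarrow> cfun f \<Longrightarrow> x \<in> carrier K \<Longrightarrow> conv \<phi> (\<lambda>x. c * f x) x = c * conv \<phi> f x"
  by (simp add: conv_eq_inner inner_scale_right conv_kernel_cfun)

lemma conv_symmetric:
  assumes \<phi>: "cfun \<phi>" and sym: "\<And>x. x \<in> carrier K \<Longrightarrow> \<phi> (inv x) = \<phi> x"
    and f: "cfun f" and g: "cfun g"
  shows "inner (conv \<phi> f) g = inner f (conv \<phi> g)"
proof -
  let ?F = "\<lambda>x y. \<phi> (x \<otimes> inv y) * f y * g x"
  have F: "continuous_map (prod_topology T T) euclideanreal (\<lambda>(x, y). ?F x y)"
    using conv_kernel_continuous[OF \<phi> f] cfun_compose[OF g continuous_map_fst[of T T]]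
    unfolding case_prod_unfold by (rule continuous_map_real_mult)
  have "inner (conv \<phi> f) g = mean (\<lambda>x. mean (?F x))"
    unfolding inner_def
  proof (rule mean_cong)
    fix x assume x: "x \<in> carrier K"
    have "mean (\<lambda>y. g x * (\<phi> (x \<otimes> inv y) * f y)) = g x * conv \<phi> f x"
      unfolding conv_def using x \<phi> f by (intro mean_scale continuous_map_real_mult conv_kernel_cfun)
    then show "conv \<phi> f x * g x = mean (?F x)" by (simp add: mult.commute mult.left_commute)
  qed
  also have "\<dots> = mean (\<lambda>y. mean (\<lambda>x. ?F x y))" by (rule mean_Fubini[OF F])
  also have "\<dots> = inner f (conv \<phi> g)"
    unfolding inner_def
  proof (rule mean_cong)
    fix y assume y: "y \<in> carrier K"
    have "mean (\<lambda>x. ?F x y) = mean (\<lambda>x. f y * (\<phi> (y \<otimes> inv x) * g x))"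
    proof (rule mean_cong)
      fix x assume x: "x \<in> carrier K"
      have "\<phi> (x \<otimes> inv y) = \<phi> (y \<otimes> inv x)"
        using sym[of "y \<otimes> inv x"] x y by (simp add: inv_mult_group)
      then show "?F x y = f y * (\<phi> (y \<otimes> inv x) * g x)" by simp
    qed
    also have "\<dots> = f y * conv \<phi> g y"
      unfolding conv_def using y \<phi> g by (intro mean_scale continuous_map_real_mult conv_kernel_cfun)
    finally show "mean (\<lambda>x. ?F x y) = f y * conv \<phi> g y" .
  qed
  finally show ?thesis .
qed

lemma conv_translate:
  assumes \<phi>: "cfun \<phi>" and f: "cfun f" and a: "a \<in> carrier K" and x: "x \<in> carrier K"
  shows "conv \<phi> (\<lambda>x. f (x \<otimes> a)) x = conv \<phi> f (x \<otimes> a)"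
proof -
  have c: "cfun (\<lambda>y. \<phi> (x \<otimes> a \<otimes> inv y) * f y)"
    using a x by (intro continuous_map_real_mult conv_kernel_cfun \<phi> f) auto
  have "conv \<phi> f (x \<otimes> a) = mean (\<lambda>y. \<phi> (x \<otimes> a \<otimes> inv (y \<otimes> a)) * f (y \<otimes> a))"
    unfolding conv_def by (rule mean_rtranslate[OF c a, symmetric])
  also have "\<dots> = conv \<phi> (\<lambda>x. f (x \<otimes> a)) x"
    unfolding conv_def
  proof (rule mean_cong)
    fix y assume y: "y \<in> carrier K"
    have "a \<otimes> (inv a \<otimes> inv y) = inv y" using y a by (simp flip: m_assoc)
    then have "x \<otimes> a \<otimes> inv (y \<otimes> a) = x \<otimes> inv y"
      using x y a by (simp add: inv_mult_group m_assoc)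
    then show "\<phi> (x \<otimes> a \<otimes> inv (y \<otimes> a)) * f (y \<otimes> a) = \<phi> (x \<otimes> inv y) * f (y \<otimes> a)"
      using x a by simp
  qed
  finally show ?thesis by simp
qed

lemma inner_square_le:
  assumes f: "cfun f" and \<psi>: "cfun \<psi>" and e: "0 \<le> e" and le: "\<And>y. y \<in> carrier K \<Longrightarrow> \<bar>\<psi> y\<bar> \<le> e"
  shows "(inner \<psi> f)\<^sup>2 \<le> e\<^sup>2 * inner f f"
proof -
  have "inner \<psi> \<psi> \<le> mean (\<lambda>x. e\<^sup>2)"
    unfolding inner_def
  proof (rule mean_mono)
    fix x assume "x \<in> carrier K"
    from le[OF this] show "\<psi> x * \<psi> x \<le> e\<^sup>2"
      using e abs_le_square_iff[of "\<psi> x" e] by (simp add: power2_eq_square)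
  qed (auto intro: continuous_map_real_mult \<psi>)
  then have "inner \<psi> \<psi> * inner f f \<le> e\<^sup>2 * inner f f"
    using inner_nonneg[OF f] by (intro mult_right_mono) auto
  with inner_Cauchy_Schwarz[OF \<psi> f] show ?thesis by simp
qed

lemma conv_bound:
  assumes \<phi>: "cfun \<phi>" and \<phi>1: "\<And>x. x \<in> carrier K \<Longrightarrow> \<bar>\<phi> x\<bar> \<le> 1" and f: "cfun f" and x: "x \<in> carrier K"
  shows "(conv \<phi> f x)\<^sup>2 \<le> inner f f"
  using inner_square_le[OF f conv_kernel_cfun[OF \<phi> x], of 1] x \<phi>1 by (simp add: conv_eq_inner)

lemma conv_norm:
  assumes \<phi>: "cfun \<phi>" and \<phi>1: "\<And>x. x \<in> carrier K \<Longrightarrow> \<bar>\<phi> x\<bar> \<le> 1" and f: "cfun f"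
  shows "inner (conv \<phi> f) (conv \<phi> f) \<le> inner f f"
proof -
  have "mean (\<lambda>x. conv \<phi> f x * conv \<phi> f x) \<le> mean (\<lambda>x. inner f f)"
    using conv_bound[OF \<phi> \<phi>1 f]
    by (intro mean_mono continuous_map_real_mult conv_cfun \<phi> f) (auto simp: power2_eq_square)
  then show ?thesis by (simp add: inner_def)
qed

text \<open>Convolution with a continuous function is a compact operator: the images of the unit ball of the
  norm given by the inner product are uniformly bounded and vary together. This is the
  Arzela-Ascoli argument. Up to any error the kernel distinguishes only finitely many points of the
  group, so that convergence on a countable set suffices.\<close>

lemma conv_compact:
  assumes \<phi>: "cfun \<phi>" and \<phi>1: "\<And>x. x \<in> carrier K \<Longrightarrow> \<bar>\<phi> x\<bar> \<le> 1"
    and v: "\<And>n. cfun (v n)" and v1: "\<And>n. inner (v n) (v n) \<le> 1"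
  obtains k w where "strict_mono (k :: nat \<Rightarrow> nat)" "cfun w"
    "\<And>e. 0 < e \<Longrightarrow> \<exists>N. \<forall>n\<ge>N. \<forall>x\<in>carrier K. \<bar>conv \<phi> (v (k n)) x - w x\<bar> \<le> e"
proof -
  define net where "net e D \<longleftrightarrow> finite D \<and> D \<subseteq> carrier K \<and>
      (\<forall>x\<in>carrier K. \<exists>d\<in>D. \<forall>y\<in>carrier K. \<bar>\<phi> (x \<otimes> inv y) - \<phi> (d \<otimes> inv y)\<bar> < e)" for e D
  have "\<exists>D. net e D" if e: "0 < e" for e
  proof -
    have "continuous_map (prod_topology T T) euclideanreal (\<lambda>(x, y). \<phi> (x \<otimes> inv y))"
      using conv_kernel_continuous[OF \<phi>, of "\<lambda>x. 1"] by simp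
    then have "\<exists>U. openin T U \<and> x \<in> U \<and> (\<forall>x'\<in>U. \<forall>y\<in>carrier K. \<bar>\<phi> (x' \<otimes> inv y) - \<phi> (x \<otimes> inv y)\<bar> < e)"
      if "x \<in> carrier K" for x
      using uniform_in_compact_variable[of T "\<lambda>x y. \<phi> (x \<otimes> inv y)" x e] e that by (metis topspace_eq)
    then obtain U where U: "\<And>x. x \<in> carrier K \<Longrightarrow> openin T (U x)" "\<And>x. x \<in> carrier K \<Longrightarrow> x \<in> U x"
      "\<And>x x' y. x \<in> carrier K \<Longrightarrow> x' \<in> U x \<Longrightarrow> y \<in> carrier K \<Longrightarrow> \<bar>\<phi> (x' \<otimes> inv y) - \<phi> (x \<otimes> inv y)\<bar> < e"
      by metis
    have "carrier K \<subseteq> \<Union>(U ` carrier K)" using U(2) by blast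
    from U(1) this obtain D where D: "finite D" "D \<subseteq> carrier K" "carrier K \<subseteq> \<Union>(U ` D)"
      by (rule finite_subcover)
    have "\<exists>d\<in>D. \<forall>y\<in>carrier K. \<bar>\<phi> (x \<otimes> inv y) - \<phi> (d \<otimes> inv y)\<bar> < e" if "x \<in> carrier K" for x
    proof -
      from subsetD[OF D(3) that] obtain d where d: "d \<in> D" "x \<in> U d" by (rule UN_E)
      have "d \<in> carrier K" using D(2) d(1) by (rule subsetD)
      then show ?thesis by (intro bexI[OF _ d(1)] ballI U(3) d(2))
    qed
    then have "net e D" unfolding net_def by (intro conjI ballI D)
    then show ?thesis by (rule exI)
  qed
  then obtain D where nD: "\<And>e. 0 < e \<Longrightarrow> net e (D e)" by metis
  have D: "\<And>e. 0 < e \<Longrightarrow> finite (D e)" "\<And>e. 0 < e \<Longrightarrow> D e \<subseteq> carrier K"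
    "\<And>e x. 0 < e \<Longrightarrow> x \<in> carrier K \<Longrightarrow> \<exists>d\<in>D e. \<forall>y\<in>carrier K. \<bar>\<phi> (x \<otimes> inv y) - \<phi> (d \<otimes> inv y)\<bar> < e"
    using nD by (simp_all add: net_def)
  define W where "W n = conv \<phi> (v n)" for n
  have W_bound: "\<bar>W n x\<bar> \<le> 1" if "x \<in> carrier K" for n x
    using conv_bound[OF \<phi> \<phi>1 v that, of n] v1[of n] unfolding W_def
    by (metis abs_square_le_1 order_trans)
  have W_equi: "\<bar>W n x - W n d\<bar> \<le> e"
    if e: "0 < e" and xd: "x \<in> carrier K" "d \<in> carrier K"
      and near: "\<And>y. y \<in> carrier K \<Longrightarrow> \<bar>\<phi> (x \<otimes> inv y) - \<phi> (d \<otimes> inv y)\<bar> \<le> e" for e x d n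
  proof -
    have c: "cfun (\<lambda>y. \<phi> (x \<otimes> inv y) - \<phi> (d \<otimes> inv y))"
      using xd by (intro continuous_map_diff conv_kernel_cfun \<phi>)
    have "W n x - W n d = inner (\<lambda>y. \<phi> (x \<otimes> inv y) - \<phi> (d \<otimes> inv y)) (v n)"
      using xd by (simp add: W_def conv_eq_inner inner_diff conv_kernel_cfun \<phi> v)
    then have "(W n x - W n d)\<^sup>2 \<le> e\<^sup>2 * inner (v n) (v n)"
      using inner_square_le[OF v[of n] c _ near] e by simp
    also have "\<dots> \<le> e\<^sup>2 * 1" using v1[of n] by (intro mult_left_mono) auto
    finally show ?thesis using e abs_le_square_iff[of "W n x - W n d" e] by simp
  qed
  define S where "S = (\<Union>j::nat. D (1 / Suc j))"
  have S: "countable S" "S \<subseteq> carrier K"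
  proof -
    have j0: "0 < 1 / real (Suc j)" for j by simp
    show "countable S" unfolding S_def
      by (rule countable_UN) (simp, rule countable_finite[OF D(1)[OF j0]])
    show "S \<subseteq> carrier K" unfolding S_def using D(2)[OF j0] by blast
  qed
  obtain k where k: "strict_mono (k :: nat \<Rightarrow> nat)" "\<And>x. x \<in> S \<Longrightarrow> \<exists>l. (\<lambda>n. W (k n) x) \<longlonglongrightarrow> l"
    using function_convergent_subsequence[OF S(1), of W 1] W_bound S(2) by (auto simp: subset_iff)
  have Cauchy: "\<exists>N. \<forall>n\<ge>N. \<forall>m\<ge>N. \<forall>x\<in>carrier K. \<bar>W (k n) x - W (k m) x\<bar> \<le> e" if e: "0 < e" for e
  proof -
    obtain j where j: "1 / real (Suc j) < e / 3"
      using e reals_Archimedean[of "e/3"] by (auto simp: inverse_eq_divide)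
    let ?D = "D (1 / Suc j)"
    have "\<exists>N. \<forall>n\<ge>N. \<forall>m\<ge>N. \<bar>W (k n) d - W (k m) d\<bar> < e / 3" if "d \<in> ?D" for d
    proof -
      have "d \<in> S" using that unfolding S_def by blast
      then have "Cauchy (\<lambda>n. W (k n) d)" using k(2) LIMSEQ_imp_Cauchy by blast
      then show ?thesis using e metric_CauchyD[of "\<lambda>n. W (k n) d" "e/3"] by (simp add: dist_real_def)
    qed
    then obtain N where N: "\<And>d n m. d \<in> ?D \<Longrightarrow> N d \<le> n \<Longrightarrow> N d \<le> m \<Longrightarrow> \<bar>W (k n) d - W (k m) d\<bar> < e / 3"
      by metis
    show ?thesis
    proof (intro exI[of _ "\<Sum>d\<in>?D. N d"] allI impI ballI)
      fix n m x assume nm: "(\<Sum>d\<in>?D. N d) \<le> n" "(\<Sum>d\<in>?D. N d) \<le> m" and x: "x \<in> carrier K"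
      have j0: "(0::real) < 1 / Suc j" by simp
      obtain d where d: "d \<in> ?D" "\<forall>y\<in>carrier K. \<bar>\<phi> (x \<otimes> inv y) - \<phi> (d \<otimes> inv y)\<bar> < 1 / Suc j"
        using D(3)[OF j0 x] by blast
      have dK: "d \<in> carrier K" using D(2)[OF j0] d by blast
      have close: "\<bar>W i x - W i d\<bar> \<le> e / 3" for i
        using W_equi[OF j0 x dK, of i] d j by (simp add: less_imp_le) 
      have "N d \<le> (\<Sum>d\<in>?D. N d)" using d(1) D(1)[OF j0] by (intro member_le_sum) auto
      then have "\<bar>W (k n) d - W (k m) d\<bar> < e / 3" using N[OF d(1)] nm by simp
      with close[of "k n"] close[of "k m"] show "\<bar>W (k n) x - W (k m) x\<bar> \<le> e" by linarith
    qed
  qed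
  define w where "w x = lim (\<lambda>n. W (k n) x)" for x
  have lim: "(\<lambda>n. W (k n) x) \<longlonglongrightarrow> w x" if x: "x \<in> carrier K" for x
  proof -
    have "Cauchy (\<lambda>n. W (k n) x)"
    proof (rule metric_CauchyI)
      fix e :: real assume "0 < e"
      then obtain N where "\<forall>n\<ge>N. \<forall>m\<ge>N. \<forall>x\<in>carrier K. \<bar>W (k n) x - W (k m) x\<bar> \<le> e/2"
        using Cauchy[of "e/2"] by auto
      with x \<open>0 < e\<close> show "\<exists>M. \<forall>m\<ge>M. \<forall>n\<ge>M. dist (W (k m) x) (W (k n) x) < e"
        by (intro exI[of _ N]) (force simp: dist_real_def)
    qed
    then show ?thesis unfolding w_def by (simp add: Cauchy_convergent_iff convergent_LIMSEQ_iff)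
  qed
  have unif: "\<exists>N. \<forall>n\<ge>N. \<forall>x\<in>carrier K. \<bar>W (k n) x - w x\<bar> \<le> e" if "0 < e" for e
  proof -
    obtain N where N: "\<And>n m x. n \<ge> N \<Longrightarrow> m \<ge> N \<Longrightarrow> x \<in> carrier K \<Longrightarrow> \<bar>W (k n) x - W (k m) x\<bar> \<le> e"
      using Cauchy[OF \<open>0 < e\<close>] by blast
    have "\<bar>W (k n) x - w x\<bar> \<le> e" if "n \<ge> N" "x \<in> carrier K" for n x
    proof (rule LIMSEQ_le_const2)
      show "(\<lambda>m. \<bar>W (k n) x - W (k m) x\<bar>) \<longlonglongrightarrow> \<bar>W (k n) x - w x\<bar>"
        by (intro tendsto_intros lim that)
      show "\<exists>M. \<forall>m\<ge>M. \<bar>W (k n) x - W (k m) x\<bar> \<le> e" using N that by blast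
    qed
    then show ?thesis by blast
  qed
  have "continuous_map T Met_TC.mtopology w"
  proof (rule Met_TC.continuous_map_uniform_limit[where F = sequentially and f = "\<lambda>n. W (k n)"])
    show "\<forall>\<^sub>F n in sequentially. continuous_map T Met_TC.mtopology (W (k n))"
      by (simp add: W_def conv_cfun \<phi> v)
    fix e :: real assume e: "0 < e"
    then obtain N where "\<forall>n\<ge>N. \<forall>x\<in>carrier K. \<bar>W (k n) x - w x\<bar> \<le> e/2" using unif[of "e/2"] by auto
    then show "\<forall>\<^sub>F n in sequentially. \<forall>x\<in>topspace T. w x \<in> UNIV \<and> dist (W (k n) x) (w x) < e"
      unfolding eventually_sequentially using e by (intro exI[of _ N]) (force simp: dist_real_def)
  qed simp
  then have "cfun w" by simp
  then show thesis by (rule that[OF k(1) _ unif[unfolded W_def]])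
qed

text \<open>The power method: starting from a function that convolution does not kill, the normalised iterates
  accumulate at an eigenfunction of the square of the operator. The norm quotients of
  consecutive iterates increase by the Cauchy-Schwarz inequality; their limit is the eigenvalue.\<close>

lemma eigenfunction:
  assumes \<phi>: "cfun \<phi>" and sym: "\<And>x. x \<in> carrier K \<Longrightarrow> \<phi> (inv x) = \<phi> x"
    and \<phi>1: "\<And>x. x \<in> carrier K \<Longrightarrow> \<bar>\<phi> x\<bar> \<le> 1" and g: "cfun g"
    and nz: "inner (conv \<phi> g) (conv \<phi> g) \<noteq> 0"
  obtains l w where "0 < l" "cfun w" "0 < inner w w"
    "\<And>x. x \<in> carrier K \<Longrightarrow> conv \<phi> (conv \<phi> w) x = l\<^sup>2 * w x"
    "\<And>f. cfun f \<Longrightarrow> (\<And>n. inner ((conv \<phi> ^^ n) g) f = 0) \<Longrightarrow> inner w f = 0"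
proof -
  define p where "p n = (conv \<phi> ^^ n) g" for n
  have pc: "cfun (p n)" for n by (induction n) (auto simp: p_def g conv_cfun \<phi>)
  have p_Suc: "conv \<phi> (p n) = p (Suc n)" for n by (simp add: p_def)
  have p_shift: "inner (p (Suc n)) (p m) = inner (p n) (p (Suc m))" for n m
    unfolding p_Suc[symmetric] by (rule conv_symmetric[OF \<phi> sym pc pc])
  define a where "a n = sqrt (inner (p n) (p n))" for n
  have a2: "(a n)\<^sup>2 = inner (p n) (p n)" for n unfolding a_def by (simp add: inner_nonneg pc)
  have CS: "(inner (p n) (p m)) \<le> a n * a m" for n m
  proof -
    have "(inner (p n) (p m))\<^sup>2 \<le> (a n * a m)\<^sup>2"
      using inner_Cauchy_Schwarz[OF pc pc, of n m] by (simp add: power_mult_distrib a2)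
    moreover have "0 \<le> a n * a m" by (simp add: a_def inner_nonneg pc)
    ultimately show ?thesis using power2_le_imp_le by blast
  qed
  have log_convex: "(a (Suc n))\<^sup>2 \<le> a n * a (Suc (Suc n))" for n
    using CS[of n "Suc (Suc n)"] by (simp add: a2 p_shift)
  have a_nonneg: "0 \<le> a n" for n by (simp add: a_def inner_nonneg pc)
  have a1: "0 < a (Suc n)" for n
  proof (induction n)
    case 0
    have "0 \<noteq> inner (p 1) (p 1)" using nz by (simp add: p_def)
    then show ?case using inner_nonneg[OF pc[of 1]] by (simp add: a_def)
  next
    case (Suc n)
    have "0 < (a (Suc n))\<^sup>2" using Suc by simp
    also have "\<dots> \<le> a n * a (Suc (Suc n))" by (rule log_convex)
    finally show ?case using a_nonneg[of n] by (auto simp: zero_less_mult_iff)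
  qed
  have apos: "0 < a n" for n
  proof (cases n)
    case 0
    have "0 < (a (Suc 0))\<^sup>2" using a1[of 0] by simp
    with log_convex[of 0] have "a 0 \<noteq> 0" by auto
    then show ?thesis using 0 by (simp add: a_def inner_nonneg pc less_le)
  qed (use a1 in simp)
  define r where "r n = a (Suc n) / a n" for n
  have r_inc: "r n \<le> r (Suc n)" for n
    using log_convex[of n] apos unfolding r_def by (simp add: divide_simps power2_eq_square mult.commute)
  have r1: "r n \<le> 1" for n
  proof -
    have "(a (Suc n))\<^sup>2 \<le> (a n)\<^sup>2" unfolding a2 p_Suc[symmetric] by (rule conv_norm[OF \<phi> \<phi>1 pc])
    then show ?thesis using apos[of n] apos[of "Suc n"] unfolding r_def
      by (simp add: power2_le_iff_abs_le)
  qed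
  obtain l where l: "r \<longlonglongrightarrow> l" "\<And>n. r n \<le> l"
    using incseq_convergent[of r 1] r1 r_inc by (auto simp: incseq_SucI)
  have l0: "0 < l" using l(2)[of 0] divide_pos_pos[OF apos[of 1] apos[of 0]] by (simp add: r_def)
  define v where "v n = (\<lambda>x. (1 / a n) * p n x)" for n
  have vc: "cfun (v n)" for n unfolding v_def by (intro continuous_map_real_mult_left pc)
  have ip: "inner (\<lambda>x. c * p n x) (\<lambda>x. d * p m x) = c * d * inner (p n) (p m)" for c d n m
    by (simp add: inner_scale inner_scale_right pc continuous_map_real_mult_left)
  have v1: "inner (v n) (v n) = 1" for n
    unfolding v_def ip using apos[of n] by (simp add: a2[symmetric] power2_eq_square)
  define W where "W n = (\<lambda>x. (1 / a n) * p (Suc n) x)" for n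
  have Wc: "cfun (W n)" for n unfolding W_def by (intro continuous_map_real_mult_left pc)
  have Wv: "conv \<phi> (v n) x = W n x" if "x \<in> carrier K" for n x
    unfolding v_def W_def using that by (simp add: conv_scale \<phi> pc p_Suc del: times_divide_eq_left)
  obtain k w where k: "strict_mono (k :: nat \<Rightarrow> nat)" and wc: "cfun w"
    and unif: "\<And>e. 0 < e \<Longrightarrow> \<exists>N. \<forall>n\<ge>N. \<forall>x\<in>carrier K. \<bar>conv \<phi> (v (k n)) x - w x\<bar> \<le> e"
    by (rule conv_compact[where v = v, OF \<phi> \<phi>1 vc eq_refl[OF v1]]) (assumption | (rule that; assumption))+
  have W1: "\<bar>W n x\<bar> \<le> 1" if "x \<in> carrier K" for n x
    using conv_bound[OF \<phi> \<phi>1 vc that, of n] Wv[OF that] v1 by (simp add: abs_square_le_1)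
  (* Uniform convergence to w implies convergence of inner products with bounded functions. *)
  have small: "(\<lambda>n. inner (\<lambda>x. W (k n) x - w x) (f n)) \<longlonglongrightarrow> 0"
    if fc: "\<And>n. cfun (f n)" and fb: "\<And>n x. x \<in> carrier K \<Longrightarrow> \<bar>f n x\<bar> \<le> b" for f b
  proof (rule LIMSEQ_I)
    fix e :: real assume e: "0 < e"
    have b: "0 \<le> b" using fb[of \<one> 0] by simp
    obtain N where N: "\<And>n x. N \<le> n \<Longrightarrow> x \<in> carrier K \<Longrightarrow> \<bar>W (k n) x - w x\<bar> \<le> e / (2 * (b + 1))"
    proof -
      have "\<exists>N. \<forall>n\<ge>N. \<forall>x\<in>carrier K. \<bar>W (k n) x - w x\<bar> \<le> e / (2 * (b + 1))"
        using unif[of "e / (2 * (b + 1))"] e b Wv by simp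
      then show thesis using that by blast
    qed
    show "\<exists>N. \<forall>n\<ge>N. norm (inner (\<lambda>x. W (k n) x - w x) (f n) - 0) < e"
    proof (intro exI[of _ N] allI impI)
      fix n assume n: "N \<le> n"
      have "\<bar>inner (\<lambda>x. W (k n) x - w x) (f n)\<bar> \<le> e / (2 * (b + 1)) * b"
        unfolding inner_def
      proof (rule mean_abs_le)
        fix x assume "x \<in> carrier K"
        then show "\<bar>(W (k n) x - w x) * f n x\<bar> \<le> e / (2 * (b + 1)) * b"
          unfolding abs_mult using N[OF n] fb b e by (intro mult_mono) auto
      qed (intro continuous_map_real_mult continuous_map_diff Wc wc fc)
      also have "\<dots> < e" using e b by (simp add: field_simps add_nonneg_pos)
      finally show "norm (inner (\<lambda>x. W (k n) x - w x) (f n) - 0) < e" by simp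
    qed
  qed
  have weak: "(\<lambda>n. inner (W (k n)) f) \<longlonglongrightarrow> inner w f" if fc: "cfun f" for f
  proof -
    obtain b where "\<And>x. x \<in> carrier K \<Longrightarrow> \<bar>f x\<bar> \<le> b" using cfun_bounded[OF fc] by blast
    then have "(\<lambda>n. inner (\<lambda>x. W (k n) x - w x) f) \<longlonglongrightarrow> 0" by (intro small fc)
    then show ?thesis by (simp add: inner_diff Wc wc fc LIM_zero_iff)
  qed
  have norms: "(\<lambda>n. inner (W (k n)) (W (k n))) \<longlonglongrightarrow> inner w w"
  proof -
    have "(\<lambda>n. inner (\<lambda>x. W (k n) x - w x) (W (k n))) \<longlonglongrightarrow> 0" by (rule small[where b = 1]) (auto intro: Wc W1)
    moreover have "inner (\<lambda>x. W (k n) x - w x) (W (k n)) + inner (W (k n)) w = inner (W (k n)) (W (k n))" for n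
      using inner_commute[of w "W (k n)"] by (simp add: inner_diff Wc wc)
    ultimately show ?thesis using tendsto_add[OF _ weak[OF wc]] by fastforce
  qed
  have WW: "inner (W n) (W n) = (r n)\<^sup>2" for n
    unfolding W_def ip by (simp add: a2[symmetric] r_def power2_eq_square)
  have "(\<lambda>n. (r (k n))\<^sup>2) \<longlonglongrightarrow> l\<^sup>2"
    by (intro tendsto_power LIMSEQ_subseq_LIMSEQ[OF l(1) k, unfolded comp_def])
  with norms have ww: "inner w w = l\<^sup>2" unfolding WW by (rule LIMSEQ_unique)
  (* The defect of W n as an eigenfunction of the squared operator for l^2. Its norm is a polynomial in the quotients r, which vanishes in the limit. *)
  define Err where "Err n = (\<lambda>x. (1 / a n) * p (Suc (Suc (Suc n))) x - l\<^sup>2 * ((1 / a n) * p (Suc n) x))" for n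
  have Err: "Err n = (\<lambda>x. (1 / a n) * p (Suc (Suc (Suc n))) x - (l\<^sup>2 * (1 / a n)) * p (Suc n) x)" for n
    by (simp add: Err_def mult.assoc)
  have ErrC: "cfun (Err n)" for n unfolding Err by (intro continuous_map_diff continuous_map_real_mult_left pc)
  have ErrErr: "inner (Err n) (Err n) =
      (r n * r (Suc n) * r (Suc (Suc n)))\<^sup>2 - 2 * l\<^sup>2 * (r n * r (Suc n))\<^sup>2 + l ^ 4 * (r n)\<^sup>2" for n
  proof -
    have c: "cfun (\<lambda>x. c * p i x)" for c i by (intro continuous_map_real_mult_left pc)
    have s1: "inner (p (Suc (Suc (Suc n)))) (p (Suc n)) = (a (Suc (Suc n)))\<^sup>2" by (simp add: a2 p_shift)
    then have s2: "inner (p (Suc n)) (p (Suc (Suc (Suc n)))) = (a (Suc (Suc n)))\<^sup>2" by (simp add: inner_commute)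
    have q: "r n = a (Suc n) / a n" "r n * r (Suc n) = a (Suc (Suc n)) / a n"
      "r n * r (Suc n) * r (Suc (Suc n)) = a (Suc (Suc (Suc n))) / a n"
      using apos[of "Suc n"] apos[of "Suc (Suc n)"] by (simp_all add: r_def)
    have "inner (Err n) (Err n) = (1 / a n) * (1 / a n) * (a (Suc (Suc (Suc n))))\<^sup>2
        - 2 * ((1 / a n) * (l\<^sup>2 * (1 / a n)) * (a (Suc (Suc n)))\<^sup>2)
        + (l\<^sup>2 * (1 / a n)) * (l\<^sup>2 * (1 / a n)) * (a (Suc n))\<^sup>2"
      unfolding Err inner_diff[OF c c continuous_map_diff[OF c c]] inner_diff_right[OF c c c] ip s1 s2 a2[symmetric]
      by (simp add: algebra_simps)
    also have "\<dots> = (r n * r (Suc n) * r (Suc (Suc n)))\<^sup>2 - 2 * l\<^sup>2 * (r n * r (Suc n))\<^sup>2 + l ^ 4 * (r n)\<^sup>2"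
      unfolding q(3) unfolding q(2) unfolding q(1) by (simp add: mult.assoc power2_eq_square power4_eq_xxxx)
    finally show ?thesis .
  qed
  have Err0: "(\<lambda>n. inner (Err n) (Err n)) \<longlonglongrightarrow> 0"
  proof -
    have "(\<lambda>n. (r n * r (Suc n) * r (Suc (Suc n)))\<^sup>2 - 2 * l\<^sup>2 * (r n * r (Suc n))\<^sup>2 + l ^ 4 * (r n)\<^sup>2)
        \<longlonglongrightarrow> (l * l * l)\<^sup>2 - 2 * l\<^sup>2 * (l * l)\<^sup>2 + l ^ 4 * l\<^sup>2"
      by (intro tendsto_intros l(1) LIMSEQ_Suc)
    moreover have "(l * l * l)\<^sup>2 - 2 * l\<^sup>2 * (l * l)\<^sup>2 + l ^ 4 * l\<^sup>2 = 0"
      by (simp add: power2_eq_square power4_eq_xxxx)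
    ultimately show ?thesis by (simp add: ErrErr)
  qed
  let ?d = "\<lambda>x. conv \<phi> (conv \<phi> w) x - l\<^sup>2 * w x"
  have Sc: "cfun (conv \<phi> (conv \<phi> f))" if "cfun f" for f by (intro conv_cfun \<phi> that)
  have dc: "cfun ?d" by (intro continuous_map_diff Sc wc continuous_map_real_mult_left)
  have S_sym: "inner (\<lambda>x. conv \<phi> (conv \<phi> u) x - l\<^sup>2 * u x) f = inner u (\<lambda>x. conv \<phi> (conv \<phi> f) x - l\<^sup>2 * f x)"
    if u: "cfun u" and f: "cfun f" for u f
  proof -
    have "inner (conv \<phi> (conv \<phi> u)) f = inner u (conv \<phi> (conv \<phi> f))"
      using conv_symmetric[OF \<phi> sym conv_cfun[OF \<phi> u] f] conv_symmetric[OF \<phi> sym u conv_cfun[OF \<phi> f]] by simp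
    then show ?thesis
      by (simp add: inner_diff inner_diff_right Sc u f inner_scale inner_scale_right continuous_map_real_mult_left)
  qed
  have SW: "conv \<phi> (conv \<phi> (W n)) x - l\<^sup>2 * W n x = Err n x" if "x \<in> carrier K" for n x
  proof -
    have "conv \<phi> (conv \<phi> (W n)) x = conv \<phi> (\<lambda>x. (1 / a n) * p (Suc (Suc n)) x) x"
      unfolding W_def by (rule conv_cong) (simp add: conv_scale \<phi> pc p_Suc del: times_divide_eq_left)
    also have "\<dots> = (1 / a n) * p (Suc (Suc (Suc n))) x"
      using that by (simp add: conv_scale \<phi> pc p_Suc del: times_divide_eq_left)
    finally show ?thesis by (simp add: Err_def W_def)
  qed
  (* The defect ?d of w is reached by moving the self-adjoint operator to the other side, where only weak convergence is used. *)
  have "inner ?d ?d = 0"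
  proof (rule LIMSEQ_unique)
    let ?f = "\<lambda>x. conv \<phi> (conv \<phi> ?d) x - l\<^sup>2 * ?d x"
    have fc: "cfun ?f" by (intro continuous_map_diff Sc dc continuous_map_real_mult_left)
    have "inner (W (k n)) ?f = inner (Err (k n)) ?d" for n
      unfolding S_sym[OF Wc dc, symmetric] by (rule inner_cong) (auto simp: SW)
    with weak[OF fc] S_sym[OF wc dc] show "(\<lambda>n. inner (Err (k n)) ?d) \<longlonglongrightarrow> inner ?d ?d" by simp
    have "(\<lambda>n. (inner (Err (k n)) ?d)\<^sup>2) \<longlonglongrightarrow> 0"
    proof (rule tendsto_sandwich[OF _ _ tendsto_const])
      show "(\<lambda>n. inner (Err (k n)) (Err (k n)) * inner ?d ?d) \<longlonglongrightarrow> 0"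
        using tendsto_mult_right[OF LIMSEQ_subseq_LIMSEQ[OF Err0 k], of "inner ?d ?d"] by (simp add: comp_def)
    qed (auto intro!: always_eventually inner_Cauchy_Schwarz ErrC dc)
    then show "(\<lambda>n. inner (Err (k n)) ?d) \<longlonglongrightarrow> 0" by simp
  qed
  then have "conv \<phi> (conv \<phi> w) x = l\<^sup>2 * w x" if "x \<in> carrier K" for x
    using inner_eq_0[OF dc _ that] by simp
  moreover have "inner w f = 0" if fc: "cfun f" and 0: "\<And>n. inner ((conv \<phi> ^^ n) g) f = 0" for f
  proof (rule LIMSEQ_unique)
    show "(\<lambda>n. inner (W (k n)) f) \<longlonglongrightarrow> inner w f" by (rule weak[OF fc])
    have "inner (W n) f = 0" for n
      unfolding W_def using 0[of "Suc n"] by (subst inner_scale) (auto simp: pc fc, simp add: p_def)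
    then show "(\<lambda>n. inner (W (k n)) f) \<longlonglongrightarrow> 0" by simp
  qed
  ultimately show thesis using l0 wc ww by (intro that[of l w]) auto
qed


text \<open>A unitary representation is found on an eigenspace of a convolution operator. The operator commutes
  with right translations, so that they act on the eigenspace, and Bessel's inequality for the
  kernel bounds the dimension. Starting the power method at \<open>\<phi>\<close> minus its translate by \<open>d\<close> yields an
  eigenfunction that is orthogonal to all functions invariant under \<open>d\<close>, on which \<open>d\<close>
  therefore acts non-trivially.\<close>

theorem Peter_Weyl:
  assumes d: "d \<in> carrier K" and d1: "d \<noteq> \<one>"
  obtains m \<rho> where "\<rho> \<in> cont_hom K T (unitary_group m) (unitary_topology m)" "\<rho> d \<noteq> 1\<^sub>m m"
proof -
  have "completely_regular_space T"
    using compact Hausdorff compact_Hausdorff_or_regular_imp_normal_space normal_imp_completely_regular_space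
    by blast
  moreover have "compactin T {\<one>}" "closedin T {d}" "disjnt {\<one>} {d}"
    using d d1 Hausdorff by (auto simp: closedin_Hausdorff_singleton)
  ultimately obtain \<psi> where \<psi>: "continuous_map T (subtopology euclideanreal {0..1}) \<psi>" "\<psi> d = 0" "\<psi> \<one> = 1"
    using Urysohn_completely_regular_compact_closed[of 0 1 T "{\<one>}" "{d}"] by (auto simp: image_subset_iff)
  then have \<psi>c: "cfun \<psi>" and \<psi>01: "\<And>x. x \<in> carrier K \<Longrightarrow> 0 \<le> \<psi> x \<and> \<psi> x \<le> 1"
    by (auto simp: continuous_map_in_subtopology)
  (* The symmetry of the kernel makes the convolution operator self-adjoint. *)
  define \<phi> where "\<phi> x = \<psi> x * \<psi> (inv x)" for x
  have \<phi>: "cfun \<phi>" unfolding \<phi>_def[abs_def]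
    by (intro continuous_map_real_mult \<psi>c cfun_compose[OF \<psi>c] inv_continuous)
  have sym: "\<phi> (inv x) = \<phi> x" if "x \<in> carrier K" for x using that by (simp add: \<phi>_def mult.commute)
  have \<phi>1: "\<bar>\<phi> x\<bar> \<le> 1" if "x \<in> carrier K" for x
    unfolding \<phi>_def abs_mult using \<psi>01[OF that] \<psi>01[of "inv x"] that by (intro mult_le_one) auto
  have \<phi>v: "\<phi> \<one> = 1" "\<phi> d = 0" using \<psi> by (simp_all add: \<phi>_def)
  define g where "g x = \<phi> x - \<phi> (x \<otimes> d)" for x
  have \<phi>t: "cfun (\<lambda>x. \<phi> (x \<otimes> d))" by (rule cfun_translate(2)[OF \<phi> d])
  have gc: "cfun g" unfolding g_def[abs_def] by (intro continuous_map_diff \<phi> \<phi>t)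
  (* At the identity, the convolution of g is half of the squared norm of g. *)
  have "inner (conv \<phi> g) (conv \<phi> g) \<noteq> 0"
  proof
    assume "inner (conv \<phi> g) (conv \<phi> g) = 0"
    then have "conv \<phi> g \<one> = 0" by (rule inner_eq_0[OF conv_cfun[OF \<phi> gc]]) simp
    moreover have "conv \<phi> g \<one> = inner \<phi> g"
      unfolding conv_eq_inner by (rule inner_cong) (auto simp: sym)
    moreover have "inner g g = 2 * inner \<phi> g"
    proof -
      have "inner (\<lambda>x. \<phi> (x \<otimes> d)) (\<lambda>x. \<phi> (x \<otimes> d)) = inner \<phi> \<phi>"
        unfolding inner_def by (rule mean_rtranslate[OF continuous_map_real_mult[OF \<phi> \<phi>] d])
      then show ?thesis
        unfolding g_def[abs_def] inner_diff[OF \<phi> \<phi>t continuous_map_diff[OF \<phi> \<phi>t]]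
          inner_diff_right[OF \<phi> \<phi>t \<phi>] inner_diff_right[OF \<phi> \<phi>t \<phi>t] inner_commute[of "\<lambda>x. \<phi> (x \<otimes> d)" \<phi>]
        by simp
    qed
    moreover have "0 < inner g g"
      using inner_pos[OF gc, of \<one>] \<phi>v d by (simp add: g_def)
    ultimately show False by simp
  qed
  then obtain l w where l: "0 < l" and w: "cfun w" "0 < inner w w"
    and eig: "\<And>x. x \<in> carrier K \<Longrightarrow> conv \<phi> (conv \<phi> w) x = l\<^sup>2 * w x"
    and orth: "\<And>f. cfun f \<Longrightarrow> (\<And>n. inner ((conv \<phi> ^^ n) g) f = 0) \<Longrightarrow> inner w f = 0"
    using eigenfunction[OF \<phi> sym \<phi>1 gc] by blast
  have w_orth: "inner w f = 0" if f: "cfun f" and inv: "\<And>x. x \<in> carrier K \<Longrightarrow> f (x \<otimes> d) = f x" for f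
  proof (rule orth[OF f])
    fix n
    define q where "q = (conv \<phi> ^^ n) \<phi>"
    have "cfun ((conv \<phi> ^^ n) \<phi>) \<and> (\<forall>x\<in>carrier K. (conv \<phi> ^^ n) g x = (conv \<phi> ^^ n) \<phi> x - (conv \<phi> ^^ n) \<phi> (x \<otimes> d))"
    proof (induction n)
      case 0
      then show ?case by (simp add: \<phi> g_def)
    next
      case (Suc n)
      define q where "q = (conv \<phi> ^^ n) \<phi>"
      have q: "cfun q" using Suc by (simp add: q_def)
      have "conv \<phi> ((conv \<phi> ^^ n) g) x = conv \<phi> q x - conv \<phi> q (x \<otimes> d)" if "x \<in> carrier K" for x
      proof -
        have "conv \<phi> ((conv \<phi> ^^ n) g) x = conv \<phi> (\<lambda>x. q x - q (x \<otimes> d)) x"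
          using Suc by (intro conv_cong) (simp add: q_def)
        also have "\<dots> = conv \<phi> q x - conv \<phi> q (x \<otimes> d)"
          using that d q by (simp add: conv_diff \<phi> cfun_translate conv_translate)
        finally show ?thesis .
      qed
      then show ?case using q by (simp add: q_def[symmetric] conv_cfun \<phi>)
    qed
    then have q: "cfun q" "\<And>x. x \<in> carrier K \<Longrightarrow> (conv \<phi> ^^ n) g x = q x - q (x \<otimes> d)" by (auto simp: q_def)
    have "inner ((conv \<phi> ^^ n) g) f = inner (\<lambda>x. q x - q (x \<otimes> d)) f" by (rule inner_cong) (simp_all add: q)
    also have "\<dots> = inner q f - inner (\<lambda>x. q (x \<otimes> d)) f" by (intro inner_diff q cfun_translate d f)
    also have "inner (\<lambda>x. q (x \<otimes> d)) f = inner (\<lambda>x. q (x \<otimes> d)) (\<lambda>x. f (x \<otimes> d))"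
      by (rule inner_cong) (simp_all add: inv)
    also have "\<dots> = inner q f"
      unfolding inner_def by (rule mean_rtranslate[OF continuous_map_real_mult[OF q(1) f] d])
    finally show "inner ((conv \<phi> ^^ n) g) f = 0" by simp
  qed
  define E where "E = {f. cfun f \<and> (\<forall>x\<in>carrier K. conv \<phi> (conv \<phi> f) x = l\<^sup>2 * f x)}"
  have Ec: "cfun f" if "f \<in> E" for f using that by (simp add: E_def)
  have wE: "w \<in> E" using w eig by (simp add: E_def)
  have E_add: "(\<lambda>x. a x + b x) \<in> E" if "a \<in> E" "b \<in> E" for a b
  proof -
    have ab: "cfun a" "cfun b" using that Ec by auto
    have "conv \<phi> (conv \<phi> (\<lambda>x. a x + b x)) x = conv \<phi> (\<lambda>x. conv \<phi> a x + conv \<phi> b x) x" for x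
      by (rule conv_cong) (simp add: conv_add \<phi> ab)
    with that ab show ?thesis
      by (simp add: E_def continuous_map_add conv_add \<phi> conv_cfun distrib_left)
  qed
  have E_scale: "(\<lambda>x. c * a x) \<in> E" if "a \<in> E" for a c
  proof -
    have a: "cfun a" using that Ec by auto
    have "conv \<phi> (conv \<phi> (\<lambda>x. c * a x)) x = conv \<phi> (\<lambda>x. c * conv \<phi> a x) x" for x
      by (rule conv_cong) (simp add: conv_scale \<phi> a)
    with that a show ?thesis
      by (simp add: E_def continuous_map_real_mult_left conv_scale \<phi> conv_cfun mult.left_commute)
  qed
  have E_translate: "(\<lambda>x. a (x \<otimes> y)) \<in> E" if "a \<in> E" and y: "y \<in> carrier K" for a y
  proof -
    have a: "cfun a" using that Ec by auto
    have "conv \<phi> (conv \<phi> (\<lambda>x. a (x \<otimes> y))) x = conv \<phi> (conv \<phi> a) (x \<otimes> y)" if x: "x \<in> carrier K" for x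
    proof -
      have "conv \<phi> (conv \<phi> (\<lambda>x. a (x \<otimes> y))) x = conv \<phi> (\<lambda>x. conv \<phi> a (x \<otimes> y)) x"
        by (rule conv_cong) (simp add: conv_translate \<phi> a y)
      also have "\<dots> = conv \<phi> (conv \<phi> a) (x \<otimes> y)"
        by (intro conv_translate \<phi> conv_cfun a y x)
      finally show ?thesis .
    qed
    with that a show ?thesis by (simp add: E_def cfun_translate)
  qed
  have bound: "m \<le> nat \<lfloor>1 / l ^ 4\<rfloor>"
    if f: "\<And>i. i < m \<Longrightarrow> f i \<in> E"
      and on: "\<And>i j. i < m \<Longrightarrow> j < m \<Longrightarrow> inner (f i) (f j) = (if i = j then 1 else 0)" for m :: nat and f
  proof -
    have fc: "cfun (f i)" if "i < m" for i using f[OF that] Ec by simp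
    have "(\<Sum>i<m. (l\<^sup>2 * f i x)\<^sup>2) \<le> 1" if x: "x \<in> carrier K" for x
    proof -
      define k where "k = conv \<phi> (\<lambda>y. \<phi> (x \<otimes> inv y))"
      have kx: "cfun (\<lambda>y. \<phi> (x \<otimes> inv y))" by (rule conv_kernel_cfun[OF \<phi> x])
      have kc: "cfun k" unfolding k_def by (intro conv_cfun \<phi> kx)
      have coef: "l\<^sup>2 * f i x = inner k (f i)" if i: "i < m" for i
      proof -
        have "l\<^sup>2 * f i x = conv \<phi> (conv \<phi> (f i)) x" using f[OF i] x by (simp add: E_def)
        also have "\<dots> = inner k (f i)"
          unfolding conv_eq_inner[of \<phi> "conv \<phi> (f i)"] k_def
          by (rule conv_symmetric[OF \<phi> sym kx fc[OF i], symmetric])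
        finally show ?thesis .
      qed
      define c where "c i = inner k (f i)" for i
      define s where "s = (\<lambda>x. \<Sum>i<m. c i * f i x)"
      have cf: "cfun (\<lambda>x. c i * f i x)" if "i < m" for i by (intro continuous_map_real_mult_left fc that)
      have sc: "cfun s" unfolding s_def by (intro continuous_map_sum cf) auto
      have sum_inner: "inner s h = (\<Sum>i<m. c i * inner (f i) h)" if h: "cfun h" for h
      proof -
        have "inner s h = mean (\<lambda>x. \<Sum>i<m. c i * f i x * h x)"
          by (simp add: inner_def s_def sum_distrib_right)
        also have "\<dots> = (\<Sum>i<m. inner (\<lambda>x. c i * f i x) h)"
          unfolding inner_def by (intro mean_sum continuous_map_real_mult cf h) auto
        also have "\<dots> = (\<Sum>i<m. c i * inner (f i) h)" by (intro sum.cong refl inner_scale fc h) auto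
        finally show ?thesis .
      qed
      have sk: "inner s k = (\<Sum>i<m. (c i)\<^sup>2)"
        unfolding sum_inner[OF kc] by (simp add: c_def inner_commute power2_eq_square)
      have "inner s s = (\<Sum>i<m. c i * inner s (f i))"
        unfolding sum_inner[OF sc] by (simp add: inner_commute)
      also have "\<dots> = (\<Sum>i<m. (c i)\<^sup>2)"
      proof (intro sum.cong refl)
        fix i assume "i \<in> {..<m}"
        then have i: "i < m" by simp
        have "inner s (f i) = (\<Sum>j<m. if j = i then c j else 0)"
          unfolding sum_inner[OF fc[OF i]] using i by (intro sum.cong) (auto simp: on)
        then show "c i * inner s (f i) = (c i)\<^sup>2" using i by (simp add: power2_eq_square)
      qed
      finally have ss: "inner s s = (\<Sum>i<m. (c i)\<^sup>2)" .
      have "0 \<le> inner (\<lambda>x. k x - s x) (\<lambda>x. k x - s x)" by (intro inner_nonneg continuous_map_diff kc sc)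
      also have "\<dots> = inner k k - (\<Sum>i<m. (c i)\<^sup>2)"
        unfolding inner_diff[OF kc sc continuous_map_diff[OF kc sc]] inner_diff_right[OF kc sc kc]
          inner_diff_right[OF kc sc sc] inner_commute[of k s] sk ss by simp
      finally have "(\<Sum>i<m. (c i)\<^sup>2) \<le> inner k k" by simp
      also have "\<dots> \<le> inner (\<lambda>y. \<phi> (x \<otimes> inv y)) (\<lambda>y. \<phi> (x \<otimes> inv y))"
        unfolding k_def by (rule conv_norm[OF \<phi> \<phi>1 kx])
      also have "\<dots> \<le> 1"
        unfolding inner_def using mean_mono[OF continuous_map_real_mult[OF kx kx], of "\<lambda>x. 1"] \<phi>1 x
        by (simp add: abs_square_le_1 flip: power2_eq_square)
      finally show ?thesis using coef by (simp add: c_def)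
    qed
    then have "mean (\<lambda>x. \<Sum>i<m. (l\<^sup>2 * f i x)\<^sup>2) \<le> mean (\<lambda>x. 1)"
      by (intro mean_mono continuous_map_sum continuous_map_real_pow continuous_map_real_mult_left fc) auto
    also have "mean (\<lambda>x. \<Sum>i<m. (l\<^sup>2 * f i x)\<^sup>2) = (\<Sum>i<m. mean (\<lambda>x. (l\<^sup>2 * f i x)\<^sup>2))"
      by (intro mean_sum continuous_map_real_pow continuous_map_real_mult_left fc) auto
    also have "\<dots> = (\<Sum>i<m. l ^ 4)"
    proof (intro sum.cong refl)
      fix i assume "i \<in> {..<m}"
      then have i: "i < m" by simp
      have "mean (\<lambda>x. (l\<^sup>2 * f i x)\<^sup>2) = mean (\<lambda>x. l ^ 4 * (f i x * f i x))"
        by (rule mean_cong) (simp add: power2_eq_square power4_eq_xxxx)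
      also have "\<dots> = l ^ 4 * inner (f i) (f i)"
        unfolding inner_def by (intro mean_scale continuous_map_real_mult fc i)
      finally show "mean (\<lambda>x. (l\<^sup>2 * f i x)\<^sup>2) = l ^ 4" using on[OF i i] by simp
    qed
    finally have "real m * l ^ 4 \<le> 1" by simp
    then have "real m \<le> 1 / l ^ 4" using l by (simp add: pos_le_divide_eq)
    then show ?thesis by (simp add: le_nat_iff le_floor_iff)
  qed
  have zeroE: "(\<lambda>x. 0) \<in> E" using E_scale[OF wE, of 0] by simp
  obtain m :: nat and f where f: "\<And>i. i < m \<Longrightarrow> f i \<in> E"
    and on: "\<And>i j. i < m \<Longrightarrow> j < m \<Longrightarrow> inner (f i) (f j) = (if i = j then 1 else 0)"
    and Parseval: "\<And>a b. a \<in> E \<Longrightarrow> b \<in> E \<Longrightarrow> inner a b = (\<Sum>i<m. inner a (f i) * inner b (f i))"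
  proof -
    have B1: "inner (\<lambda>x. a x + b x) c = inner a c + inner b c" if "a \<in> E" "b \<in> E" "c \<in> E" for a b c
      using that by (intro inner_add Ec)
    have B2: "inner (\<lambda>x. c * a x) b = c * inner a b" if "a \<in> E" "b \<in> E" for a b c
      using that by (intro inner_scale Ec)
    have B3: "0 \<le> inner a a" if "a \<in> E" for a using that by (intro inner_nonneg Ec)
    show thesis
      by (rule Parseval_system[where B = inner, OF zeroE E_add E_scale inner_commute B1 B2 B3 bound])
        (assumption | rule that)+
  qed
  define R where "R y a = (\<lambda>x. a (x \<otimes> y))" for y and a :: "'a \<Rightarrow> real"
  have tg: "topological_group K T" using compact_group by (simp add: compact_group_def)
  obtain \<rho> where \<rho>: "\<rho> \<in> cont_hom K T (unitary_group m) (unitary_topology m)"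
    and \<rho>_eq: "\<And>g a b. g \<in> carrier K \<Longrightarrow> a \<in> E \<Longrightarrow> b \<in> E \<Longrightarrow>
      inner (R g a) b = (\<Sum>i<m. \<Sum>j<m. inner a (f j) * inner b (f i) * Re (\<rho> g $$ (i, j)))"
  proof (rule unitary_rep_of_Parseval_system[OF tg, where f = f and E = E and B = inner and R = R and m = m])
    fix a b assume ab: "a \<in> E" "b \<in> E"
    show "inner (R \<one> a) b = inner a b" by (rule inner_cong) (simp_all add: R_def)
    show "inner a b = inner b a" by (rule inner_commute)
    show "inner a b = (\<Sum>i<m. inner a (f i) * inner b (f i))" by (rule Parseval[OF ab])
    have "continuous_map (prod_topology T T) euclideanreal (\<lambda>(y, x). a (x \<otimes> y) * b x)"
      unfolding case_prod_unfold
      by (intro continuous_map_real_mult cfun_compose[OF Ec[OF ab(1)]] cfun_compose[OF Ec[OF ab(2)]]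
          continuous_map_mult_group continuous_map_fst continuous_map_snd)
    from continuous_map_mean[OF this] show "continuous_map T euclideanreal (\<lambda>g. inner (R g a) b)"
      by (simp add: inner_def R_def)
    fix g h assume gh: "g \<in> carrier K" "h \<in> carrier K"
    have c: "cfun (\<lambda>x. a (x \<otimes> (g \<otimes> h)) * b x)"
      using gh ab Ec by (intro continuous_map_real_mult cfun_translate) auto
    have "inner (R (g \<otimes> h) a) b = mean (\<lambda>x. a (x \<otimes> inv g \<otimes> (g \<otimes> h)) * b (x \<otimes> inv g))"
      unfolding inner_def R_def using gh mean_rtranslate[OF c, of "inv g"] by simp
    also have "\<dots> = inner (R h a) (R (inv g) b)"
      unfolding inner_def R_def
    proof (rule mean_cong)
      fix x assume x: "x \<in> carrier K"
      have "inv g \<otimes> (g \<otimes> h) = h" using gh by (simp flip: m_assoc)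
      then show "a (x \<otimes> inv g \<otimes> (g \<otimes> h)) * b (x \<otimes> inv g) = a (x \<otimes> h) * b (x \<otimes> inv g)"
        using x gh by (simp add: m_assoc)
    qed
    finally show "inner (R (g \<otimes> h) a) b = inner (R h a) (R (inv g) b)" .
  qed (use f on E_translate in \<open>auto simp: R_def\<close>)
  have "\<rho> d \<noteq> 1\<^sub>m m"
  proof
    assume 1: "\<rho> d = 1\<^sub>m m"
    have "inner (R d w) b = inner w b" if b: "b \<in> E" for b
    proof -
      have "inner (R d w) b = (\<Sum>i<m. \<Sum>j<m. if i = j then inner w (f i) * inner b (f i) else 0)"
        unfolding \<rho>_eq[OF d wE b] 1 by (intro sum.cong refl) auto
      also have "\<dots> = inner w b" by (simp add: Parseval[OF wE b])
      finally show ?thesis .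
    qed
    moreover have RE: "R d w \<in> E" unfolding R_def by (rule E_translate[OF wE d])
    moreover have dE: "(\<lambda>x. R d w x - w x) \<in> E" using E_add[OF RE E_scale[OF wE, of "- 1"]] by simp
    ultimately have "inner (\<lambda>x. R d w x - w x) (\<lambda>x. R d w x - w x) = 0"
      by (simp add: inner_diff[OF Ec[OF RE] w(1) Ec[OF dE]])
    then have "w (x \<otimes> d) = w x" if "x \<in> carrier K" for x
      using inner_eq_0[OF Ec[OF dE] _ that] by (simp add: R_def)
    then have "inner w w = 0" by (intro w_orth w)
    with w(2) show False by simp
  qed
  with \<rho> show thesis by (rule that)
qed

end

section \<open>Invariant subspaces and intertwiners\<close>

text \<open>Bessel's inequality for each coordinate vector, summed over the coordinates.\<close>

lemma orthonormal_le_card: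
  fixes h :: "nat \<Rightarrow> 'i \<Rightarrow> real"
  assumes I: "finite I"
    and on: "\<And>j l. j < m \<Longrightarrow> l < m \<Longrightarrow> (\<Sum>k\<in>I. h j k * h l k) = (if j = l then 1 else 0)"
  shows "m \<le> card I"
proof -
  have Bessel: "(\<Sum>j<m. (h j i)\<^sup>2) \<le> 1" if i: "i \<in> I" for i
  proof -
    define v where "v k = (\<Sum>j<m. h j i * h j k)" for k
    have "(\<Sum>k\<in>I. (v k)\<^sup>2) = (\<Sum>k\<in>I. \<Sum>j<m. \<Sum>l<m. (h j i * h l i) * (h j k * h l k))"
      by (simp add: v_def power2_eq_square sum_product mult_ac)
    also have "\<dots> = (\<Sum>j<m. \<Sum>k\<in>I. \<Sum>l<m. (h j i * h l i) * (h j k * h l k))" by (rule sum.swap)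
    also have "\<dots> = (\<Sum>j<m. \<Sum>l<m. \<Sum>k\<in>I. (h j i * h l i) * (h j k * h l k))"
      by (intro sum.cong refl sum.swap)
    also have "\<dots> = (\<Sum>j<m. \<Sum>l<m. if j = l then h j i * h l i else 0)"
      by (intro sum.cong refl) (simp add: on flip: sum_distrib_left)
    also have "\<dots> = v i" by (simp add: v_def)
    finally have vv: "(\<Sum>k\<in>I. (v k)\<^sup>2) = v i" .
    have "0 \<le> (\<Sum>k\<in>I. ((if k = i then 1 else 0) - v k)\<^sup>2)" by (intro sum_nonneg) simp
    also have "\<dots> = (\<Sum>k\<in>I. ((if k = i then 1 - 2 * v k else 0) + (v k)\<^sup>2))"
      by (intro sum.cong refl) (simp add: power2_eq_square algebra_simps)
    also have "\<dots> = 1 - v i" using i I vv by (simp add: sum.distrib)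
    finally show ?thesis by (simp add: v_def power2_eq_square)
  qed
  have "real m = (\<Sum>j<m. \<Sum>i\<in>I. (h j i)\<^sup>2)"
    using on by (simp add: power2_eq_square)
  also have "\<dots> = (\<Sum>i\<in>I. \<Sum>j<m. (h j i)\<^sup>2)" by (rule sum.swap)
  also have "\<dots> \<le> (\<Sum>i\<in>I. 1)" by (intro sum_mono Bessel)
  finally show ?thesis by simp
qed

lemma subspace_iff:
  "VectorSpace.subspace class_ring W (module_vec TYPE(complex) n) \<longleftrightarrow>
     W \<subseteq> carrier_vec n \<and> 0\<^sub>v n \<in> W \<and> (\<forall>v\<in>W. \<forall>w\<in>W. v + w \<in> W) \<and> (\<forall>c. \<forall>v\<in>W. c \<cdot>\<^sub>v v \<in> W)"
proof -
  interpret vec_space "TYPE(complex)" n .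
  show ?thesis
    unfolding VectorSpace.subspace_def submodule_def
    using vectorspace_axioms module_axioms by (auto simp: module_vec_simps)
qed

lemma adjoint_mult_index:
  fixes A B :: "complex mat"
  assumes "A \<in> carrier_mat n p" "B \<in> carrier_mat n q" "i < p" "j < q"
  shows "(mat_adjoint A * B) $$ (i, j) = (\<Sum>k<n. cnj (A $$ (k, i)) * B $$ (k, j))"
  using assms by (subst mat_mult_index[of _ p n _ q]) auto

lemma mat_vec_index:
  fixes A :: "complex mat"
  assumes "A \<in> carrier_mat n p" "v \<in> carrier_vec p" "i < n"
  shows "(A *\<^sub>v v) $ i = (\<Sum>k<p. A $$ (i, k) * v $ k)"
proof -
  have "(A *\<^sub>v v) $ i = row A i \<bullet> v" using assms by simp
  also have "\<dots> = (\<Sum>k<p. A $$ (i, k) * v $ k)"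
    unfolding scalar_prod_def atLeast0LessThan using assms by (intro sum.cong) auto
  finally show ?thesis .
qed

lemma zero_mat_vec:
  fixes v :: "complex vec"
  assumes v: "v \<in> carrier_vec q"
  shows "0\<^sub>m p q *\<^sub>v v = 0\<^sub>v p"
proof (rule eq_vecI)
  fix i assume "i < dim_vec (0\<^sub>v p :: complex vec)"
  then have i: "i < p" by simp
  show "(0\<^sub>m p q *\<^sub>v v) $ i = 0\<^sub>v p $ i"
    unfolding mat_vec_index[OF zero_carrier_mat v i] using i by simp
qed simp

lemma mat_eq_on_vecs:
  fixes A B :: "complex mat"
  assumes A: "A \<in> carrier_mat n m" and B: "B \<in> carrier_mat n m"
    and eq: "\<And>v. v \<in> carrier_vec m \<Longrightarrow> A *\<^sub>v v = B *\<^sub>v v"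
  shows "A = B"
proof (rule eq_matI)
  fix i j assume "i < dim_row B" "j < dim_col B"
  then have ij: "i < n" "j < m" using B by auto
  have "(M *\<^sub>v unit_vec m j) $ i = M $$ (i, j)" if M: "M \<in> carrier_mat n m" for M :: "complex mat"
  proof -
    have "(M *\<^sub>v unit_vec m j) $ i = (\<Sum>k<m. M $$ (i, k) * unit_vec m j $ k)"
      using M ij by (intro mat_vec_index) auto
    also have "\<dots> = (\<Sum>k<m. if k = j then M $$ (i, k) else 0)"
      using ij by (intro sum.cong) (auto simp: unit_vec_def)
    finally show ?thesis using ij by simp
  qed
  from this[OF A] this[OF B] eq[of "unit_vec m j"] show "A $$ (i, j) = B $$ (i, j)" by simp
qed (use A B in auto)

text \<open>The columns, split into real and imaginary parts, are orthonormal in a real space of dimension \<open>2 * n\<close>.\<close>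

lemma isometry_bound:
  fixes J :: "complex mat"
  assumes J: "J \<in> carrier_mat n p" and iso: "mat_adjoint J * J = 1\<^sub>m p"
  shows "p \<le> 2 * n"
proof -
  define h where "h j = (\<lambda>(k, b). if b then Re (J $$ (k, j)) else Im (J $$ (k, j)))" for j
  have "p \<le> card ({..<n} \<times> (UNIV :: bool set))"
  proof (rule orthonormal_le_card[where h = h])
    fix j l assume jl: "j < p" "l < p"
    have "(\<Sum>k\<in>{..<n} \<times> UNIV. h j k * h l k) = (\<Sum>k<n. \<Sum>b\<in>UNIV. h j (k, b) * h l (k, b))"
      by (simp add: sum.cartesian_product)
    also have "\<dots> = Re (\<Sum>k<n. cnj (J $$ (k, j)) * J $$ (k, l))"
      by (simp add: h_def UNIV_bool)
    also have "\<dots> = Re ((mat_adjoint J * J) $$ (j, l))"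
      using J jl by (simp only: adjoint_mult_index[OF J J jl])
    finally show "(\<Sum>k\<in>{..<n} \<times> UNIV. h j k * h l k) = (if j = l then 1 else 0)" using jl iso by simp
  qed simp
  then show ?thesis by (simp add: card_cartesian_product)
qed

text \<open>The columns of \<open>J\<close> are an orthonormal basis of the subspace: an orthonormal system of the largest
  possible size, to which the component of \<open>w\<close> orthogonal to it could be added if it did not vanish.\<close>

lemma subspace_isometry:
  assumes W: "VectorSpace.subspace class_ring W (module_vec TYPE(complex) n)"
  obtains p J where "J \<in> carrier_mat n p" "mat_adjoint J * J = 1\<^sub>m p"
    "\<And>v. v \<in> carrier_vec p \<Longrightarrow> J *\<^sub>v v \<in> W"
    "\<And>w. w \<in> W \<Longrightarrow> J *\<^sub>v (mat_adjoint J *\<^sub>v w) = w"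
proof -
  from W have sub: "W \<subseteq> carrier_vec n" and zero: "0\<^sub>v n \<in> W"
    and add: "\<And>v w. v \<in> W \<Longrightarrow> w \<in> W \<Longrightarrow> v + w \<in> W" and smult: "\<And>c v. v \<in> W \<Longrightarrow> c \<cdot>\<^sub>v v \<in> W"
    unfolding subspace_iff by auto
  define Q where "Q p J \<longleftrightarrow> J \<in> carrier_mat n p \<and> mat_adjoint J * J = 1\<^sub>m p \<and> (\<forall>v\<in>carrier_vec p. J *\<^sub>v v \<in> W)"
    for p and J :: "complex mat"
  have "Q 0 (0\<^sub>m n 0)"
    unfolding Q_def
  proof (intro conjI ballI)
    show "mat_adjoint (0\<^sub>m n 0 :: complex mat) * 0\<^sub>m n 0 = 1\<^sub>m 0" by (rule eq_matI) simp_all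
    fix v :: "complex vec" assume v: "v \<in> carrier_vec 0"
    have "0\<^sub>m n 0 *\<^sub>v v = 0\<^sub>v n" by (rule zero_mat_vec[OF v])
    with zero show "0\<^sub>m n 0 *\<^sub>v v \<in> W" by simp
  qed simp
  then have "\<exists>J. Q 0 J" by blast
  moreover have "\<forall>p. (\<exists>J. Q p J) \<longrightarrow> p \<le> 2 * n" unfolding Q_def using isometry_bound by blast
  ultimately obtain p where "\<exists>J. Q p J" and max: "\<And>p'. \<exists>J. Q p' J \<Longrightarrow> p' \<le> p"
    using Nat.ex_has_greatest_nat[of "\<lambda>p. \<exists>J. Q p J" 0 "2 * n"] by blast
  then obtain J where J: "J \<in> carrier_mat n p" and iso: "mat_adjoint J * J = 1\<^sub>m p"
    and JW: "\<And>v. v \<in> carrier_vec p \<Longrightarrow> J *\<^sub>v v \<in> W" unfolding Q_def by blast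
  note Ja = mat_adjoint_carrier[OF J]
  have WJ: "J *\<^sub>v (mat_adjoint J *\<^sub>v w) = w" if w: "w \<in> W" for w
  proof (rule ccontr)
    assume ne: "J *\<^sub>v (mat_adjoint J *\<^sub>v w) \<noteq> w"
    have wc: "w \<in> carrier_vec n" using w sub by blast
    let ?c = "mat_adjoint J *\<^sub>v w"
    have cc: "?c \<in> carrier_vec p" using Ja wc by simp
    have Jc: "J *\<^sub>v ?c \<in> carrier_vec n" using J cc by simp
    define r where "r = w - J *\<^sub>v ?c"
    have rc: "r \<in> carrier_vec n" unfolding r_def using wc Jc by simp
    have "w + (- 1) \<cdot>\<^sub>v (J *\<^sub>v ?c) \<in> W" by (intro add w smult JW cc)
    moreover have "w + (- 1) \<cdot>\<^sub>v (J *\<^sub>v ?c) = r" unfolding r_def using wc Jc by (intro eq_vecI) auto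
    ultimately have rW: "r \<in> W" by simp
    have Jr: "mat_adjoint J *\<^sub>v r = 0\<^sub>v p"
    proof -
      have "mat_adjoint J *\<^sub>v r = ?c - mat_adjoint J *\<^sub>v (J *\<^sub>v ?c)"
        unfolding r_def by (rule mult_minus_distrib_mat_vec[OF Ja wc Jc])
      also have "mat_adjoint J *\<^sub>v (J *\<^sub>v ?c) = (mat_adjoint J * J) *\<^sub>v ?c"
        by (rule assoc_mult_mat_vec[OF Ja J cc, symmetric])
      also have "\<dots> = ?c" unfolding iso using cc by simp
      finally show ?thesis using cc by simp
    qed
    define s where "s = (\<Sum>k<n. (cmod (r $ k))\<^sup>2)"
    have "\<exists>k<n. r $ k \<noteq> 0"
    proof (rule ccontr)
      assume "\<not> ?thesis"
      then have "w $ k = (J *\<^sub>v ?c) $ k" if "k < n" for k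
      proof -
        have "r $ k = w $ k - (J *\<^sub>v ?c) $ k"
          unfolding r_def by (rule index_minus_vec(1)) (simp only: carrier_vecD[OF Jc] that)
        moreover have "r $ k = 0" using that \<open>\<not> (\<exists>k<n. r $ k \<noteq> 0)\<close> by blast
        ultimately show ?thesis by simp
      qed
      then have "w = J *\<^sub>v ?c"
        by (intro eq_vecI) (simp_all only: carrier_vecD[OF wc] carrier_vecD[OF Jc])
      with ne show False by simp
    qed
    then obtain k where k: "k < n" "r $ k \<noteq> 0" by blast
    have s: "0 < s" unfolding s_def using k by (intro sum_pos2[of _ k]) auto
    define u where "u = complex_of_real (1 / sqrt s) \<cdot>\<^sub>v r"
    have uW: "u \<in> W" unfolding u_def by (intro smult rW)
    have uc: "u \<in> carrier_vec n" using uW sub by blast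
    have ui: "u $ k = complex_of_real (1 / sqrt s) * r $ k" if "k < n" for k
      using that rc by (simp add: u_def)
    have Ju: "(\<Sum>k<n. cnj (J $$ (k, i)) * u $ k) = 0" if i: "i < p" for i
    proof -
      have "(\<Sum>k<n. cnj (J $$ (k, i)) * u $ k) = complex_of_real (1 / sqrt s) * (\<Sum>k<n. cnj (J $$ (k, i)) * r $ k)"
        unfolding sum_distrib_left by (intro sum.cong refl) (simp add: ui)
      also have "(\<Sum>k<n. cnj (J $$ (k, i)) * r $ k) = (mat_adjoint J *\<^sub>v r) $ i"
        using J i by (subst mat_vec_index[OF Ja rc i]) (intro sum.cong refl, simp)
      finally show ?thesis using Jr i by simp
    qed
    have uu: "(\<Sum>k<n. cnj (u $ k) * u $ k) = 1"
    proof -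
      have "(\<Sum>k<n. cnj (u $ k) * u $ k) = (\<Sum>k<n. complex_of_real ((cmod (r $ k))\<^sup>2 / s))"
      proof (intro sum.cong refl)
        fix k assume "k \<in> {..<n}"
        then have k: "k < n" by simp
        have "cnj (u $ k) * u $ k = complex_of_real ((1 / sqrt s) * (1 / sqrt s)) * (r $ k * cnj (r $ k))"
          unfolding ui[OF k] by (simp only: complex_cnj_mult complex_cnj_complex_of_real of_real_mult mult_ac)
        also have "(1 / sqrt s) * (1 / sqrt s) = 1 / s" using s by simp
        finally show "cnj (u $ k) * u $ k = complex_of_real ((cmod (r $ k))\<^sup>2 / s)"
          by (simp add: complex_norm_square[symmetric])
      qed
      also have "\<dots> = complex_of_real (s / s)"
        unfolding s_def sum_divide_distrib of_real_sum ..
      finally show ?thesis using s by simp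
    qed
    define J' where "J' = mat n (Suc p) (\<lambda>(k, i). if i < p then J $$ (k, i) else u $ k)"
    have J': "J' \<in> carrier_mat n (Suc p)" by (simp add: J'_def)
    have "Q (Suc p) J'"
      unfolding Q_def
    proof (intro conjI ballI J')
      show "mat_adjoint J' * J' = 1\<^sub>m (Suc p)"
      proof (rule eq_matI)
        fix i j assume "i < dim_row (1\<^sub>m (Suc p) :: complex mat)" "j < dim_col (1\<^sub>m (Suc p) :: complex mat)"
        then have ij: "i < Suc p" "j < Suc p" by auto
        have JJ: "(\<Sum>k<n. cnj (J $$ (k, i)) * J $$ (k, j)) = (if i = j then 1 else 0)" if "i < p" "j < p"
          using adjoint_mult_index[OF J J that] iso that by simp
        have uJ: "(\<Sum>k<n. cnj (u $ k) * J $$ (k, j)) = 0" if "j < p"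
        proof -
          have "(\<Sum>k<n. cnj (u $ k) * J $$ (k, j)) = cnj (\<Sum>k<n. cnj (J $$ (k, j)) * u $ k)"
            by (simp add: mult.commute)
          then show ?thesis using Ju[OF that] by simp
        qed
        have "(mat_adjoint J' * J') $$ (i, j) =
            (\<Sum>k<n. cnj (if i < p then J $$ (k, i) else u $ k) * (if j < p then J $$ (k, j) else u $ k))"
          unfolding adjoint_mult_index[OF J' J' ij] using ij by (intro sum.cong refl) (simp add: J'_def)
        also have "\<dots> = (if i = j then 1 else 0)"
          using ij JJ uJ Ju[of i] uu by (auto simp: less_Suc_eq)
        finally show "(mat_adjoint J' * J') $$ (i, j) = 1\<^sub>m (Suc p) $$ (i, j)" using ij by simp
      qed (use J' in auto)
      fix v :: "complex vec" assume v: "v \<in> carrier_vec (Suc p)"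
      define v' where "v' = vec p (\<lambda>i. v $ i)"
      have v': "v' \<in> carrier_vec p" by (simp add: v'_def)
      have "J' *\<^sub>v v = J *\<^sub>v v' + (v $ p) \<cdot>\<^sub>v u"
      proof (rule eq_vecI)
        fix k assume "k < dim_vec (J *\<^sub>v v' + (v $ p) \<cdot>\<^sub>v u)"
        then have k: "k < n" using uc by simp
        have "(J' *\<^sub>v v) $ k = (\<Sum>i<Suc p. J' $$ (k, i) * v $ i)" by (rule mat_vec_index[OF J' v k])
        also have "\<dots> = (\<Sum>i<p. J $$ (k, i) * v' $ i) + u $ k * v $ p"
          using k by (simp add: J'_def v'_def)
        also have "(\<Sum>i<p. J $$ (k, i) * v' $ i) = (J *\<^sub>v v') $ k" by (rule mat_vec_index[OF J v' k, symmetric])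
        finally show "(J' *\<^sub>v v) $ k = (J *\<^sub>v v' + (v $ p) \<cdot>\<^sub>v u) $ k"
          using k uc by (simp add: mult.commute del: index_mult_mat_vec)
      qed (use J' uc in simp)
      then show "J' *\<^sub>v v \<in> W" using add[OF JW[OF v'] smult[OF uW]] by simp
    qed
    with max show False by force
  qed
  show thesis by (rule that) (fact J iso JW WJ)+
qed

lemma isometry_trace:
  fixes J :: "complex mat"
  assumes J: "J \<in> carrier_mat n p" and iso: "mat_adjoint J * J = 1\<^sub>m p"
  shows "(\<Sum>i<n. (J * mat_adjoint J) $$ (i, i)) = of_nat p"
proof -
  note Ja = mat_adjoint_carrier[OF J]
  have "(\<Sum>i<n. (J * mat_adjoint J) $$ (i, i)) = (\<Sum>i<n. \<Sum>k<p. cnj (J $$ (i, k)) * J $$ (i, k))"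
  proof (intro sum.cong refl)
    fix i assume "i \<in> {..<n}"
    then have i: "i < n" by simp
    show "(J * mat_adjoint J) $$ (i, i) = (\<Sum>k<p. cnj (J $$ (i, k)) * J $$ (i, k))"
      unfolding mat_mult_index[OF J Ja i i] using J i by (intro sum.cong refl) (simp add: mult.commute)
  qed
  also have "\<dots> = (\<Sum>k<p. \<Sum>i<n. cnj (J $$ (i, k)) * J $$ (i, k))" by (rule sum.swap)
  also have "\<dots> = (\<Sum>k<p. (mat_adjoint J * J) $$ (k, k))"
    by (intro sum.cong refl) (simp only: adjoint_mult_index[OF J J] lessThan_iff)
  also have "\<dots> = of_nat p" by (simp add: iso)
  finally show ?thesis .
qed

text \<open>The columns of \<open>J1\<close> and \<open>J2\<close> are orthonormal bases of the subspace and of its orthogonal complement.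
  The dimensions are compared through the traces of the projections.\<close>

lemma orthogonal_splitting:
  assumes W: "VectorSpace.subspace class_ring W (module_vec TYPE(complex) n)"
    and W0: "W \<noteq> {0\<^sub>v n}" and W1: "W \<noteq> carrier_vec n"
  obtains p q J1 J2 where "p < n" "q < n"
    "J1 \<in> carrier_mat n p" "mat_adjoint J1 * J1 = 1\<^sub>m p"
    "J2 \<in> carrier_mat n q" "mat_adjoint J2 * J2 = 1\<^sub>m q"
    "J1 * mat_adjoint J1 + J2 * mat_adjoint J2 = 1\<^sub>m n" "mat_adjoint J1 * J2 = 0\<^sub>m p q"
    "\<And>v. v \<in> carrier_vec p \<Longrightarrow> J1 *\<^sub>v v \<in> W"
    "\<And>w. w \<in> W \<Longrightarrow> J1 *\<^sub>v (mat_adjoint J1 *\<^sub>v w) = w"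
proof -
  obtain p J1 where J1: "J1 \<in> carrier_mat n p" and iso1: "mat_adjoint J1 * J1 = 1\<^sub>m p"
    and J1W: "\<And>v. v \<in> carrier_vec p \<Longrightarrow> J1 *\<^sub>v v \<in> W"
    and WJ1: "\<And>w. w \<in> W \<Longrightarrow> J1 *\<^sub>v (mat_adjoint J1 *\<^sub>v w) = w"
    by (rule subspace_isometry[OF W]) (rule that; assumption)
  note J1a = mat_adjoint_carrier[OF J1]
  define V where "V = {v \<in> carrier_vec n. mat_adjoint J1 *\<^sub>v v = 0\<^sub>v p}"
  have "VectorSpace.subspace class_ring V (module_vec TYPE(complex) n)"
    unfolding subspace_iff V_def
  proof (intro conjI ballI allI)
    show "0\<^sub>v n \<in> {v \<in> carrier_vec n. mat_adjoint J1 *\<^sub>v v = 0\<^sub>v p}"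
      using J1 by (auto intro!: eq_vecI simp: scalar_prod_def)
  qed (use J1a in \<open>auto simp: mult_add_distrib_mat_vec mult_mat_vec\<close>)
  then obtain q J2 where J2: "J2 \<in> carrier_mat n q" and iso2: "mat_adjoint J2 * J2 = 1\<^sub>m q"
    and J2V: "\<And>v. v \<in> carrier_vec q \<Longrightarrow> J2 *\<^sub>v v \<in> V"
    and VJ2: "\<And>w. w \<in> V \<Longrightarrow> J2 *\<^sub>v (mat_adjoint J2 *\<^sub>v w) = w"
    by (rule subspace_isometry) (rule that; assumption)
  note J2a = mat_adjoint_carrier[OF J2]
  have zero12: "mat_adjoint J1 * J2 = 0\<^sub>m p q"
  proof (rule mat_eq_on_vecs[of _ p q])
    fix v :: "complex vec" assume v: "v \<in> carrier_vec q"
    have "(mat_adjoint J1 * J2) *\<^sub>v v = mat_adjoint J1 *\<^sub>v (J2 *\<^sub>v v)"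
      by (rule assoc_mult_mat_vec[OF J1a J2 v])
    also have "\<dots> = 0\<^sub>v p" using J2V[OF v] by (simp add: V_def)
    also have "\<dots> = 0\<^sub>m p q *\<^sub>v v" by (rule zero_mat_vec[OF v, symmetric])
    finally show "(mat_adjoint J1 * J2) *\<^sub>v v = 0\<^sub>m p q *\<^sub>v v" .
  qed (use J1a J2 in auto)
  have zero21: "mat_adjoint J2 * J1 = 0\<^sub>m q p"
  proof -
    have "mat_adjoint J2 * J1 = mat_adjoint (mat_adjoint J1 * J2)"
      by (simp add: mat_adjoint_mult[OF J1a J2])
    also have "\<dots> = 0\<^sub>m q p" unfolding zero12 by (rule eq_matI) auto
    finally show ?thesis .
  qed
  have sum: "J1 * mat_adjoint J1 + J2 * mat_adjoint J2 = 1\<^sub>m n"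
  proof (rule mat_eq_on_vecs[of _ n n])
    fix v :: "complex vec" assume v: "v \<in> carrier_vec n"
    define a where "a = J1 *\<^sub>v (mat_adjoint J1 *\<^sub>v v)"
    define b where "b = J2 *\<^sub>v (mat_adjoint J2 *\<^sub>v v)"
    have c: "mat_adjoint J1 *\<^sub>v v \<in> carrier_vec p" "mat_adjoint J2 *\<^sub>v v \<in> carrier_vec q"
      using J1a J2a v by auto
    have ac: "a \<in> carrier_vec n" and bc: "b \<in> carrier_vec n" unfolding a_def b_def using J1 J2 c by auto
    have "mat_adjoint J1 *\<^sub>v a = (mat_adjoint J1 * J1) *\<^sub>v (mat_adjoint J1 *\<^sub>v v)"
      unfolding a_def by (rule assoc_mult_mat_vec[OF J1a J1 c(1), symmetric])
    then have "mat_adjoint J1 *\<^sub>v a = mat_adjoint J1 *\<^sub>v v" using c by (simp add: iso1)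
    then have "mat_adjoint J1 *\<^sub>v (v - a) = 0\<^sub>v p"
      unfolding mult_minus_distrib_mat_vec[OF J1a v ac] using c by simp
    then have "v - a \<in> V" using v ac by (simp add: V_def)
    then have "J2 *\<^sub>v (mat_adjoint J2 *\<^sub>v (v - a)) = v - a" by (rule VJ2)
    moreover have "mat_adjoint J2 *\<^sub>v a = 0\<^sub>v q"
    proof -
      have "mat_adjoint J2 *\<^sub>v a = (mat_adjoint J2 * J1) *\<^sub>v (mat_adjoint J1 *\<^sub>v v)"
        unfolding a_def by (rule assoc_mult_mat_vec[OF J2a J1 c(1), symmetric])
      also have "\<dots> = 0\<^sub>v q" unfolding zero21 by (rule zero_mat_vec[OF c(1)])
      finally show ?thesis .
    qed
    then have "mat_adjoint J2 *\<^sub>v (v - a) = mat_adjoint J2 *\<^sub>v v"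
      unfolding mult_minus_distrib_mat_vec[OF J2a v ac] using c by simp
    ultimately have "b = v - a" by (simp add: b_def)
    then have "a + b = v" using v ac by (intro eq_vecI) auto
    moreover have "(J1 * mat_adjoint J1 + J2 * mat_adjoint J2) *\<^sub>v v = a + b"
      unfolding a_def b_def assoc_mult_mat_vec[OF J1 J1a v, symmetric] assoc_mult_mat_vec[OF J2 J2a v, symmetric]
      using J1 J1a J2 J2a v by (intro add_mult_distrib_mat_vec) auto
    ultimately show "(J1 * mat_adjoint J1 + J2 * mat_adjoint J2) *\<^sub>v v = 1\<^sub>m n *\<^sub>v v" using v by simp
  qed (use J1 J2 J1a J2a in auto)
  have "of_nat p + of_nat q = (\<Sum>i<n. (J1 * mat_adjoint J1) $$ (i, i) + (J2 * mat_adjoint J2) $$ (i, i))"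
    unfolding sum.distrib isometry_trace[OF J1 iso1] isometry_trace[OF J2 iso2] ..
  also have "\<dots> = (\<Sum>i<n. (J1 * mat_adjoint J1 + J2 * mat_adjoint J2) $$ (i, i))"
    using J1 J2 by (intro sum.cong refl) (simp del: index_mult_mat(1))
  also have "\<dots> = of_nat n" unfolding sum by simp
  finally have "of_nat (p + q) = (of_nat n :: complex)" by simp
  then have pq: "p + q = n" by (simp only: of_nat_eq_iff)
  have "p \<noteq> 0"
  proof
    assume p: "p = 0"
    have "w = 0\<^sub>v n" if w: "w \<in> W" for w
    proof -
      have wc: "w \<in> carrier_vec n" using w W by (auto simp: subspace_iff)
      have "w = J1 *\<^sub>v (mat_adjoint J1 *\<^sub>v w)" using WJ1[OF w] by simp
      also have "\<dots> = 0\<^sub>v n"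
      proof (rule eq_vecI)
        fix i assume "i < dim_vec (0\<^sub>v n :: complex vec)"
        then show "(J1 *\<^sub>v (mat_adjoint J1 *\<^sub>v w)) $ i = 0\<^sub>v n $ i"
          using p mat_vec_index[OF J1, of "mat_adjoint J1 *\<^sub>v w" i] J1a wc by simp
      qed (use J1 in simp)
      finally show ?thesis .
    qed
    moreover have "0\<^sub>v n \<in> W" using W by (auto simp: subspace_iff)
    ultimately show False using W0 by blast
  qed
  moreover have "q \<noteq> 0"
  proof
    assume q: "q = 0"
    have "J2 * mat_adjoint J2 = 0\<^sub>m n n"
    proof (rule eq_matI)
      fix i j assume "i < dim_row (0\<^sub>m n n :: complex mat)" "j < dim_col (0\<^sub>m n n :: complex mat)"
      then show "(J2 * mat_adjoint J2) $$ (i, j) = 0\<^sub>m n n $$ (i, j)"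
        using mat_mult_index[OF J2 J2a, of i j] q by simp
    qed (use J2 in auto)
    then have 1: "J1 * mat_adjoint J1 = 1\<^sub>m n" using sum J1 J1a by simp
    have "v \<in> W" if v: "v \<in> carrier_vec n" for v
    proof -
      have "v = J1 *\<^sub>v (mat_adjoint J1 *\<^sub>v v)"
        using assoc_mult_mat_vec[OF J1 J1a v] v by (simp add: 1)
      also have "\<dots> \<in> W" using J1a v by (intro J1W) simp
      finally show ?thesis .
    qed
    with W1 W show False by (auto simp: subspace_iff)
  qed
  ultimately have pn: "p < n" and qn: "q < n" using pq by auto
  show thesis by (rule that) (fact pn qn J1 iso1 J2 iso2 sum zero12 J1W WJ1)+
qed

lemma rep_adjoint:
  assumes "group G" and \<sigma>: "\<sigma> \<in> cont_hom G T (unitary_group n) (unitary_topology n)" and x: "x \<in> carrier G"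
  shows "mat_adjoint (\<sigma> x) = \<sigma> (inv\<^bsub>G\<^esub> x)"
proof -
  have h: "\<sigma> \<in> hom G (unitary_group n)" using \<sigma> by (simp add: cont_hom_def)
  interpret group_hom G "unitary_group n" \<sigma>
    using assms(1) group_unitary h by (simp add: group_hom_def group_hom_axioms_def)
  show ?thesis using hom_inv[OF x] unitary_inv[OF hom_closed[OF x]] by simp
qed

lemma rep_carrier:
  "\<sigma> \<in> cont_hom G T (unitary_group n) (unitary_topology n) \<Longrightarrow> x \<in> carrier G \<Longrightarrow> \<sigma> x \<in> carrier (unitary_group n)"
  by (auto simp: cont_hom_def hom_def)

text \<open>An eigenspace of \<open>S\<close> is invariant under the representation.\<close>

lemma commutant_scalar:
  assumes irr: "(m, \<sigma>) \<in> irreps G T" and S: "S \<in> carrier_mat m m"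
    and comm: "\<And>x. x \<in> carrier G \<Longrightarrow> S * \<sigma> x = \<sigma> x * S"
  obtains c where "S = c \<cdot>\<^sub>m 1\<^sub>m m"
proof -
  have m: "1 \<le> m" and \<sigma>: "\<sigma> \<in> cont_hom G T (unitary_group m) (unitary_topology m)"
    and simple: "\<And>W. VectorSpace.subspace class_ring W (module_vec TYPE(complex) m) \<Longrightarrow>
      (\<forall>x\<in>carrier G. \<forall>w\<in>W. \<sigma> x *\<^sub>v w \<in> W) \<Longrightarrow> W = {0\<^sub>v m} \<or> W = carrier_vec m"
    using irr by (auto simp: irreps_def)
  have "spectrum S \<noteq> {}" using spectrum_non_empty[OF S] m by simp
  then obtain c v where v: "v \<in> carrier_vec m" "v \<noteq> 0\<^sub>v m" "S *\<^sub>v v = c \<cdot>\<^sub>v v"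
    using S by (auto simp: spectrum_def eigenvalue_def eigenvector_def)
  define W where "W = {v \<in> carrier_vec m. S *\<^sub>v v = c \<cdot>\<^sub>v v}"
  have "VectorSpace.subspace class_ring W (module_vec TYPE(complex) m)"
    unfolding subspace_iff W_def
  proof (intro conjI ballI allI)
    show "0\<^sub>v m \<in> {v \<in> carrier_vec m. S *\<^sub>v v = c \<cdot>\<^sub>v v}"
      using S by (auto intro!: eq_vecI simp: scalar_prod_def)
  qed (use S in \<open>auto simp: mult_add_distrib_mat_vec mult_mat_vec smult_add_distrib_vec smult_smult_assoc mult.commute\<close>)
  moreover have "\<sigma> x *\<^sub>v w \<in> W" if x: "x \<in> carrier G" and w: "w \<in> W" for x w
  proof -
    have w: "w \<in> carrier_vec m" "S *\<^sub>v w = c \<cdot>\<^sub>v w" using w by (auto simp: W_def)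
    have sx: "\<sigma> x \<in> carrier_mat m m" using rep_carrier[OF \<sigma> x] by (rule unitary_carrier)
    have "S *\<^sub>v (\<sigma> x *\<^sub>v w) = (S * \<sigma> x) *\<^sub>v w" by (rule assoc_mult_mat_vec[OF S sx w(1), symmetric])
    also have "\<dots> = \<sigma> x *\<^sub>v (S *\<^sub>v w)" unfolding comm[OF x] by (rule assoc_mult_mat_vec[OF sx S w(1)])
    also have "\<dots> = c \<cdot>\<^sub>v (\<sigma> x *\<^sub>v w)" unfolding w(2) by (rule mult_mat_vec[OF sx w(1)])
    finally show ?thesis using sx w by (simp add: W_def)
  qed
  ultimately have "W = {0\<^sub>v m} \<or> W = carrier_vec m" by (intro simple) auto
  moreover have "v \<in> W" using v by (simp add: W_def)
  ultimately have W: "W = carrier_vec m" using v by auto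
  have "S = c \<cdot>\<^sub>m 1\<^sub>m m"
  proof (rule mat_eq_on_vecs[OF S])
    fix v :: "complex vec" assume v: "v \<in> carrier_vec m"
    then have "S *\<^sub>v v = c \<cdot>\<^sub>v v" using W by (auto simp: W_def)
    also have "\<dots> = (c \<cdot>\<^sub>m 1\<^sub>m m) *\<^sub>v v" using v by (intro eq_vecI) auto
    finally show "S *\<^sub>v v = (c \<cdot>\<^sub>m 1\<^sub>m m) *\<^sub>v v" .
  qed simp
  then show thesis by (rule that)
qed

text \<open>By Schur's lemma, \<open>A\<^sup>* A\<close> and \<open>A A\<^sup>*\<close> are scalars. The scalar is the same positive number for both and,
  as the traces agree, so are the dimensions. Hence \<open>A\<close> is a multiple of a unitary matrix.\<close>

lemma Schur_unitary_equiv: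
  assumes gG: "group G" and irr: "(m, \<sigma>) \<in> irreps G T" and irr': "(m', \<tau>) \<in> irreps G T"
    and A: "A \<in> carrier_mat m' m" and A0: "A \<noteq> 0\<^sub>m m' m"
    and inter: "\<And>x. x \<in> carrier G \<Longrightarrow> A * \<sigma> x = \<tau> x * A"
  shows "((m, \<sigma>), (m', \<tau>)) \<in> unitary_equiv G T"
proof -
  interpret G: group G by (rule gG)
  note Aa = mat_adjoint_carrier[OF A]
  have \<sigma>: "\<sigma> \<in> cont_hom G T (unitary_group m) (unitary_topology m)" and m: "0 < m"
    and \<tau>: "\<tau> \<in> cont_hom G T (unitary_group m') (unitary_topology m')"
    using irr irr' by (auto simp: irreps_def)
  have sc: "\<sigma> x \<in> carrier_mat m m" and tc: "\<tau> x \<in> carrier_mat m' m'" if "x \<in> carrier G" for x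
    using rep_carrier[OF \<sigma> that] rep_carrier[OF \<tau> that] by (auto dest: unitary_carrier)
  have inter': "mat_adjoint A * \<tau> x = \<sigma> x * mat_adjoint A" if x: "x \<in> carrier G" for x
  proof -
    have x': "inv\<^bsub>G\<^esub> x \<in> carrier G" using x by simp
    have "mat_adjoint (A * \<sigma> (inv\<^bsub>G\<^esub> x)) = mat_adjoint (\<tau> (inv\<^bsub>G\<^esub> x) * A)" by (simp only: inter[OF x'])
    then show ?thesis
      by (simp add: mat_adjoint_mult[OF A sc[OF x']] mat_adjoint_mult[OF tc[OF x'] A]
          rep_adjoint[OF gG \<sigma> x'] rep_adjoint[OF gG \<tau> x'] x)
  qed
  have "(mat_adjoint A * A) * \<sigma> x = \<sigma> x * (mat_adjoint A * A)" if x: "x \<in> carrier G" for x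
    by (simp add: assoc_mult_mat[OF Aa A sc[OF x]] inter[OF x] inter'[OF x]
        assoc_mult_mat[OF sc[OF x] Aa A, symmetric] assoc_mult_mat[OF Aa tc[OF x] A, symmetric])
  then obtain c where c: "mat_adjoint A * A = c \<cdot>\<^sub>m 1\<^sub>m m"
    using commutant_scalar[OF irr, of "mat_adjoint A * A"] A Aa by auto
  have "(A * mat_adjoint A) * \<tau> x = \<tau> x * (A * mat_adjoint A)" if x: "x \<in> carrier G" for x
    by (simp add: assoc_mult_mat[OF A Aa tc[OF x]] inter[OF x] inter'[OF x]
        assoc_mult_mat[OF tc[OF x] A Aa, symmetric] assoc_mult_mat[OF A sc[OF x] Aa, symmetric])
  then obtain c' where c': "A * mat_adjoint A = c' \<cdot>\<^sub>m 1\<^sub>m m'"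
    using commutant_scalar[OF irr', of "A * mat_adjoint A"] A Aa by auto
  have "\<exists>i<m'. \<exists>j<m. A $$ (i, j) \<noteq> 0"
  proof (rule ccontr)
    assume "\<not> ?thesis"
    then have "A = 0\<^sub>m m' m" using A by (intro eq_matI) auto
    with A0 show False ..
  qed
  then obtain i j where ij: "i < m'" "j < m" "A $$ (i, j) \<noteq> 0" by blast
  have "A * (mat_adjoint A * A) = (A * mat_adjoint A) * A" by (rule assoc_mult_mat[OF A Aa A, symmetric])
  then have "c \<cdot>\<^sub>m A = c' \<cdot>\<^sub>m A"
    using A by (simp add: c c' mult_smult_distrib[OF A one_carrier_mat] mult_smult_assoc_mat[OF one_carrier_mat A])
  then have "(c \<cdot>\<^sub>m A) $$ (i, j) = (c' \<cdot>\<^sub>m A) $$ (i, j)" by simp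
  then have cc': "c' = c" using ij A by simp
  define r where "r = (\<Sum>k<m'. (cmod (A $$ (k, j)))\<^sup>2)"
  have r: "0 < r" unfolding r_def using ij by (intro sum_pos2[of _ i]) auto
  have "c = (mat_adjoint A * A) $$ (j, j)" using ij by (simp add: c)
  also have "\<dots> = complex_of_real r"
    unfolding adjoint_mult_index[OF A A ij(2,2)] r_def of_real_sum
    by (intro sum.cong refl) (simp only: complex_norm_square mult.commute)
  finally have cr: "c = complex_of_real r" .
  (* The two products of A with its adjoint have the same trace, which gives m' = m. *)
  have "c * of_nat m = (\<Sum>j<m. (mat_adjoint A * A) $$ (j, j))" by (simp add: c mult.commute)
  also have "\<dots> = (\<Sum>j<m. \<Sum>k<m'. cnj (A $$ (k, j)) * A $$ (k, j))"
    by (intro sum.cong refl) (simp only: adjoint_mult_index[OF A A] lessThan_iff)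
  also have "\<dots> = (\<Sum>k<m'. \<Sum>j<m. cnj (A $$ (k, j)) * A $$ (k, j))" by (rule sum.swap)
  also have "\<dots> = (\<Sum>k<m'. (A * mat_adjoint A) $$ (k, k))"
  proof (intro sum.cong refl)
    fix k assume "k \<in> {..<m'}"
    then have k: "k < m'" by simp
    show "(\<Sum>j<m. cnj (A $$ (k, j)) * A $$ (k, j)) = (A * mat_adjoint A) $$ (k, k)"
      unfolding mat_mult_index[OF A Aa k k] using A k by (intro sum.cong refl) (simp add: mult.commute)
  qed
  also have "\<dots> = c * of_nat m'" by (simp add: c' cc' mult.commute)
  finally have mm: "m' = m" using cr r by simp
  define U where "U = complex_of_real (1 / sqrt r) \<cdot>\<^sub>m A"
  have U: "U \<in> carrier_mat m m" using A by (simp add: U_def mm)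
  have Ua: "mat_adjoint U = complex_of_real (1 / sqrt r) \<cdot>\<^sub>m mat_adjoint A"
    unfolding U_def using A by (intro eq_matI) auto
  have "U * mat_adjoint U = complex_of_real (1 / sqrt r) \<cdot>\<^sub>m (complex_of_real (1 / sqrt r) \<cdot>\<^sub>m (A * mat_adjoint A))"
    unfolding Ua unfolding U_def
    using A Aa by (simp add: mult_smult_distrib[of _ m' m _ m'] mult_smult_assoc_mat[of _ m' m _ m'])
  also have "\<dots> = 1\<^sub>m m"
  proof (rule eq_matI)
    fix k l assume "k < dim_row (1\<^sub>m m :: complex mat)" "l < dim_col (1\<^sub>m m :: complex mat)"
    moreover have "complex_of_real (1 / sqrt r) * (complex_of_real (1 / sqrt r) * complex_of_real r) = 1"
      using r by (simp flip: of_real_mult)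
    ultimately show "(complex_of_real (1 / sqrt r) \<cdot>\<^sub>m (complex_of_real (1 / sqrt r) \<cdot>\<^sub>m (A * mat_adjoint A))) $$ (k, l) = 1\<^sub>m m $$ (k, l)"
      by (simp add: c' cc' cr mm)
  qed (simp_all add: c' mm)
  finally have Uu: "U \<in> carrier (unitary_group m)" using U by (intro unitaryI)
  have "\<tau> x = U * \<sigma> x * mat_adjoint U" if x: "x \<in> carrier G" for x
  proof -
    have "U * \<sigma> x = \<tau> x * U"
      unfolding U_def using inter[OF x]
      by (simp add: mult_smult_assoc_mat[OF A sc[OF x]] mult_smult_distrib[OF tc[OF x] A])
    then have "U * \<sigma> x * mat_adjoint U = \<tau> x * U * mat_adjoint U" by simp
    also have "\<dots> = \<tau> x * (U * mat_adjoint U)"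
      using tc[OF x] U mat_adjoint_carrier[OF U] by (intro assoc_mult_mat[of _ m m _ m _ m]) (auto simp: mm)
    also have "\<dots> = \<tau> x" using tc[OF x] by (simp add: unitary_adjoint[OF Uu] mm)
    finally show ?thesis by simp
  qed
  then show ?thesis using irr irr' Uu mm by (auto simp: unitary_equiv_def)
qed

section \<open>Representations of finite rank\<close>

text \<open>A Gelfand-Naimark-Segal construction. Finitely supported functions on the group, on which it acts by
  translation, carry the invariant form for which the inner product of the point masses at \<open>a\<close> and \<open>b\<close> is
  that of the vectors \<open>u a\<close> and \<open>u b\<close>. The form factors through the finite dimensional space of these
  vectors, by the map \<open>hat\<close>, which bounds the dimension of the representation.\<close>

lemma unitary_rep_of_invariant_vectors:
  fixes G :: "('g, 'm) monoid_scheme" (structure) and u :: "'i \<Rightarrow> 'g \<Rightarrow> real"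
  assumes tg: "topological_group G T" and I: "finite I"
    and cont: "\<And>i. i \<in> I \<Longrightarrow> continuous_map T euclideanreal (u i)"
    and inv: "\<And>g a b. g \<in> carrier G \<Longrightarrow> a \<in> carrier G \<Longrightarrow> b \<in> carrier G \<Longrightarrow>
      (\<Sum>i\<in>I. u i (g \<otimes> a) * u i (g \<otimes> b)) = (\<Sum>i\<in>I. u i a * u i b)"
  obtains m \<rho> c where "\<rho> \<in> cont_hom G T (unitary_group m) (unitary_topology m)"
    "\<And>g. g \<in> carrier G \<Longrightarrow>
      (\<Sum>i\<in>I. u i g * u i \<one>) = (\<Sum>i<m. \<Sum>j<m. c j * c i * Re (\<rho> g $$ (i, j)))"
proof -
  interpret group G using tg by (simp add: topological_group_def)
  have top: "topspace T = carrier G" and mc: "continuous_map (prod_topology T T) T (\<lambda>(x, y). x \<otimes> y)"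
    using tg by (auto simp: topological_group_def)
  define supp where "supp a = {x. a x \<noteq> 0}" for a :: "'g \<Rightarrow> real"
  define E where "E = {a :: 'g \<Rightarrow> real. finite (supp a) \<and> supp a \<subseteq> carrier G}"
  have E_supp: "finite (supp a)" "supp a \<subseteq> carrier G" if "a \<in> E" for a using that by (auto simp: E_def)
  define hat where "hat a i = (\<Sum>x\<in>supp a. a x * u i x)" for a i
  have hat: "hat a i = (\<Sum>x\<in>S. a x * u i x)" if "finite S" "supp a \<subseteq> S" for a S i
    unfolding hat_def using that by (intro sum.mono_neutral_left) (auto simp: supp_def)
  define B where "B a b = (\<Sum>i\<in>I. hat a i * hat b i)" for a b
  have zero: "(\<lambda>x. 0) \<in> E" by (simp add: E_def supp_def)
  have E_add: "(\<lambda>x. a x + b x) \<in> E" if "a \<in> E" "b \<in> E" for a b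
  proof -
    have sub: "supp (\<lambda>x. a x + b x) \<subseteq> supp a \<union> supp b" by (auto simp: supp_def)
    have "finite (supp a \<union> supp b)" "supp a \<union> supp b \<subseteq> carrier G" using that by (auto simp: E_def)
    with finite_subset[OF sub] subset_trans[OF sub] show ?thesis by (simp add: E_def)
  qed
  have E_scale: "(\<lambda>x. c * a x) \<in> E" if "a \<in> E" for a c
  proof -
    have sub: "supp (\<lambda>x. c * a x) \<subseteq> supp a" by (auto simp: supp_def)
    have "finite (supp a)" "supp a \<subseteq> carrier G" using that by (auto simp: E_def)
    with finite_subset[OF sub] subset_trans[OF sub] show ?thesis by (simp add: E_def)
  qed
  have hat_add: "hat (\<lambda>x. a x + b x) i = hat a i + hat b i" if "a \<in> E" "b \<in> E" for a b i
  proof -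
    let ?S = "supp a \<union> supp b"
    have S: "finite ?S" using that E_supp by auto
    have "supp (\<lambda>x. a x + b x) \<subseteq> ?S" by (auto simp: supp_def)
    from hat[OF S this] hat[OF S, of a] hat[OF S, of b] show ?thesis
      by (simp add: distrib_right sum.distrib)
  qed
  have hat_scale: "hat (\<lambda>x. c * a x) i = c * hat a i" if "a \<in> E" for a c i
  proof -
    have "supp (\<lambda>x. c * a x) \<subseteq> supp a" by (auto simp: supp_def)
    from hat[OF E_supp(1)[OF that] this] show ?thesis by (simp add: hat_def sum_distrib_left mult.assoc)
  qed
  have sym: "B a b = B b a" for a b by (simp add: B_def mult.commute)
  have B_add: "B (\<lambda>x. a x + b x) c = B a c + B b c" if "a \<in> E" "b \<in> E" "c \<in> E" for a b c
    using that by (simp add: B_def hat_add distrib_right sum.distrib)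
  have B_scale: "B (\<lambda>x. c * a x) b = c * B a b" if "a \<in> E" "b \<in> E" for a b c
    using that by (simp add: B_def hat_scale sum_distrib_left mult.assoc)
  have B_pos: "0 \<le> B a a" if "a \<in> E" for a unfolding B_def by (intro sum_nonneg) simp
  have bound: "m \<le> card I"
    if "\<And>i. i < m \<Longrightarrow> f i \<in> E" "\<And>i j. i < m \<Longrightarrow> j < m \<Longrightarrow> B (f i) (f j) = (if i = j then 1 else 0)"
    for m :: nat and f
    by (rule orthonormal_le_card[OF I, where h = "\<lambda>j. hat (f j)"]) (use that(2) in \<open>simp add: B_def\<close>)
  obtain m :: nat and f where f: "\<And>i. i < m \<Longrightarrow> f i \<in> E"
    and on: "\<And>i j. i < m \<Longrightarrow> j < m \<Longrightarrow> B (f i) (f j) = (if i = j then 1 else 0)"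
    and Parseval: "\<And>a b. a \<in> E \<Longrightarrow> b \<in> E \<Longrightarrow> B a b = (\<Sum>i<m. B a (f i) * B b (f i))"
    by (rule Parseval_system[where B = B, OF zero E_add E_scale sym B_add B_scale B_pos bound])
      (assumption | rule that)+
  define R where "R g a = (\<lambda>x. if x \<in> carrier G then a (inv g \<otimes> x) else 0)" for g and a :: "'g \<Rightarrow> real"
  have supp_R: "supp (R g a) = (\<lambda>y. g \<otimes> y) ` supp a" if g: "g \<in> carrier G" and a: "a \<in> E" for g a
  proof
    show "supp (R g a) \<subseteq> (\<lambda>y. g \<otimes> y) ` supp a"
    proof
      fix x assume "x \<in> supp (R g a)"
      then have x: "x \<in> carrier G" "inv g \<otimes> x \<in> supp a" by (auto simp: supp_def R_def split: if_splits)
      moreover have "x = g \<otimes> (inv g \<otimes> x)" using g x by (simp flip: m_assoc)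
      ultimately show "x \<in> (\<lambda>y. g \<otimes> y) ` supp a" by blast
    qed
    show "(\<lambda>y. g \<otimes> y) ` supp a \<subseteq> supp (R g a)"
    proof
      fix x assume "x \<in> (\<lambda>y. g \<otimes> y) ` supp a"
      then obtain y where y: "y \<in> supp a" "x = g \<otimes> y" by blast
      then have "y \<in> carrier G" using E_supp(2)[OF a] by blast
      moreover have "inv g \<otimes> (g \<otimes> y) = y" using g \<open>y \<in> carrier G\<close> by (simp flip: m_assoc)
      ultimately show "x \<in> supp (R g a)" using y g by (auto simp: supp_def R_def)
    qed
  qed
  have RE: "R g a \<in> E" if g: "g \<in> carrier G" and a: "a \<in> E" for g a
    using E_supp[OF a] g by (auto simp: E_def supp_R[OF g a])
  have hat_R: "hat (R g a) i = (\<Sum>y\<in>supp a. a y * u i (g \<otimes> y))" if g: "g \<in> carrier G" and a: "a \<in> E" for g a i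
  proof -
    have "inj_on (\<lambda>y. g \<otimes> y) (supp a)" using E_supp(2)[OF a] g by (auto simp: inj_on_def subset_iff)
    then have "hat (R g a) i = (\<Sum>y\<in>supp a. R g a (g \<otimes> y) * u i (g \<otimes> y))"
      unfolding hat_def supp_R[OF g a] by (simp add: sum.reindex)
    also have "\<dots> = (\<Sum>y\<in>supp a. a y * u i (g \<otimes> y))"
    proof (intro sum.cong refl)
      fix y assume "y \<in> supp a"
      then have y: "y \<in> carrier G" using E_supp(2)[OF a] by blast
      have "inv g \<otimes> (g \<otimes> y) = y" using g y by (simp flip: m_assoc)
      then show "R g a (g \<otimes> y) * u i (g \<otimes> y) = a y * u i (g \<otimes> y)" using g y by (simp add: R_def)
    qed
    finally show ?thesis .
  qed
  have B_R: "B (R g a) (R h b) = (\<Sum>y\<in>supp a. \<Sum>z\<in>supp b. a y * b z * (\<Sum>i\<in>I. u i (g \<otimes> y) * u i (h \<otimes> z)))"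
    if g: "g \<in> carrier G" "h \<in> carrier G" and ab: "a \<in> E" "b \<in> E" for g h a b
  proof -
    have "B (R g a) (R h b) = (\<Sum>i\<in>I. \<Sum>y\<in>supp a. \<Sum>z\<in>supp b. a y * b z * (u i (g \<otimes> y) * u i (h \<otimes> z)))"
      by (simp add: B_def hat_R g ab sum_product mult_ac)
    also have "\<dots> = (\<Sum>y\<in>supp a. \<Sum>i\<in>I. \<Sum>z\<in>supp b. a y * b z * (u i (g \<otimes> y) * u i (h \<otimes> z)))"
      by (rule sum.swap)
    also have "\<dots> = (\<Sum>y\<in>supp a. \<Sum>z\<in>supp b. \<Sum>i\<in>I. a y * b z * (u i (g \<otimes> y) * u i (h \<otimes> z)))"
      by (intro sum.cong refl sum.swap)
    finally show ?thesis by (simp add: sum_distrib_left)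
  qed
  have hat_one: "hat (R \<one> a) = hat a" if "a \<in> E" for a
  proof
    fix i
    have "a y * u i (\<one> \<otimes> y) = a y * u i y" if "y \<in> supp a" for y
      using that E_supp(2)[OF \<open>a \<in> E\<close>] by (simp add: subset_iff)
    then have "(\<Sum>y\<in>supp a. a y * u i (\<one> \<otimes> y)) = hat a i" unfolding hat_def by (intro sum.cong refl)
    with hat_R[OF one_closed that] show "hat (R \<one> a) i = hat a i" by simp
  qed
  have mult: "B (R (g \<otimes> h) a) b = B (R h a) (R (inv g) b)"
    if gh: "g \<in> carrier G" "h \<in> carrier G" and ab: "a \<in> E" "b \<in> E" for g h a b
  proof -
    have "B (R (g \<otimes> h) a) b = B (R (g \<otimes> h) a) (R \<one> b)" by (simp add: B_def hat_one ab)
    also have "\<dots> = B (R h a) (R (inv g) b)"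
      unfolding B_R[OF m_closed[OF gh] one_closed ab] B_R[OF gh(2) inv_closed[OF gh(1)] ab]
    proof (intro sum.cong refl)
      fix y z assume "y \<in> supp a" "z \<in> supp b"
      then have yz: "y \<in> carrier G" "z \<in> carrier G" using E_supp(2) ab by blast+
      have "g \<otimes> (inv g \<otimes> z) = z" using gh yz by (simp flip: m_assoc)
      then have "(\<Sum>i\<in>I. u i (g \<otimes> h \<otimes> y) * u i (\<one> \<otimes> z)) = (\<Sum>i\<in>I. u i (h \<otimes> y) * u i (inv g \<otimes> z))"
        using inv[of g "h \<otimes> y" "inv g \<otimes> z"] gh yz by (simp add: m_assoc)
      then show "a y * b z * (\<Sum>i\<in>I. u i (g \<otimes> h \<otimes> y) * u i (\<one> \<otimes> z)) =
          a y * b z * (\<Sum>i\<in>I. u i (h \<otimes> y) * u i (inv g \<otimes> z))" by simp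
    qed
    finally show ?thesis .
  qed
  have contR: "continuous_map T euclideanreal (\<lambda>g. B (R g a) b)" if ab: "a \<in> E" "b \<in> E" for a b
  proof -
    have "continuous_map T euclideanreal (\<lambda>g. u i (g \<otimes> y))" if "i \<in> I" "y \<in> supp a" for i y
    proof -
      have y: "y \<in> carrier G" using E_supp(2) ab that by blast
      have "continuous_map T (prod_topology T T) (\<lambda>g. (g, y))"
        using y top by (intro continuous_map_pairedI) auto
      from continuous_map_compose[OF continuous_map_compose[OF this mc] cont[OF that(1)]] show ?thesis
        by (simp add: comp_def)
    qed
    then have "continuous_map T euclideanreal (\<lambda>g. \<Sum>i\<in>I. (\<Sum>y\<in>supp a. a y * u i (g \<otimes> y)) * hat b i)"
      using I E_supp(1)[OF ab(1)]
      by (intro continuous_map_sum continuous_map_real_mult_right continuous_map_real_mult_left) auto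
    then show ?thesis
      by (rule continuous_map_eq) (simp add: B_def hat_R ab top)
  qed
  obtain \<rho> where \<rho>: "\<rho> \<in> cont_hom G T (unitary_group m) (unitary_topology m)"
    and \<rho>_eq: "\<And>g a b. g \<in> carrier G \<Longrightarrow> a \<in> E \<Longrightarrow> b \<in> E \<Longrightarrow>
      B (R g a) b = (\<Sum>i<m. \<Sum>j<m. B a (f j) * B b (f i) * Re (\<rho> g $$ (i, j)))"
  proof -
    have one: "B (R \<one> a) b = B a b" if "a \<in> E" "b \<in> E" for a b by (simp add: B_def hat_one that)
    show thesis
      by (rule unitary_rep_of_Parseval_system[where B = B and R = R,
            OF tg f sym on Parseval RE one mult contR]) (assumption | rule that)+
  qed
  define \<delta> where "\<delta> = (\<lambda>x. if x = \<one> then 1 else 0 :: real)"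
  have supp_\<delta>: "supp \<delta> = {\<one>}" by (auto simp: supp_def \<delta>_def)
  then have \<delta>E: "\<delta> \<in> E" by (simp add: E_def)
  have \<delta>1: "\<delta> \<one> = 1" by (simp add: \<delta>_def)
  have "hat \<delta> i = u i \<one>" for i by (simp add: hat_def supp_\<delta> \<delta>1)
  moreover have "hat (R g \<delta>) i = u i g" if "g \<in> carrier G" for g i
    using hat_R[OF that \<delta>E] that by (simp add: supp_\<delta> \<delta>1)
  ultimately have "(\<Sum>i\<in>I. u i g * u i \<one>) = B (R g \<delta>) \<delta>" if "g \<in> carrier G" for g
    using that by (simp add: B_def)
  then show thesis
    using \<rho>_eq[OF _ \<delta>E \<delta>E] by (intro that[OF \<rho>, of "\<lambda>i. B \<delta> (f i)"]) simp
qed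

section \<open>Subrepresentations\<close>

lemma mat_assoc:
  fixes A B C :: "complex mat"
  shows "dim_col A = dim_row B \<Longrightarrow> dim_col B = dim_row C \<Longrightarrow> A * B * C = A * (B * C)"
  by (intro assoc_mult_mat[of _ "dim_row A" "dim_col A" _ "dim_col B" _ "dim_col C"]) auto

lemma mat_adjoint_mult':
  fixes A B :: "complex mat"
  shows "dim_col A = dim_row B \<Longrightarrow> mat_adjoint (A * B) = mat_adjoint B * mat_adjoint A"
  by (intro mat_adjoint_mult[of _ "dim_row A" "dim_col A" _ "dim_col B"]) auto

text \<open>An isometry \<open>J\<close> with \<open>\<pi> x J = J \<tau> x\<close>, where \<open>\<tau> x = J\<^sup>* \<pi> x J\<close>, embeds the representation \<open>\<tau>\<close>
  into \<open>\<pi>\<close>.\<close>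

definition invariant_isometry ::
  "('g, 'm) monoid_scheme \<Rightarrow> nat \<Rightarrow> ('g \<Rightarrow> complex mat) \<Rightarrow> nat \<Rightarrow> complex mat \<Rightarrow> bool" where
  "invariant_isometry G n \<pi> m J \<longleftrightarrow> J \<in> carrier_mat n m \<and> mat_adjoint J * J = 1\<^sub>m m \<and>
     (\<forall>x\<in>carrier G. \<pi> x * J = J * (mat_adjoint J * \<pi> x * J))"

lemma rep_mat:
  assumes "\<pi> \<in> cont_hom G T (unitary_group n) (unitary_topology n)" "x \<in> carrier G"
  shows "\<pi> x \<in> carrier_mat n n" "dim_row (\<pi> x) = n" "dim_col (\<pi> x) = n"
  using unitary_carrier[OF rep_carrier[OF assms]] by auto

lemma rep_mult:
  assumes "\<pi> \<in> cont_hom G T (unitary_group n) (unitary_topology n)" "x \<in> carrier G" "y \<in> carrier G"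
  shows "\<pi> (x \<otimes>\<^bsub>G\<^esub> y) = \<pi> x * \<pi> y"
  using assms by (auto simp: cont_hom_def hom_def)

lemma rep_one:
  assumes "group G" "\<pi> \<in> cont_hom G T (unitary_group n) (unitary_topology n)"
  shows "\<pi> \<one>\<^bsub>G\<^esub> = 1\<^sub>m n"
  using hom_one[of \<pi> G "unitary_group n"] assms group_unitary by (simp add: cont_hom_def)

lemma rep_entry_continuous:
  assumes top: "topspace T = carrier G"
    and \<psi>: "\<psi> \<in> cont_hom G T (unitary_group n) (unitary_topology n)"
    and A: "A \<in> carrier_mat p n" and C: "C \<in> carrier_mat n q" and ij: "i < p" "j < q"
  shows "continuous_map T euclidean (\<lambda>y. (A * \<psi> y * C) $$ (i, j))"
proof -
  have cp: "continuous_map T euclidean (\<lambda>y. \<psi> y $$ (k, l))" if "k < n" "l < n" for k l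
    using \<psi> that unfolding cont_hom_unitary_iff[OF top] by blast
  have "continuous_map T euclidean (\<lambda>y. \<Sum>l<n. (\<Sum>k<n. A $$ (i, k) * \<psi> y $$ (k, l)) * C $$ (l, j))"
    by (intro continuous_map_sum continuous_map_complex_mult cp) auto
  then show ?thesis
  proof (rule continuous_map_eq)
    fix y assume "y \<in> topspace T"
    then have px: "\<psi> y \<in> carrier_mat n n" using rep_mat[OF \<psi>] top by simp
    have 1: "(A * \<psi> y) $$ (i, l) = (\<Sum>k<n. A $$ (i, k) * \<psi> y $$ (k, l))" if "l < n" for l
      by (rule mat_mult_index[OF A px ij(1) that])
    have "(A * \<psi> y * C) $$ (i, j) = (\<Sum>l<n. (A * \<psi> y) $$ (i, l) * C $$ (l, j))"
      by (rule mat_mult_index[OF mult_carrier_mat[OF A px] C ij])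
    then show "(\<Sum>l<n. (\<Sum>k<n. A $$ (i, k) * \<psi> y $$ (k, l)) * C $$ (l, j)) = (A * \<psi> y * C) $$ (i, j)"
      using 1 by simp
  qed
qed

lemma subrep_cont_hom:
  fixes G (structure)
  assumes tg: "topological_group G T"
    and \<pi>: "\<pi> \<in> cont_hom G T (unitary_group n) (unitary_topology n)"
    and J: "invariant_isometry G n \<pi> m J"
  shows "(\<lambda>x. mat_adjoint J * \<pi> x * J) \<in> cont_hom G T (unitary_group m) (unitary_topology m)"
proof -
  interpret group G using tg by (simp add: topological_group_def)
  have gG: "group G" by (rule is_group)
  have top: "topspace T = carrier G" using tg by (simp add: topological_group_def)
  have Jc: "J \<in> carrier_mat n m" and iso: "mat_adjoint J * J = 1\<^sub>m m"
    and inter: "\<And>x. x \<in> carrier G \<Longrightarrow> \<pi> x * J = J * (mat_adjoint J * \<pi> x * J)"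
    using J by (auto simp: invariant_isometry_def)
  have Jd [simp]: "dim_row J = n" "dim_col J = m" using Jc by auto
  have mult: "mat_adjoint J * \<pi> (x \<otimes> y) * J = (mat_adjoint J * \<pi> x * J) * (mat_adjoint J * \<pi> y * J)"
    if xy: "x \<in> carrier G" "y \<in> carrier G" for x y
  proof -
    note d [simp] = rep_mat(2,3)[OF \<pi> xy(1)] rep_mat(2,3)[OF \<pi> xy(2)]
    have "mat_adjoint J * \<pi> (x \<otimes> y) * J = mat_adjoint J * (\<pi> x * (\<pi> y * J))"
      by (simp add: rep_mult[OF \<pi> xy] mat_assoc)
    also have "\<pi> y * J = J * (mat_adjoint J * \<pi> y * J)" by (rule inter[OF xy(2)])
    finally show ?thesis by (simp add: mat_assoc)
  qed
  have unit: "mat_adjoint J * \<pi> x * J \<in> carrier (unitary_group m)" if x: "x \<in> carrier G" for x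
  proof (rule unitaryI)
    note d [simp] = rep_mat(2,3)[OF \<pi> x]
    have x': "inv x \<in> carrier G" using x by simp
    note d' [simp] = rep_mat(2,3)[OF \<pi> x']
    show "mat_adjoint J * \<pi> x * J \<in> carrier_mat m m" by (rule carrier_matI) simp_all
    have "mat_adjoint (mat_adjoint J * \<pi> x * J) = mat_adjoint J * \<pi> (inv x) * J"
      by (simp add: mat_adjoint_mult' rep_adjoint[OF gG \<pi> x] mat_assoc)
    then have "(mat_adjoint J * \<pi> x * J) * mat_adjoint (mat_adjoint J * \<pi> x * J) = mat_adjoint J * \<pi> (x \<otimes> inv x) * J"
      by (simp only: mult[OF x x'])
    also have "\<dots> = 1\<^sub>m m" using x Jc iso by (simp add: rep_one[OF gG \<pi>] mat_adjoint_carrier)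
    finally show "(mat_adjoint J * \<pi> x * J) * mat_adjoint (mat_adjoint J * \<pi> x * J) = 1\<^sub>m m" .
  qed
  show ?thesis
    unfolding cont_hom_unitary_iff[OF top]
  proof (intro conjI ballI allI impI)
    fix i j assume ij: "i < m" "j < m"
    show "continuous_map T euclidean (\<lambda>x. (mat_adjoint J * \<pi> x * J) $$ (i, j))"
      by (rule rep_entry_continuous[OF top \<pi> mat_adjoint_carrier[OF Jc] Jc ij])
  qed (use unit mult in auto)
qed

text \<open>Complete reducibility, by induction on the dimension of a subrepresentation: unless it is irreducible,
  it splits into an invariant subspace and its orthogonal complement, which is invariant as well because
  the representation is unitary.\<close>

lemma trivial_on_irreducibles:
  fixes G (structure)
  assumes tg: "topological_group G T"
    and \<pi>: "\<pi> \<in> cont_hom G T (unitary_group n) (unitary_topology n)"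
    and P: "P \<in> carrier_mat n n"
    and triv: "\<And>m J. invariant_isometry G n \<pi> m J \<Longrightarrow>
      (m, \<lambda>x. mat_adjoint J * \<pi> x * J) \<in> irreps G T \<Longrightarrow> P * J = J"
  shows "P = 1\<^sub>m n"
proof -
  interpret group G using tg by (simp add: topological_group_def)
  have gG: "group G" by (rule is_group)
  have "P * J = J" if "invariant_isometry G n \<pi> m J" for m J
    using that
  proof (induction m arbitrary: J rule: less_induct)
    case (less m)
    let ?\<tau> = "\<lambda>x. mat_adjoint J * \<pi> x * J"
    have Jc: "J \<in> carrier_mat n m" and iso: "mat_adjoint J * J = 1\<^sub>m m"
      and inter: "\<And>x. x \<in> carrier G \<Longrightarrow> \<pi> x * J = J * ?\<tau> x"
      using less.prems by (auto simp: invariant_isometry_def)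
    have \<tau>: "?\<tau> \<in> cont_hom G T (unitary_group m) (unitary_topology m)"
      by (rule subrep_cont_hom[OF tg \<pi> less.prems])
    consider "m = 0" | "(m, ?\<tau>) \<in> irreps G T" | "1 \<le> m" "(m, ?\<tau>) \<notin> irreps G T"
      by (cases "m = 0") auto
    then show ?case
    proof cases
      case 1
      then show ?thesis using Jc P by (intro eq_matI) auto
    next
      case 2
      then show ?thesis by (rule triv[OF less.prems])
    next
      case 3
      then obtain W where W: "VectorSpace.subspace class_ring W (module_vec TYPE(complex) m)"
        and inv: "\<And>x w. x \<in> carrier G \<Longrightarrow> w \<in> W \<Longrightarrow> ?\<tau> x *\<^sub>v w \<in> W"
        and ne: "W \<noteq> {0\<^sub>v m}" "W \<noteq> carrier_vec m"
      proof -
        have "\<exists>W. VectorSpace.subspace class_ring W (module_vec TYPE(complex) m) \<and>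
            (\<forall>x\<in>carrier G. \<forall>w\<in>W. ?\<tau> x *\<^sub>v w \<in> W) \<and> \<not> (W = {0\<^sub>v m} \<or> W = carrier_vec m)"
          using 3 \<tau> by (simp add: irreps_def)
        then show thesis using that by blast
      qed
      obtain p q J1 J2 where pq: "p < m" "q < m"
        and J1: "J1 \<in> carrier_mat m p" "mat_adjoint J1 * J1 = 1\<^sub>m p"
        and J2: "J2 \<in> carrier_mat m q" "mat_adjoint J2 * J2 = 1\<^sub>m q"
        and sum: "J1 * mat_adjoint J1 + J2 * mat_adjoint J2 = 1\<^sub>m m" and zero: "mat_adjoint J1 * J2 = 0\<^sub>m p q"
        and J1W: "\<And>v. v \<in> carrier_vec p \<Longrightarrow> J1 *\<^sub>v v \<in> W"
        and WJ1: "\<And>w. w \<in> W \<Longrightarrow> J1 *\<^sub>v (mat_adjoint J1 *\<^sub>v w) = w"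
        by (rule orthogonal_splitting[OF W ne]) (rule that; assumption)
      note J1a = mat_adjoint_carrier[OF J1(1)] and J2a = mat_adjoint_carrier[OF J2(1)]
      have d [simp]: "dim_row J = n" "dim_col J = m" "dim_row J1 = m" "dim_col J1 = p" "dim_row J2 = m" "dim_col J2 = q"
        using Jc J1 J2 by auto
      have tc: "?\<tau> x \<in> carrier_mat m m" if "x \<in> carrier G" for x by (rule rep_mat(1)[OF \<tau> that])
      have inv1: "?\<tau> x * J1 = J1 * (mat_adjoint J1 * (?\<tau> x * J1))" if x: "x \<in> carrier G" for x
      proof (rule mat_eq_on_vecs[of _ m p])
        fix v :: "complex vec" assume v: "v \<in> carrier_vec p"
        have J1v: "J1 *\<^sub>v v \<in> carrier_vec m" using J1(1) v by simp
        have e: "(?\<tau> x * J1) *\<^sub>v v = ?\<tau> x *\<^sub>v (J1 *\<^sub>v v)" by (rule assoc_mult_mat_vec[OF tc[OF x] J1(1) v])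
        have "(?\<tau> x * J1) *\<^sub>v v \<in> W" unfolding e by (rule inv[OF x J1W[OF v]])
        then have "(?\<tau> x * J1) *\<^sub>v v = J1 *\<^sub>v (mat_adjoint J1 *\<^sub>v ((?\<tau> x * J1) *\<^sub>v v))" by (rule WJ1[symmetric])
        also have "\<dots> = J1 *\<^sub>v ((mat_adjoint J1 * (?\<tau> x * J1)) *\<^sub>v v)"
          by (simp only: assoc_mult_mat_vec[OF J1a mult_carrier_mat[OF tc[OF x] J1(1)] v])
        also have "\<dots> = (J1 * (mat_adjoint J1 * (?\<tau> x * J1))) *\<^sub>v v"
          by (rule assoc_mult_mat_vec[OF J1(1) mult_carrier_mat[OF J1a mult_carrier_mat[OF tc[OF x] J1(1)]] v, symmetric])
        finally show "(?\<tau> x * J1) *\<^sub>v v = (J1 * (mat_adjoint J1 * (?\<tau> x * J1))) *\<^sub>v v" .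
      qed (rule mult_carrier_mat[OF tc[OF x] J1(1)],
          rule mult_carrier_mat[OF J1(1) mult_carrier_mat[OF J1a mult_carrier_mat[OF tc[OF x] J1(1)]]])
      have inv2: "?\<tau> x * J2 = J2 * (mat_adjoint J2 * (?\<tau> x * J2))" if x: "x \<in> carrier G" for x
      proof -
        have x': "inv x \<in> carrier G" using x by simp
        note td [simp] = rep_mat(2,3)[OF \<tau> x] and td' [simp] = rep_mat(2,3)[OF \<tau> x']
        have "mat_adjoint (?\<tau> (inv x) * J1) = mat_adjoint (J1 * (mat_adjoint J1 * (?\<tau> (inv x) * J1)))"
          by (simp only: inv1[OF x', symmetric])
        then have "mat_adjoint J1 * ?\<tau> x = mat_adjoint (mat_adjoint J1 * (?\<tau> (inv x) * J1)) * mat_adjoint J1"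
          using rep_adjoint[OF gG \<tau> x'] x by (simp only: mat_adjoint_mult' td td' d mat_adjoint_dim inv_inv index_mult_mat(2,3))
        then have "mat_adjoint J1 * ?\<tau> x * J2 = mat_adjoint (mat_adjoint J1 * (?\<tau> (inv x) * J1)) * (mat_adjoint J1 * J2)"
          by (simp only: mat_assoc td td' d mat_adjoint_dim index_mult_mat(2,3))
        also have "\<dots> = 0\<^sub>m p q" unfolding zero by (intro right_mult_zero_mat) (rule carrier_matI, simp_all)
        finally have z: "mat_adjoint J1 * (?\<tau> x * J2) = 0\<^sub>m p q"
          by (simp only: mat_assoc td d mat_adjoint_dim index_mult_mat(2,3))
        have tJ: "?\<tau> x * J2 \<in> carrier_mat m q" by (rule mult_carrier_mat[OF tc[OF x] J2(1)])
        have "?\<tau> x * J2 = (J1 * mat_adjoint J1 + J2 * mat_adjoint J2) * (?\<tau> x * J2)" unfolding sum using tJ by simp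
        also have "\<dots> = J1 * mat_adjoint J1 * (?\<tau> x * J2) + J2 * mat_adjoint J2 * (?\<tau> x * J2)"
          by (rule add_mult_distrib_mat[OF mult_carrier_mat[OF J1(1) J1a] mult_carrier_mat[OF J2(1) J2a] tJ])
        also have "J1 * mat_adjoint J1 * (?\<tau> x * J2) = J1 * (mat_adjoint J1 * (?\<tau> x * J2))"
          by (rule assoc_mult_mat[OF J1(1) J1a tJ])
        also have "\<dots> = 0\<^sub>m m q" unfolding z by (rule right_mult_zero_mat[OF J1(1)])
        also have "J2 * mat_adjoint J2 * (?\<tau> x * J2) = J2 * (mat_adjoint J2 * (?\<tau> x * J2))"
          by (rule assoc_mult_mat[OF J2(1) J2a tJ])
        finally show ?thesis
          using left_add_zero_mat[OF mult_carrier_mat[OF J2(1) mult_carrier_mat[OF J2a tJ]]] by simp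
      qed
      have sub: "invariant_isometry G n \<pi> k (J * K)"
        if K: "K \<in> carrier_mat m k" "mat_adjoint K * K = 1\<^sub>m k"
          and Kinv: "\<And>x. x \<in> carrier G \<Longrightarrow> ?\<tau> x * K = K * (mat_adjoint K * (?\<tau> x * K))" for k K
        unfolding invariant_isometry_def
      proof (intro conjI ballI)
        have Kd [simp]: "dim_row K = m" "dim_col K = k" using K by auto
        note Ka = mat_adjoint_carrier[OF K(1)]
        show "J * K \<in> carrier_mat n k" using Jc K(1) by simp
        have "mat_adjoint (J * K) * (J * K) = mat_adjoint K * ((mat_adjoint J * J) * K)"
          by (simp add: mat_adjoint_mult' mat_assoc)
        also have "\<dots> = 1\<^sub>m k" unfolding iso using K by simp
        finally show "mat_adjoint (J * K) * (J * K) = 1\<^sub>m k" .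
        fix x assume x: "x \<in> carrier G"
        note pd [simp] = rep_mat(2,3)[OF \<pi> x]
        have "\<pi> x * (J * K) = (\<pi> x * J) * K" by (simp add: mat_assoc)
        also have "\<dots> = J * (?\<tau> x * K)" unfolding inter[OF x] by (simp add: mat_assoc)
        also have "\<dots> = J * (K * (mat_adjoint K * (?\<tau> x * K)))" by (simp only: Kinv[OF x, symmetric])
        finally show "\<pi> x * (J * K) = J * K * (mat_adjoint (J * K) * \<pi> x * (J * K))"
          by (simp add: mat_adjoint_mult' mat_assoc)
      qed
      have 1: "P * (J * J1) = J * J1" by (rule less.IH[OF pq(1) sub[OF J1 inv1]])
      have 2: "P * (J * J2) = J * J2" by (rule less.IH[OF pq(2) sub[OF J2 inv2]])
      have Pd [simp]: "dim_row P = n" "dim_col P = n" using P by auto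
      have JJ: "J = J * J1 * mat_adjoint J1 + J * J2 * mat_adjoint J2"
      proof -
        have "J = J * (J1 * mat_adjoint J1 + J2 * mat_adjoint J2)"
          unfolding sum by (rule right_mult_one_mat[OF Jc, symmetric])
        also have "\<dots> = J * (J1 * mat_adjoint J1) + J * (J2 * mat_adjoint J2)"
          by (rule mult_add_distrib_mat[OF Jc mult_carrier_mat[OF J1(1) J1a] mult_carrier_mat[OF J2(1) J2a]])
        also have "\<dots> = J * J1 * mat_adjoint J1 + J * J2 * mat_adjoint J2"
          by (simp only: assoc_mult_mat[OF Jc J1(1) J1a] assoc_mult_mat[OF Jc J2(1) J2a])
        finally show ?thesis .
      qed
      have "P * J = P * (J * J1 * mat_adjoint J1 + J * J2 * mat_adjoint J2)" by (simp only: JJ[symmetric])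
      also have "\<dots> = P * (J * J1 * mat_adjoint J1) + P * (J * J2 * mat_adjoint J2)"
        by (rule mult_add_distrib_mat[OF P mult_carrier_mat[OF mult_carrier_mat[OF Jc J1(1)] J1a]
              mult_carrier_mat[OF mult_carrier_mat[OF Jc J2(1)] J2a]])
      also have "\<dots> = P * (J * J1) * mat_adjoint J1 + P * (J * J2) * mat_adjoint J2"
        by (simp only: assoc_mult_mat[OF P mult_carrier_mat[OF Jc J1(1)] J1a]
            assoc_mult_mat[OF P mult_carrier_mat[OF Jc J2(1)] J2a])
      also have "\<dots> = J" unfolding 1 2 by (rule JJ[symmetric])
      finally show ?thesis .
    qed
  qed
  moreover have "invariant_isometry G n \<pi> n (1\<^sub>m n)"
  proof -
    have "mat_adjoint (1\<^sub>m n) = (1\<^sub>m n :: complex mat)" by (rule eq_matI) simp_all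
    then show ?thesis using rep_mat[OF \<pi>] by (simp add: invariant_isometry_def)
  qed
  ultimately have "P * 1\<^sub>m n = 1\<^sub>m n" by blast
  then show ?thesis using P by simp
qed

section \<open>The action on the finite dimensional dual of a normal subgroup\<close>

lemma trace_cyclic:
  fixes A B :: "complex mat"
  assumes A: "A \<in> carrier_mat n m" and B: "B \<in> carrier_mat m n"
  shows "(\<Sum>i<n. (A * B) $$ (i, i)) = (\<Sum>j<m. (B * A) $$ (j, j))"
proof -
  have "(\<Sum>i<n. (A * B) $$ (i, i)) = (\<Sum>i<n. \<Sum>j<m. A $$ (i, j) * B $$ (j, i))"
    by (intro sum.cong refl mat_mult_index[OF A B]) auto
  also have "\<dots> = (\<Sum>j<m. \<Sum>i<n. A $$ (i, j) * B $$ (j, i))" by (rule sum.swap)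
  also have "\<dots> = (\<Sum>j<m. \<Sum>i<n. B $$ (j, i) * A $$ (i, j))" by (simp only: mult.commute)
  also have "\<dots> = (\<Sum>j<m. (B * A) $$ (j, j))"
    by (intro sum.cong refl mat_mult_index[OF B A, symmetric]) auto
  finally show ?thesis .
qed

text \<open>The real part of the character. It attains the value \<open>n\<close> only where \<open>\<sigma>\<close> is the identity matrix.\<close>

definition rchar :: "nat \<Rightarrow> ('g \<Rightarrow> complex mat) \<Rightarrow> 'g \<Rightarrow> real" where
  "rchar n \<sigma> x = (\<Sum>i<n. Re (\<sigma> x $$ (i, i)))"

lemma rchar_Re_trace: "rchar n \<sigma> x = Re (\<Sum>i<n. \<sigma> x $$ (i, i))"
  by (simp add: rchar_def)

lemma rchar_unitary_equiv:
  assumes eq: "((n, \<sigma>), (m, \<tau>)) \<in> unitary_equiv G T" and x: "x \<in> carrier G"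
  shows "m = n" "rchar m \<tau> x = rchar n \<sigma> x"
proof -
  from eq obtain U where mn: "m = n" and U: "U \<in> carrier (unitary_group n)"
    and \<tau>: "\<tau> x = U * \<sigma> x * mat_adjoint U" and \<sigma>: "\<sigma> \<in> cont_hom G T (unitary_group n) (unitary_topology n)"
    using x by (auto simp: unitary_equiv_def irreps_def)
  show "m = n" by (rule mn)
  note Uc = unitary_carrier[OF U]
  note sc = rep_mat(1)[OF \<sigma> x]
  note Ua = mat_adjoint_carrier[OF Uc]
  have "(\<Sum>i<n. \<tau> x $$ (i, i)) = (\<Sum>i<n. (mat_adjoint U * (U * \<sigma> x)) $$ (i, i))"
    unfolding \<tau> by (rule trace_cyclic[OF mult_carrier_mat[OF Uc sc] Ua])
  also have "mat_adjoint U * (U * \<sigma> x) = mat_adjoint U * U * \<sigma> x"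
    by (rule assoc_mult_mat[OF Ua Uc sc, symmetric])
  also have "\<dots> = \<sigma> x" unfolding unitary_adjoint(2)[OF U] by (rule left_mult_one_mat[OF sc])
  finally show "rchar m \<tau> x = rchar n \<sigma> x" unfolding rchar_Re_trace mn by simp
qed

lemma rchar_conj:
  assumes gG: "group G" and \<sigma>: "\<sigma> \<in> cont_hom G T (unitary_group n) (unitary_topology n)"
    and x: "x \<in> carrier G" and y: "y \<in> carrier G"
  shows "rchar n \<sigma> (x \<otimes>\<^bsub>G\<^esub> y \<otimes>\<^bsub>G\<^esub> inv\<^bsub>G\<^esub> x) = rchar n \<sigma> y"
proof -
  interpret group G by (rule gG)
  have x': "inv\<^bsub>G\<^esub> x \<in> carrier G" using x by simp
  note sx = rep_mat(1)[OF \<sigma> x] and sy = rep_mat(1)[OF \<sigma> y] and sx' = rep_mat(1)[OF \<sigma> x']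
  have "(\<Sum>i<n. \<sigma> (x \<otimes>\<^bsub>G\<^esub> y \<otimes>\<^bsub>G\<^esub> inv\<^bsub>G\<^esub> x) $$ (i, i)) = (\<Sum>i<n. (\<sigma> x * \<sigma> y * \<sigma> (inv\<^bsub>G\<^esub> x)) $$ (i, i))"
    by (simp only: rep_mult[OF \<sigma> m_closed[OF x y] x'] rep_mult[OF \<sigma> x y])
  also have "\<dots> = (\<Sum>i<n. (\<sigma> (inv\<^bsub>G\<^esub> x) * (\<sigma> x * \<sigma> y)) $$ (i, i))"
    by (rule trace_cyclic[OF mult_carrier_mat[OF sx sy] sx'])
  also have "\<sigma> (inv\<^bsub>G\<^esub> x) * (\<sigma> x * \<sigma> y) = \<sigma> (inv\<^bsub>G\<^esub> x \<otimes>\<^bsub>G\<^esub> (x \<otimes>\<^bsub>G\<^esub> y))"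
    by (simp only: rep_mult[OF \<sigma> x' m_closed[OF x y]] rep_mult[OF \<sigma> x y])
  also have "inv\<^bsub>G\<^esub> x \<otimes>\<^bsub>G\<^esub> (x \<otimes>\<^bsub>G\<^esub> y) = y" using x y by (simp flip: m_assoc)
  finally show ?thesis unfolding rchar_Re_trace by simp
qed

lemma unitary_equiv_subset: "unitary_equiv G T \<subseteq> irreps G T \<times> irreps G T"
  by (auto simp: unitary_equiv_def)

lemma equiv_unitary_equiv:
  "equiv (irreps G T) (unitary_equiv G T)"
proof (rule equivI)
  show "unitary_equiv G T \<subseteq> irreps G T \<times> irreps G T" by (rule unitary_equiv_subset)
  show "refl_on (irreps G T) (unitary_equiv G T)"
  proof (rule refl_onI)
    fix s assume s: "s \<in> irreps G T"
    obtain n \<sigma> where s_eq: "s = (n, \<sigma>)" by force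
    have \<sigma>: "\<sigma> \<in> cont_hom G T (unitary_group n) (unitary_topology n)" using s by (auto simp: s_eq irreps_def)
    have 1: "mat_adjoint (1\<^sub>m n) = (1\<^sub>m n :: complex mat)" by (rule eq_matI) simp_all
    have "1\<^sub>m n \<in> carrier (unitary_group n)" by (rule unitaryI) (simp_all add: 1)
    moreover have "\<sigma> x = 1\<^sub>m n * \<sigma> x * mat_adjoint (1\<^sub>m n)" if "x \<in> carrier G" for x
      using rep_mat(1)[OF \<sigma> that] by (simp add: 1)
    ultimately show "(s, s) \<in> unitary_equiv G T" using s unfolding s_eq unitary_equiv_def by blast
  qed
  show "sym (unitary_equiv G T)"
  proof (rule symI)
    fix s t assume st: "(s, t) \<in> unitary_equiv G T"
    obtain n \<sigma> where s_eq: "s = (n, \<sigma>)" by force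
    obtain m \<tau> where t_eq: "t = (m, \<tau>)" by force
    from st obtain U where s: "(n, \<sigma>) \<in> irreps G T" and t: "(n, \<tau>) \<in> irreps G T" and mn: "m = n"
      and U: "U \<in> carrier (unitary_group n)" and eq: "\<And>x. x \<in> carrier G \<Longrightarrow> \<tau> x = U * \<sigma> x * mat_adjoint U"
      unfolding s_eq t_eq unitary_equiv_def by blast
    have \<sigma>: "\<sigma> \<in> cont_hom G T (unitary_group n) (unitary_topology n)" using s by (auto simp: irreps_def)
    note Uc = unitary_carrier[OF U]
    note Ua = mat_adjoint_carrier[OF Uc]
    have "\<sigma> x = mat_adjoint U * \<tau> x * mat_adjoint (mat_adjoint U)" if x: "x \<in> carrier G" for x
    proof -
      have d: "dim_row U = n" "dim_col U = n" using Uc by auto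
      note sd = rep_mat(2,3)[OF \<sigma> x]
      note sc = rep_mat(1)[OF \<sigma> x]
      have "mat_adjoint U * \<tau> x * mat_adjoint (mat_adjoint U) = (mat_adjoint U * U) * \<sigma> x * (mat_adjoint U * U)"
        unfolding eq[OF x] by (simp add: mat_assoc d sd)
      then show ?thesis unfolding unitary_adjoint(2)[OF U] using sc by simp
    qed
    then show "(t, s) \<in> unitary_equiv G T"
      using s t mn unitary_adjoint_closed[OF U] unfolding s_eq t_eq unitary_equiv_def by blast
  qed
  show "trans (unitary_equiv G T)"
  proof (rule transI)
    fix r s t assume rs: "(r, s) \<in> unitary_equiv G T" and st: "(s, t) \<in> unitary_equiv G T"
    obtain l \<rho> where r_eq: "r = (l, \<rho>)" by force
    obtain n \<sigma> where s_eq: "s = (n, \<sigma>)" by force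
    obtain m \<tau> where t_eq: "t = (m, \<tau>)" by force
    from rs obtain V where r: "(n, \<rho>) \<in> irreps G T" and ln: "l = n"
      and V: "V \<in> carrier (unitary_group n)" and eqV: "\<And>x. x \<in> carrier G \<Longrightarrow> \<sigma> x = V * \<rho> x * mat_adjoint V"
      unfolding s_eq r_eq unitary_equiv_def by blast
    from st obtain U where t: "(n, \<tau>) \<in> irreps G T" and mn: "m = n"
      and U: "U \<in> carrier (unitary_group n)" and eqU: "\<And>x. x \<in> carrier G \<Longrightarrow> \<tau> x = U * \<sigma> x * mat_adjoint U"
      unfolding s_eq t_eq unitary_equiv_def by blast
    have \<rho>: "\<rho> \<in> cont_hom G T (unitary_group n) (unitary_topology n)" using r by (auto simp: irreps_def)
    have d: "dim_row U = n" "dim_col U = n" "dim_row V = n" "dim_col V = n"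
      using unitary_carrier[OF U] unitary_carrier[OF V] by auto
    have "\<tau> x = U * V * \<rho> x * mat_adjoint (U * V)" if x: "x \<in> carrier G" for x
      unfolding eqU[OF x] eqV[OF x] by (simp add: mat_assoc mat_adjoint_mult' d rep_mat(2,3)[OF \<rho> x])
    then show "(r, t) \<in> unitary_equiv G T"
      using r t mn ln unitary_closed[OF U V] unfolding r_eq t_eq unitary_equiv_def by blast
  qed
qed

locale normal_topological_subgroup =
  fixes G :: "('g, 'm) monoid_scheme" (structure) and T :: "'g topology" and N :: "'g set"
  assumes topological_group: "topological_group G T" and normal: "N \<lhd> G"
begin

sublocale group G using topological_group by (simp add: topological_group_def)

abbreviation GN where "GN \<equiv> G\<lparr>carrier := N\<rparr>"
abbreviation TN where "TN \<equiv> subtopology T N"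
abbreviation Eq where "Eq \<equiv> unitary_equiv GN TN"

lemma top [simp]: "topspace T = carrier G"
  using topological_group by (simp add: topological_group_def)

lemma N_subgroup: "subgroup N G" using normal by (rule normal_imp_subgroup)

lemma N_carrier: "x \<in> N \<Longrightarrow> x \<in> carrier G" using N_subgroup by (auto dest: subgroup.subset)

lemma group_GN: "group GN" by (rule subgroup.subgroup_is_group[OF N_subgroup is_group])

lemma tg_GN: "topological_group GN TN" by (rule topological_group_subgroup[OF topological_group N_subgroup])

lemma inv_GN: "x \<in> N \<Longrightarrow> inv\<^bsub>GN\<^esub> x = inv x" by (rule m_inv_consistent[OF N_subgroup])

lemma topspace_TN [simp]: "topspace TN = N" using N_carrier by auto

lemma conj_closed: "h \<in> carrier G \<Longrightarrow> x \<in> N \<Longrightarrow> h \<otimes> x \<otimes> inv h \<in> N"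
  using normal by (simp add: normal.inv_op_closed2)

lemma conj_closed': "h \<in> carrier G \<Longrightarrow> x \<in> N \<Longrightarrow> inv h \<otimes> x \<otimes> h \<in> N"
  using normal by (simp add: normal.inv_op_closed1)

lemma rep_restrict:
  assumes "\<pi> \<in> cont_hom G T (unitary_group n) (unitary_topology n)"
  shows "\<pi> \<in> cont_hom GN TN (unitary_group n) (unitary_topology n)"
  using assms N_carrier by (auto simp: cont_hom_def hom_def continuous_map_from_subtopology)

lemma continuous_conj:
  assumes h: "h \<in> carrier G" shows "continuous_map TN TN (\<lambda>x. inv h \<otimes> x \<otimes> h)"
proof -
  have mc: "continuous_map (prod_topology T T) T (\<lambda>(x, y). x \<otimes> y)"
    using topological_group by (simp add: topological_group_def)
  have "continuous_map T (prod_topology T T) (\<lambda>x. (inv h, x))"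
    using h by (intro continuous_map_pairedI) auto
  from continuous_map_compose[OF this mc] have 1: "continuous_map T T (\<lambda>x. inv h \<otimes> x)" by (simp add: comp_def)
  have "continuous_map T (prod_topology T T) (\<lambda>x. (x, h))"
    using h by (intro continuous_map_pairedI) auto
  from continuous_map_compose[OF 1 continuous_map_compose[OF this mc]]
  have "continuous_map T T (\<lambda>x. inv h \<otimes> x \<otimes> h)" by (simp add: comp_def)
  then show ?thesis
    using conj_closed'[OF h] N_carrier
    by (auto simp: continuous_map_in_subtopology continuous_map_from_subtopology)
qed

lemma conj_rep_cont_hom:
  assumes h: "h \<in> carrier G" and \<sigma>: "\<sigma> \<in> cont_hom GN TN (unitary_group n) (unitary_topology n)"
  shows "(\<lambda>x. \<sigma> (inv h \<otimes> x \<otimes> h)) \<in> cont_hom GN TN (unitary_group n) (unitary_topology n)"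
proof -
  have "\<sigma> (inv h \<otimes> (x \<otimes> y) \<otimes> h) = \<sigma> (inv h \<otimes> x \<otimes> h) * \<sigma> (inv h \<otimes> y \<otimes> h)" if xy: "x \<in> N" "y \<in> N" for x y
  proof -
    note c = N_carrier[OF xy(1)] N_carrier[OF xy(2)]
    have "h \<otimes> (inv h \<otimes> y) = y" using h c by (simp flip: m_assoc)
    then have "inv h \<otimes> (x \<otimes> y) \<otimes> h = (inv h \<otimes> x \<otimes> h) \<otimes> (inv h \<otimes> y \<otimes> h)"
      using h c by (simp add: m_assoc) (metis h c inv_closed m_assoc m_closed)
    then show ?thesis
      using rep_mult[OF \<sigma>, of "inv h \<otimes> x \<otimes> h" "inv h \<otimes> y \<otimes> h"] conj_closed'[OF h] xy by simp
  qed
  moreover have "continuous_map TN (unitary_topology n) (\<lambda>x. \<sigma> (inv h \<otimes> x \<otimes> h))"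
    using continuous_map_compose[OF continuous_conj[OF h], of "unitary_topology n" \<sigma>] \<sigma>
    by (simp add: cont_hom_def comp_def)
  moreover have "\<sigma> (inv h \<otimes> x \<otimes> h) \<in> carrier (unitary_group n)" if "x \<in> N" for x
    using rep_carrier[OF \<sigma>] conj_closed'[OF h that] by simp
  ultimately show ?thesis by (simp add: cont_hom_def hom_def)
qed

lemma conj_rep_irreps:
  assumes h: "h \<in> carrier G" and s: "s \<in> irreps GN TN"
  shows "conj_rep G h s \<in> irreps GN TN"
proof -
  obtain n \<sigma> where s_eq: "s = (n, \<sigma>)" by force
  have n: "1 \<le> n" and \<sigma>: "\<sigma> \<in> cont_hom GN TN (unitary_group n) (unitary_topology n)"
    and simple: "\<And>W. VectorSpace.subspace class_ring W (module_vec TYPE(complex) n) \<Longrightarrow>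
      (\<forall>x\<in>N. \<forall>w\<in>W. \<sigma> x *\<^sub>v w \<in> W) \<Longrightarrow> W = {0\<^sub>v n} \<or> W = carrier_vec n"
    using s by (auto simp: s_eq irreps_def)
  have "W = {0\<^sub>v n} \<or> W = carrier_vec n"
    if W: "VectorSpace.subspace class_ring W (module_vec TYPE(complex) n)"
      and inv: "\<forall>x\<in>N. \<forall>w\<in>W. \<sigma> (inv h \<otimes> x \<otimes> h) *\<^sub>v w \<in> W" for W
  proof (rule simple[OF W], intro ballI)
    fix x w assume x: "x \<in> N" and w: "w \<in> W"
    have "inv h \<otimes> (h \<otimes> x \<otimes> inv h) \<otimes> h = x"
      using h N_carrier[OF x] by (simp add: m_assoc) (simp flip: m_assoc)
    then show "\<sigma> x *\<^sub>v w \<in> W" using inv conj_closed[OF h x] w by fastforce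
  qed
  then show ?thesis using n conj_rep_cont_hom[OF h \<sigma>] by (simp add: s_eq conj_rep_def irreps_def)
qed

lemma conj_rep_equiv:
  assumes h: "h \<in> carrier G" and st: "(s, t) \<in> Eq"
  shows "(conj_rep G h s, conj_rep G h t) \<in> Eq"
proof -
  obtain n \<sigma> where s_eq: "s = (n, \<sigma>)" by force
  obtain m \<tau> where t_eq: "t = (m, \<tau>)" by force
  from st have irr: "s \<in> irreps GN TN" "t \<in> irreps GN TN" using unitary_equiv_subset by blast+
  from st obtain U where U: "m = n" "U \<in> carrier (unitary_group n)"
    "\<And>x. x \<in> N \<Longrightarrow> \<tau> x = U * \<sigma> x * mat_adjoint U"
    by (auto simp: s_eq t_eq unitary_equiv_def)
  then have "\<forall>x\<in>N. \<tau> (inv h \<otimes> x \<otimes> h) = U * \<sigma> (inv h \<otimes> x \<otimes> h) * mat_adjoint U"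
    using conj_closed'[OF h] by blast
  then show ?thesis
    using U(1,2) conj_rep_irreps[OF h irr(1)] conj_rep_irreps[OF h irr(2)]
    unfolding s_eq t_eq conj_rep_def unitary_equiv_def by auto
qed

lemma dual_act_class:
  assumes h: "h \<in> carrier G" and s: "s \<in> irreps GN TN"
  shows "dual_act G T N h (Eq `` {s}) = Eq `` {conj_rep G h s}"
proof -
  note equiv = equiv_unitary_equiv[of GN TN]
  have "(s, s) \<in> Eq" using equiv s by (meson equiv_class_self Image_singleton_iff)
  then have "dual_act G T N h (Eq `` {s}) \<supseteq> Eq `` {conj_rep G h s}" by (auto simp: dual_act_def)
  moreover have "r \<in> Eq `` {conj_rep G h s}" if "r \<in> dual_act G T N h (Eq `` {s})" for r
  proof -
    from that obtain t where t: "(s, t) \<in> Eq" "(conj_rep G h t, r) \<in> Eq" by (auto simp: dual_act_def)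
    have "trans Eq" using equiv by (auto simp: equiv_def)
    then show ?thesis using conj_rep_equiv[OF h t(1)] t(2) by (auto dest: transD)
  qed
  ultimately show ?thesis by blast
qed

text \<open>Let \<open>J\<close> embed an irreducible representation of \<open>N\<close> into the restriction of a representation \<open>\<pi>\<close>
  of \<open>G\<close>. Then \<open>\<pi> h J\<close> embeds its conjugate by \<open>h\<close>. By Schur's lemma, inequivalent conjugates have
  orthogonal ranges, and the ambient dimension bounds the number of them.\<close>

lemma finite_orbit_of_subrep:
  assumes \<pi>: "\<pi> \<in> cont_hom G T (unitary_group n) (unitary_topology n)"
    and J: "invariant_isometry GN n \<pi> m J"
    and irr: "(m, \<lambda>x. mat_adjoint J * \<pi> x * J) \<in> irreps GN TN" (is "(m, ?\<tau>) \<in> _")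
    and H: "H \<subseteq> carrier G"
  shows "finite ((\<lambda>h. Eq `` {conj_rep G h (m, ?\<tau>)}) ` H)"
proof (rule ccontr)
  let ?c = "\<lambda>h. Eq `` {conj_rep G h (m, ?\<tau>)}"
  assume "infinite (?c ` H)"
  then obtain F where F: "F \<subseteq> ?c ` H" "finite F" "card F = Suc (2 * n)"
    using infinite_arbitrarily_large by blast
  obtain e where e: "bij_betw e {0..<Suc (2 * n)} F" using ex_bij_betw_nat_finite[OF F(2)] F(3) by auto
  have "\<exists>h\<in>H. e i = ?c h" if "i < Suc (2 * n)" for i
    using e F(1) that by (force simp: bij_betw_def)
  then obtain h where h: "\<And>i. i < Suc (2 * n) \<Longrightarrow> h i \<in> H" "\<And>i. i < Suc (2 * n) \<Longrightarrow> e i = ?c (h i)"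
    by metis
  have inj: "i = j" if "i < Suc (2 * n)" "j < Suc (2 * n)" "?c (h i) = ?c (h j)" for i j
    using e h(2) that by (auto simp: bij_betw_def inj_on_def)
  have Jc: "J \<in> carrier_mat n m" and iso: "mat_adjoint J * J = 1\<^sub>m m"
    and inter: "\<And>x. x \<in> N \<Longrightarrow> \<pi> x * J = J * ?\<tau> x"
    using J by (auto simp: invariant_isometry_def)
  have m: "0 < m" and \<tau>: "?\<tau> \<in> cont_hom GN TN (unitary_group m) (unitary_topology m)"
    using irr by (auto simp: irreps_def)
  define \<tau>' where "\<tau>' g x = ?\<tau> (inv g \<otimes> x \<otimes> g)" for g x
  have Jd [simp]: "dim_row J = n" "dim_col J = m" using Jc by auto
  have \<pi>h: "\<pi> g \<in> carrier_mat n n" "dim_row (\<pi> g) = n" "dim_col (\<pi> g) = n" if "g \<in> carrier G" for g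
    by (rule rep_mat[OF \<pi> that])+
  have inter': "\<pi> x * (\<pi> g * J) = (\<pi> g * J) * \<tau>' g x" if g: "g \<in> carrier G" and x: "x \<in> N" for g x
  proof -
    note xc = N_carrier[OF x] and x' = conj_closed'[OF g x]
    have eq: "x \<otimes> g = g \<otimes> (inv g \<otimes> x \<otimes> g)" using g xc by (simp flip: m_assoc)
    have "\<pi> x * (\<pi> g * J) = \<pi> (x \<otimes> g) * J"
      by (simp add: rep_mult[OF \<pi> xc g] mat_assoc \<pi>h g xc)
    also have "\<dots> = \<pi> g * (\<pi> (inv g \<otimes> x \<otimes> g) * J)"
      unfolding eq rep_mult[OF \<pi> g N_carrier[OF x']]
      by (rule mat_assoc) (simp_all add: \<pi>h g N_carrier[OF x'])
    also have "\<dots> = \<pi> g * (J * \<tau>' g x)" unfolding inter[OF x'] \<tau>'_def ..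
    also have "\<dots> = (\<pi> g * J) * \<tau>' g x"
      by (rule mat_assoc[symmetric]) (simp_all add: \<pi>h g \<tau>'_def)
    finally show ?thesis .
  qed
  have \<tau>'irr: "(m, \<tau>' g) \<in> irreps GN TN" if "g \<in> carrier G" for g
    using conj_rep_irreps[OF that irr] by (simp add: conj_rep_def \<tau>'_def[abs_def])
  have \<tau>'c: "\<tau>' g \<in> cont_hom GN TN (unitary_group m) (unitary_topology m)" if "g \<in> carrier G" for g
    using \<tau>'irr[OF that] by (simp add: irreps_def)
  have orth: "mat_adjoint (\<pi> (h i) * J) * (\<pi> (h j) * J) = 0\<^sub>m m m"
    if ij: "i < Suc (2 * n)" "j < Suc (2 * n)" "i \<noteq> j" for i j
  proof (rule ccontr)
    let ?A = "mat_adjoint (\<pi> (h i) * J) * (\<pi> (h j) * J)"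
    assume ne: "?A \<noteq> 0\<^sub>m m m"
    have hc: "h i \<in> carrier G" "h j \<in> carrier G" using h(1) ij H by blast+
    have Ki: "\<pi> (h i) * J \<in> carrier_mat n m" and Kj: "\<pi> (h j) * J \<in> carrier_mat n m"
      using mult_carrier_mat[OF \<pi>h(1) Jc] hc by blast+
    note Kia = mat_adjoint_carrier[OF Ki]
    have "?A * \<tau>' (h j) x = \<tau>' (h i) x * ?A" if x: "x \<in> carrier GN" for x
    proof -
      from x have xN: "x \<in> N" by simp
      note xc = N_carrier[OF xN]
      have x'N: "inv x \<in> N" using xN N_subgroup by (simp add: subgroup.m_inv_closed)
      have tj: "\<tau>' (h j) x \<in> carrier_mat m m" and ti: "\<tau>' (h i) x \<in> carrier_mat m m"
        and ti': "\<tau>' (h i) (inv x) \<in> carrier_mat m m"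
        using rep_mat(1)[OF \<tau>'c[OF hc(2)]] rep_mat(1)[OF \<tau>'c[OF hc(1)]] xN x'N by simp_all
      note px = \<pi>h(1)[OF xc]
      have "mat_adjoint (\<pi> (inv x) * (\<pi> (h i) * J)) = mat_adjoint ((\<pi> (h i) * J) * \<tau>' (h i) (inv x))"
        by (simp only: inter'[OF hc(1) x'N])
      then have "mat_adjoint (\<pi> (h i) * J) * mat_adjoint (\<pi> (inv x)) = mat_adjoint (\<tau>' (h i) (inv x)) * mat_adjoint (\<pi> (h i) * J)"
        by (simp only: mat_adjoint_mult[OF \<pi>h(1)[OF inv_closed[OF xc]] Ki] mat_adjoint_mult[OF Ki ti'])
      moreover have "mat_adjoint (\<pi> (inv x)) = \<pi> x"
        using rep_adjoint[OF is_group \<pi> inv_closed[OF xc]] xc by simp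
      moreover have "mat_adjoint (\<tau>' (h i) (inv x)) = \<tau>' (h i) x"
        using rep_adjoint[OF group_GN \<tau>'c[OF hc(1)], of "inv x"] x'N xc by (simp add: inv_GN)
      ultimately have adj: "mat_adjoint (\<pi> (h i) * J) * \<pi> x = \<tau>' (h i) x * mat_adjoint (\<pi> (h i) * J)" by simp
      have "?A * \<tau>' (h j) x = mat_adjoint (\<pi> (h i) * J) * (\<pi> x * (\<pi> (h j) * J))"
        unfolding inter'[OF hc(2) xN] by (rule assoc_mult_mat[OF Kia Kj tj])
      also have "\<dots> = mat_adjoint (\<pi> (h i) * J) * \<pi> x * (\<pi> (h j) * J)"
        by (rule assoc_mult_mat[OF Kia px Kj, symmetric])
      also have "\<dots> = \<tau>' (h i) x * ?A" unfolding adj by (rule assoc_mult_mat[OF ti Kia Kj])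
      finally show ?thesis .
    qed
    then have "((m, \<tau>' (h j)), (m, \<tau>' (h i))) \<in> Eq"
      using Schur_unitary_equiv[OF group_GN \<tau>'irr[OF hc(2)] \<tau>'irr[OF hc(1)] mult_carrier_mat[OF Kia Kj] ne] by blast
    then have "?c (h j) = ?c (h i)"
      using equiv_class_eq[OF equiv_unitary_equiv] by (simp add: conj_rep_def \<tau>'_def[abs_def])
    with inj ij show False by metis
  qed
  have norm: "mat_adjoint (\<pi> (h i) * J) * (\<pi> (h i) * J) = 1\<^sub>m m" if i: "i < Suc (2 * n)" for i
  proof -
    have hc: "h i \<in> carrier G" using h(1)[OF i] H by blast
    have "mat_adjoint (\<pi> (h i) * J) * (\<pi> (h i) * J) = mat_adjoint J * (mat_adjoint (\<pi> (h i)) * \<pi> (h i)) * J"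
      by (simp add: mat_adjoint_mult' mat_assoc \<pi>h[OF hc])
    then show ?thesis
      unfolding unitary_adjoint(2)[OF rep_carrier[OF \<pi> hc]]
      using right_mult_one_mat[OF mat_adjoint_carrier[OF Jc]] iso by simp
  qed
  (* One column of each embedding: too many orthonormal vectors. *)
  define Q where "Q = mat n (Suc (2 * n)) (\<lambda>(k, i). (\<pi> (h i) * J) $$ (k, 0))"
  have Qc: "Q \<in> carrier_mat n (Suc (2 * n))" by (simp add: Q_def)
  have "mat_adjoint Q * Q = 1\<^sub>m (Suc (2 * n))"
  proof (rule eq_matI)
    fix i j assume "i < dim_row (1\<^sub>m (Suc (2 * n)) :: complex mat)" "j < dim_col (1\<^sub>m (Suc (2 * n)) :: complex mat)"
    then have ij: "i < Suc (2 * n)" "j < Suc (2 * n)" by simp_all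
    have hc: "h i \<in> carrier G" "h j \<in> carrier G" using h(1) ij H by blast+
    have Ki: "\<pi> (h i) * J \<in> carrier_mat n m" and Kj: "\<pi> (h j) * J \<in> carrier_mat n m"
      using mult_carrier_mat[OF \<pi>h(1) Jc] hc by blast+
    have "(mat_adjoint Q * Q) $$ (i, j) = (\<Sum>k<n. cnj ((\<pi> (h i) * J) $$ (k, 0)) * (\<pi> (h j) * J) $$ (k, 0))"
      unfolding adjoint_mult_index[OF Qc Qc ij] using ij
      by (intro sum.cong refl) (simp add: Q_def del: index_mult_mat(1))
    also have "\<dots> = (mat_adjoint (\<pi> (h i) * J) * (\<pi> (h j) * J)) $$ (0, 0)"
      by (rule adjoint_mult_index[OF Ki Kj m m, symmetric])
    also have "\<dots> = (if i = j then 1 else 0)" using norm orth ij m by (cases "i = j") auto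
    finally show "(mat_adjoint Q * Q) $$ (i, j) = 1\<^sub>m (Suc (2 * n)) $$ (i, j)" using ij by simp
  qed (use Qc in auto)
  from isometry_bound[OF Qc this] show False by simp
qed

lemma subrep_in_fd_dual_per:
  assumes \<pi>: "\<pi> \<in> cont_hom G T (unitary_group n) (unitary_topology n)"
    and J: "invariant_isometry GN n \<pi> m J"
    and irr: "(m, \<lambda>x. mat_adjoint J * \<pi> x * J) \<in> irreps GN TN"
    and H: "H \<subseteq> carrier G"
  shows "(m, \<lambda>x. mat_adjoint J * \<pi> x * J) \<in> \<Union>(fd_dual_per G T N H)"
proof -
  let ?s = "(m, \<lambda>x. mat_adjoint J * \<pi> x * J)"
  have eq: "(\<lambda>h. dual_act G T N h (Eq `` {?s})) ` H = (\<lambda>h. Eq `` {conj_rep G h ?s}) ` H"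
    using H by (intro image_cong refl dual_act_class irr) auto
  have "finite ((\<lambda>h. dual_act G T N h (Eq `` {?s})) ` H)"
    unfolding eq by (rule finite_orbit_of_subrep[OF assms])
  then have "Eq `` {?s} \<in> fd_dual_per G T N H"
    using irr by (simp add: fd_dual_per_def fd_dual_def quotientI)
  moreover have "?s \<in> Eq `` {?s}" by (rule equiv_class_self[OF equiv_unitary_equiv irr])
  ultimately show ?thesis by blast
qed

end

section \<open>Extending representations to the Bohr compactification\<close>

lemma bohr_dense_eq:
  assumes B: "bohr_compactification G T B TB \<beta>" and H: "Hausdorff_space S"
    and f: "continuous_map TB S f" and g: "continuous_map TB S g"
    and eq: "\<And>x. x \<in> carrier G \<Longrightarrow> f (\<beta> x) = g (\<beta> x)" and y: "y \<in> carrier B"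
  shows "f y = g y"
proof -
  have "y \<in> TB closure_of (\<beta> ` carrier G)" using B y by (simp add: bohr_compactification_def)
  then show ?thesis by (rule forall_in_closure_of_eq[OF _ H f g]) (use eq in auto)
qed

lemma unitary_Hausdorff: "Hausdorff_space (unitary_topology n)"
  using compact_group_unitary by (simp add: compact_group_def)

lemma bohr_rep:
  fixes G :: "('g, 'm) monoid_scheme"
  assumes B: "bohr_compactification G T B TB \<beta>"
    and \<sigma>: "\<sigma> \<in> cont_hom G T (unitary_group n) (unitary_topology n)"
  shows "bohr_rep G B TB \<beta> (n, \<sigma>) \<in> cont_hom B TB (unitary_group n) (unitary_topology n)"
    and "x \<in> carrier G \<Longrightarrow> bohr_rep G B TB \<beta> (n, \<sigma>) (\<beta> x) = \<sigma> x"
proof -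
  have topB: "topspace TB = carrier B"
    using B by (auto simp: bohr_compactification_def compact_group_def topological_group_def)
  have gB: "group B" using B by (auto simp: bohr_compactification_def compact_group_def topological_group_def)
  have \<beta>: "\<beta> x \<in> carrier B" if "x \<in> carrier G" for x
    using B that by (auto simp: bohr_compactification_def cont_hom_def hom_def)
  let ?P = "\<lambda>\<rho>. \<rho> \<in> extensional (carrier B) \<and> \<rho> \<in> cont_hom B TB (unitary_group n) (unitary_topology n) \<and>
    (\<forall>x\<in>carrier G. \<rho> (\<beta> x) = \<sigma> x)"
  obtain \<rho> where \<rho>: "\<rho> \<in> cont_hom B TB (unitary_group n) (unitary_topology n)" "\<forall>x\<in>carrier G. \<sigma> x = \<rho> (\<beta> x)"
    using bohr_compactification_universal[OF B compact_group_unitary \<sigma>] by blast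
  have "restrict \<rho> (carrier B) \<in> cont_hom B TB (unitary_group n) (unitary_topology n)"
  proof -
    have "continuous_map TB (unitary_topology n) (restrict \<rho> (carrier B))"
      by (rule continuous_map_eq[of _ _ \<rho>]) (use \<rho> topB in \<open>auto simp: cont_hom_def\<close>)
    moreover have "restrict \<rho> (carrier B) \<in> hom B (unitary_group n)"
      using \<rho>(1) group.is_monoid[OF gB] by (auto simp: cont_hom_def hom_def monoid.m_closed)
    ultimately show ?thesis by (simp add: cont_hom_def)
  qed
  moreover define \<rho>0 where "\<rho>0 = restrict \<rho> (carrier B)"
  ultimately have 1: "?P \<rho>0" using \<rho>(2) \<beta> by auto
  have "\<exists>!\<rho>. ?P \<rho>"
  proof (rule ex1I[of ?P, OF 1])
    fix \<rho>' assume \<rho>': "?P \<rho>'"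
    show "\<rho>' = \<rho>0"
    proof (rule extensionalityI[of _ "carrier B"])
      fix y assume y: "y \<in> carrier B"
      show "\<rho>' y = \<rho>0 y"
        by (rule bohr_dense_eq[OF B unitary_Hausdorff[of n]]) (use \<rho>' 1 y in \<open>auto simp: cont_hom_def\<close>)
    qed (use \<rho>' 1 in auto)
  qed
  then have "?P (THE \<rho>. ?P \<rho>)" by (rule theI')
  then have *: "?P (bohr_rep G B TB \<beta> (n, \<sigma>))" by (simp add: bohr_rep_def)
  then show "bohr_rep G B TB \<beta> (n, \<sigma>) \<in> cont_hom B TB (unitary_group n) (unitary_topology n)" by blast
  from * show "x \<in> carrier G \<Longrightarrow> bohr_rep G B TB \<beta> (n, \<sigma>) (\<beta> x) = \<sigma> x" by blast
qed

section \<open>The kernel of the map from the Bohr compactification of the normal factor\<close>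

lemma finite_image_factor:
  assumes "finite (f ` A)" and "\<And>x y. x \<in> A \<Longrightarrow> y \<in> A \<Longrightarrow> f x = f y \<Longrightarrow> g x = g y"
  shows "finite (g ` A)"
proof -
  have "g ` A \<subseteq> (\<lambda>c. g (SOME x. x \<in> A \<and> f x = c)) ` f ` A"
  proof
    fix z assume "z \<in> g ` A"
    then obtain x where x: "x \<in> A" "z = g x" by blast
    let ?x = "SOME x'. x' \<in> A \<and> f x' = f x"
    have "?x \<in> A \<and> f ?x = f x" using x by (intro someI[of "\<lambda>x'. x' \<in> A \<and> f x' = f x" x]) auto
    then have "z = g ?x" using x assms(2)[of x ?x] by simp
    then show "z \<in> (\<lambda>c. g (SOME x. x \<in> A \<and> f x = c)) ` f ` A" using x by blast
  qed
  then show ?thesis using assms(1) finite_surj by blast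
qed

locale semidirect_bohr = normal_topological_subgroup G T N
  for G :: "('g, 'm) monoid_scheme" (structure) and T and N +
  fixes H :: "'g set"
    and BG :: "('b, 'n) monoid_scheme" and TBG :: "'b topology" and \<beta>G :: "'g \<Rightarrow> 'b"
    and BN :: "('c, 'k) monoid_scheme" and TBN :: "'c topology" and \<beta>N :: "'g \<Rightarrow> 'c"
    and \<phi>N :: "'c \<Rightarrow> 'b"
  assumes semidirect: "internal_semidirect_product G T N H"
    and bohr_G: "bohr_compactification G T BG TBG \<beta>G"
    and bohr_N: "bohr_compactification GN TN BN TBN \<beta>N"
    and \<phi>N_cont_hom: "\<phi>N \<in> cont_hom BN TBN BG TBG"
    and \<phi>N_\<beta>N: "\<And>x. x \<in> N \<Longrightarrow> \<phi>N (\<beta>N x) = \<beta>G x"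
begin

abbreviation TH where "TH \<equiv> subtopology T H"

lemma H_subgroup: "subgroup H G" using semidirect by (simp add: internal_semidirect_product_def)

lemma H_carrier: "h \<in> H \<Longrightarrow> h \<in> carrier G" using H_subgroup by (auto dest: subgroup.subset)

lemma one_H: "\<one> \<in> H" and one_N: "\<one> \<in> N"
  using H_subgroup N_subgroup by (simp_all add: subgroup.one_closed)

sublocale BG: compact_top_group BG TBG
proof -
  have "compact_group BG TBG" using bohr_G by (simp add: bohr_compactification_def)
  moreover from this have "group BG" by (simp add: compact_group_def topological_group_def)
  ultimately show "compact_top_group BG TBG"
    by (simp add: compact_top_group_def compact_top_group_axioms_def)
qed

sublocale BN: compact_top_group BN TBN
proof -
  have "compact_group BN TBN" using bohr_N by (simp add: bohr_compactification_def)
  moreover from this have "group BN" by (simp add: compact_group_def topological_group_def)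
  ultimately show "compact_top_group BN TBN"
    by (simp add: compact_top_group_def compact_top_group_axioms_def)
qed

lemma \<beta>G_closed: "x \<in> carrier G \<Longrightarrow> \<beta>G x \<in> carrier BG"
  and \<beta>G_mult: "x \<in> carrier G \<Longrightarrow> y \<in> carrier G \<Longrightarrow> \<beta>G (x \<otimes> y) = \<beta>G x \<otimes>\<^bsub>BG\<^esub> \<beta>G y"
  and \<beta>G_continuous: "continuous_map T TBG \<beta>G"
  using bohr_G by (auto simp: bohr_compactification_def cont_hom_def hom_def)

lemma \<beta>N_closed: "x \<in> N \<Longrightarrow> \<beta>N x \<in> carrier BN"
  and \<beta>N_mult: "x \<in> N \<Longrightarrow> y \<in> N \<Longrightarrow> \<beta>N (x \<otimes> y) = \<beta>N x \<otimes>\<^bsub>BN\<^esub> \<beta>N y"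
  and \<beta>N_continuous: "continuous_map TN TBN \<beta>N"
  using bohr_N by (auto simp: bohr_compactification_def cont_hom_def hom_def)

lemma \<phi>N_closed: "y \<in> carrier BN \<Longrightarrow> \<phi>N y \<in> carrier BG"
  and \<phi>N_continuous: "continuous_map TBN TBG \<phi>N"
  using \<phi>N_cont_hom by (auto simp: cont_hom_def hom_def)

lemma \<phi>N_group_hom: "group_hom BN BG \<phi>N"
  using \<phi>N_cont_hom BN.is_group BG.is_group by (simp add: group_hom_def group_hom_axioms_def cont_hom_def)

lemma bohr_N_dense_eq:
  assumes "Hausdorff_space S" "continuous_map TBN S f" "continuous_map TBN S g"
    "\<And>x. x \<in> N \<Longrightarrow> f (\<beta>N x) = g (\<beta>N x)" "y \<in> carrier BN"
  shows "f y = g y"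
  by (rule bohr_dense_eq[OF bohr_N assms(1-3)]) (use assms(4,5) in auto)

definition decomp :: "'g \<Rightarrow> 'g \<times> 'g" where
  "decomp = (SOME d. homeomorphic_maps (prod_topology TN TH) T (\<lambda>(n, h). n \<otimes> h) d)"

definition pN :: "'g \<Rightarrow> 'g" where "pN g = fst (decomp g)"
definition pH :: "'g \<Rightarrow> 'g" where "pH g = snd (decomp g)"

lemma topspace_TH [simp]: "topspace TH = H" using H_carrier by auto

lemma decomp: "homeomorphic_maps (prod_topology TN TH) T (\<lambda>(n, h). n \<otimes> h) decomp"
proof -
  have "\<exists>d. homeomorphic_maps (prod_topology TN TH) T (\<lambda>(n, h). n \<otimes> h) d"
    using semidirect by (simp add: internal_semidirect_product_def homeomorphic_map_maps)
  then show ?thesis unfolding decomp_def by (rule someI_ex)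
qed

lemma pN_closed: "g \<in> carrier G \<Longrightarrow> pN g \<in> N"
  and pH_closed: "g \<in> carrier G \<Longrightarrow> pH g \<in> H"
  and decomp_eq: "g \<in> carrier G \<Longrightarrow> pN g \<otimes> pH g = g"
proof -
  assume g: "g \<in> carrier G"
  have "decomp \<in> topspace T \<rightarrow> topspace (prod_topology TN TH)"
    using decomp by (auto simp: homeomorphic_maps_def continuous_map_def)
  then have "decomp g \<in> topspace (prod_topology TN TH)" by (rule funcset_mem) (simp add: g)
  then have "decomp g \<in> N \<times> H" by auto
  then show "pN g \<in> N" "pH g \<in> H" by (auto simp: pN_def pH_def)
  show "pN g \<otimes> pH g = g"
    using decomp g by (auto simp: homeomorphic_maps_def pN_def pH_def case_prod_unfold)
qed

lemma decomp_unique: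
  assumes "n \<in> N" "h \<in> H" shows "pN (n \<otimes> h) = n" "pH (n \<otimes> h) = h"
proof -
  have "decomp (n \<otimes> h) = (n, h)" using decomp assms N_carrier[OF assms(1)] H_carrier[OF assms(2)]
    by (auto simp: homeomorphic_maps_def)
  then show "pN (n \<otimes> h) = n" "pH (n \<otimes> h) = h" by (simp_all add: pN_def pH_def)
qed

lemma pN_continuous: "continuous_map T TN pN" and pH_continuous: "continuous_map T TH pH"
proof -
  have "continuous_map T (prod_topology TN TH) decomp" using decomp by (simp add: homeomorphic_maps_def)
  then have "continuous_map T TN (fst \<circ> decomp)" "continuous_map T TH (snd \<circ> decomp)"
    by (simp_all add: continuous_map_pairwise)
  then show "continuous_map T TN pN" "continuous_map T TH pH" by (simp_all add: pN_def[abs_def] pH_def[abs_def] comp_def)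
qed

lemma pN_N: "n \<in> N \<Longrightarrow> pN n = n"
  using decomp_unique(1)[of n \<one>] one_H N_carrier by simp

lemma decomp_mult:
  assumes g: "g \<in> carrier G" and a: "a \<in> carrier G"
  shows "pN (g \<otimes> a) = g \<otimes> pN a \<otimes> inv g \<otimes> pN g" "pH (g \<otimes> a) = pH g \<otimes> pH a"
proof -
  have c: "pN a \<in> carrier G" "pH a \<in> carrier G" "pN g \<in> carrier G" "pH g \<in> carrier G"
    using pN_closed pH_closed N_carrier H_carrier g a by auto
  have 1: "g \<otimes> pN a \<otimes> inv g \<otimes> pN g \<in> N"
    using conj_closed[OF g pN_closed[OF a]] pN_closed[OF g] N_subgroup by (simp add: subgroup.m_closed)
  have 2: "pH g \<otimes> pH a \<in> H" using pH_closed g a H_subgroup by (simp add: subgroup.m_closed)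
  have "g \<otimes> pN a \<otimes> inv g \<otimes> pN g \<otimes> (pH g \<otimes> pH a) = g \<otimes> pN a \<otimes> inv g \<otimes> (pN g \<otimes> pH g) \<otimes> pH a"
    using g c by (simp add: m_assoc)
  also have "\<dots> = g \<otimes> pN a \<otimes> (inv g \<otimes> g) \<otimes> pH a" unfolding decomp_eq[OF g] using g c by (simp add: m_assoc)
  also have "\<dots> = g \<otimes> a" using g c decomp_eq[OF a] by (simp add: m_assoc)
  finally have "g \<otimes> a = g \<otimes> pN a \<otimes> inv g \<otimes> pN g \<otimes> (pH g \<otimes> pH a)" ..
  then show "pN (g \<otimes> a) = g \<otimes> pN a \<otimes> inv g \<otimes> pN g" "pH (g \<otimes> a) = pH g \<otimes> pH a"
    using decomp_unique[OF 1 2] by simp_all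
qed

lemma cancel_left:
  assumes "a \<in> carrier G" "x \<in> carrier G"
  shows "a \<otimes> (inv a \<otimes> x) = x" "inv a \<otimes> (a \<otimes> x) = x"
  using assms by (simp_all flip: m_assoc)

text \<open>This identity turns translations of \<open>G\<close> into conjugations of \<open>N\<close>.\<close>

lemma pN_quotient:
  assumes g: "g \<in> carrier G" and a: "a \<in> carrier G" and b: "b \<in> carrier G"
  shows "pN (g \<otimes> a) \<otimes> inv (pN (g \<otimes> b)) = g \<otimes> (pN a \<otimes> inv (pN b)) \<otimes> inv g"
proof -
  have c: "pN a \<in> carrier G" "pN b \<in> carrier G" "pN g \<in> carrier G"
    using pN_closed N_carrier g a b by auto
  then show ?thesis
    unfolding decomp_mult(1)[OF g a] decomp_mult(1)[OF g b] using g
    by (simp add: inv_mult_group m_assoc cancel_left)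
qed

text \<open>The characters of the conjugates of a representation with finite orbit form a finite set \<open>Ch\<close> of
  functions that conjugation by any element of the group permutes. So their sum is invariant under
  conjugation, which is what makes the vectors \<open>u\<close> of all matrix entries, composed with the projection
  to \<open>N\<close>, satisfy the hypothesis of \<open>unitary_rep_of_invariant_vectors\<close>. Hence the sum of the characters is a
  combination of matrix entries of a representation of \<open>G\<close>. If \<open>k\<close> becomes trivial in the
  compactification of \<open>G\<close>, the sum therefore takes its largest value at \<open>k\<close>, and so does each character.\<close>

lemma trivial_on_periodic_rep:
  assumes k: "k \<in> carrier BN" "\<phi>N k = \<one>\<^bsub>BG\<^esub>" and per: "(n, \<sigma>) \<in> \<Union>(fd_dual_per G T N H)"
  shows "bohr_rep GN BN TBN \<beta>N (n, \<sigma>) k = 1\<^sub>m n"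
proof -
  from per obtain cl where cl: "cl \<in> irreps GN TN // Eq" "finite ((\<lambda>h. dual_act G T N h cl) ` H)" "(n, \<sigma>) \<in> cl"
    by (auto simp: fd_dual_per_def fd_dual_def)
  obtain t where t: "cl = Eq `` {t}" using cl(1) by (auto elim: quotientE)
  then have ts: "(t, (n, \<sigma>)) \<in> Eq" using cl(3) by blast
  then have irr: "(n, \<sigma>) \<in> irreps GN TN" using unitary_equiv_subset by blast
  have cl_eq: "cl = Eq `` {(n, \<sigma>)}" unfolding t by (rule equiv_class_eq[OF equiv_unitary_equiv ts])
  have \<sigma>: "\<sigma> \<in> cont_hom GN TN (unitary_group n) (unitary_topology n)" using irr by (simp add: irreps_def)
  define \<eta> where "\<eta> h = restrict (rchar n (\<lambda>x. \<sigma> (inv h \<otimes> x \<otimes> h))) N" for h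
  define Ch where "Ch = \<eta> ` H"
  have finX: "finite Ch" unfolding Ch_def
  proof (rule finite_image_factor[OF cl(2)])
    fix h h' assume h: "h \<in> H" "h' \<in> H" and eq: "dual_act G T N h cl = dual_act G T N h' cl"
    have "Eq `` {conj_rep G h (n, \<sigma>)} = Eq `` {conj_rep G h' (n, \<sigma>)}"
      using eq unfolding cl_eq using h by (simp add: dual_act_class H_carrier irr)
    then have "(conj_rep G h (n, \<sigma>), conj_rep G h' (n, \<sigma>)) \<in> Eq"
      using eq_equiv_class[OF _ equiv_unitary_equiv] conj_rep_irreps[OF H_carrier[OF h(2)] irr] by blast
    then show "\<eta> h = \<eta> h'"
      unfolding \<eta>_def conj_rep_def by (intro restrict_ext) (simp add: rchar_unitary_equiv(2))
  qed
  (* A conjugating element for each character; the choice for \<eta> \<one> makes S (\<eta> \<one>) equal to \<sigma>. *)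
  define r where "r x = (if x = \<eta> \<one> then \<one> else SOME h. h \<in> H \<and> \<eta> h = x)" for x
  have r: "r x \<in> H \<and> \<eta> (r x) = x" if "x \<in> Ch" for x
  proof (cases "x = \<eta> \<one>")
    case False
    have "\<exists>h. h \<in> H \<and> \<eta> h = x" using that by (auto simp: Ch_def)
    then show ?thesis unfolding r_def using False by (simp add: someI_ex[of "\<lambda>h. h \<in> H \<and> \<eta> h = x"])
  qed (simp add: r_def one_H)
  have oneX: "\<eta> \<one> \<in> Ch" using one_H by (simp add: Ch_def)
  define S where "S x y = \<sigma> (inv (r x) \<otimes> y \<otimes> r x)" for x y
  have S: "S x \<in> cont_hom GN TN (unitary_group n) (unitary_topology n)" if "x \<in> Ch" for x
    unfolding S_def by (rule conj_rep_cont_hom[OF H_carrier \<sigma>]) (use r[OF that] in simp)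
  have S_char: "rchar n (S x) y = x y" if x: "x \<in> Ch" and y: "y \<in> N" for x y
  proof -
    have "x y = \<eta> (r x) y" using r[OF x] by simp
    then show ?thesis using y by (simp add: \<eta>_def S_def[abs_def])
  qed
  have X_sum: "(\<Sum>x\<in>Ch. x (g \<otimes> y \<otimes> inv g)) = (\<Sum>x\<in>Ch. x y)" if g: "g \<in> carrier G" and y: "y \<in> N" for g y
  proof -
    define \<Phi> where "\<Phi> x = restrict (\<lambda>y. x (g \<otimes> y \<otimes> inv g)) N" for x :: "'g \<Rightarrow> real"
    have \<Phi>Ch: "\<Phi> x \<in> Ch" if "x \<in> Ch" for x
    proof -
      from that obtain h where h: "h \<in> H" "x = \<eta> h" by (auto simp: Ch_def)
      define h'' where "h'' = inv (pH g) \<otimes> h"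
      define z where "z = inv h \<otimes> pN g \<otimes> h"
      have gc: "pN g \<in> carrier G" "pH g \<in> carrier G" using pN_closed pH_closed g N_carrier H_carrier by auto
      have hc: "h \<in> carrier G" using h(1) H_carrier by simp
      have h'': "h'' \<in> H" unfolding h''_def using pH_closed[OF g] h(1) H_subgroup
        by (simp add: subgroup.m_closed subgroup.m_inv_closed)
      have h''c: "h'' \<in> carrier G" using h'' H_carrier by simp
      have z: "z \<in> N" unfolding z_def by (rule conj_closed'[OF hc pN_closed[OF g]])
      have zc: "z \<in> carrier G" using z N_carrier by simp
      have ihg: "inv h \<otimes> g = z \<otimes> inv h''"
      proof -
        have "z \<otimes> inv h'' = inv h \<otimes> pN g \<otimes> (h \<otimes> inv h) \<otimes> pH g"
          unfolding z_def h''_def using hc gc by (simp add: inv_mult_group m_assoc cancel_left)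
        also have "\<dots> = inv h \<otimes> (pN g \<otimes> pH g)" using hc gc by (simp add: m_assoc)
        finally show ?thesis by (simp add: decomp_eq[OF g])
      qed
      have gih: "inv g \<otimes> h = h'' \<otimes> inv z"
      proof -
        have "inv (inv h \<otimes> g) = inv (z \<otimes> inv h'')" by (simp only: ihg)
        then show ?thesis using hc g zc h''c by (simp add: inv_mult_group)
      qed
      have "\<Phi> x y = \<eta> h'' y" if y: "y \<in> N" for y
      proof -
        note yc = N_carrier[OF y]
        have "inv h \<otimes> (g \<otimes> y \<otimes> inv g) \<otimes> h = (inv h \<otimes> g) \<otimes> y \<otimes> (inv g \<otimes> h)"
          using hc g yc by (simp add: m_assoc)
        also have "\<dots> = z \<otimes> (inv h'' \<otimes> y \<otimes> h'') \<otimes> inv z"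
          unfolding ihg gih using zc h''c yc by (simp add: m_assoc)
        finally have "\<Phi> x y = rchar n \<sigma> (z \<otimes> (inv h'' \<otimes> y \<otimes> h'') \<otimes> inv z)"
          using y conj_closed[OF g y] by (simp add: \<Phi>_def h(2) \<eta>_def rchar_def)
        also have "\<dots> = rchar n \<sigma> (inv h'' \<otimes> y \<otimes> h'')"
          using rchar_conj[OF group_GN \<sigma>, of z "inv h'' \<otimes> y \<otimes> h''"] z conj_closed'[OF h''c y] by (simp add: inv_GN)
        finally show ?thesis using y by (simp add: \<eta>_def rchar_def)
      qed
      then have "\<Phi> x = \<eta> h''" by (intro extensionalityI[of _ N]) (auto simp: \<Phi>_def \<eta>_def)
      then show ?thesis using h'' by (simp add: Ch_def)
    qed
    have inj: "inj_on \<Phi> Ch"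
    proof (rule inj_onI)
      fix x x' assume x: "x \<in> Ch" "x' \<in> Ch" and eq: "\<Phi> x = \<Phi> x'"
      show "x = x'"
      proof (rule extensionalityI[of _ N])
        fix z assume z: "z \<in> N"
        have "inv g \<otimes> z \<otimes> g \<in> N" by (rule conj_closed'[OF g z])
        moreover have "g \<otimes> (inv g \<otimes> z \<otimes> g) \<otimes> inv g = z"
          using g N_carrier[OF z] by (simp add: m_assoc) (simp flip: m_assoc)
        ultimately show "x z = x' z" using fun_cong[OF eq, of "inv g \<otimes> z \<otimes> g"] by (simp add: \<Phi>_def)
      qed (use x in \<open>auto simp: Ch_def \<eta>_def\<close>)
    qed
    have im: "\<Phi> ` Ch = Ch" using \<Phi>Ch inj finX by (intro endo_inj_surj) auto
    have "(\<Sum>x\<in>Ch. x (g \<otimes> y \<otimes> inv g)) = (\<Sum>x\<in>Ch. \<Phi> x y)" using y by (simp add: \<Phi>_def)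
    also have "\<dots> = (\<Sum>x\<in>\<Phi> ` Ch. x y)" using inj by (simp add: sum.reindex)
    finally show ?thesis unfolding im .
  qed
  define I where "I = Ch \<times> ({..<n} \<times> {..<n}) \<times> (UNIV :: bool set)"
  (* Real and imaginary parts are separate entries of the real vectors u. *)
  define u where "u = (\<lambda>(x, (i, j), b) g. if b then Re (S x (pN g) $$ (i, j)) else Im (S x (pN g) $$ (i, j)))"
  have u_sum: "(\<Sum>i\<in>I. u i a * u i b) = (\<Sum>x\<in>Ch. x (pN a \<otimes> inv (pN b)))"
    if ab: "a \<in> carrier G" "b \<in> carrier G" for a b
  proof -
    have "(\<Sum>i\<in>I. u i a * u i b) =
        (\<Sum>x\<in>Ch. \<Sum>(i, j)\<in>{..<n} \<times> {..<n}. \<Sum>c\<in>UNIV. u (x, (i, j), c) a * u (x, (i, j), c) b)"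
      unfolding I_def by (simp add: sum.cartesian_product case_prod_unfold)
    also have "\<dots> = (\<Sum>x\<in>Ch. \<Sum>i<n. \<Sum>j<n. Re (S x (pN a) $$ (i, j) * cnj (S x (pN b) $$ (i, j))))"
      unfolding sum.cartesian_product[symmetric] by (simp add: u_def UNIV_bool add.commute)
    also have "\<dots> = (\<Sum>x\<in>Ch. x (pN a \<otimes> inv (pN b)))"
    proof (intro sum.cong refl)
      fix x assume x: "x \<in> Ch"
      have ab': "pN a \<in> carrier GN" "pN b \<in> carrier GN" using pN_closed ab by auto
      have ib: "inv (pN b) \<in> carrier GN" using ab' N_subgroup by (simp add: subgroup.m_inv_closed)
      have abN: "pN a \<otimes> inv (pN b) \<in> N" using ab' ib N_subgroup by (simp add: subgroup.m_closed)
      note Sa = rep_mat(1)[OF S[OF x] ab'(1)] and Sb = rep_mat(1)[OF S[OF x] ab'(2)]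
      have "S x (pN a \<otimes> inv (pN b)) = S x (pN a) * mat_adjoint (S x (pN b))"
        using rep_mult[OF S[OF x] ab'(1) ib] rep_adjoint[OF group_GN S[OF x] ab'(2)] ab' by (simp add: inv_GN)
      then have "x (pN a \<otimes> inv (pN b)) = (\<Sum>i<n. Re ((S x (pN a) * mat_adjoint (S x (pN b))) $$ (i, i)))"
        using S_char[OF x abN] by (simp add: rchar_def)
      also have "\<dots> = (\<Sum>i<n. \<Sum>j<n. Re (S x (pN a) $$ (i, j) * cnj (S x (pN b) $$ (i, j))))"
      proof (intro sum.cong refl)
        fix i assume "i \<in> {..<n}"
        then have i: "i < n" by simp
        show "Re ((S x (pN a) * mat_adjoint (S x (pN b))) $$ (i, i)) = (\<Sum>j<n. Re (S x (pN a) $$ (i, j) * cnj (S x (pN b) $$ (i, j))))"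
          unfolding mat_mult_index[OF Sa mat_adjoint_carrier[OF Sb] i i] Re_sum
          using Sb i by (intro sum.cong refl) simp
      qed
      finally show "(\<Sum>i<n. \<Sum>j<n. Re (S x (pN a) $$ (i, j) * cnj (S x (pN b) $$ (i, j)))) = x (pN a \<otimes> inv (pN b))" ..
    qed
    finally show ?thesis .
  qed
  have finI: "finite I" using finX by (simp add: I_def)
  have u_cont: "continuous_map T euclideanreal (u i)" if "i \<in> I" for i
  proof -
    from that obtain x k l b where i: "i = (x, (k, l), b)" "x \<in> Ch" "k < n" "l < n" by (auto simp: I_def)
    have "continuous_map TN euclidean (\<lambda>y. S x y $$ (k, l))"
      using S[OF i(2)] i by (simp add: cont_hom_def continuous_map_unitary_topology)
    from continuous_map_compose[OF pN_continuous this]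
    have "continuous_map T euclidean (\<lambda>g. S x (pN g) $$ (k, l))" by (simp add: comp_def)
    then show ?thesis using continuous_map_Re continuous_map_Im by (cases b) (auto simp: i u_def)
  qed
  have u_inv: "(\<Sum>i\<in>I. u i (g \<otimes> a) * u i (g \<otimes> b)) = (\<Sum>i\<in>I. u i a * u i b)"
    if gab: "g \<in> carrier G" "a \<in> carrier G" "b \<in> carrier G" for g a b
  proof -
    have "pN a \<otimes> inv (pN b) \<in> N"
      using pN_closed gab N_subgroup by (simp add: subgroup.m_closed subgroup.m_inv_closed)
    then show ?thesis
      using gab by (simp add: u_sum pN_quotient X_sum)
  qed
  obtain m \<rho> c where \<rho>: "\<rho> \<in> cont_hom G T (unitary_group m) (unitary_topology m)"
    and \<rho>_eq: "\<And>g. g \<in> carrier G \<Longrightarrow>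
      (\<Sum>i\<in>I. u i g * u i \<one>) = (\<Sum>i<m. \<Sum>j<m. c j * c i * Re (\<rho> g $$ (i, j)))"
    by (rule unitary_rep_of_invariant_vectors[OF topological_group finI u_cont u_inv]) (assumption | rule that)+
  obtain \<rho>' where \<rho>': "\<rho>' \<in> cont_hom BG TBG (unitary_group m) (unitary_topology m)"
    and \<rho>'_eq: "\<And>g. g \<in> carrier G \<Longrightarrow> \<rho> g = \<rho>' (\<beta>G g)"
    using bohr_compactification_universal[OF bohr_G compact_group_unitary \<rho>] by blast
  define D where "D x = bohr_rep GN BN TBN \<beta>N (n, S x)" for x
  have D: "D x \<in> cont_hom BN TBN (unitary_group n) (unitary_topology n)" if "x \<in> Ch" for x
    unfolding D_def by (rule bohr_rep(1)[OF bohr_N S[OF that]])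
  have D_\<beta>: "D x (\<beta>N z) = S x z" if "x \<in> Ch" "z \<in> N" for x z
    unfolding D_def using bohr_rep(2)[OF bohr_N S[OF that(1)]] that by simp
  define L where "L y = (\<Sum>x\<in>Ch. \<Sum>i<n. Re (D x y $$ (i, i)))" for y
  define R where "R y = (\<Sum>i<m. \<Sum>j<m. c j * c i * Re (\<rho>' (\<phi>N y) $$ (i, j)))" for y
  have LR: "L y = R y" if y: "y \<in> carrier BN" for y
  proof (rule bohr_N_dense_eq[of euclideanreal])
    have "continuous_map TBN euclidean (\<lambda>y. D x y $$ (i, i))" if "x \<in> Ch" "i < n" for x i
      using D[OF that(1)] that by (simp add: cont_hom_def continuous_map_unitary_topology)
    then show "continuous_map TBN euclideanreal L"
      unfolding L_def[abs_def] using finX by (intro continuous_map_sum continuous_map_Re) auto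
    have "continuous_map TBN euclidean (\<lambda>y. \<rho>' (\<phi>N y) $$ (i, j))" if "i < m" "j < m" for i j
    proof -
      have "continuous_map TBG euclidean (\<lambda>z. \<rho>' z $$ (i, j))"
        using \<rho>' that by (simp add: cont_hom_def continuous_map_unitary_topology)
      from continuous_map_compose[OF \<phi>N_continuous this] show ?thesis by (simp add: comp_def)
    qed
    then show "continuous_map TBN euclideanreal R"
      unfolding R_def[abs_def] by (intro continuous_map_sum continuous_map_real_mult_left continuous_map_Re) auto
    fix z assume z: "z \<in> N"
    have "L (\<beta>N z) = (\<Sum>x\<in>Ch. x z)"
      unfolding L_def using z S_char by (intro sum.cong refl) (simp add: D_\<beta> rchar_def)
    also have "\<dots> = (\<Sum>i\<in>I. u i z * u i \<one>)"
      using u_sum[OF N_carrier[OF z] one_closed] N_carrier[OF z] by (simp add: pN_N z one_N)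
    also have "\<dots> = R (\<beta>N z)"
      using \<rho>_eq[OF N_carrier[OF z]] \<rho>'_eq[OF N_carrier[OF z]] z by (simp add: R_def \<phi>N_\<beta>N)
    finally show "L (\<beta>N z) = R (\<beta>N z)" .
  qed (simp_all add: y)
  have "\<phi>N \<one>\<^bsub>BN\<^esub> = \<one>\<^bsub>BG\<^esub>" using group_hom.hom_one[OF \<phi>N_group_hom] by simp
  then have "L k = L \<one>\<^bsub>BN\<^esub>" using LR k by (simp add: R_def)
  also have "\<dots> = (\<Sum>x\<in>Ch. real n)"
    unfolding L_def using rep_one[OF BN.is_group D] by (intro sum.cong refl) simp
  finally have Lk: "(\<Sum>x\<in>Ch. \<Sum>i<n. Re (D x k $$ (i, i))) = (\<Sum>x\<in>Ch. real n)" by (simp add: L_def)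
  have le: "(\<Sum>i<n. Re (D x k $$ (i, i))) \<le> real n" if x: "x \<in> Ch" for x
  proof -
    have "(\<Sum>i<n. Re (D x k $$ (i, i))) \<le> (\<Sum>i<n. 1)"
      using unitary_entry_le_1[OF rep_carrier[OF D[OF x] k(1)]]
      by (intro sum_mono order_trans[OF complex_Re_le_cmod]) simp
    then show ?thesis by simp
  qed
  have "real n \<le> (\<Sum>i<n. Re (D (\<eta> \<one>) k $$ (i, i)))"
  proof (rule ccontr)
    assume "\<not> ?thesis"
    then have "(\<Sum>x\<in>Ch. \<Sum>i<n. Re (D x k $$ (i, i))) < (\<Sum>x\<in>Ch. real n)"
      using le oneX finX by (intro sum_strict_mono_ex1) (auto simp: not_le)
    with Lk show False by simp
  qed
  then have "D (\<eta> \<one>) k = 1\<^sub>m n"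
    by (rule unitary_eq_one_if_Re_diag[OF rep_carrier[OF D[OF oneX] k(1)]])
  moreover have "bohr_rep GN BN TBN \<beta>N (n, \<sigma>) k = D (\<eta> \<one>) k"
  proof (rule bohr_N_dense_eq[OF unitary_Hausdorff[of n]])
    fix z assume z: "z \<in> N"
    have "S (\<eta> \<one>) z = \<sigma> z" using N_carrier[OF z] by (simp add: S_def r_def)
    then show "bohr_rep GN BN TBN \<beta>N (n, \<sigma>) (\<beta>N z) = D (\<eta> \<one>) (\<beta>N z)"
      using bohr_rep(2)[OF bohr_N \<sigma>, of z] D_\<beta>[OF oneX z] z by simp
  qed (use bohr_rep(1)[OF bohr_N \<sigma>] D[OF oneX] k in \<open>auto simp: cont_hom_def\<close>)
  ultimately show ?thesis by simp
qed

text \<open>The intersection of kernels is thus over a non-empty family, which puts it inside \<open>Bohr(N)\<close>.\<close>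

lemma trivial_rep_periodic: "\<Union>(fd_dual_per G T N H) \<noteq> {}"
proof -
  let ?\<pi> = "\<lambda>x :: 'g. 1\<^sub>m 1 :: complex mat"
  have adj1: "mat_adjoint (1\<^sub>m n) = (1\<^sub>m n :: complex mat)" for n by (rule eq_matI) simp_all
  have one: "1\<^sub>m 1 \<in> carrier (unitary_group 1)" by (rule unitaryI) (simp_all add: adj1)
  have \<pi>: "?\<pi> \<in> cont_hom G T (unitary_group 1) (unitary_topology 1)"
    unfolding cont_hom_unitary_iff[OF top] using one by simp
  have J: "invariant_isometry GN 1 ?\<pi> 1 (1\<^sub>m 1)" by (simp add: invariant_isometry_def adj1)
  have "W = {0\<^sub>v 1} \<or> W = carrier_vec 1"
    if W: "VectorSpace.subspace class_ring W (module_vec TYPE(complex) 1)" for W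
  proof (cases "W = {0\<^sub>v 1}")
    case False
    from W have sub: "W \<subseteq> carrier_vec 1" and zero: "0\<^sub>v 1 \<in> W" and smult: "\<And>c v. v \<in> W \<Longrightarrow> c \<cdot>\<^sub>v v \<in> W"
      unfolding subspace_iff by auto
    from False zero obtain w where w: "w \<in> W" "w \<noteq> 0\<^sub>v 1" by blast
    have wc: "w \<in> carrier_vec 1" using w(1) sub by blast
    have w0: "w $ 0 \<noteq> 0"
    proof
      assume "w $ 0 = 0"
      then have "w = 0\<^sub>v 1" using wc by (intro eq_vecI) auto
      with w(2) show False ..
    qed
    have "v \<in> W" if v: "v \<in> carrier_vec 1" for v
    proof -
      have "v = (v $ 0 / w $ 0) \<cdot>\<^sub>v w" using v wc w0 by (intro eq_vecI) auto
      then show ?thesis using smult[OF w(1), of "v $ 0 / w $ 0"] by simp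
    qed
    then show ?thesis using sub by blast
  qed simp
  then have "(1, \<lambda>x. mat_adjoint (1\<^sub>m 1) * ?\<pi> x * 1\<^sub>m 1) \<in> irreps GN TN"
    using rep_restrict[OF \<pi>] by (simp add: irreps_def adj1)
  from subrep_in_fd_dual_per[OF \<pi> J this] H_carrier show ?thesis by blast
qed

text \<open>A representation of \<open>G\<close> that restricts to \<open>\<psi>\<close> is on \<open>N\<close> a sum of irreducible ones with finite orbit,
  so that \<open>\<psi>\<close> is trivial on their common kernel.\<close>

lemma per_kernel_trivial:
  assumes kC: "k \<in> per_kernel G T N H BN TBN \<beta>N"
    and \<pi>: "\<pi> \<in> cont_hom G T (unitary_group n) (unitary_topology n)"
    and \<psi>: "\<psi> \<in> cont_hom BN TBN (unitary_group n) (unitary_topology n)"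
    and eq: "\<And>x. x \<in> N \<Longrightarrow> \<psi> (\<beta>N x) = \<pi> x"
  shows "\<psi> k = 1\<^sub>m n"
proof -
  have ker: "k \<in> carrier BN" "bohr_rep GN BN TBN \<beta>N (m, \<tau>) k = 1\<^sub>m m"
    if "(m, \<tau>) \<in> \<Union>(fd_dual_per G T N H)" for m \<tau>
    using kC that by (auto simp: per_kernel_def kernel_def)
  have k: "k \<in> carrier BN" using trivial_rep_periodic ker(1) by force
  show ?thesis
  proof (rule trivial_on_irreducibles[OF tg_GN rep_restrict[OF \<pi>] rep_mat(1)[OF \<psi> k]])
    fix m J assume J: "invariant_isometry GN n \<pi> m J"
      and irr: "(m, \<lambda>x. mat_adjoint J * \<pi> x * J) \<in> irreps GN TN"
    have Jc: "J \<in> carrier_mat n m" and iso: "mat_adjoint J * J = 1\<^sub>m m"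
      and inter: "\<And>x. x \<in> N \<Longrightarrow> \<pi> x * J = J * (mat_adjoint J * \<pi> x * J)"
      using J by (auto simp: invariant_isometry_def)
    note Ja = mat_adjoint_carrier[OF Jc]
    have per: "(m, \<lambda>x. mat_adjoint J * \<pi> x * J) \<in> \<Union>(fd_dual_per G T N H)"
      by (rule subrep_in_fd_dual_per[OF \<pi> J irr]) (use H_carrier in blast)
    have \<psi>c: "\<psi> y \<in> carrier_mat n n" if "y \<in> carrier BN" for y by (rule rep_mat(1)[OF \<psi> that])
    have assoc: "J * mat_adjoint J * \<psi> y * J = J * (mat_adjoint J * \<psi> y * J)" if y: "y \<in> carrier BN" for y
      using Jc \<psi>c[OF y] by (simp add: mat_assoc)
    have inv: "\<psi> y * J = J * (mat_adjoint J * \<psi> y * J)" if y: "y \<in> carrier BN" for y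
    proof (rule eq_matI)
      fix i j assume "i < dim_row (J * (mat_adjoint J * \<psi> y * J))" "j < dim_col (J * (mat_adjoint J * \<psi> y * J))"
      then have ij: "i < n" "j < m" using Jc by auto
      have "(1\<^sub>m n * \<psi> y * J) $$ (i, j) = (J * mat_adjoint J * \<psi> y * J) $$ (i, j)"
      proof (rule bohr_N_dense_eq[of euclidean])
        show "continuous_map TBN euclidean (\<lambda>y. (1\<^sub>m n * \<psi> y * J) $$ (i, j))"
          by (rule rep_entry_continuous[OF BN.topspace_eq \<psi> one_carrier_mat Jc ij])
        show "continuous_map TBN euclidean (\<lambda>y. (J * mat_adjoint J * \<psi> y * J) $$ (i, j))"
          by (rule rep_entry_continuous[OF BN.topspace_eq \<psi> mult_carrier_mat[OF Jc Ja] Jc ij])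
        fix x assume x: "x \<in> N"
        have "1\<^sub>m n * \<psi> (\<beta>N x) * J = \<pi> x * J"
          using left_mult_one_mat[OF \<psi>c[OF \<beta>N_closed[OF x]]] by (simp add: eq[OF x])
        also have "\<dots> = J * mat_adjoint J * \<psi> (\<beta>N x) * J"
          using assoc[OF \<beta>N_closed[OF x]] inter[OF x] by (simp add: eq[OF x])
        finally show "(1\<^sub>m n * \<psi> (\<beta>N x) * J) $$ (i, j) = (J * mat_adjoint J * \<psi> (\<beta>N x) * J) $$ (i, j)" by simp
      qed (simp_all add: y)
      then show "(\<psi> y * J) $$ (i, j) = (J * (mat_adjoint J * \<psi> y * J)) $$ (i, j)"
        unfolding assoc[OF y] left_mult_one_mat[OF \<psi>c[OF y]] .
    qed (use Jc \<psi>c[OF y] in auto)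
    have "invariant_isometry BN n \<psi> m J" unfolding invariant_isometry_def using Jc iso inv by blast
    from subrep_cont_hom[OF _ \<psi> this] BN.compact_group
    have sub: "(\<lambda>y. mat_adjoint J * \<psi> y * J) \<in> cont_hom BN TBN (unitary_group m) (unitary_topology m)"
      by (simp add: compact_group_def)
    have \<tau>: "(\<lambda>x. mat_adjoint J * \<pi> x * J) \<in> cont_hom GN TN (unitary_group m) (unitary_topology m)"
      using irr by (simp add: irreps_def)
    have "mat_adjoint J * \<psi> k * J = bohr_rep GN BN TBN \<beta>N (m, \<lambda>x. mat_adjoint J * \<pi> x * J) k"
    proof (rule bohr_N_dense_eq[OF unitary_Hausdorff[of m]])
      show "mat_adjoint J * \<psi> (\<beta>N x) * J = bohr_rep GN BN TBN \<beta>N (m, \<lambda>x. mat_adjoint J * \<pi> x * J) (\<beta>N x)"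
        if "x \<in> N" for x
        using bohr_rep(2)[OF bohr_N \<tau>, of x] that by (simp add: eq)
    qed (use sub bohr_rep(1)[OF bohr_N \<tau>] k in \<open>auto simp: cont_hom_def\<close>)
    then have "mat_adjoint J * \<psi> k * J = 1\<^sub>m m" using ker(2)[OF per] by simp
    then show "\<psi> k * J = J" using inv[OF k] right_mult_one_mat[OF Jc] by simp
  qed
qed

text \<open>The inclusion from left to right is \<open>trivial_on_periodic_rep\<close>. For the other one, the theorem of Peter and
  Weyl provides a representation of \<open>Bohr(G)\<close> that would detect the image of \<open>k\<close>.\<close>

lemma kernel_\<phi>N: "{k \<in> carrier BN. \<phi>N k = \<one>\<^bsub>BG\<^esub>} = per_kernel G T N H BN TBN \<beta>N"
proof (intro equalityI subsetI)
  fix k assume "k \<in> {k \<in> carrier BN. \<phi>N k = \<one>\<^bsub>BG\<^esub>}"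
  then have k: "k \<in> carrier BN" "\<phi>N k = \<one>\<^bsub>BG\<^esub>" by auto
  show "k \<in> per_kernel G T N H BN TBN \<beta>N"
    unfolding per_kernel_def
  proof (intro INT_I)
    fix s assume s: "s \<in> \<Union>(fd_dual_per G T N H)"
    obtain n \<sigma> where s_eq: "s = (n, \<sigma>)" by force
    show "k \<in> (case s of (n, \<sigma>) \<Rightarrow> kernel BN (unitary_group n) (bohr_rep GN BN TBN \<beta>N (n, \<sigma>)))"
      using trivial_on_periodic_rep[OF k, of n \<sigma>] s k(1) by (simp add: s_eq kernel_def)
  qed
next
  fix k assume kC: "k \<in> per_kernel G T N H BN TBN \<beta>N"
  obtain s where s: "s \<in> \<Union>(fd_dual_per G T N H)" using trivial_rep_periodic by blast
  then have k: "k \<in> carrier BN" using kC by (cases s) (fastforce simp: per_kernel_def kernel_def)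
  have "\<phi>N k = \<one>\<^bsub>BG\<^esub>"
  proof (rule ccontr)
    assume "\<phi>N k \<noteq> \<one>\<^bsub>BG\<^esub>"
    then obtain n \<rho> where \<rho>: "\<rho> \<in> cont_hom BG TBG (unitary_group n) (unitary_topology n)" "\<rho> (\<phi>N k) \<noteq> 1\<^sub>m n"
      using BG.Peter_Weyl[OF \<phi>N_closed[OF k]] by blast
    have 1: "(\<lambda>g. \<rho> (\<beta>G g)) \<in> cont_hom G T (unitary_group n) (unitary_topology n)"
      using \<rho>(1) \<beta>G_closed \<beta>G_mult continuous_map_compose[OF \<beta>G_continuous, of "unitary_topology n" \<rho>]
      by (auto simp: cont_hom_def hom_def comp_def)
    have 2: "(\<lambda>y. \<rho> (\<phi>N y)) \<in> cont_hom BN TBN (unitary_group n) (unitary_topology n)"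
      using \<rho>(1) \<phi>N_cont_hom continuous_map_compose[OF \<phi>N_continuous, of "unitary_topology n" \<rho>]
      by (auto simp: cont_hom_def hom_def comp_def Pi_iff)
    have "\<rho> (\<phi>N k) = 1\<^sub>m n" by (rule per_kernel_trivial[OF kC 1 2]) (simp add: \<phi>N_\<beta>N)
    with \<rho>(2) show False ..
  qed
  with k show "k \<in> {k \<in> carrier BN. \<phi>N k = \<one>\<^bsub>BG\<^esub>}" by simp
qed

end

section \<open>The compactification of a semidirect product\<close>

lemma continuous_compact_Hausdorff_homeomorphic_map:
  assumes "compact_space S" "Hausdorff_space Y" "continuous_map S Y f"
    "f ` topspace S = topspace Y" "inj_on f (topspace S)"
  shows "homeomorphic_map S Y f"
  using assms by (intro bijective_closed_imp_homeomorphic_map continuous_imp_closed_map_gen Hausdorff_imp_kc_space)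

lemma compact_image_eq_closure:
  assumes "compact_space S" "Hausdorff_space Y" "continuous_map S Y f"
    and "A \<subseteq> f ` topspace S" and "f ` topspace S \<subseteq> Y closure_of A"
  shows "f ` topspace S = Y closure_of A"
proof -
  have "compactin Y (f ` topspace S)"
    using assms(1,3) image_compactin by (fastforce simp: compact_space_def)
  then have "closedin Y (f ` topspace S)" using assms(2) by (rule compactin_imp_closedin[rotated])
  then have "Y closure_of A \<subseteq> f ` topspace S" using assms(4) by (intro closure_of_minimal)
  with assms(5) show ?thesis by blast
qed

context semidirect_bohr
begin

text \<open>The automorphism of \<open>Bohr(N)\<close> given by \<open>h\<close>, with the one given by \<open>h\<^sup>-\<^sup>1\<close> as its inverse.\<close>

lemma bohr_act:
  assumes h: "h \<in> carrier G"
  shows "bohr_act G N BN TBN \<beta>N h \<in> auto BN"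
    and "continuous_map TBN TBN (bohr_act G N BN TBN \<beta>N h)"
    and "\<And>x. x \<in> N \<Longrightarrow> bohr_act G N BN TBN \<beta>N h (\<beta>N x) = \<beta>N (h \<otimes> x \<otimes> inv h)"
proof -
  have ex: "\<exists>a. a \<in> hom BN BN \<and> continuous_map TBN TBN a \<and> (\<forall>x\<in>N. a (\<beta>N x) = \<beta>N (g \<otimes> x \<otimes> inv g))"
    if g: "g \<in> carrier G" for g
  proof -
    have g': "inv g \<in> carrier G" using g by simp
    have cm: "continuous_map TN TN (\<lambda>x. g \<otimes> x \<otimes> inv g)" using continuous_conj[OF g'] g by simp
    have mult: "g \<otimes> (x \<otimes> y) \<otimes> inv g = (g \<otimes> x \<otimes> inv g) \<otimes> (g \<otimes> y \<otimes> inv g)" if "x \<in> N" "y \<in> N" for x y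
      using g N_carrier[OF that(1)] N_carrier[OF that(2)] by (simp add: m_assoc cancel_left)
    have "(\<lambda>x. \<beta>N (g \<otimes> x \<otimes> inv g)) \<in> cont_hom GN TN BN TBN"
      using continuous_map_compose[OF cm \<beta>N_continuous] conj_closed[OF g]
      by (auto simp: cont_hom_def hom_def comp_def mult \<beta>N_mult \<beta>N_closed)
    from bohr_compactification_universal[OF bohr_N BN.compact_group this] show ?thesis
      by (fastforce simp: cont_hom_def)
  qed
  obtain a where a: "a \<in> hom BN BN" "continuous_map TBN TBN a" "\<And>x. x \<in> N \<Longrightarrow> a (\<beta>N x) = \<beta>N (h \<otimes> x \<otimes> inv h)"
    using ex[OF h] by blast
  obtain b where b: "b \<in> hom BN BN" "continuous_map TBN TBN b" "\<And>x. x \<in> N \<Longrightarrow> b (\<beta>N x) = \<beta>N (inv h \<otimes> x \<otimes> h)"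
    using ex[of "inv h"] h by fastforce
  have ac: "a y \<in> carrier BN" and bc: "b y \<in> carrier BN" if "y \<in> carrier BN" for y
    using a(1) b(1) that by (auto simp: hom_def)
  have ab: "a (b y) = y" if y: "y \<in> carrier BN" for y
  proof (rule bohr_N_dense_eq[OF BN.Hausdorff])
    show "continuous_map TBN TBN (\<lambda>y. a (b y))" using continuous_map_compose[OF b(2) a(2)] by (simp add: comp_def)
    show "a (b (\<beta>N x)) = \<beta>N x" if x: "x \<in> N" for x
      using a(3)[OF conj_closed'[OF h x]] b(3)[OF x] h N_carrier[OF x] by (simp add: m_assoc cancel_left)
  qed (simp_all add: y)
  have ba: "b (a y) = y" if y: "y \<in> carrier BN" for y
  proof (rule bohr_N_dense_eq[OF BN.Hausdorff])
    show "continuous_map TBN TBN (\<lambda>y. b (a y))" using continuous_map_compose[OF a(2) b(2)] by (simp add: comp_def)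
    show "b (a (\<beta>N x)) = \<beta>N x" if x: "x \<in> N" for x
      using b(3)[OF conj_closed[OF h x]] a(3)[OF x] h N_carrier[OF x] by (simp add: m_assoc cancel_left)
  qed (simp_all add: y)
  let ?P = "\<lambda>a. a \<in> auto BN \<and> continuous_map TBN TBN a \<and> (\<forall>x\<in>N. a (\<beta>N x) = \<beta>N (h \<otimes> x \<otimes> inv h))"
  define a' where "a' = restrict a (carrier BN)"
  have "bij_betw a' (carrier BN) (carrier BN)"
    by (rule bij_betw_byWitness[where f' = b]) (use ac bc ab ba in \<open>auto simp: a'_def\<close>)
  moreover have "a' \<in> hom BN BN" using a(1) by (auto simp: a'_def hom_def)
  ultimately have "a' \<in> auto BN" by (simp add: auto_def Bij_def) (simp add: a'_def)
  moreover have "continuous_map TBN TBN a'" by (rule continuous_map_eq[OF a(2)]) (simp add: a'_def)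
  ultimately have 1: "?P a'" using a(3) \<beta>N_closed by (simp add: a'_def)
  have "\<exists>!a. ?P a"
  proof (rule ex1I[of ?P, OF 1])
    fix c assume c: "?P c"
    show "c = a'"
    proof (rule extensionalityI[of _ "carrier BN"])
      fix y assume y: "y \<in> carrier BN"
      show "c y = a' y" by (rule bohr_N_dense_eq[OF BN.Hausdorff]) (use c 1 y in auto)
    qed (use c in \<open>auto simp: auto_def Bij_def a'_def\<close>)
  qed
  then have "?P (THE a. ?P a)" by (rule theI')
  then have "?P (bohr_act G N BN TBN \<beta>N h)" by (simp add: bohr_act_def)
  then show "bohr_act G N BN TBN \<beta>N h \<in> auto BN"
    "continuous_map TBN TBN (bohr_act G N BN TBN \<beta>N h)"
    "\<And>x. x \<in> N \<Longrightarrow> bohr_act G N BN TBN \<beta>N h (\<beta>N x) = \<beta>N (h \<otimes> x \<otimes> inv h)"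
    by blast+
qed

lemma \<phi>N_bohr_act:
  assumes h: "h \<in> carrier G" and y: "y \<in> carrier BN"
  shows "\<phi>N (bohr_act G N BN TBN \<beta>N h y) = \<beta>G h \<otimes>\<^bsub>BG\<^esub> \<phi>N y \<otimes>\<^bsub>BG\<^esub> inv\<^bsub>BG\<^esub> \<beta>G h"
proof (rule bohr_N_dense_eq[OF BG.Hausdorff])
  note bh = \<beta>G_closed[OF h]
  show "continuous_map TBN TBG (\<lambda>y. \<phi>N (bohr_act G N BN TBN \<beta>N h y))"
    using continuous_map_compose[OF bohr_act(2)[OF h] \<phi>N_continuous] by (simp add: comp_def)
  show "continuous_map TBN TBG (\<lambda>y. \<beta>G h \<otimes>\<^bsub>BG\<^esub> \<phi>N y \<otimes>\<^bsub>BG\<^esub> inv\<^bsub>BG\<^esub> \<beta>G h)"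
    using bh by (intro BG.continuous_map_mult_group \<phi>N_continuous) auto
  fix x assume x: "x \<in> N"
  have "\<beta>G (h \<otimes> x \<otimes> inv h) = \<beta>G h \<otimes>\<^bsub>BG\<^esub> \<beta>G x \<otimes>\<^bsub>BG\<^esub> inv\<^bsub>BG\<^esub> \<beta>G h"
  proof -
    have "\<beta>G \<in> hom G BG" using \<beta>G_closed \<beta>G_mult by (auto simp: hom_def)
    then interpret b: group_hom G BG \<beta>G
      using is_group BG.is_group by (simp add: group_hom_def group_hom_axioms_def)
    show ?thesis using h N_carrier[OF x] by simp
  qed
  then show "\<phi>N (bohr_act G N BN TBN \<beta>N h (\<beta>N x)) = \<beta>G h \<otimes>\<^bsub>BG\<^esub> \<phi>N (\<beta>N x) \<otimes>\<^bsub>BG\<^esub> inv\<^bsub>BG\<^esub> \<beta>G h"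
    using bohr_act(3)[OF h x] \<phi>N_\<beta>N[OF conj_closed[OF h x]] \<phi>N_\<beta>N[OF x] by simp
qed (rule y)

abbreviation KN where "KN \<equiv> TBG closure_of (\<beta>G ` N)"

lemma KN_carrier: "KN \<subseteq> carrier BG" using closure_of_subset_topspace[of TBG] by simp

lemma KN_subgroup: "subgroup KN BG"
proof (rule subgroup_closure_of)
  show "topological_group BG TBG" using BG.compact_group by (simp add: compact_group_def)
  have "\<beta>G \<in> hom G BG" using \<beta>G_closed \<beta>G_mult by (auto simp: hom_def)
  then interpret b: group_hom G BG \<beta>G
    using is_group BG.is_group by (simp add: group_hom_def group_hom_axioms_def)
  show "subgroup (\<beta>G ` N) BG" by (rule b.subgroup_img_is_subgroup[OF N_subgroup])
qed

text \<open>The set is invariant under conjugation by the image of \<open>G\<close>, which is dense, and the elements that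
  conjugate \<open>z\<close> into the closed set form a closed set.\<close>

lemma KN_conj:
  assumes g: "g \<in> carrier BG" and z: "z \<in> KN"
  shows "g \<otimes>\<^bsub>BG\<^esub> z \<otimes>\<^bsub>BG\<^esub> inv\<^bsub>BG\<^esub> g \<in> KN"
proof -
  have zc: "z \<in> carrier BG" using z KN_carrier by blast
  have 1: "\<beta>G h \<otimes>\<^bsub>BG\<^esub> z \<otimes>\<^bsub>BG\<^esub> inv\<^bsub>BG\<^esub> \<beta>G h \<in> KN" if h: "h \<in> carrier G" for h
  proof -
    note bh = \<beta>G_closed[OF h]
    have "continuous_map TBG TBG (\<lambda>z. \<beta>G h \<otimes>\<^bsub>BG\<^esub> z \<otimes>\<^bsub>BG\<^esub> inv\<^bsub>BG\<^esub> \<beta>G h)"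
      using bh by (intro BG.continuous_map_mult_group) auto
    from continuous_map_image_closure_subset[OF this, of "\<beta>G ` N"]
    have "(\<lambda>z. \<beta>G h \<otimes>\<^bsub>BG\<^esub> z \<otimes>\<^bsub>BG\<^esub> inv\<^bsub>BG\<^esub> \<beta>G h) ` KN \<subseteq>
        TBG closure_of ((\<lambda>z. \<beta>G h \<otimes>\<^bsub>BG\<^esub> z \<otimes>\<^bsub>BG\<^esub> inv\<^bsub>BG\<^esub> \<beta>G h) ` \<beta>G ` N)" .
    also have "\<dots> \<subseteq> KN"
    proof (rule closure_of_mono, clarify)
      fix x assume x: "x \<in> N"
      have "\<beta>G h \<otimes>\<^bsub>BG\<^esub> \<beta>G x \<otimes>\<^bsub>BG\<^esub> inv\<^bsub>BG\<^esub> \<beta>G h = \<phi>N (\<beta>N (h \<otimes> x \<otimes> inv h))"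
        using \<phi>N_bohr_act[OF h \<beta>N_closed[OF x]] bohr_act(3)[OF h x] \<phi>N_\<beta>N[OF x] by simp
      also have "\<dots> = \<beta>G (h \<otimes> x \<otimes> inv h)" by (rule \<phi>N_\<beta>N[OF conj_closed[OF h x]])
      finally show "\<beta>G h \<otimes>\<^bsub>BG\<^esub> \<beta>G x \<otimes>\<^bsub>BG\<^esub> inv\<^bsub>BG\<^esub> \<beta>G h \<in> \<beta>G ` N" using conj_closed[OF h x] by simp
    qed
    finally show ?thesis using z by blast
  qed
  show ?thesis
  proof (rule forall_in_closure_of[of g TBG "\<beta>G ` carrier G" "\<lambda>g. g \<otimes>\<^bsub>BG\<^esub> z \<otimes>\<^bsub>BG\<^esub> inv\<^bsub>BG\<^esub> g \<in> KN"])
    show "g \<in> TBG closure_of \<beta>G ` carrier G" using g bohr_G by (simp add: bohr_compactification_def)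
    have "continuous_map TBG TBG (\<lambda>g. g \<otimes>\<^bsub>BG\<^esub> z \<otimes>\<^bsub>BG\<^esub> inv\<^bsub>BG\<^esub> g)"
      using zc by (intro BG.continuous_map_mult_group BG.continuous_map_inv_group) auto
    from closedin_continuous_map_preimage[OF this closedin_closure_of]
    show "closedin TBG {g \<in> topspace TBG. g \<otimes>\<^bsub>BG\<^esub> z \<otimes>\<^bsub>BG\<^esub> inv\<^bsub>BG\<^esub> g \<in> KN}" .
  qed (use 1 in auto)
qed

end

lemma image_rcoset:
  assumes "group B" "a \<in> hom B B" "a ` C = C" "C \<subseteq> carrier B" "x \<in> carrier B"
  shows "a ` (C #>\<^bsub>B\<^esub> x) = C #>\<^bsub>B\<^esub> a x"
proof -
  have "a ` (C #>\<^bsub>B\<^esub> x) = (\<lambda>c. a (c \<otimes>\<^bsub>B\<^esub> x)) ` C" by (auto simp: r_coset_def)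
  also have "\<dots> = (\<lambda>c. a c \<otimes>\<^bsub>B\<^esub> a x) ` C"
    using assms by (intro image_cong refl) (auto simp: hom_def)
  also have "\<dots> = (\<lambda>c. c \<otimes>\<^bsub>B\<^esub> a x) ` a ` C" by (simp add: image_image)
  finally show ?thesis unfolding assms(3) by (auto simp: r_coset_def)
qed

context semidirect_bohr
begin

abbreviation CN where "CN \<equiv> per_kernel G T N H BN TBN \<beta>N"
abbreviation Q where "Q \<equiv> BN Mod CN"
abbreviation TQ where "TQ \<equiv> coset_topology BN TBN CN"
abbreviation GK where "GK \<equiv> BG\<lparr>carrier := KN\<rparr>"
abbreviation TK where "TK \<equiv> subtopology TBG KN"

definition \<psi> :: "'c set \<Rightarrow> 'b" where "\<psi> = (\<lambda>S. the_elem (\<phi>N ` S))"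

lemma topspace_TK [simp]: "topspace TK = KN" using KN_carrier by auto

lemma \<phi>N_image: "\<phi>N ` carrier BN = KN"
proof -
  have "\<phi>N ` topspace TBN = KN"
  proof (rule compact_image_eq_closure[OF BN.compact BG.Hausdorff \<phi>N_continuous])
    show "\<beta>G ` N \<subseteq> \<phi>N ` topspace TBN"
    proof
      fix z assume "z \<in> \<beta>G ` N"
      then obtain x where "x \<in> N" "z = \<phi>N (\<beta>N x)" using \<phi>N_\<beta>N by force
      then show "z \<in> \<phi>N ` topspace TBN" using \<beta>N_closed by simp
    qed
    have "topspace TBN = TBN closure_of (\<beta>N ` N)" using bohr_N by (simp add: bohr_compactification_def)
    moreover have "\<phi>N ` \<beta>N ` N = \<beta>G ` N" using \<phi>N_\<beta>N by (simp add: image_image)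
    ultimately show "\<phi>N ` topspace TBN \<subseteq> KN"
      using continuous_map_image_closure_subset[OF \<phi>N_continuous, of "\<beta>N ` N"] by simp
  qed
  then show ?thesis by simp
qed

lemma group_GK: "group GK" by (rule subgroup.subgroup_is_group[OF KN_subgroup BG.is_group])

lemma kernel_\<phi>N_GK: "kernel BN GK \<phi>N = CN" using kernel_\<phi>N by (simp add: kernel_def)

lemma \<phi>N_GK_hom: "group_hom BN GK \<phi>N"
proof -
  have "\<phi>N \<in> hom BN GK" using group_hom.hom_mult[OF \<phi>N_group_hom] \<phi>N_image by (auto simp: hom_def)
  then show ?thesis using BN.is_group group_GK by (simp add: group_hom_def group_hom_axioms_def)
qed

lemma CN_normal: "CN \<lhd> BN" using group_hom.normal_kernel[OF \<phi>N_GK_hom] by (simp add: kernel_\<phi>N_GK)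

lemma CN_carrier: "CN \<subseteq> carrier BN" using CN_normal by (simp add: normal_imp_subgroup subgroup.subset)

lemma group_Q: "group Q" by (rule normal.factorgroup_is_group[OF CN_normal])

lemma carrier_Q: "carrier Q = (\<lambda>x. CN #>\<^bsub>BN\<^esub> x) ` carrier BN"
  by (auto simp: FactGroup_def RCOSETS_def)

lemma topspace_TQ [simp]: "topspace TQ = carrier Q" by (simp add: topspace_coset_topology carrier_Q)

lemma \<psi>_iso: "\<psi> \<in> iso Q GK"
  using group_hom.FactGroup_iso_set[OF \<phi>N_GK_hom] by (simp add: \<phi>N_image kernel_\<phi>N_GK \<psi>_def)

lemma \<psi>_coset: assumes x: "x \<in> carrier BN" shows "\<psi> (CN #>\<^bsub>BN\<^esub> x) = \<phi>N x"
proof -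
  have c: "\<phi>N (c \<otimes>\<^bsub>BN\<^esub> x) = \<phi>N x" if "c \<in> CN" for c
  proof -
    have "c \<in> carrier BN" "\<phi>N c = \<one>\<^bsub>BG\<^esub>" using that by (auto simp: kernel_\<phi>N[symmetric])
    then show ?thesis using group_hom.hom_mult[OF \<phi>N_group_hom, of c x] x \<phi>N_closed[OF x] by simp
  qed
  have "\<one>\<^bsub>BN\<^esub> \<in> CN" using CN_normal by (simp add: normal_imp_subgroup subgroup.one_closed)
  moreover have "\<phi>N ` (CN #>\<^bsub>BN\<^esub> x) = (\<lambda>c. \<phi>N (c \<otimes>\<^bsub>BN\<^esub> x)) ` CN" by (auto simp only: r_coset_def)
  moreover have "(\<lambda>c. \<phi>N (c \<otimes>\<^bsub>BN\<^esub> x)) ` CN = (\<lambda>c. \<phi>N x) ` CN" by (rule image_cong[OF refl c])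
  ultimately have "\<phi>N ` (CN #>\<^bsub>BN\<^esub> x) = {\<phi>N x}" by (simp only: image_constant)
  then show ?thesis by (simp add: \<psi>_def)
qed

lemma \<psi>_closed: "S \<in> carrier Q \<Longrightarrow> \<psi> S \<in> KN" and \<psi>_mult: "S \<in> carrier Q \<Longrightarrow> S' \<in> carrier Q \<Longrightarrow> \<psi> (S \<otimes>\<^bsub>Q\<^esub> S') = \<psi> S \<otimes>\<^bsub>BG\<^esub> \<psi> S'"
  and \<psi>_inj: "inj_on \<psi> (carrier Q)" and \<psi>_image: "\<psi> ` carrier Q = KN"
proof -
  have i: "\<psi> \<in> hom Q GK" "bij_betw \<psi> (carrier Q) (carrier GK)" using \<psi>_iso by (simp_all add: iso_def)
  show "S \<in> carrier Q \<Longrightarrow> \<psi> S \<in> KN" using Group.hom_in_carrier[OF i(1)] by simp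
  show "S \<in> carrier Q \<Longrightarrow> S' \<in> carrier Q \<Longrightarrow> \<psi> (S \<otimes>\<^bsub>Q\<^esub> S') = \<psi> S \<otimes>\<^bsub>BG\<^esub> \<psi> S'"
    using hom_mult[OF i(1)] by simp
  show "inj_on \<psi> (carrier Q)" "\<psi> ` carrier Q = KN" using i(2) by (simp_all add: bij_betw_def)
qed

lemma \<psi>_carrier: "S \<in> carrier Q \<Longrightarrow> \<psi> S \<in> carrier BG" using \<psi>_closed KN_carrier by blast

lemma \<psi>_continuous: "continuous_map TQ TBG \<psi>"
proof (rule continuous_compose_quotient_map[OF quotient_map_coset_topology])
  show "continuous_map TBN TBG (\<psi> \<circ> (\<lambda>x. CN #>\<^bsub>BN\<^esub> x))"
    by (rule continuous_map_eq[OF \<phi>N_continuous]) (simp add: \<psi>_coset)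
qed

lemma compact_TQ: "compact_space TQ"
proof -
  note q = quotient_map_coset_topology[of TBN BN CN]
  show ?thesis
    using image_compactin[OF _ quotient_imp_continuous_map[OF q], of "topspace TBN"] BN.compact
      quotient_imp_surjective_map[OF q] by (simp add: compact_space_def)
qed

lemma \<psi>_homeomorphic: "homeomorphic_map TQ TK \<psi>"
proof (rule continuous_compact_Hausdorff_homeomorphic_map[OF compact_TQ])
  show "Hausdorff_space TK" using BG.Hausdorff by (rule Hausdorff_space_subtopology)
  show "continuous_map TQ TK \<psi>" using \<psi>_continuous \<psi>_closed by (simp add: continuous_map_in_subtopology image_subset_iff del: topspace_prod_topology)
qed (use \<psi>_image \<psi>_inj topspace_TK in \<open>simp_all del: topspace_subtopology\<close>)

definition \<psi>inv :: "'b \<Rightarrow> 'c set" where "\<psi>inv = inv_into (carrier Q) \<psi>"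

lemma \<psi>inv_closed: "z \<in> KN \<Longrightarrow> \<psi>inv z \<in> carrier Q" and \<psi>_\<psi>inv: "z \<in> KN \<Longrightarrow> \<psi> (\<psi>inv z) = z"
  unfolding \<psi>inv_def \<psi>_image[symmetric] by (rule inv_into_into f_inv_into_f; assumption)+

lemma \<psi>inv_continuous: "continuous_map TK TQ \<psi>inv"
proof -
  obtain g where g: "homeomorphic_maps TQ TK \<psi> g" using \<psi>_homeomorphic by (auto simp: homeomorphic_map_maps)
  then have gc: "continuous_map TK TQ g" and gi: "\<And>z. z \<in> KN \<Longrightarrow> \<psi> (g z) = z"
    using topspace_TK by (auto simp: homeomorphic_maps_def)
  show ?thesis
  proof (rule continuous_map_eq[OF gc])
    fix z assume "z \<in> topspace TK"
    then have z: "z \<in> KN" by simp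
    have "g z \<in> carrier Q" using continuous_map_funspace[OF gc] z topspace_TK topspace_TQ by blast
    then show "g z = \<psi>inv z" using inj_onD[OF \<psi>_inj] gi[OF z] \<psi>inv_closed[OF z] \<psi>_\<psi>inv[OF z] by metis
  qed
qed

text \<open>Conjugation by an element of \<open>Bohr(G)\<close>, carried over from the closure of the image of \<open>N\<close> to the
  quotient of \<open>Bohr(N)\<close>.\<close>

definition cj :: "'b \<Rightarrow> 'c set \<Rightarrow> 'c set" where
  "cj a = (\<lambda>S \<in> carrier Q. \<psi>inv (a \<otimes>\<^bsub>BG\<^esub> \<psi> S \<otimes>\<^bsub>BG\<^esub> inv\<^bsub>BG\<^esub> a))"

lemma cj_closed: "a \<in> carrier BG \<Longrightarrow> S \<in> carrier Q \<Longrightarrow> cj a S \<in> carrier Q"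
  and \<psi>_cj: "a \<in> carrier BG \<Longrightarrow> S \<in> carrier Q \<Longrightarrow> \<psi> (cj a S) = a \<otimes>\<^bsub>BG\<^esub> \<psi> S \<otimes>\<^bsub>BG\<^esub> inv\<^bsub>BG\<^esub> a"
  using KN_conj \<psi>_closed by (simp_all add: cj_def \<psi>inv_closed \<psi>_\<psi>inv)

lemma Q_eqI: "S \<in> carrier Q \<Longrightarrow> S' \<in> carrier Q \<Longrightarrow> \<psi> S = \<psi> S' \<Longrightarrow> S = S'"
  using inj_onD[OF \<psi>_inj] by blast

lemma BG_cancel:
  assumes "a \<in> carrier BG" "x \<in> carrier BG"
  shows "inv\<^bsub>BG\<^esub> a \<otimes>\<^bsub>BG\<^esub> (a \<otimes>\<^bsub>BG\<^esub> x) = x" "a \<otimes>\<^bsub>BG\<^esub> (inv\<^bsub>BG\<^esub> a \<otimes>\<^bsub>BG\<^esub> x) = x"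
  using assms by (simp_all flip: BG.m_assoc)

lemma cj_compose:
  assumes a: "a \<in> carrier BG" and b: "b \<in> carrier BG" and S: "S \<in> carrier Q"
  shows "cj (a \<otimes>\<^bsub>BG\<^esub> b) S = cj a (cj b S)"
  by (rule Q_eqI) (use assms \<psi>_carrier[OF S] in \<open>simp_all add: cj_closed \<psi>_cj BG.m_assoc BG.inv_mult_group\<close>)

lemma cj_one: assumes S: "S \<in> carrier Q" shows "cj \<one>\<^bsub>BG\<^esub> S = S"
  by (rule Q_eqI) (use assms \<psi>_carrier[OF S] in \<open>simp_all add: cj_closed \<psi>_cj\<close>)

lemma cj_auto: assumes a: "a \<in> carrier BG" shows "cj a \<in> auto Q"
proof -
  have "cj a (S \<otimes>\<^bsub>Q\<^esub> S') = cj a S \<otimes>\<^bsub>Q\<^esub> cj a S'" if S: "S \<in> carrier Q" "S' \<in> carrier Q" for S S'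
  proof (rule Q_eqI)
    have SS: "S \<otimes>\<^bsub>Q\<^esub> S' \<in> carrier Q" by (rule monoid.m_closed[OF group.is_monoid[OF group_Q] S])
    then show "cj a (S \<otimes>\<^bsub>Q\<^esub> S') \<in> carrier Q" using cj_closed a by blast
    show "cj a S \<otimes>\<^bsub>Q\<^esub> cj a S' \<in> carrier Q"
      by (rule monoid.m_closed[OF group.is_monoid[OF group_Q]]) (use S a cj_closed in auto)
    show "\<psi> (cj a (S \<otimes>\<^bsub>Q\<^esub> S')) = \<psi> (cj a S \<otimes>\<^bsub>Q\<^esub> cj a S')"
      unfolding \<psi>_mult[OF cj_closed[OF a S(1)] cj_closed[OF a S(2)]] \<psi>_cj[OF a SS] \<psi>_mult[OF S]
        \<psi>_cj[OF a S(1)] \<psi>_cj[OF a S(2)]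
      using a \<psi>_carrier[OF S(1)] \<psi>_carrier[OF S(2)] by (simp add: BG.m_assoc BG_cancel)
  qed
  then have "cj a \<in> hom Q Q" using cj_closed[OF a] by (simp add: hom_def Pi_iff)
  moreover have "bij_betw (cj a) (carrier Q) (carrier Q)"
  proof (rule bij_betw_byWitness[where f' = "cj (inv\<^bsub>BG\<^esub> a)"])
    show "\<forall>S\<in>carrier Q. cj (inv\<^bsub>BG\<^esub> a) (cj a S) = S" "\<forall>S\<in>carrier Q. cj a (cj (inv\<^bsub>BG\<^esub> a) S) = S"
      using a by (simp_all flip: cj_compose add: cj_one)
  qed (use a cj_closed in auto)
  moreover have "cj a \<in> extensional (carrier Q)" by (simp add: cj_def)
  ultimately show ?thesis by (simp add: auto_def Bij_def)
qed

lemma cj_hom: "cj \<in> hom BG (AutoGroup Q)"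
proof -
  have "cj (a \<otimes>\<^bsub>BG\<^esub> b) = cj a \<otimes>\<^bsub>AutoGroup Q\<^esub> cj b" if ab: "a \<in> carrier BG" "b \<in> carrier BG" for a b
  proof -
    have B: "cj a \<in> Bij (carrier Q)" "cj b \<in> Bij (carrier Q)" using cj_auto ab by (auto simp: auto_def)
    have "cj (a \<otimes>\<^bsub>BG\<^esub> b) = compose (carrier Q) (cj a) (cj b)"
    proof (rule extensionalityI[of _ "carrier Q"])
      show "cj (a \<otimes>\<^bsub>BG\<^esub> b) S = compose (carrier Q) (cj a) (cj b) S" if "S \<in> carrier Q" for S
        using cj_compose[OF ab that] that by (simp add: compose_def)
    qed (simp_all add: cj_def compose_def)
    then show ?thesis using B by (simp add: AutoGroup_def BijGroup_def)
  qed
  then show ?thesis using cj_auto by (simp add: hom_def AutoGroup_def)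
qed

lemma cj_continuous: "continuous_map (prod_topology TBG TQ) TQ (\<lambda>(a, S). cj a S)"
proof -
  let ?P = "prod_topology TBG TQ"
  let ?f = "\<lambda>p. fst p \<otimes>\<^bsub>BG\<^esub> \<psi> (snd p) \<otimes>\<^bsub>BG\<^esub> inv\<^bsub>BG\<^esub> (fst p)"
  have f: "continuous_map ?P TBG fst" by (rule continuous_map_fst)
  have p: "continuous_map ?P TBG (\<lambda>p. \<psi> (snd p))"
    using continuous_map_compose[OF continuous_map_snd \<psi>_continuous] by (simp add: comp_def)
  have c: "continuous_map ?P TBG ?f"
    by (intro BG.continuous_map_mult_group BG.continuous_map_inv_group f p)
  have "?f p \<in> KN" if "p \<in> topspace ?P" for p
    using KN_conj[of "fst p" "\<psi> (snd p)"] \<psi>_closed[of "snd p"] that by auto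
  with c have "continuous_map ?P TK ?f" by (simp add: continuous_map_in_subtopology image_subset_iff del: topspace_prod_topology)
  from continuous_map_compose[OF this \<psi>inv_continuous]
  show ?thesis by (rule continuous_map_eq) (auto simp: cj_def)
qed

lemma bohr_act_CN:
  assumes h: "h \<in> carrier G" shows "bohr_act G N BN TBN \<beta>N h ` CN = CN"
proof -
  let ?a = "bohr_act G N BN TBN \<beta>N h"
  note bh = \<beta>G_closed[OF h]
  have a: "bij_betw ?a (carrier BN) (carrier BN)" using bohr_act(1)[OF h] by (simp add: auto_def Bij_def)
  have iff: "?a y \<in> CN \<longleftrightarrow> y \<in> CN" if y: "y \<in> carrier BN" for y
  proof -
    have ay: "?a y \<in> carrier BN" using a y by (auto simp: bij_betw_def)
    have c: "\<phi>N y \<in> carrier BG" by (rule \<phi>N_closed[OF y])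
    have "\<beta>G h \<otimes>\<^bsub>BG\<^esub> \<phi>N y \<otimes>\<^bsub>BG\<^esub> inv\<^bsub>BG\<^esub> \<beta>G h = \<one>\<^bsub>BG\<^esub> \<longleftrightarrow> \<phi>N y = \<one>\<^bsub>BG\<^esub>"
    proof
      assume e: "\<beta>G h \<otimes>\<^bsub>BG\<^esub> \<phi>N y \<otimes>\<^bsub>BG\<^esub> inv\<^bsub>BG\<^esub> \<beta>G h = \<one>\<^bsub>BG\<^esub>"
      have "\<phi>N y = inv\<^bsub>BG\<^esub> \<beta>G h \<otimes>\<^bsub>BG\<^esub> (\<beta>G h \<otimes>\<^bsub>BG\<^esub> \<phi>N y \<otimes>\<^bsub>BG\<^esub> inv\<^bsub>BG\<^esub> \<beta>G h) \<otimes>\<^bsub>BG\<^esub> \<beta>G h"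
        using bh c by (simp add: BG.m_assoc BG_cancel)
      then show "\<phi>N y = \<one>\<^bsub>BG\<^esub>" unfolding e using bh by simp
    qed (use bh in simp)
    then show ?thesis
      using y ay unfolding kernel_\<phi>N[symmetric] by (simp add: \<phi>N_bohr_act[OF h y])
  qed
  show ?thesis
  proof
    show "?a ` CN \<subseteq> CN" using iff CN_carrier by auto
    show "CN \<subseteq> ?a ` CN"
    proof
      fix z assume z: "z \<in> CN"
      then obtain y where y: "y \<in> carrier BN" "z = ?a y" using a CN_carrier by (auto simp: bij_betw_def)
      then show "z \<in> ?a ` CN" using iff[OF y(1)] z by blast
    qed
  qed
qed

lemma cj_\<beta>G:
  assumes h: "h \<in> carrier G" and S: "S \<in> carrier Q"
  shows "cj (\<beta>G h) S = bohr_act G N BN TBN \<beta>N h ` S"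
proof -
  let ?a = "bohr_act G N BN TBN \<beta>N h"
  obtain x where x: "x \<in> carrier BN" "S = CN #>\<^bsub>BN\<^esub> x" using S by (auto simp: carrier_Q)
  have a: "?a \<in> hom BN BN" using bohr_act(1)[OF h] by (simp add: auto_def)
  then have ax: "?a x \<in> carrier BN" using x by (auto simp: hom_def)
  have im: "?a ` S = CN #>\<^bsub>BN\<^esub> ?a x"
    unfolding x(2) by (rule image_rcoset[OF BN.is_group a bohr_act_CN[OF h] CN_carrier x(1)])
  show ?thesis unfolding im
  proof (rule Q_eqI)
    show "CN #>\<^bsub>BN\<^esub> ?a x \<in> carrier Q" using ax by (simp add: carrier_Q)
    have "\<psi> (cj (\<beta>G h) S) = \<beta>G h \<otimes>\<^bsub>BG\<^esub> \<phi>N x \<otimes>\<^bsub>BG\<^esub> inv\<^bsub>BG\<^esub> \<beta>G h"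
      using \<psi>_cj[OF \<beta>G_closed[OF h] S] by (simp add: x(2) \<psi>_coset[OF x(1)])
    then show "\<psi> (cj (\<beta>G h) S) = \<psi> (CN #>\<^bsub>BN\<^esub> ?a x)"
      by (simp add: \<psi>_coset[OF ax] \<phi>N_bohr_act[OF h x(1)])
  qed (rule cj_closed[OF \<beta>G_closed[OF h] S])
qed

end

locale semidirect_bohr_factors = semidirect_bohr G T N H BG TBG \<beta>G BN TBN \<beta>N \<phi>N
  for G :: "('g, 'm) monoid_scheme" (structure) and T N H
    and BG :: "('b, 'n) monoid_scheme" and TBG \<beta>G
    and BN :: "('c, 'k) monoid_scheme" and TBN \<beta>N \<phi>N +
  fixes BH :: "('d, 'l) monoid_scheme" and TBH :: "'d topology" and \<beta>H :: "'g \<Rightarrow> 'd" and \<phi>H :: "'d \<Rightarrow> 'b"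
  assumes bohr_H: "bohr_compactification (G\<lparr>carrier := H\<rparr>) TH BH TBH \<beta>H"
    and \<phi>H_cont_hom: "\<phi>H \<in> cont_hom BH TBH BG TBG"
    and \<phi>H_\<beta>H: "\<And>x. x \<in> H \<Longrightarrow> \<phi>H (\<beta>H x) = \<beta>G x"
begin

sublocale BH: compact_top_group BH TBH
proof -
  have "compact_group BH TBH" using bohr_H by (simp add: bohr_compactification_def)
  moreover from this have "group BH" by (simp add: compact_group_def topological_group_def)
  ultimately show "compact_top_group BH TBH"
    by (simp add: compact_top_group_def compact_top_group_axioms_def)
qed

lemma \<beta>H_closed: "x \<in> H \<Longrightarrow> \<beta>H x \<in> carrier BH"
  and \<beta>H_mult: "x \<in> H \<Longrightarrow> y \<in> H \<Longrightarrow> \<beta>H (x \<otimes> y) = \<beta>H x \<otimes>\<^bsub>BH\<^esub> \<beta>H y"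
  and \<beta>H_continuous: "continuous_map TH TBH \<beta>H"
  using bohr_H by (auto simp: bohr_compactification_def cont_hom_def hom_def)

lemma \<phi>H_closed: "y \<in> carrier BH \<Longrightarrow> \<phi>H y \<in> carrier BG"
  and \<phi>H_mult: "y \<in> carrier BH \<Longrightarrow> z \<in> carrier BH \<Longrightarrow> \<phi>H (y \<otimes>\<^bsub>BH\<^esub> z) = \<phi>H y \<otimes>\<^bsub>BG\<^esub> \<phi>H z"
  and \<phi>H_continuous: "continuous_map TBH TBG \<phi>H"
  using \<phi>H_cont_hom by (auto simp: cont_hom_def hom_def)

abbreviation KH where "KH \<equiv> TBG closure_of (\<beta>G ` H)"

text \<open>The projection of \<open>G\<close> onto \<open>H\<close> with kernel \<open>N\<close> extends to the Bohr compactifications. The extension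
  is a left inverse of \<open>\<phi>H\<close> and trivial on the closure of the image of \<open>N\<close>.\<close>

lemma bohr_projection:
  obtains q where "q \<in> hom BG BH" "\<And>y. y \<in> carrier BH \<Longrightarrow> q (\<phi>H y) = y" "\<And>z. z \<in> KN \<Longrightarrow> q z = \<one>\<^bsub>BH\<^esub>"
proof -
  have "(\<lambda>x. \<beta>H (pH x)) \<in> cont_hom G T BH TBH"
    using continuous_map_compose[OF pH_continuous \<beta>H_continuous] pH_closed
    by (auto simp: cont_hom_def hom_def comp_def decomp_mult(2) \<beta>H_mult \<beta>H_closed)
  from bohr_compactification_universal[OF bohr_G BH.compact_group this]
  obtain q where q: "q \<in> hom BG BH" "continuous_map TBG TBH q" "\<And>x. x \<in> carrier G \<Longrightarrow> \<beta>H (pH x) = q (\<beta>G x)"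
    by (auto simp: cont_hom_def)
  have q1: "q (\<phi>H y) = y" if y: "y \<in> carrier BH" for y
  proof (rule bohr_dense_eq[OF bohr_H BH.Hausdorff])
    show "continuous_map TBH TBH (\<lambda>y. q (\<phi>H y))"
      using continuous_map_compose[OF \<phi>H_continuous q(2)] by (simp add: comp_def)
    fix x assume "x \<in> carrier (G\<lparr>carrier := H\<rparr>)"
    then have x: "x \<in> H" by simp
    have "pH x = x" using decomp_unique(2)[OF one_N x] H_carrier[OF x] by simp
    then show "q (\<phi>H (\<beta>H x)) = \<beta>H x" using q(3)[OF H_carrier[OF x]] \<phi>H_\<beta>H[OF x] by simp
  qed (use y in simp_all)
  have q2: "q z = \<one>\<^bsub>BH\<^esub>" if z: "z \<in> KN" for z
  proof (rule forall_in_closure_of_eq[OF z BH.Hausdorff q(2)])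
    fix z assume "z \<in> \<beta>G ` N"
    then obtain x where x: "x \<in> N" "z = \<beta>G x" by blast
    have "pH x = \<one>" using decomp_unique(2)[OF x(1) one_H] N_carrier[OF x(1)] by simp
    moreover have "\<beta>H \<one> = \<one>\<^bsub>BH\<^esub>"
      using BH.r_cancel_one'[of "\<beta>H \<one>" "\<beta>H \<one>"] \<beta>H_mult[OF one_H one_H] \<beta>H_closed[OF one_H] by simp
    ultimately show "q z = \<one>\<^bsub>BH\<^esub>" using q(3)[OF N_carrier[OF x(1)]] x(2) by simp
  qed simp
  show thesis by (rule that[of q]) (fact q(1) q1 q2)+
qed

lemma \<phi>H_inj: "inj_on \<phi>H (carrier BH)"
proof -
  obtain q where "\<And>y. y \<in> carrier BH \<Longrightarrow> q (\<phi>H y) = y" using bohr_projection by metis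
  then show ?thesis by (rule inj_on_inverseI)
qed

lemma \<phi>H_image: "\<phi>H ` carrier BH = KH"
proof -
  have "\<phi>H ` topspace TBH = KH"
  proof (rule compact_image_eq_closure[OF BH.compact BG.Hausdorff \<phi>H_continuous])
    have im: "\<phi>H ` \<beta>H ` H = \<beta>G ` H" using \<phi>H_\<beta>H by (simp add: image_image)
    moreover have "\<beta>H ` H \<subseteq> topspace TBH" using \<beta>H_closed by auto
    ultimately show "\<beta>G ` H \<subseteq> \<phi>H ` topspace TBH" by blast
    have "topspace TBH = TBH closure_of (\<beta>H ` H)" using bohr_H by (simp add: bohr_compactification_def)
    then show "\<phi>H ` topspace TBH \<subseteq> KH"
      using continuous_map_image_closure_subset[OF \<phi>H_continuous, of "\<beta>H ` H"] im by simp
  qed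
  then show ?thesis by simp
qed

lemma \<phi>H_topological_group_iso:
  "topological_group_iso BH TBH (BG\<lparr>carrier := KH\<rparr>) (subtopology TBG KH) \<phi>H"
proof -
  have KH: "KH \<subseteq> topspace TBG" by (rule closure_of_subset_topspace)
  have "\<phi>H \<in> iso BH (BG\<lparr>carrier := KH\<rparr>)"
    using \<phi>H_inj \<phi>H_image \<phi>H_mult by (auto simp: iso_def bij_betw_def hom_def)
  moreover have "homeomorphic_map TBH (subtopology TBG KH) \<phi>H"
  proof (rule continuous_compact_Hausdorff_homeomorphic_map[OF BH.compact])
    show "Hausdorff_space (subtopology TBG KH)" using BG.Hausdorff by (rule Hausdorff_space_subtopology)
    show "continuous_map TBH (subtopology TBG KH) \<phi>H"
      using \<phi>H_continuous \<phi>H_image by (auto simp: continuous_map_in_subtopology)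
    show "\<phi>H ` topspace TBH = topspace (subtopology TBG KH)"
      using \<phi>H_image KH by (simp add: Int_absorb1)
  qed (simp add: \<phi>H_inj)
  ultimately show ?thesis by (simp add: topological_group_iso_def)
qed

definition act :: "'d \<Rightarrow> 'c set \<Rightarrow> 'c set" where "act y = cj (\<phi>H y)"

lemma act_hom: "act \<in> hom BH (AutoGroup Q)"
  using cj_hom \<phi>H_closed \<phi>H_mult by (auto simp: act_def[abs_def] hom_def)

lemma act_continuous: "continuous_map (prod_topology TBH TQ) TQ (\<lambda>(y, S). act y S)"
proof -
  have "continuous_map (prod_topology TBH TQ) (prod_topology TBG TQ) (\<lambda>(y, S). (\<phi>H y, S))"
    using \<phi>H_continuous by (simp add: continuous_map_prod_top)
  from continuous_map_compose[OF this cj_continuous] show ?thesis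
    by (simp add: act_def comp_def case_prod_unfold)
qed

text \<open>The image of the compact product contains that of \<open>G\<close>, which is dense, so that the map is onto. It is
  injective since \<open>q\<close> recovers the second factor.\<close>

lemma bohr_semidirect_iso:
  "topological_group_iso (semidirect_product Q BH act) (prod_topology TQ TBH) BG TBG
     (\<lambda>(S, y). \<psi> S \<otimes>\<^bsub>BG\<^esub> \<phi>H y)" (is "topological_group_iso ?P ?T _ _ ?F")
proof -
  obtain q where q: "q \<in> hom BG BH" "\<And>y. y \<in> carrier BH \<Longrightarrow> q (\<phi>H y) = y" "\<And>z. z \<in> KN \<Longrightarrow> q z = \<one>\<^bsub>BH\<^esub>"
    by (rule bohr_projection) (assumption | rule that)+
  have qF: "q (\<psi> S \<otimes>\<^bsub>BG\<^esub> \<phi>H y) = y" if "S \<in> carrier Q" "y \<in> carrier BH" for S y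
  proof -
    have "q (\<psi> S \<otimes>\<^bsub>BG\<^esub> \<phi>H y) = q (\<psi> S) \<otimes>\<^bsub>BH\<^esub> q (\<phi>H y)"
      using q(1) \<psi>_carrier \<phi>H_closed that by (simp add: hom_def)
    then show ?thesis using q(2,3) \<psi>_closed that by simp
  qed
  have inj: "inj_on ?F (carrier Q \<times> carrier BH)"
  proof (rule inj_onI, clarify)
    fix S y S' y' assume S: "S \<in> carrier Q" "S' \<in> carrier Q" and y: "y \<in> carrier BH" "y' \<in> carrier BH"
      and eq: "\<psi> S \<otimes>\<^bsub>BG\<^esub> \<phi>H y = \<psi> S' \<otimes>\<^bsub>BG\<^esub> \<phi>H y'"
    have yy: "y = y'" using qF[OF S(1) y(1)] qF[OF S(2) y(2)] eq by simp
    then have "\<psi> S = \<psi> S'" using eq S y \<psi>_carrier \<phi>H_closed by simp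
    then show "S = S' \<and> y = y'" using yy S Q_eqI by simp
  qed
  have cont: "continuous_map ?T TBG ?F"
  proof -
    have "continuous_map ?T TBG (\<lambda>p. \<psi> (fst p))" "continuous_map ?T TBG (\<lambda>p. \<phi>H (snd p))"
      using continuous_map_compose[OF continuous_map_fst \<psi>_continuous]
        continuous_map_compose[OF continuous_map_snd \<phi>H_continuous] by (simp_all add: comp_def)
    then have "continuous_map ?T TBG (\<lambda>p. \<psi> (fst p) \<otimes>\<^bsub>BG\<^esub> \<phi>H (snd p))"
      by (rule BG.continuous_map_mult_group)
    then show ?thesis by (simp add: case_prod_unfold)
  qed
  have compact: "compact_space ?T" using compact_TQ BH.compact by (simp add: compact_space_prod_topology)
  have tT: "topspace ?T = carrier Q \<times> carrier BH" by simp
  have dense: "TBG closure_of (\<beta>G ` carrier G) = topspace TBG" using bohr_G by (simp add: bohr_compactification_def)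
  have surj: "?F ` topspace ?T = topspace TBG"
    unfolding dense[symmetric]
  proof (rule compact_image_eq_closure[OF compact BG.Hausdorff cont])
    show "\<beta>G ` carrier G \<subseteq> ?F ` topspace ?T"
    proof clarify
      fix g assume g: "g \<in> carrier G"
      note pc = N_carrier[OF pN_closed[OF g]] H_carrier[OF pH_closed[OF g]]
      let ?S = "CN #>\<^bsub>BN\<^esub> \<beta>N (pN g)"
      have "\<beta>G g = \<beta>G (pN g) \<otimes>\<^bsub>BG\<^esub> \<beta>G (pH g)" using \<beta>G_mult[OF pc] by (simp add: decomp_eq[OF g])
      also have "\<dots> = \<psi> ?S \<otimes>\<^bsub>BG\<^esub> \<phi>H (\<beta>H (pH g))"
        by (simp add: \<psi>_coset \<beta>N_closed pN_closed[OF g] \<phi>N_\<beta>N \<phi>H_\<beta>H pH_closed[OF g])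
      finally have "\<beta>G g = ?F (?S, \<beta>H (pH g))" by simp
      moreover have "(?S, \<beta>H (pH g)) \<in> topspace ?T"
        unfolding tT using \<beta>N_closed[OF pN_closed[OF g]] \<beta>H_closed[OF pH_closed[OF g]] by (simp add: carrier_Q)
      ultimately show "\<beta>G g \<in> ?F ` topspace ?T" by (rule image_eqI)
    qed
    show "?F ` topspace ?T \<subseteq> TBG closure_of (\<beta>G ` carrier G)"
      unfolding dense by (rule continuous_map_image_subset_topspace[OF cont])
  qed
  have "?F (p \<otimes>\<^bsub>?P\<^esub> p') = ?F p \<otimes>\<^bsub>BG\<^esub> ?F p'" if p: "p \<in> carrier ?P" "p' \<in> carrier ?P" for p p'
  proof -
    obtain S y S' y' where pp: "p = (S, y)" "p' = (S', y')" and S: "S \<in> carrier Q" "S' \<in> carrier Q"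
      and y: "y \<in> carrier BH" "y' \<in> carrier BH"
      using p by (auto simp: semidirect_product_def)
    have "?F (p \<otimes>\<^bsub>?P\<^esub> p') = \<psi> (S \<otimes>\<^bsub>Q\<^esub> act y S') \<otimes>\<^bsub>BG\<^esub> \<phi>H (y \<otimes>\<^bsub>BH\<^esub> y')"
      by (simp add: pp semidirect_product_def)
    also have "\<dots> = \<psi> S \<otimes>\<^bsub>BG\<^esub> (\<phi>H y \<otimes>\<^bsub>BG\<^esub> \<psi> S' \<otimes>\<^bsub>BG\<^esub> inv\<^bsub>BG\<^esub> \<phi>H y) \<otimes>\<^bsub>BG\<^esub> (\<phi>H y \<otimes>\<^bsub>BG\<^esub> \<phi>H y')"
      unfolding act_def \<psi>_mult[OF S(1) cj_closed[OF \<phi>H_closed[OF y(1)] S(2)]] \<psi>_cj[OF \<phi>H_closed[OF y(1)] S(2)]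
        \<phi>H_mult[OF y] ..
    also have "\<dots> = ?F p \<otimes>\<^bsub>BG\<^esub> ?F p'"
      using \<psi>_carrier[OF S(1)] \<psi>_carrier[OF S(2)] \<phi>H_closed[OF y(1)] \<phi>H_closed[OF y(2)]
      by (simp add: pp BG.m_assoc BG_cancel)
    finally show ?thesis .
  qed
  moreover have cP: "carrier ?P = topspace ?T" by (simp add: semidirect_product_def)
  moreover have "?F p \<in> carrier BG" if "p \<in> carrier ?P" for p
    using that surj unfolding cP by (metis BG.topspace_eq image_eqI)
  ultimately have "?F \<in> hom ?P BG" by (intro homI)
  moreover have "bij_betw ?F (carrier ?P) (carrier BG)"
    using inj surj unfolding bij_betw_def cP by (metis BG.topspace_eq tT)
  ultimately have "?F \<in> iso ?P BG" by (simp add: iso_def)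
  moreover have "homeomorphic_map ?T TBG ?F"
    by (rule continuous_compact_Hausdorff_homeomorphic_map[OF compact BG.Hausdorff cont surj]) (use inj tT in simp)
  ultimately show ?thesis by (simp add: topological_group_iso_def)
qed

end

lemma cont_hom_of_subgroup:
  assumes "f \<in> cont_hom A TA (B\<lparr>carrier := K\<rparr>) (subtopology TB K)" and "K \<subseteq> carrier B"
  shows "f \<in> cont_hom A TA B TB"
  using assms by (auto simp: cont_hom_def hom_def continuous_map_in_subtopology)

theorem theorem1:
  fixes G :: "('g, 'm) monoid_scheme" and T :: "'g topology" and N H :: "'g set"
    and BG :: "('b, 'n) monoid_scheme" and TBG :: "'b topology" and \<beta>G :: "'g \<Rightarrow> 'b"
    and BN :: "('c, 'k) monoid_scheme" and TBN :: "'c topology" and \<beta>N :: "'g \<Rightarrow> 'c"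
    and BH :: "('d, 'l) monoid_scheme" and TBH :: "'d topology" and \<beta>H :: "'g \<Rightarrow> 'd"
    and \<phi>N :: "'c \<Rightarrow> 'b" and \<phi>H :: "'d \<Rightarrow> 'b" and C :: "'c set"
  assumes "locally_compact_group G T"
    and "closedin T N" and "closedin T H"
    and "internal_semidirect_product G T N H"
    and "bohr_compactification G T BG TBG \<beta>G"
    and "bohr_compactification (G\<lparr>carrier := N\<rparr>) (subtopology T N) BN TBN \<beta>N"
    and "bohr_compactification (G\<lparr>carrier := H\<rparr>) (subtopology T H) BH TBH \<beta>H"
    and "\<phi>N \<in> cont_hom BN TBN (BG\<lparr>carrier := TBG closure_of (\<beta>G ` N)\<rparr>)
                (subtopology TBG (TBG closure_of (\<beta>G ` N)))"
    and "\<forall>n \<in> N. \<phi>N (\<beta>N n) = \<beta>G n"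
    and "\<phi>H \<in> cont_hom BH TBH (BG\<lparr>carrier := TBG closure_of (\<beta>G ` H)\<rparr>)
                (subtopology TBG (TBG closure_of (\<beta>G ` H)))"
    and "\<forall>h \<in> H. \<phi>H (\<beta>H h) = \<beta>G h"
    and "C = per_kernel G T N H BN TBN \<beta>N"
  shows
    "kernel BN (BG\<lparr>carrier := TBG closure_of (\<beta>G ` N)\<rparr>) \<phi>N = C \<and>
     topological_group_iso (BN Mod C) (coset_topology BN TBN C)
       (BG\<lparr>carrier := TBG closure_of (\<beta>G ` N)\<rparr>) (subtopology TBG (TBG closure_of (\<beta>G ` N)))
       (\<lambda>S. the_elem (\<phi>N ` S)) \<and>
     topological_group_iso BH TBH
       (BG\<lparr>carrier := TBG closure_of (\<beta>G ` H)\<rparr>) (subtopology TBG (TBG closure_of (\<beta>G ` H))) \<phi>H \<and>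
     (\<forall>h \<in> H. bohr_act G N BN TBN \<beta>N h ` C = C) \<and>
     (\<exists>act \<in> hom BH (AutoGroup (BN Mod C)).
        continuous_map (prod_topology TBH (coset_topology BN TBN C)) (coset_topology BN TBN C)
          (\<lambda>(y, S). act y S) \<and>
        (\<forall>h \<in> H. \<forall>S \<in> carrier (BN Mod C). act (\<beta>H h) S = bohr_act G N BN TBN \<beta>N h ` S) \<and>
        topological_group_iso (semidirect_product (BN Mod C) BH act)
          (prod_topology (coset_topology BN TBN C) TBH) BG TBG
          (\<lambda>(S, y). the_elem (\<phi>N ` S) \<otimes>\<^bsub>BG\<^esub> \<phi>H y))"
proof -
  have tG: "topological_group G T" using assms(1) by (simp add: locally_compact_group_def)
  have tBG: "topological_group BG TBG" using assms(5) by (simp add: bohr_compactification_def compact_group_def)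
  then have K: "TBG closure_of A \<subseteq> carrier BG" for A
    using closure_of_subset_topspace[of TBG A] by (simp add: topological_group_def)
  interpret semidirect_bohr_factors G T N H BG TBG \<beta>G BN TBN \<beta>N \<phi>N BH TBH \<beta>H \<phi>H
  proof (intro semidirect_bohr_factors.intro semidirect_bohr.intro normal_topological_subgroup.intro
      semidirect_bohr_axioms.intro semidirect_bohr_factors_axioms.intro)
    show "topological_group G T" by (rule tG)
    show "N \<lhd> G" using assms(4) by (simp add: internal_semidirect_product_def)
    show "\<phi>N \<in> cont_hom BN TBN BG TBG" by (rule cont_hom_of_subgroup[OF assms(8) K])
    show "\<phi>H \<in> cont_hom BH TBH BG TBG" by (rule cont_hom_of_subgroup[OF assms(10) K])
  qed (use assms in auto)
  have "topological_group_iso Q TQ GK TK \<psi>"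
    using \<psi>_iso \<psi>_homeomorphic by (simp add: topological_group_iso_def)
  moreover have "\<forall>h\<in>H. \<forall>S\<in>carrier Q. act (\<beta>H h) S = bohr_act G N BN TBN \<beta>N h ` S"
    by (simp add: act_def \<phi>H_\<beta>H cj_\<beta>G H_carrier)
  moreover have "\<forall>h\<in>H. bohr_act G N BN TBN \<beta>N h ` CN = CN" using bohr_act_CN H_carrier by simp
  ultimately show ?thesis
    unfolding assms(12)
    using kernel_\<phi>N_GK \<phi>H_topological_group_iso act_hom act_continuous bohr_semidirect_iso
    unfolding \<psi>_def by blast
qed

end
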